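(* Let $N\ge 3$, let $2^*=2N/(N-2)$, and let $f:\mathbb{R}\to\mathbb{R}$ be a continuous function such that: (a) for some $q\in(2,2^* )$, $$\sup_{t\in\mathbb{R}}\frac{|f(t)|}{1+|t|^{q-1}}<\infty;$$ (b) $$\lim_{t\to 0^+}\frac{\int_0^t f(s)\,ds}{t^2}=+\infty.$$ (c) Let $\alpha\in \big(L^1(\mathbb{B}^N)\cap L^\infty(\mathbb{B}^N)\big)\setminus\{0\}$ be nonnegative and radially symmetric with respect to the origin $\sigma_0\in\mathbb{B}^N$. Then there exists $\lambda^\star>0$ such that, for every $\lambda\in(0,\lambda^\star)$, the problem $$-\Delta_H u=\lambda\,\alpha(\sigma) f(u)\ \text{ on } \mathbb{B}^N,\qquad u\in H^{1,2}(\mathbb{B}^N),$$ admits a nontrivial (not identically zero) $SO(N)$-invariant weak solution $u_\lambda\in H^{1,2}(\mathbb{B}^N)$, and these solutions satisfy $\|u_\lambda\|\to 0$ as $\lambda\to 0^+$.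
   Context: $\mathbb{B}^N=\{\sigma\in\mathbb{R}^N : |\sigma|<1\}$ is the Poincaré ball model of hyperbolic space, i.e. the open unit ball with the Riemannian metric $g_{ij}(\sigma)=\frac{4}{(1-|\sigma|^2)^2}\delta_{ij}$, where $|\cdot|$ is the Euclidean norm; $\sigma_0=0$ is the origin. $\langle\cdot,\cdot\rangle_\sigma$ is the corresponding inner product on the tangent space $T_\sigma(\mathbb{B}^N)$, with associated norm $|\cdot|_\sigma$. The Riemannian volume measure is $d\mu=2^N(1-|\sigma|^2)^{-N}dx$, with $dx$ the Lebesgue measure. The spaces $L^p(\mathbb{B}^N)$ are taken with respect to $\mu$. $\Delta_H$ is the Laplace–Beltrami operator of this metric, and $\nabla_H=\left(\frac{1-|\sigma|^2}{2}\right)^2\nabla$ is the Riemannian (covariant) gradient, where $\nabla$ is the Euclidean gradient. $H^{1,2}(\mathbb{B}^N)$ is the completion of $C_0^\infty(\mathbb{B}^N)$ (smooth real-valued functions with compact support) with respect to the norm $$\|u\|=\left(\int_{\mathbb{B}^N}|\nabla_H u(\sigma)|_\sigma^2\,d\mu\right)^{1/2}.$$ For $N\ge3$ it embeds continuously in $L^\nu(\mathbb{B}^N)$ for every $\nu\in[2,2^*]$, so its elements are regarded as functions on $\mathbb{B}^N$ (up to a.e. equality). A weak solution of $-\Delta_H u=\lambda\alpha(\sigma) f(u)$ is a function $u\in H^{1,2}(\mathbb{B}^N)$ such that, for every $\varphi\in H^{1,2}(\mathbb{B}^N)$, $$\int_{\mathbb{B}^N}\langle\nabla_H u(\sigma),\nabla_H\varphi(\sigma)\rangle_\sigma\,d\mu=\lambda\int_{\mathbb{B}^N}\alpha(\sigma)f(u(\sigma))\varphi(\sigma)\,d\mu.$$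 $SO(N)$ is the special orthogonal group acting naturally on $\mathbb{B}^N$. A function $u\in H^{1,2}(\mathbb{B}^N)$ is $SO(N)$-invariant if, for every $g\in SO(N)$, $u(g^{-1}\cdot\sigma)=u(\sigma)$ for a.e. $\sigma\in\mathbb{B}^N$. The function $\alpha$ is radially symmetric with respect to the origin if $\alpha(\sigma)$ depends only on $|\sigma|$ (up to a.e. equality). *)

theory Defs
  imports "HOL-Analysis.Analysis"
begin

text \<open>
  The Poincare ball model is the set \<open>ball 0 1\<close> in \<open>real ^ 'n\<close>, with \<open>N = CARD('n)\<close>.
  Functions and vector fields on it are total functions on \<open>real ^ 'n\<close>; as all integrals and
  almost-everywhere statements are taken with respect to \<open>hyp_measure\<close>, whose space is the ball,
  their values outside the ball are irrelevant.
\<close>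

definition hyp_measure :: "(real ^ 'n) measure" where
  "hyp_measure = density (lebesgue_on (ball 0 1))
     (\<lambda>x. ennreal (2 ^ CARD('n) / (1 - (norm x)\<^sup>2) ^ CARD('n)))"

definition hyp_inner :: "real ^ 'n \<Rightarrow> real ^ 'n \<Rightarrow> real ^ 'n \<Rightarrow> real" where
  "hyp_inner x X Y = 4 / (1 - (norm x)\<^sup>2)\<^sup>2 * (X \<bullet> Y)"

definition hyp_norm :: "real ^ 'n \<Rightarrow> real ^ 'n \<Rightarrow> real" where
  "hyp_norm x X = sqrt (hyp_inner x X X)"

definition euclidean_grad :: "(real ^ 'n \<Rightarrow> real) \<Rightarrow> real ^ 'n \<Rightarrow> real ^ 'n" where
  "euclidean_grad \<phi> x = (\<chi> i. frechet_derivative \<phi> (at x) (axis i 1))"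

definition hyp_grad :: "(real ^ 'n \<Rightarrow> real) \<Rightarrow> real ^ 'n \<Rightarrow> real ^ 'n" where
  "hyp_grad \<phi> x = ((1 - (norm x)\<^sup>2) / 2)\<^sup>2 *\<^sub>R euclidean_grad \<phi> x"

primrec C_k :: "nat \<Rightarrow> (real ^ 'n \<Rightarrow> real) \<Rightarrow> bool" where
  "C_k 0 \<phi> \<longleftrightarrow> continuous_on UNIV \<phi>"
| "C_k (Suc k) \<phi> \<longleftrightarrow> \<phi> differentiable_on UNIV \<and> (\<forall>i. C_k k (\<lambda>x. euclidean_grad \<phi> x $ i))"

text \<open>Test functions on the ball are identified with their extensions by zero, which are smooth
  on the whole space.\<close>

definition test_function :: "(real ^ 'n \<Rightarrow> real) \<Rightarrow> bool" where
  "test_function \<phi> \<longleftrightarrow> (\<forall>k. C_k k \<phi>) \<and> compact (closure {x. \<phi> x \<noteq> 0}) \<and>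
     closure {x. \<phi> x \<noteq> 0} \<subseteq> ball 0 1"

definition in_L2 :: "(real ^ 'n \<Rightarrow> real) \<Rightarrow> bool" where
  "in_L2 u \<longleftrightarrow> u \<in> borel_measurable hyp_measure \<and> integrable hyp_measure (\<lambda>x. (u x)\<^sup>2)"

definition L2_tendsto :: "(nat \<Rightarrow> real ^ 'n \<Rightarrow> real) \<Rightarrow> (real ^ 'n \<Rightarrow> real) \<Rightarrow> bool" where
  "L2_tendsto \<phi> u \<longleftrightarrow> in_L2 u \<and>
     (\<lambda>n. \<integral>x. (\<phi> n x - u x)\<^sup>2 \<partial>hyp_measure) \<longlonglongrightarrow> 0"

definition field_in_L2 :: "(real ^ 'n \<Rightarrow> real ^ 'n) \<Rightarrow> bool" where
  "field_in_L2 G \<longleftrightarrow> G \<in> borel_measurable hyp_measure \<and>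
     integrable hyp_measure (\<lambda>x. (hyp_norm x (G x))\<^sup>2)"

definition field_norm :: "(real ^ 'n \<Rightarrow> real ^ 'n) \<Rightarrow> real" where
  "field_norm G = sqrt (\<integral>x. (hyp_norm x (G x))\<^sup>2 \<partial>hyp_measure)"

definition dirichlet_Cauchy :: "(nat \<Rightarrow> real ^ 'n \<Rightarrow> real) \<Rightarrow> bool" where
  "dirichlet_Cauchy \<phi> \<longleftrightarrow> (\<forall>e>0. \<exists>M. \<forall>m\<ge>M. \<forall>n\<ge>M.
     field_norm (hyp_grad (\<lambda>x. \<phi> m x - \<phi> n x)) < e)"

text \<open>The completion of the test functions with respect to the Dirichlet norm, realized as a space
  of functions. For \<open>CARD('n) \<ge> 3\<close> the Dirichlet norm dominates the \<open>L\<^sup>2\<close> norm, so a Cauchy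
  sequence of test functions converges in \<open>L\<^sup>2\<close>, and the element of the completion it represents
  is regarded as the function that is its \<open>L\<^sup>2\<close> limit.\<close>

definition H12 :: "(real ^ 'n \<Rightarrow> real) set" where
  "H12 = {u. \<exists>\<phi>. (\<forall>n. test_function (\<phi> n)) \<and> dirichlet_Cauchy \<phi> \<and> L2_tendsto \<phi> u}"

text \<open>The extension of the Riemannian gradient to the completion by continuity. The limit field is
  determined up to a null set (the gradient is closable), so the choice below is harmless.\<close>

definition is_H12_grad :: "(real ^ 'n \<Rightarrow> real) \<Rightarrow> (real ^ 'n \<Rightarrow> real ^ 'n) \<Rightarrow> bool" where
  "is_H12_grad u G \<longleftrightarrow> field_in_L2 G \<and>
     (\<exists>\<phi>. (\<forall>n. test_function (\<phi> n)) \<and> L2_tendsto \<phi> u \<and>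
        (\<lambda>n. field_norm (\<lambda>x. hyp_grad (\<phi> n) x - G x)) \<longlonglongrightarrow> 0)"

definition H12_grad :: "(real ^ 'n \<Rightarrow> real) \<Rightarrow> real ^ 'n \<Rightarrow> real ^ 'n" where
  "H12_grad u = (SOME G. is_H12_grad u G)"

definition H12_norm :: "(real ^ 'n \<Rightarrow> real) \<Rightarrow> real" where
  "H12_norm u = field_norm (H12_grad u)"

text \<open>Since Bochner integrals of non-integrable functions are 0, integrability on the right-hand
  side is stated explicitly. On the left-hand side it is automatic, as both gradients are in
  \<open>L\<^sup>2\<close>.\<close>

definition weak_solution ::
    "real \<Rightarrow> (real ^ 'n \<Rightarrow> real) \<Rightarrow> (real \<Rightarrow> real) \<Rightarrow> (real ^ 'n \<Rightarrow> real) \<Rightarrow> bool" where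
  "weak_solution l \<alpha> f u \<longleftrightarrow> u \<in> H12 \<and>
     (\<forall>\<phi>\<in>H12. integrable hyp_measure (\<lambda>x. \<alpha> x * f (u x) * \<phi> x) \<and>
        (\<integral>x. hyp_inner x (H12_grad u x) (H12_grad \<phi> x) \<partial>hyp_measure)
          = l * (\<integral>x. \<alpha> x * f (u x) * \<phi> x \<partial>hyp_measure))"

definition SO_invariant :: "(real ^ 'n \<Rightarrow> real) \<Rightarrow> bool" where
  "SO_invariant u \<longleftrightarrow>
     (\<forall>g. rotation_matrix g \<longrightarrow> (AE x in hyp_measure. u (matrix_inv g *v x) = u x))"

definition radially_symmetric :: "(real ^ 'n \<Rightarrow> real) \<Rightarrow> bool" where
  "radially_symmetric \<alpha> \<longleftrightarrow> (\<exists>h. AE x in hyp_measure. \<alpha> x = h (norm x))"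

definition in_Linf :: "(real ^ 'n \<Rightarrow> real) \<Rightarrow> bool" where
  "in_Linf \<alpha> \<longleftrightarrow> \<alpha> \<in> borel_measurable hyp_measure \<and> (\<exists>C. AE x in hyp_measure. \<bar>\<alpha> x\<bar> \<le> C)"

end

theory Submission
  imports Defs "HOL-Complex_Analysis.Great_Picard"
begin

text \<open>
  The solution is found among radial functions, as a minimizer \<open>U\<close> of
  \<open>J v = \<parallel>v\<parallel>\<^sup>2 / 2 - l \<integral> \<alpha> F(v) d\<mu>\<close> on the unit ball \<open>\<parallel>v\<parallel> \<le> 1\<close>, where \<open>F\<close> is the primitive of \<open>f\<close>.
  Radial functions with \<open>\<parallel>v\<parallel> \<le> 1\<close> obey the pointwise bound \<open>|v(x)| \<le> K |x| powr (-(N - 2) / 2)\<close> and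
  are uniformly equicontinuous away from the origin and the boundary. Since \<open>\<alpha>\<close> is bounded and integrable and
  \<open>q\<close> is subcritical, \<open>\<alpha>(x) |x| powr (-q (N - 2) / 2)\<close> is integrable; so along a pointwise convergent
  minimizing sequence the nonlinear term converges by dominated convergence, and the parallelogram law
  upgrades this to convergence of the gradients in \<open>L\<^sup>2\<close>.

  For small \<open>l\<close> the minimum is attained in the interior, because \<open>J U \<le> J 0 = 0\<close> gives
  \<open>\<parallel>U\<parallel>\<^sup>2 \<le> 2 l C\<close>; this also yields \<open>\<parallel>U\<parallel> \<longlonglongrightarrow> 0\<close>. The condition on \<open>F\<close> at \<open>0\<close> makes the
  minimum negative, hence \<open>U \<noteq> 0\<close>. The Euler equation holds for radial test functions, and it extends
  to arbitrary test functions by replacing them with their spherical means (the principle of symmetric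
  criticality, proved by hand), and to the whole space by the Hardy inequality
  \<open>\<integral> (u / |x|)\<^sup>2 d\<mu> \<le> 16 \<parallel>u\<parallel>\<^sup>2\<close>, which shows that \<open>\<alpha> f(U)\<close> is a bounded functional.
\<close>

section \<open>Differentiation under the integral and square-integrable functions\<close>

text \<open>Two obstacles shape the proof. First, \<open>\<alpha> f(u)\<close> must act on every
  function of the space, and not only on radial ones. No Sobolev inequality is used for this: with
  \<open>p0 = (N - 2) / 2\<close>, subcriticality of \<open>q\<close> says exactly
  \<open>p0 * q < N\<close>, and rewritten as \<open>2 * p0 * (q - 1) - 2 < N\<close> it puts
  \<open>|x| \<alpha> f(U)\<close> in L2, while the Hardy inequality puts
  \<open>\<phi> / |x|\<close> in L2. Second, the minimizer is only a pointwise limit of C1 profiles.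
  No weak topology and no regularity theory is invoked: \<open>U\<close> always occurs together with
  the L2 limit \<open>Y\<close> of the gradients of its approximants, and every variation is carried
  out on the approximants before passing to the limit. That \<open>Y\<close> is the gradient of
  \<open>U\<close> in the sense of the completion, where the gradient is a choice, rests on
  closability. Constants: 16 is 4 divided by 1/4, the two weights in Young's inequality inside the
  Hardy estimate. The threshold for \<open>l\<close> is \<open>1 / (4 * (C0 + 1))\<close>, with
  \<open>C0\<close> a bound of the nonlinear term on the unit ball; it leaves the squared norm of
  the minimizer at most 1/2.\<close>

lemma has_real_derivative_lebesgue_integral:
  fixes F F' :: "real \<Rightarrow> 'a \<Rightarrow> real"
  assumes d: "d > 0"
    and int: "\<And>t. \<bar>t - t0\<bar> < d \<Longrightarrow> integrable M (F t)"
    and der: "\<And>t x. \<bar>t - t0\<bar> < d \<Longrightarrow> x \<in> space M \<Longrightarrow> ((\<lambda>t. F t x) has_real_derivative F' t x) (at t)"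
    and bd: "AE x in M. \<forall>t. \<bar>t - t0\<bar> < d \<longrightarrow> \<bar>F' t x\<bar> \<le> B x"
    and B: "integrable M B"
  shows "integrable M (F' t0)"
    and "((\<lambda>t. \<integral>x. F t x \<partial>M) has_real_derivative (\<integral>x. F' t0 x \<partial>M)) (at t0)"
proof -
  have quot: "integrable M (F' t0) \<and> (\<lambda>i. ((\<integral>x. F (t0 + Y i) x \<partial>M) - (\<integral>x. F t0 x \<partial>M)) / Y i) \<longlonglongrightarrow> (\<integral>x. F' t0 x \<partial>M)"
    if Y0: "\<And>i. Y i \<noteq> 0" and Yd: "\<And>i. \<bar>Y i\<bar> < d" and Y: "Y \<longlonglongrightarrow> 0" for Y
  proof -
    define Q where "Q i x = (F (t0 + Y i) x - F t0 x) / Y i" for i x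
    have iF: "integrable M (F (t0 + Y i))" "integrable M (F t0)" for i
      using int[of "t0 + Y i"] int[of t0] Yd[of i] d by auto
    have iQ: "integrable M (Q i)" for i
      unfolding Q_def using iF by (intro integrable_divide integrable_diff) auto
    have lim: "(\<lambda>i. Q i x) \<longlonglongrightarrow> F' t0 x" if "x \<in> space M" for x
    proof -
      have "((\<lambda>h. (F (t0 + h) x - F t0 x) / h) \<longlongrightarrow> F' t0 x) (at 0)"
        using der[of t0 x] d that by (simp add: DERIV_def)
      moreover have "filterlim Y (at 0) sequentially"
        using Y Y0 by (auto simp: filterlim_at)
      ultimately show ?thesis unfolding Q_def
        by (rule filterlim_compose)
    qed
    \<comment> \<open>The mean value inequality turns the bound on the derivative into the same
      bound on the difference quotients.\<close>
    have bQ: "AE x in M. \<bar>Q i x\<bar> \<le> B x" for i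
      using bd
    proof (rule AE_mp, intro AE_I2 impI)
      fix x assume x: "x \<in> space M" and b: "\<forall>t. \<bar>t - t0\<bar> < d \<longrightarrow> \<bar>F' t x\<bar> \<le> B x"
      have "norm (F (t0 + Y i) x - F t0 x) \<le> B x * norm (t0 + Y i - t0)"
        by (rule field_differentiable_bound[where S="ball t0 d" and f'="\<lambda>t. F' t x"])
          (use der b x d Yd[of i] in \<open>auto simp: dist_real_def abs_minus_commute intro: DERIV_subset\<close>)
      then show "\<bar>Q i x\<bar> \<le> B x"
        using Y0[of i] by (simp add: Q_def divide_simps)
    qed
    have meas: "F' t0 \<in> borel_measurable M"
      by (rule borel_measurable_LIMSEQ_real[of M Q]) (use lim iQ in auto)
    have limAE: "AE x in M. (\<lambda>i. Q i x) \<longlonglongrightarrow> F' t0 x" using lim by auto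
    have "(\<lambda>i. \<integral>x. Q i x \<partial>M) \<longlonglongrightarrow> (\<integral>x. F' t0 x \<partial>M)"
      by (rule integral_dominated_convergence[where w=B]) (use meas iQ B limAE bQ in auto)
    moreover have "integrable M (F' t0)"
      by (rule integrable_dominated_convergence[where w=B and s=Q]) (use meas iQ B limAE bQ in auto)
    moreover have "(\<integral>x. Q i x \<partial>M) = ((\<integral>x. F (t0 + Y i) x \<partial>M) - (\<integral>x. F t0 x \<partial>M)) / Y i" for i
      unfolding Q_def using iF(1)[of i] iF(2) by simp
    ultimately show ?thesis by simp
  qed
  show "integrable M (F' t0)"
  proof -
    \<comment> \<open>Any one null sequence yields integrability; the shift by 2 keeps even the
      first term strictly below \<open>d\<close>.\<close>
    have "(\<lambda>i. d / real (i+2)) \<longlonglongrightarrow> 0"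
      by (rule LIMSEQ_ignore_initial_segment[OF lim_const_over_n])
    moreover have "\<bar>d / real (i+2)\<bar> < d" for i using d by (simp add: divide_simps)
    ultimately show ?thesis using quot[of "\<lambda>i. d / real (i+2)"] d by auto
  qed
  have "((\<lambda>h. ((\<integral>x. F (t0 + h) x \<partial>M) - (\<integral>x. F t0 x \<partial>M)) / h) \<longlongrightarrow> (\<integral>x. F' t0 x \<partial>M)) (at 0)"
    unfolding tendsto_at_iff_sequentially comp_def
  proof (intro allI impI)
    fix X :: "nat \<Rightarrow> real" assume X: "\<forall>i. X i \<in> UNIV - {0}" "X \<longlonglongrightarrow> 0"
    \<comment> \<open>\<open>quot\<close> wants all terms below \<open>d\<close>, which holds only
      for a tail of \<open>X\<close>.\<close>
    obtain i0 where i0: "\<And>i. i \<ge> i0 \<Longrightarrow> \<bar>X i\<bar> < d"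
      using X(2) d unfolding LIMSEQ_iff by auto
    have "(\<lambda>i. ((\<integral>x. F (t0 + X (i + i0)) x \<partial>M) - (\<integral>x. F t0 x \<partial>M)) / X (i + i0)) \<longlonglongrightarrow> (\<integral>x. F' t0 x \<partial>M)"
      using quot[of "\<lambda>i. X (i + i0)"] i0 X LIMSEQ_ignore_initial_segment[OF X(2)] by auto
    then show "(\<lambda>i. ((\<integral>x. F (t0 + X i) x \<partial>M) - (\<integral>x. F t0 x \<partial>M)) / X i) \<longlonglongrightarrow> (\<integral>x. F' t0 x \<partial>M)"
      by (rule LIMSEQ_offset)
  qed
  then show "((\<lambda>t. \<integral>x. F t x \<partial>M) has_real_derivative (\<integral>x. F' t0 x \<partial>M)) (at t0)"
    by (simp add: DERIV_def)
qed

section \<open>Square-integrable functions with values in a Euclidean space\<close>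

definition sq_integrable :: "'a measure \<Rightarrow> ('a \<Rightarrow> 'b::euclidean_space) \<Rightarrow> bool" where
  "sq_integrable M f \<longleftrightarrow> f \<in> borel_measurable M \<and> integrable M (\<lambda>x. (norm (f x))\<^sup>2)"

lemma sq_integrable_inner:
  assumes f: "sq_integrable M f" and g: "sq_integrable M g"
  shows "integrable M (\<lambda>x. f x \<bullet> g x)"
proof (rule Bochner_Integration.integrable_bound[where f="\<lambda>x. (norm (f x))\<^sup>2 + (norm (g x))\<^sup>2"])
  show "integrable M (\<lambda>x. (norm (f x))\<^sup>2 + (norm (g x))\<^sup>2)"
    using f g by (auto simp: sq_integrable_def)
  show "(\<lambda>x. f x \<bullet> g x) \<in> borel_measurable M"
    using f g by (auto simp: sq_integrable_def)
  have "\<bar>f x \<bullet> g x\<bar> \<le> (norm (f x))\<^sup>2 + (norm (g x))\<^sup>2" for x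
  proof -
    have "\<bar>f x \<bullet> g x\<bar> \<le> norm (f x) * norm (g x)" by (rule Cauchy_Schwarz_ineq2)
    also have "\<dots> \<le> (norm (f x))\<^sup>2 + (norm (g x))\<^sup>2"
      using sum_squares_bound[of "norm (f x)" "norm (g x)"]
        mult_nonneg_nonneg[OF norm_ge_zero[of "f x"] norm_ge_zero[of "g x"]] by linarith
    finally show ?thesis .
  qed
  then show "AE x in M. norm (f x \<bullet> g x) \<le> norm ((norm (f x))\<^sup>2 + (norm (g x))\<^sup>2)"
    by (auto intro!: order_trans[OF _ abs_ge_self])
qed

lemma sq_integrable_scaleR: "sq_integrable M f \<Longrightarrow> sq_integrable M (\<lambda>x. c *\<^sub>R f x)"
  by (auto simp: sq_integrable_def power_mult_distrib)

lemma sq_integrable_add: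
  assumes f: "sq_integrable M f" and g: "sq_integrable M g"
  shows "sq_integrable M (\<lambda>x. f x + g x)"
proof -
  have "integrable M (\<lambda>x. (norm (f x))\<^sup>2 + 2 * (f x \<bullet> g x) + (norm (g x))\<^sup>2)"
    using f g sq_integrable_inner[OF f g] by (auto simp: sq_integrable_def)
  moreover have "(norm (f x + g x))\<^sup>2 = (norm (f x))\<^sup>2 + 2 * (f x \<bullet> g x) + (norm (g x))\<^sup>2" for x
    by (simp add: power2_norm_eq_inner inner_add_left inner_add_right inner_commute)
  ultimately show ?thesis using f g by (auto simp: sq_integrable_def)
qed

lemma sq_integrable_diff:
  assumes f: "sq_integrable M f" and g: "sq_integrable M g"
  shows "sq_integrable M (\<lambda>x. f x - g x)"
  using sq_integrable_add[OF f sq_integrable_scaleR[OF g, of "-1"]] by simp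

lemma integral_norm_sq_add_scaleR:
  assumes f: "sq_integrable M f" and g: "sq_integrable M g"
  shows "(\<integral>x. (norm (f x + t *\<^sub>R g x))\<^sup>2 \<partial>M) =
    (\<integral>x. (norm (f x))\<^sup>2 \<partial>M) + 2 * t * (\<integral>x. f x \<bullet> g x \<partial>M) + t\<^sup>2 * (\<integral>x. (norm (g x))\<^sup>2 \<partial>M)"
proof -
  have *: "(norm (f x + t *\<^sub>R g x))\<^sup>2 = (norm (f x))\<^sup>2 + (2 * t) * (f x \<bullet> g x) + t\<^sup>2 * (norm (g x))\<^sup>2" for x
    by (simp add: power2_norm_eq_inner inner_add_left inner_add_right inner_commute power2_eq_square[of t])
  show ?thesis unfolding *
    using f g sq_integrable_inner[OF f g] by (simp add: sq_integrable_def)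
qed

lemma integral_Cauchy_Schwarz:
  assumes f: "sq_integrable M f" and g: "sq_integrable M g"
  shows "\<bar>\<integral>x. f x \<bullet> g x \<partial>M\<bar> \<le> sqrt (\<integral>x. (norm (f x))\<^sup>2 \<partial>M) * sqrt (\<integral>x. (norm (g x))\<^sup>2 \<partial>M)"
proof -
  define A B C where "A = (\<integral>x. (norm (f x))\<^sup>2 \<partial>M)" and "B = (\<integral>x. (norm (g x))\<^sup>2 \<partial>M)"
    and "C = (\<integral>x. f x \<bullet> g x \<partial>M)"
  have q: "0 \<le> A + 2 * t * C + t\<^sup>2 * B" for t
    unfolding A_def B_def C_def
    by (simp flip: integral_norm_sq_add_scaleR[OF f g])
  have B0: "B \<ge> 0" and A0: "A \<ge> 0" unfolding A_def B_def by auto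
  have "C\<^sup>2 \<le> A * B"
  proof (cases "B = 0")
    case True
    have "C = 0"
    proof (rule ccontr)
      assume "C \<noteq> 0"
      \<comment> \<open>With \<open>B = 0\<close> the quadratic is affine in \<open>t\<close>, and
        this \<open>t\<close> gives it the value -1.\<close>
      then show False using q[of "- (A + 1) / (2 * C)"] True by (simp add: field_simps)
    qed
    then show ?thesis using True by simp
  next
    case False
    then have "B > 0" using B0 by simp
    have "0 \<le> A + 2 * (- C / B) * C + (- C / B)\<^sup>2 * B" by (rule q)
    also have "\<dots> = A - C\<^sup>2 / B" using \<open>B > 0\<close> by (simp add: field_simps power2_eq_square)
    finally show ?thesis using \<open>B > 0\<close> by (simp add: field_simps)
  qed
  then have "sqrt (C\<^sup>2) \<le> sqrt (A * B)" by (rule real_sqrt_le_mono)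
  then show ?thesis by (simp add: real_sqrt_mult A_def B_def C_def)
qed

lemma tendsto_integral_inner:
  assumes f: "\<And>n. sq_integrable M (f n)" and h: "sq_integrable M h" and g: "sq_integrable M g"
    and lim: "(\<lambda>n. \<integral>x. (norm (f n x - h x))\<^sup>2 \<partial>M) \<longlonglongrightarrow> 0"
  shows "(\<lambda>n. \<integral>x. f n x \<bullet> g x \<partial>M) \<longlonglongrightarrow> (\<integral>x. h x \<bullet> g x \<partial>M)"
proof -
  let ?b = "\<lambda>n. sqrt (\<integral>x. (norm (f n x - h x))\<^sup>2 \<partial>M) * sqrt (\<integral>x. (norm (g x))\<^sup>2 \<partial>M)"
  have "?b \<longlonglongrightarrow> sqrt 0 * sqrt (\<integral>x. (norm (g x))\<^sup>2 \<partial>M)"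
    by (intro tendsto_intros lim)
  then have b: "?b \<longlonglongrightarrow> 0" by simp
  have "(\<lambda>n. (\<integral>x. f n x \<bullet> g x \<partial>M) - (\<integral>x. h x \<bullet> g x \<partial>M)) \<longlonglongrightarrow> 0"
  proof (rule Lim_null_comparison[OF _ b], intro always_eventually allI)
    fix n
    have "(\<integral>x. f n x \<bullet> g x \<partial>M) - (\<integral>x. h x \<bullet> g x \<partial>M) = (\<integral>x. (f n x - h x) \<bullet> g x \<partial>M)"
      using sq_integrable_inner[OF f g] sq_integrable_inner[OF h g] by (simp add: inner_diff_left)
    then show "norm ((\<integral>x. f n x \<bullet> g x \<partial>M) - (\<integral>x. h x \<bullet> g x \<partial>M)) \<le> ?b n"
      using integral_Cauchy_Schwarz[OF sq_integrable_diff[OF f[of n] h] g] by simp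
  qed
  then show ?thesis by (simp add: LIM_zero_iff)
qed

lemma tendsto_integral_norm_sq:
  assumes f: "\<And>n. sq_integrable M (f n)" and h: "sq_integrable M h"
    and lim: "(\<lambda>n. \<integral>x. (norm (f n x - h x))\<^sup>2 \<partial>M) \<longlonglongrightarrow> 0"
  shows "(\<lambda>n. \<integral>x. (norm (f n x))\<^sup>2 \<partial>M) \<longlonglongrightarrow> (\<integral>x. (norm (h x))\<^sup>2 \<partial>M)"
proof -
  have e: "(\<integral>x. (norm (f n x))\<^sup>2 \<partial>M) =
     (\<integral>x. (norm (f n x - h x))\<^sup>2 \<partial>M) + 2 * (\<integral>x. f n x \<bullet> h x \<partial>M) - (\<integral>x. (norm (h x))\<^sup>2 \<partial>M)" for n
  proof -
    have "(\<integral>x. (norm (f n x - h x))\<^sup>2 \<partial>M) =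
      (\<integral>x. (norm (f n x))\<^sup>2 \<partial>M) - 2 * (\<integral>x. f n x \<bullet> h x \<partial>M) + (\<integral>x. (norm (h x))\<^sup>2 \<partial>M)"
      using integral_norm_sq_add_scaleR[OF f[of n] h, of "-1"] by simp
    then show ?thesis by simp
  qed
  have "(\<lambda>n. (\<integral>x. (norm (f n x - h x))\<^sup>2 \<partial>M) + 2 * (\<integral>x. f n x \<bullet> h x \<partial>M) - (\<integral>x. (norm (h x))\<^sup>2 \<partial>M))
    \<longlonglongrightarrow> 0 + 2 * (\<integral>x. h x \<bullet> h x \<partial>M) - (\<integral>x. (norm (h x))\<^sup>2 \<partial>M)"
    by (intro tendsto_intros lim tendsto_integral_inner f h)
  then show ?thesis unfolding e by (simp add: power2_norm_eq_inner)
qed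

lemma integral_norm_sq_triangle:
  assumes f: "sq_integrable M f" and g: "sq_integrable M g" and h: "sq_integrable M h"
  shows "(\<integral>x. (norm (f x - h x))\<^sup>2 \<partial>M) \<le> 2 * (\<integral>x. (norm (f x - g x))\<^sup>2 \<partial>M) + 2 * (\<integral>x. (norm (g x - h x))\<^sup>2 \<partial>M)"
proof -
  have fg: "integrable M (\<lambda>x. (norm (f x - g x))\<^sup>2)" and gh: "integrable M (\<lambda>x. (norm (g x - h x))\<^sup>2)"
    and fh: "integrable M (\<lambda>x. (norm (f x - h x))\<^sup>2)"
    using sq_integrable_diff[OF f g] sq_integrable_diff[OF g h] sq_integrable_diff[OF f h] by (auto simp: sq_integrable_def)
  have "(\<integral>x. (norm (f x - h x))\<^sup>2 \<partial>M) \<le> (\<integral>x. 2 * (norm (f x - g x))\<^sup>2 + 2 * (norm (g x - h x))\<^sup>2 \<partial>M)"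
  proof (rule Bochner_Integration.integral_mono[OF fh])
    show "integrable M (\<lambda>x. 2 * (norm (f x - g x))\<^sup>2 + 2 * (norm (g x - h x))\<^sup>2)" using fg gh by auto
    fix x
    have "norm (f x - h x) \<le> norm (f x - g x) + norm (g x - h x)" by (rule norm_diff_triangle_ineq[of "f x" "g x" "g x" "h x", simplified])
    then have "(norm (f x - h x))\<^sup>2 \<le> (norm (f x - g x) + norm (g x - h x))\<^sup>2" by (intro power_mono) auto
    also have "\<dots> \<le> 2 * (norm (f x - g x))\<^sup>2 + 2 * (norm (g x - h x))\<^sup>2"
      using sum_squares_bound[of "norm (f x - g x)" "norm (g x - h x)"] by (simp add: power2_sum)
    finally show "(norm (f x - h x))\<^sup>2 \<le> 2 * (norm (f x - g x))\<^sup>2 + 2 * (norm (g x - h x))\<^sup>2" .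
  qed
  then show ?thesis using fg gh by simp
qed

lemma norm_sq_limit_triangle:
  assumes f: "\<And>n. sq_integrable M (f n)" and g: "\<And>n. sq_integrable M (g n)" and h: "\<And>n. sq_integrable M (h n)"
    and fg: "(\<lambda>n. \<integral>x. (norm (f n x - g n x))\<^sup>2 \<partial>M) \<longlonglongrightarrow> 0"
    and gh: "(\<lambda>n. \<integral>x. (norm (g n x - h n x))\<^sup>2 \<partial>M) \<longlonglongrightarrow> 0"
  shows "(\<lambda>n. \<integral>x. (norm (f n x - h n x))\<^sup>2 \<partial>M) \<longlonglongrightarrow> 0"
proof (rule tendsto_sandwich[OF _ _ tendsto_const])
  show "\<forall>\<^sub>F n in sequentially. (\<integral>x. (norm (f n x - h n x))\<^sup>2 \<partial>M)
      \<le> 2 * (\<integral>x. (norm (f n x - g n x))\<^sup>2 \<partial>M) + 2 * (\<integral>x. (norm (g n x - h n x))\<^sup>2 \<partial>M)"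
    by (intro always_eventually allI integral_norm_sq_triangle f g h)
  show "(\<lambda>n. 2 * (\<integral>x. (norm (f n x - g n x))\<^sup>2 \<partial>M) + 2 * (\<integral>x. (norm (g n x - h n x))\<^sup>2 \<partial>M)) \<longlonglongrightarrow> 0"
    using tendsto_add[OF tendsto_mult_left[OF fg, of 2] tendsto_mult_left[OF gh, of 2]] by simp
qed simp

text \<open>Parallelogram law. The subtracted term is what makes minimizing sequences Cauchy,
  because a midpoint of two competitors is again a competitor.\<close>

lemma integral_norm_sq_midpoint:
  assumes f: "sq_integrable M f" and g: "sq_integrable M g"
  shows "(\<integral>x. (norm ((1/2) *\<^sub>R f x + (1/2) *\<^sub>R g x))\<^sup>2 \<partial>M) =
    (1/2) * (\<integral>x. (norm (f x))\<^sup>2 \<partial>M) + (1/2) * (\<integral>x. (norm (g x))\<^sup>2 \<partial>M) - (1/4) * (\<integral>x. (norm (f x - g x))\<^sup>2 \<partial>M)"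
proof -
  have "(norm ((1/2) *\<^sub>R f x + (1/2) *\<^sub>R g x))\<^sup>2 = (1/2) * (norm (f x))\<^sup>2 + (1/2) * (norm (g x))\<^sup>2 - (1/4) * (norm (f x - g x))\<^sup>2" for x
    by (simp add: power2_norm_eq_inner inner_add_left inner_add_right inner_diff_left inner_diff_right inner_commute[of "g x" "f x"] field_simps)
  then show ?thesis
    using f g sq_integrable_diff[OF f g] by (simp add: sq_integrable_def)
qed

lemma L2_limit_unique:
  assumes f: "\<And>n. sq_integrable M (f n)" and u: "sq_integrable M u" and v: "sq_integrable M v"
    and fu: "(\<lambda>n. \<integral>x. (norm (f n x - u x))\<^sup>2 \<partial>M) \<longlonglongrightarrow> 0"
    and fv: "(\<lambda>n. \<integral>x. (norm (f n x - v x))\<^sup>2 \<partial>M) \<longlonglongrightarrow> 0"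
  shows "AE x in M. u x = v x"
proof -
  have "(\<lambda>n. \<integral>x. (norm (u x - v x))\<^sup>2 \<partial>M) \<longlonglongrightarrow> 0"
    by (rule norm_sq_limit_triangle[where f="\<lambda>_. u" and g=f and h="\<lambda>_. v", OF u f v _ fv])
      (use fu in \<open>simp add: norm_minus_commute\<close>)
  then have "(\<integral>x. (norm (u x - v x))\<^sup>2 \<partial>M) = 0" by (simp add: tendsto_const_iff)
  moreover have "integrable M (\<lambda>x. (norm (u x - v x))\<^sup>2)"
    using sq_integrable_diff[OF u v] by (simp add: sq_integrable_def)
  ultimately have "AE x in M. (norm (u x - v x))\<^sup>2 = 0" by (subst (asm) integral_nonneg_eq_0_iff_AE) auto
  then show ?thesis by eventually_elim simp
qed

section \<open>Completeness of L2\<close>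

definition L2_Cauchy :: "'a measure \<Rightarrow> (nat \<Rightarrow> 'a \<Rightarrow> 'b::euclidean_space) \<Rightarrow> bool" where
  "L2_Cauchy M f \<longleftrightarrow> (\<forall>e>0. \<exists>K. \<forall>m\<ge>K. \<forall>n\<ge>K. (\<integral>x. (norm (f m x - f n x))\<^sup>2 \<partial>M) < e)"

lemma L2_Cauchy_of_limit:
  assumes f: "\<And>n. sq_integrable M (f n)" and h: "sq_integrable M h"
    and lim: "(\<lambda>n. \<integral>x. (norm (f n x - h x))\<^sup>2 \<partial>M) \<longlonglongrightarrow> 0"
  shows "L2_Cauchy M f"
  unfolding L2_Cauchy_def
proof (intro allI impI)
  fix e :: real assume e: "e > 0"
  then obtain K where K: "\<And>n. n \<ge> K \<Longrightarrow> norm ((\<integral>x. (norm (f n x - h x))\<^sup>2 \<partial>M) - 0) < e / 4"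
    using LIMSEQ_D[OF lim, of "e / 4"] by auto
  have "(\<integral>x. (norm (f m x - f n x))\<^sup>2 \<partial>M) < e" if "m \<ge> K" "n \<ge> K" for m n
  proof -
    have "(\<integral>x. (norm (h x - f n x))\<^sup>2 \<partial>M) = (\<integral>x. (norm (f n x - h x))\<^sup>2 \<partial>M)" by (simp add: norm_minus_commute)
    then show ?thesis
      using integral_norm_sq_triangle[OF f[of m] h f[of n]] K[OF that(1)] K[OF that(2)] by simp
  qed
  then show "\<exists>K. \<forall>m\<ge>K. \<forall>n\<ge>K. (\<integral>x. (norm (f m x - f n x))\<^sup>2 \<partial>M) < e" by blast
qed

lemma L2_Cauchy_dominated:
  assumes f: "L2_Cauchy M f" and C: "C > 0"
    and le: "\<And>m n. (\<integral>x. (norm (s m x - s n x))\<^sup>2 \<partial>M) \<le> C * (\<integral>x. (norm (f m x - f n x))\<^sup>2 \<partial>M)"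
  shows "L2_Cauchy M s"
  unfolding L2_Cauchy_def
proof (intro allI impI)
  fix e :: real assume "e > 0"
  then have "e / C > 0" using C by simp
  then obtain K where K: "\<forall>m\<ge>K. \<forall>n\<ge>K. (\<integral>x. (norm (f m x - f n x))\<^sup>2 \<partial>M) < e / C"
    using f unfolding L2_Cauchy_def by blast
  have "(\<integral>x. (norm (s m x - s n x))\<^sup>2 \<partial>M) < e" if "m \<ge> K" "n \<ge> K" for m n
  proof -
    have "(\<integral>x. (norm (f m x - f n x))\<^sup>2 \<partial>M) < e / C" using K that by blast
    then have "C * (\<integral>x. (norm (f m x - f n x))\<^sup>2 \<partial>M) < e" using C by (simp add: field_simps)
    then show ?thesis using le[of m n] by linarith
  qed
  then show "\<exists>K. \<forall>m\<ge>K. \<forall>n\<ge>K. (\<integral>x. (norm (s m x - s n x))\<^sup>2 \<partial>M) < e" by blast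
qed

text \<open>Fatou's lemma in the second index, along the subsequence, transfers the Cauchy bound to
  the distance from the pointwise limit. It serves completeness and later also identifies the L2
  limit of radial approximants with their pointwise limit.\<close>

lemma L2_Cauchy_AE_limit:
  assumes f: "\<And>n. sq_integrable M (f n)" and C: "L2_Cauchy M f"
    and r: "strict_mono r" and h: "h \<in> borel_measurable M"
    and lim: "AE x in M. (\<lambda>k. f (r k) x) \<longlonglongrightarrow> h x"
  shows "sq_integrable M h" and "(\<lambda>n. \<integral>x. (norm (f n x - h x))\<^sup>2 \<partial>M) \<longlonglongrightarrow> 0"
proof -
  have fm[measurable]: "f n \<in> borel_measurable M" for n using f by (auto simp: sq_integrable_def)
  note h[measurable]
  have bound: "(\<integral>\<^sup>+x. ennreal ((norm (f n x - h x))\<^sup>2) \<partial>M) \<le> ennreal e"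
    if K: "\<And>m n. m \<ge> K \<Longrightarrow> n \<ge> K \<Longrightarrow> (\<integral>x. (norm (f m x - f n x))\<^sup>2 \<partial>M) < e" and n: "n \<ge> K" for K n e
  proof -
    have "(\<integral>\<^sup>+x. ennreal ((norm (f n x - h x))\<^sup>2) \<partial>M)
      = (\<integral>\<^sup>+x. liminf (\<lambda>k. ennreal ((norm (f n x - f (r k) x))\<^sup>2)) \<partial>M)"
    proof (rule nn_integral_cong_AE)
      show "AE x in M. ennreal ((norm (f n x - h x))\<^sup>2) = liminf (\<lambda>k. ennreal ((norm (f n x - f (r k) x))\<^sup>2))"
        using lim
      proof eventually_elim
        case (elim x)
        have "(\<lambda>k. ennreal ((norm (f n x - f (r k) x))\<^sup>2)) \<longlonglongrightarrow> ennreal ((norm (f n x - h x))\<^sup>2)"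
          by (intro tendsto_ennrealI tendsto_intros elim)
        then show ?case by (rule lim_imp_Liminf[OF trivial_limit_sequentially, symmetric])
      qed
    qed
    also have "\<dots> \<le> liminf (\<lambda>k. \<integral>\<^sup>+x. ennreal ((norm (f n x - f (r k) x))\<^sup>2) \<partial>M)"
      by (rule nn_integral_liminf) simp
    also have "\<dots> \<le> ennreal e"
    proof (rule Liminf_le)
      show "\<forall>\<^sub>F k in sequentially. (\<integral>\<^sup>+x. ennreal ((norm (f n x - f (r k) x))\<^sup>2) \<partial>M) \<le> ennreal e"
        using eventually_ge_at_top[of K]
      proof eventually_elim
        case (elim k)
        have "r k \<ge> K" using elim seq_suble[OF r, of k] by simp
        then have "(\<integral>x. (norm (f n x - f (r k) x))\<^sup>2 \<partial>M) < e" using K n by simp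
        then show ?case
          using sq_integrable_diff[OF f[of n] f[of "r k"]]
          by (subst nn_integral_eq_integral) (auto simp: sq_integrable_def intro: ennreal_leI)
      qed
    qed simp
    finally show ?thesis .
  qed
  have sqd: "sq_integrable M (\<lambda>x. f n x - h x)"
    if K: "\<And>m n. m \<ge> K \<Longrightarrow> n \<ge> K \<Longrightarrow> (\<integral>x. (norm (f m x - f n x))\<^sup>2 \<partial>M) < e" and n: "n \<ge> K" for K n e
    unfolding sq_integrable_def
  proof
    show "integrable M (\<lambda>x. (norm (f n x - h x))\<^sup>2)"
      by (rule integrableI_bounded) (use le_less_trans[OF bound[OF K n]] in auto)
  qed simp
  obtain K where K: "\<And>m n. m \<ge> K \<Longrightarrow> n \<ge> K \<Longrightarrow> (\<integral>x. (norm (f m x - f n x))\<^sup>2 \<partial>M) < 1"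
    using C[unfolded L2_Cauchy_def, rule_format, of 1] by auto
  have "sq_integrable M (\<lambda>x. f K x - h x)"
    by (rule sqd[of K 1 K]) (use K in auto)
  from sq_integrable_diff[OF f[of K] this] show "sq_integrable M h" by simp
  show "(\<lambda>n. \<integral>x. (norm (f n x - h x))\<^sup>2 \<partial>M) \<longlonglongrightarrow> 0"
  proof (rule LIMSEQ_I)
    fix e :: real assume e: "e > 0"
    obtain K where K: "\<And>m n. m \<ge> K \<Longrightarrow> n \<ge> K \<Longrightarrow> (\<integral>x. (norm (f m x - f n x))\<^sup>2 \<partial>M) < e / 2"
      using C[unfolded L2_Cauchy_def, rule_format, of "e/2"] e by auto
    have "norm ((\<integral>x. (norm (f n x - h x))\<^sup>2 \<partial>M) - 0) < e" if n: "n \<ge> K" for n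
    proof -
      have "ennreal (\<integral>x. (norm (f n x - h x))\<^sup>2 \<partial>M) \<le> ennreal (e / 2)"
      proof -
        have "(\<integral>\<^sup>+x. ennreal ((norm (f n x - h x))\<^sup>2) \<partial>M) \<le> ennreal (e / 2)"
          by (rule bound[of K "e / 2" n]) (use K n in auto)
        moreover have "sq_integrable M (\<lambda>x. f n x - h x)"
          by (rule sqd[of K "e / 2" n]) (use K n in auto)
        ultimately show ?thesis
          by (subst (asm) nn_integral_eq_integral) (auto simp: sq_integrable_def)
      qed
      then show ?thesis using e by (simp add: ennreal_le_iff)
    qed
    then show "\<exists>no. \<forall>n\<ge>no. norm ((\<integral>x. (norm (f n x - h x))\<^sup>2 \<partial>M) - 0) < e" by blast
  qed
qed

text \<open>On a measure space of infinite measure L2 does not embed in L1. Multiplication by the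
  positive square-integrable \<open>\<theta>\<close> repairs this: by Cauchy-Schwarz the products
  are Cauchy in L1, so a subsequence is almost everywhere Cauchy, and \<open>\<theta>\<close> can be
  divided out pointwise.\<close>

lemma L2_complete:
  assumes f: "\<And>n. sq_integrable M (f n)" and C: "L2_Cauchy M f"
    and \<theta>: "sq_integrable M (\<theta> :: 'a \<Rightarrow> real)" and \<theta>pos: "\<And>x. x \<in> space M \<Longrightarrow> \<theta> x > 0"
  shows "\<exists>h. sq_integrable M h \<and> (\<lambda>n. \<integral>x. (norm (f n x - h x))\<^sup>2 \<partial>M) \<longlonglongrightarrow> 0"
proof -
  have fm[measurable]: "f n \<in> borel_measurable M" for n using f by (auto simp: sq_integrable_def)
  have \<theta>m[measurable]: "\<theta> \<in> borel_measurable M" using \<theta> by (auto simp: sq_integrable_def)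
  have nd: "sq_integrable M (\<lambda>x. norm (f m x - f n x))" for m n
    using sq_integrable_diff[OF f f] by (auto simp: sq_integrable_def)
  have int\<theta>: "integrable M (\<lambda>x. \<theta> x *\<^sub>R f n x)" for n
  proof (rule Bochner_Integration.integrable_bound[where f="\<lambda>x. \<theta> x \<bullet> norm (f n x)"])
    show "integrable M (\<lambda>x. \<theta> x \<bullet> norm (f n x))"
      using f by (intro sq_integrable_inner \<theta>) (auto simp: sq_integrable_def)
  qed auto
  define T where "T = sqrt (\<integral>x. (norm (\<theta> x))\<^sup>2 \<partial>M)"
  have T: "T \<ge> 0" unfolding T_def by simp
  have L1: "\<exists>N. \<forall>i\<ge>N. \<forall>j\<ge>N. (\<integral>x. norm (\<theta> x *\<^sub>R f i x - \<theta> x *\<^sub>R f j x) \<partial>M) < e" if e: "e > 0" for e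
  proof -
    \<comment> \<open>\<open>T + 1\<close> in place of \<open>T\<close> covers the case
      \<open>T = 0\<close>.\<close>
    obtain K where K: "\<And>m n. m \<ge> K \<Longrightarrow> n \<ge> K \<Longrightarrow> (\<integral>x. (norm (f m x - f n x))\<^sup>2 \<partial>M) < (e / (T + 1))\<^sup>2"
      using C[unfolded L2_Cauchy_def, rule_format, of "(e / (T + 1))\<^sup>2"] e T by auto
    have "(\<integral>x. norm (\<theta> x *\<^sub>R f i x - \<theta> x *\<^sub>R f j x) \<partial>M) < e" if "i \<ge> K" "j \<ge> K" for i j
    proof -
      have "(\<integral>x. norm (\<theta> x *\<^sub>R f i x - \<theta> x *\<^sub>R f j x) \<partial>M) = (\<integral>x. \<theta> x \<bullet> norm (f i x - f j x) \<partial>M)"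
        using \<theta>pos by (intro Bochner_Integration.integral_cong) (auto simp flip: scaleR_diff_right simp: less_imp_le)
      also have "\<dots> \<le> T * sqrt (\<integral>x. (norm (norm (f i x - f j x)))\<^sup>2 \<partial>M)"
        using integral_Cauchy_Schwarz[OF \<theta> nd[of i j]] unfolding T_def by linarith
      also have "\<dots> \<le> T * (e / (T + 1))"
      proof (rule mult_left_mono[OF _ T])
        show "sqrt (\<integral>x. (norm (norm (f i x - f j x)))\<^sup>2 \<partial>M) \<le> e / (T + 1)"
          using K[OF that] e T by (intro real_le_lsqrt) auto
      qed
      also have "\<dots> < e" using e T by (simp add: divide_simps)
      finally show ?thesis .
    qed
    then show ?thesis by blast
  qed
  obtain r where r: "strict_mono r" and cau: "AE x in M. Cauchy (\<lambda>i. \<theta> x *\<^sub>R f (r i) x)"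
    by (rule cauchy_L1_AE_cauchy_subseq[of M "\<lambda>n x. \<theta> x *\<^sub>R f n x"]) (use int\<theta> L1 in auto)
  define h where "h x = lim (\<lambda>i. f (r i) x)" for x
  have hm: "h \<in> borel_measurable M" unfolding h_def[abs_def] by measurable
  have lim: "AE x in M. (\<lambda>i. f (r i) x) \<longlonglongrightarrow> h x"
    using cau AE_space
  proof eventually_elim
    case (elim x)
    obtain l where "(\<lambda>i. \<theta> x *\<^sub>R f (r i) x) \<longlonglongrightarrow> l"
      using elim(1) unfolding Cauchy_convergent_iff convergent_def by blast
    from tendsto_scaleR[OF tendsto_const[of "1 / \<theta> x"] this]
    have "convergent (\<lambda>i. f (r i) x)"
      using \<theta>pos[OF elim(2)] by (auto simp: convergent_def)
    then show ?case unfolding h_def by (simp add: convergent_LIMSEQ_iff)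
  qed
  show ?thesis
    using L2_Cauchy_AE_limit[OF f C r hm lim] by blast
qed

section \<open>Hardy weights on the ball\<close>

definition C1_grad :: "('a::euclidean_space \<Rightarrow> real) \<Rightarrow> ('a \<Rightarrow> 'a) \<Rightarrow> bool" where
  "C1_grad \<phi> g \<longleftrightarrow> (\<forall>x. (\<phi> has_derivative (\<lambda>h. g x \<bullet> h)) (at x)) \<and> continuous_on UNIV g"

text \<open>C1 functions supported in a smaller concentric ball, extended by zero. The class
  contains the test functions and also the radial functions of C1 profiles, which need not be
  smooth.\<close>

definition C1_ball :: "('a::euclidean_space \<Rightarrow> real) \<Rightarrow> ('a \<Rightarrow> 'a) \<Rightarrow> bool" where
  "C1_ball \<phi> g \<longleftrightarrow> C1_grad \<phi> g \<and> (\<exists>R. 0 < R \<and> R < 1 \<and> (\<forall>x. R \<le> norm x \<longrightarrow> \<phi> x = 0))"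

lemma C1_gradD:
  assumes "C1_grad \<phi> g"
  shows "(\<phi> has_derivative (\<lambda>h. g x \<bullet> h)) (at x)" "continuous_on UNIV g" "continuous_on UNIV \<phi>"
    "g \<in> borel_measurable borel" "\<phi> \<in> borel_measurable borel"
proof -
  show 1: "(\<phi> has_derivative (\<lambda>h. g x \<bullet> h)) (at x)" for x using assms by (auto simp: C1_grad_def)
  show 2: "continuous_on UNIV g" using assms by (auto simp: C1_grad_def)
  show 3: "continuous_on UNIV \<phi>"
    using has_derivative_continuous[OF 1] by (simp add: continuous_at_imp_continuous_on)
  show "g \<in> borel_measurable borel" "\<phi> \<in> borel_measurable borel"
    using 2 3 by (auto intro: borel_measurable_continuous_onI)
qed

lemma C1_grad_eq_0:
  assumes "C1_grad \<phi> g" and "\<And>x. R \<le> norm x \<Longrightarrow> \<phi> x = 0" and x: "R < norm x"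
  shows "g x = 0"
proof -
  have "open {x::'a. R < norm x}" by (intro open_Collect_less continuous_intros)
  then have "((\<lambda>x. 0) has_derivative (\<lambda>h. g x \<bullet> h)) (at x)"
    by (rule has_derivative_transform_within_open[OF C1_gradD(1)[OF assms(1)]]) (use assms in auto)
  then have "(\<lambda>h. g x \<bullet> h) = (\<lambda>h. 0)"
    by (rule has_derivative_unique) simp
  from fun_cong[OF this, of "g x"] show ?thesis by simp
qed

lemma C1_grad_diff:
  assumes "C1_grad \<phi> g" "C1_grad \<psi> h"
  shows "C1_grad (\<lambda>x. \<phi> x - \<psi> x) (\<lambda>x. g x - h x)"
  unfolding C1_grad_def
proof (intro conjI allI)
  fix x
  show "((\<lambda>x. \<phi> x - \<psi> x) has_derivative (\<lambda>v. (g x - h x) \<bullet> v)) (at x)"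
    using has_derivative_diff[OF C1_gradD(1)[OF assms(1), of x] C1_gradD(1)[OF assms(2), of x]] by (simp add: inner_diff_left)
qed (intro continuous_intros C1_gradD(2)[OF assms(1)] C1_gradD(2)[OF assms(2)])

lemma bounded_continuous_support:
  fixes \<phi> :: "'a::euclidean_space \<Rightarrow> 'b::real_normed_vector"
  assumes c: "continuous_on UNIV \<phi>" and z: "\<And>x. R < norm x \<Longrightarrow> \<phi> x = 0"
  shows "\<exists>B>0. \<forall>x. norm (\<phi> x) \<le> B"
proof -
  have "continuous_on (cball 0 R) \<phi>" using c by (rule continuous_on_subset) simp
  then have "bounded (\<phi> ` cball 0 R)"
    by (rule compact_imp_bounded[OF compact_continuous_image]) simp
  then obtain B where B': "\<forall>y\<in>\<phi> ` cball 0 R. norm y \<le> B"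
    unfolding bounded_iff by (elim exE)
  have B: "norm (\<phi> x) \<le> B" if "x \<in> cball 0 R" for x by (rule bspec[OF B' imageI[OF that]])
  have "norm (\<phi> x) \<le> \<bar>B\<bar> + 1" for x
  proof (cases "norm x \<le> R")
    case True
    then have "norm (\<phi> x) \<le> B" by (intro B) simp
    then show ?thesis by linarith
  next
    case False
    then have "\<phi> x = 0" by (intro z) simp
    then show ?thesis by simp
  qed
  then show ?thesis by (intro exI[of _ "\<bar>B\<bar> + 1"] conjI allI) (auto simp: add_nonneg_pos)
qed

lemma integrable_bounded_support:
  fixes \<phi> :: "'a::euclidean_space \<Rightarrow> 'b::euclidean_space"
  assumes m: "\<phi> \<in> borel_measurable borel" and z: "\<And>x. R < norm x \<Longrightarrow> \<phi> x = 0" and B: "\<And>x. norm (\<phi> x) \<le> B"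
  shows "integrable lborel \<phi>"
proof (rule Bochner_Integration.integrable_bound[where f="\<lambda>x. B * indicator (cball 0 R) x"])
  show "integrable lborel (\<lambda>x::'a. B * indicator (cball 0 R) x)"
    by (intro integrable_mult_right integrable_real_indicator) (auto simp: emeasure_lborel_cball_finite[unfolded infinity_ennreal_def])
  have "B \<ge> 0" using B[of 0] norm_ge_zero order_trans by blast
  then show "AE x in lborel. norm (\<phi> x) \<le> norm (B * indicat_real (cball 0 R) x)"
    using B z by (auto simp: indicator_def not_le)
qed (use m in auto)

lemma integrable_continuous_support:
  fixes \<phi> :: "'a::euclidean_space \<Rightarrow> 'b::euclidean_space"
  assumes c: "continuous_on UNIV \<phi>" and z: "\<And>x. R < norm x \<Longrightarrow> \<phi> x = 0"
  shows "integrable lborel \<phi>"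
proof -
  obtain B where "\<And>x. norm (\<phi> x) \<le> B" using bounded_continuous_support[OF assms] by blast
  then show ?thesis
    by (intro integrable_bounded_support[OF borel_measurable_continuous_onI[OF c] z, of R]) auto
qed

section \<open>Integration by parts for compactly supported functions\<close>

text \<open>By translation invariance the integral of \<open>\<phi> (x + t *\<^sub>R e)\<close> is
  constant in \<open>t\<close>; differentiating under the integral at 0 gives the claim. All
  integrations by parts below come from this.\<close>

lemma integral_partial_derivative_eq_0:
  assumes C: "C1_grad \<phi> g" and z: "\<And>x. R \<le> norm x \<Longrightarrow> \<phi> x = 0"
  shows "integrable lborel (\<lambda>x. g x \<bullet> e)" "(\<integral>x. g x \<bullet> e \<partial>lborel) = 0"
proof -
  have gz: "\<And>x. R < norm x \<Longrightarrow> g x = 0" by (rule C1_grad_eq_0[OF C z])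
  obtain B where B: "B > 0" "\<And>x. norm (g x) \<le> B"
    using bounded_continuous_support[OF C1_gradD(2)[OF C] gz] by blast
  have intF: "integrable lborel (\<lambda>x. \<phi> (x + t *\<^sub>R e))" and
    eqF: "(\<integral>x. \<phi> (x + t *\<^sub>R e) \<partial>lborel) = (\<integral>x. \<phi> x \<partial>lborel)" for t
  proof -
    have i: "integrable lborel \<phi>"
      by (rule integrable_continuous_support[OF C1_gradD(3)[OF C], of R]) (use z in auto)
    have "integrable (distr lborel borel ((+) (t *\<^sub>R e))) \<phi>" using i by (simp add: lborel_distr_plus)
    then show "integrable lborel (\<lambda>x. \<phi> (x + t *\<^sub>R e))"
      by (subst (asm) integrable_distr_eq) (use C1_gradD(5)[OF C] in \<open>auto simp: add.commute\<close>)
    have "(\<integral>x. \<phi> x \<partial>lborel) = (\<integral>x. \<phi> x \<partial>(distr lborel borel ((+) (t *\<^sub>R e))))"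
      by (simp add: lborel_distr_plus)
    also have "\<dots> = (\<integral>x. \<phi> (x + t *\<^sub>R e) \<partial>lborel)"
      by (subst integral_distr) (use C1_gradD(5)[OF C] in \<open>auto simp: add.commute\<close>)
    finally show "(\<integral>x. \<phi> (x + t *\<^sub>R e) \<partial>lborel) = (\<integral>x. \<phi> x \<partial>lborel)" by simp
  qed
  have der: "((\<lambda>t. \<phi> (x + t *\<^sub>R e)) has_real_derivative g (x + t *\<^sub>R e) \<bullet> e) (at t)" for x t
  proof -
    have "((\<lambda>t. \<phi> (x + t *\<^sub>R e)) has_derivative (\<lambda>h. g (x + t *\<^sub>R e) \<bullet> (h *\<^sub>R e))) (at t)"
      by (rule has_derivative_compose[where f="\<lambda>t. x + t *\<^sub>R e" and g=\<phi>, OF _ C1_gradD(1)[OF C]])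
        (auto intro!: derivative_eq_intros)
    then show ?thesis by (simp add: has_field_derivative_def mult_commute_abs)
  qed
  \<comment> \<open>For \<open>\<bar>t\<bar> < 1\<close> all translated supports stay in the ball of
    radius \<open>R + norm e\<close>.\<close>
  define D where "D x = (B * norm e) * indicator (cball 0 (R + norm e)) x" for x :: 'a
  have D: "integrable lborel D" unfolding D_def
    by (intro integrable_mult_right integrable_real_indicator) (auto simp: emeasure_lborel_cball_finite[unfolded infinity_ennreal_def])
  have bd: "\<bar>g (x + t *\<^sub>R e) \<bullet> e\<bar> \<le> D x" if "\<bar>t - 0\<bar> < 1" for x t
  proof (cases "norm x \<le> R + norm e")
    case True
    have "\<bar>g (x + t *\<^sub>R e) \<bullet> e\<bar> \<le> norm (g (x + t *\<^sub>R e)) * norm e" by (rule Cauchy_Schwarz_ineq2)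
    also have "\<dots> \<le> B * norm e" by (intro mult_right_mono B) auto
    finally show ?thesis using True by (simp add: D_def)
  next
    case False
    have "\<bar>t\<bar> * norm e \<le> 1 * norm e" using that by (intro mult_right_mono) auto
    then have "norm (t *\<^sub>R e) \<le> norm e" by simp
    moreover have "norm x \<le> norm (x + t *\<^sub>R e) + norm (t *\<^sub>R e)"
      using norm_triangle_ineq4[of "x + t *\<^sub>R e" "t *\<^sub>R e"] by simp
    ultimately have "R < norm (x + t *\<^sub>R e)" using False by linarith
    then show ?thesis using gz B(1) by (simp add: D_def)
  qed
  have bdAE: "AE x in lborel. \<forall>t. \<bar>t - 0\<bar> < 1 \<longrightarrow> \<bar>g (x + t *\<^sub>R e) \<bullet> e\<bar> \<le> D x"
    by (intro AE_I2 allI impI bd)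
  note DUI = has_real_derivative_lebesgue_integral[of 1 0 lborel "\<lambda>t x. \<phi> (x + t *\<^sub>R e)" "\<lambda>t x. g (x + t *\<^sub>R e) \<bullet> e" D,
      OF zero_less_one intF der bdAE D]
  note 1 = DUI(1) and 2 = DUI(2)
  show "integrable lborel (\<lambda>x. g x \<bullet> e)" using 1 by simp
  have "((\<lambda>t. \<integral>x. \<phi> (x + t *\<^sub>R e) \<partial>lborel) has_real_derivative 0) (at 0)"
    unfolding eqF by simp
  from DERIV_unique[OF 2 this] show "(\<integral>x. g x \<bullet> e \<partial>lborel) = 0" by simp
qed

text \<open>The factor \<open>b\<close> may blow up at the unit sphere, as the Hardy weight does.
  Since \<open>\<phi>\<close> vanishes beyond \<open>R < 1\<close>, the product is C1 on two open
  sets that cover the space.\<close>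

lemma C1_grad_mult_ball:
  assumes C: "C1_grad \<phi> g" and z: "\<And>x. R \<le> norm x \<Longrightarrow> \<phi> x = 0" and R: "R < 1"
    and b: "\<And>x. norm x < 1 \<Longrightarrow> (b has_derivative (\<lambda>h. gb x \<bullet> h)) (at x)"
    and cb: "continuous_on (ball 0 1) gb"
  shows "C1_grad (\<lambda>x. \<phi> x * b x) (\<lambda>x. b x *\<^sub>R g x + \<phi> x *\<^sub>R gb x)"
proof -
  have gz: "\<And>x. R < norm x \<Longrightarrow> g x = 0" by (rule C1_grad_eq_0[OF C z])
  have op: "open {x::'a. R < norm x}" by (intro open_Collect_less continuous_intros)
  have "((\<lambda>x. \<phi> x * b x) has_derivative (\<lambda>h. (b x *\<^sub>R g x + \<phi> x *\<^sub>R gb x) \<bullet> h)) (at x)" for x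
  proof (cases "norm x < 1")
    case True
    show ?thesis
      by (rule has_derivative_eq_rhs[OF has_derivative_mult[OF C1_gradD(1)[OF C, of x] b[OF True]]])
        (auto simp: fun_eq_iff inner_add_left)
  next
    case False
    then have x: "R < norm x" using R by simp
    have "((\<lambda>x. \<phi> x * b x) has_derivative (\<lambda>h. 0)) (at x)"
      by (rule has_derivative_transform_within_open[OF has_derivative_const op, of x]) (use z x in auto)
    then show ?thesis using gz[OF x] z[of x] x by simp
  qed
  moreover have "continuous_on UNIV (\<lambda>x. b x *\<^sub>R g x + \<phi> x *\<^sub>R gb x)"
  proof -
    have "continuous_on (ball 0 1) b"
      using has_derivative_continuous[OF b] by (simp add: continuous_at_imp_continuous_on)
    then have "continuous_on (ball 0 1) (\<lambda>x. b x *\<^sub>R g x + \<phi> x *\<^sub>R gb x)"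
      by (intro continuous_intros cb continuous_on_subset[OF C1_gradD(2)[OF C]] continuous_on_subset[OF C1_gradD(3)[OF C]]) auto
    moreover have "continuous_on {x. R < norm x} (\<lambda>x. b x *\<^sub>R g x + \<phi> x *\<^sub>R gb x)"
      by (rule continuous_on_eq[OF continuous_on_const[of _ 0]]) (use gz z in auto)
    ultimately have "continuous_on (ball 0 1 \<union> {x. R < norm x}) (\<lambda>x. b x *\<^sub>R g x + \<phi> x *\<^sub>R gb x)"
      using op by (intro continuous_on_open_Un) auto
    moreover have "ball 0 1 \<union> {x. R < norm x} = (UNIV :: 'a set)" using R by auto
    ultimately show ?thesis by simp
  qed
  ultimately show ?thesis by (simp add: C1_grad_def)
qed

section \<open>The Hardy weight\<close>

text \<open>The derivative is kept as the weight times its logarithmic derivative, so that the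
  weight factors out of the divergence in the pointwise inequality.\<close>

lemma Hardy_weight_deriv:
  fixes s e :: real
  assumes "0 \<le> s" "s < 1" "e > 0" "k \<ge> 1"
  shows "((\<lambda>s. (2 / (1 - s)) ^ k / (s + e)) has_real_derivative
    (2 / (1 - s)) ^ k / (s + e) * (k / (1 - s) - 1 / (s + e))) (at s)"
proof -
  obtain j where k: "k = Suc j" using assms(4) by (cases k) auto
  have d1: "((\<lambda>s. 2 / (1 - s)) has_real_derivative 2 / (1 - s)\<^sup>2) (at s)"
    using assms by (auto intro!: derivative_eq_intros simp: power2_eq_square)
  have d2: "((\<lambda>s. (2 / (1 - s)) ^ k) has_real_derivative real k * (2 / (1 - s)) ^ j * (2 / (1 - s)\<^sup>2)) (at s)"
    using DERIV_power[OF d1, of k] by (simp add: k mult_ac)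
  have d3: "((\<lambda>s. s + e) has_real_derivative 1) (at s)"
    by (auto intro!: derivative_eq_intros)
  have "((\<lambda>s. (2 / (1 - s)) ^ k / (s + e)) has_real_derivative
    ((real k * (2 / (1 - s)) ^ j * (2 / (1 - s)\<^sup>2)) * (s + e) - (2 / (1 - s)) ^ k * 1) / ((s + e) * (s + e))) (at s)"
    by (rule DERIV_divide[OF d2 d3]) (use assms in auto)
  also have "((real k * (2 / (1 - s)) ^ j * (2 / (1 - s)\<^sup>2)) * (s + e) - (2 / (1 - s)) ^ k * 1) / ((s + e) * (s + e))
    = (2 / (1 - s)) ^ k / (s + e) * (k / (1 - s) - 1 / (s + e))"
  proof -
    have nz: "s + e \<noteq> 0" "1 - s \<noteq> 0" using assms by auto
    have "(2 / (1 - s)) ^ k = (2 / (1 - s)) ^ j * (2 / (1 - s))" by (simp add: k)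
    moreover have "(K * P * (2 / a\<^sup>2) * c - P * (2 / a) * 1) / (c * c) = P * (2 / a) / c * (K / a - 1 / c)"
      if "a \<noteq> 0" "c \<noteq> 0" for K P a c :: real
      using that by (simp add: field_simps power2_eq_square)
    ultimately show ?thesis using nz by simp
  qed
  finally show ?thesis .
qed

text \<open>
  With \<open>s = |x|\<^sup>2\<close>, \<open>p = \<phi> x\<close> and \<open>d = \<nabla>\<phi> x \<bullet> x\<close>, the parenthesized expression is the divergence of
  \<open>\<phi>\<^sup>2 b x\<close> in dimension \<open>k + 1\<close>, whose integral vanishes.
\<close>

lemma Hardy_pointwise:
  fixes s e p G d :: real
  assumes s: "0 \<le> s" "s < 1" and e: "e > 0" and k: "k \<ge> 2" and d: "\<bar>d\<bar> \<le> G * sqrt s"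
  defines "w \<equiv> 2 / (1 - s)"
  defines "b \<equiv> w ^ k / (s + e)"
  shows "1/4 * (p\<^sup>2 * (w ^ (k+1) / (s + e))) \<le>
    (b * (2 * p * d) + p\<^sup>2 * (2 * (b * (k / (1 - s) - 1 / (s + e))) * s + (real k + 1) * b)) + 4 * (w ^ (k-1) * G\<^sup>2)"
proof -
  define V where "V = w ^ (k+1) / (s + e)"
  have w: "w > 0" using s by (simp add: w_def)
  have b0: "b > 0" using w s e by (simp add: b_def)
  have V: "V > 0" using w s e by (simp add: V_def)
  have "w / 2 = 1 / (1 - s)" using s by (simp add: w_def field_simps)
  then have V2: "V / 2 = b / (1 - s)"
    by (metis V_def b_def mult.commute power_Suc Suc_eq_plus1 times_divide_eq_left times_divide_eq_right mult.right_neutral)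
  \<comment> \<open>The zero-order part of the divergence controls twice the weight that is finally
    kept; the other half pays for the mixed term.\<close>
  have dv: "V / 2 \<le> 2 * (b * (k / (1 - s) - 1 / (s + e))) * s + (real k + 1) * b"
  proof -
    have kk: "real k \<ge> 2" using k by simp
    \<comment> \<open>The worst case is \<open>k = 2\<close>, that is dimension 3: the right-hand
      side increases with \<open>k\<close>.\<close>
    have "1 / (1 - s) \<le> 2 * (2 / (1 - s) - 1 / (s + e)) * s + 3"
    proof -
      have "s / (s + e) \<le> 1" using s e by simp
      moreover have "1 / (1 - s) = 1 + s / (1 - s)" using s by (simp add: field_simps)
      moreover have "s / (1 - s) \<ge> 0" using s by simp
      moreover have "2 * (2 / (1 - s) - 1 / (s + e)) * s + 3 = 4 * (s / (1 - s)) - 2 * (s / (s + e)) + 3"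
        by (simp add: algebra_simps)
      ultimately show ?thesis by linarith
    qed
    also have "\<dots> \<le> 2 * (k / (1 - s) - 1 / (s + e)) * s + (real k + 1)"
    proof -
      have "2 / (1 - s) \<le> k / (1 - s)" using kk s by (intro divide_right_mono) auto
      then have "2 * (2 / (1 - s) - 1 / (s + e)) * s \<le> 2 * (k / (1 - s) - 1 / (s + e)) * s"
        using s by (intro mult_right_mono) auto
      then show ?thesis using kk by simp
    qed
    finally have "b * (1 / (1 - s)) \<le> b * (2 * (k / (1 - s) - 1 / (s + e)) * s + (real k + 1))"
      using b0 by (intro mult_left_mono) auto
    then show ?thesis unfolding V2 by (simp add: algebra_simps)
  qed
  \<comment> \<open>Young's inequality with weights 1/4 and 4, applied to the mixed term.\<close>
  have am: "- (b * (2 * p * d)) \<le> 1/4 * (p\<^sup>2 * V) + 4 * (w ^ (k-1) * G\<^sup>2)"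
  proof -
    have G: "G * sqrt s \<ge> 0" using d by linarith
    have "\<bar>b * (2 * p * d)\<bar> \<le> 2 * (b * \<bar>p\<bar> * (G * sqrt s))"
      using d b0 by (simp add: abs_mult mult_left_mono mult.assoc)
    also have "\<dots> \<le> 1/4 * (p\<^sup>2 * V) + 4 * (w ^ (k-1) * G\<^sup>2)"
    proof -
      define x y where "x = \<bar>p\<bar> * sqrt V / 2" and "y = 2 * sqrt (w ^ (k-1)) * \<bar>G\<bar>"
      have "x\<^sup>2 = 1/4 * (p\<^sup>2 * V)" "y\<^sup>2 = 4 * (w ^ (k-1) * G\<^sup>2)"
        using V w by (simp_all add: x_def y_def power_mult_distrib power_divide)
      moreover have "2 * x * y \<le> x\<^sup>2 + y\<^sup>2" by (rule sum_squares_bound)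
      moreover have "b * \<bar>p\<bar> * (G * sqrt s) \<le> x * y"
      proof -
        have "(b * sqrt s)\<^sup>2 \<le> V * w ^ (k-1)"
        proof -
          have ww: "w ^ (k+1) * w ^ (k-1) = (w ^ k)\<^sup>2"
          proof -
            have "k + 1 + (k - 1) = k * 2" using k by simp
            then show ?thesis by (metis power_add power_mult)
          qed
          have "(b * sqrt s)\<^sup>2 = (w ^ k)\<^sup>2 * (s / (s + e)\<^sup>2)"
            using s by (simp add: b_def power_mult_distrib power_divide)
          also have "\<dots> \<le> (w ^ k)\<^sup>2 * (1 / (s + e))"
            using s e by (intro mult_left_mono) (auto simp: divide_simps power2_eq_square)
          also have "\<dots> = V * w ^ (k-1)" by (simp add: V_def ww[symmetric])
          finally show ?thesis .
        qed
        then have "b * sqrt s \<le> sqrt (V * w ^ (k-1))" by (rule real_le_rsqrt)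
        then have "b * sqrt s * (\<bar>p\<bar> * \<bar>G\<bar>) \<le> sqrt (V * w ^ (k-1)) * (\<bar>p\<bar> * \<bar>G\<bar>)"
          by (intro mult_right_mono) auto
        also have "\<dots> = x * y" by (simp add: x_def y_def real_sqrt_mult)
        finally have "b * sqrt s * (\<bar>p\<bar> * \<bar>G\<bar>) \<le> x * y" .
        moreover have "b * \<bar>p\<bar> * (G * sqrt s) \<le> b * sqrt s * (\<bar>p\<bar> * \<bar>G\<bar>)"
        proof -
          have "b * sqrt s * \<bar>p\<bar> * G \<le> b * sqrt s * \<bar>p\<bar> * \<bar>G\<bar>"
            using b0 s by (intro mult_left_mono) auto
          then show ?thesis by (simp add: mult_ac)
        qed
        ultimately show ?thesis by linarith
      qed
      ultimately show ?thesis by linarith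
    qed
    finally show ?thesis by linarith
  qed
  have "p\<^sup>2 * (V / 2) \<le> p\<^sup>2 * (2 * (b * (k / (1 - s) - 1 / (s + e))) * s + (real k + 1) * b)"
    by (rule mult_left_mono[OF dv]) simp
  then show ?thesis using am unfolding V_def[symmetric] by linarith
qed

section \<open>The hyperbolic measure and the Hardy--Poincare inequality\<close>

text \<open>The conformal factor: the metric is its square times the Euclidean one, so the volume
  density is its \<open>N\<close>-th power.\<close>

definition conf :: "real ^ 'n \<Rightarrow> real" where
  "conf x = 2 / (1 - (norm x)\<^sup>2)"

lemma conf_pos: "norm x < 1 \<Longrightarrow> conf x > 0"
  by (simp add: conf_def abs_square_less_1)

lemma conf_ge_2: "norm x < 1 \<Longrightarrow> conf x \<ge> 2"
proof -
  assume "norm x < 1"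
  then have "(norm x)\<^sup>2 < 1" by (simp add: abs_square_less_1)
  then show ?thesis by (simp add: conf_def field_simps)
qed

lemma conf_mono: "norm x \<le> R \<Longrightarrow> R < 1 \<Longrightarrow> conf x \<le> 2 / (1 - R\<^sup>2)"
proof -
  assume a: "norm x \<le> R" "R < 1"
  then have "(norm x)\<^sup>2 \<le> R\<^sup>2" by (intro power_mono) auto
  moreover have "0 \<le> R" using a norm_ge_zero order_trans by blast
  then have "R\<^sup>2 < 1" using a by (simp add: abs_square_less_1)
  ultimately show ?thesis by (simp add: conf_def frac_le)
qed

lemma conf_measurable[measurable]: "conf \<in> borel_measurable borel"
  unfolding conf_def[abs_def] by measurable

lemma hyp_measure_conf:
  "(hyp_measure :: (real ^ 'n) measure) = density (lebesgue_on (ball 0 1)) (\<lambda>x. ennreal (conf x ^ CARD('n)))"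
  by (simp add: hyp_measure_def conf_def power_divide)

lemma space_hyp_measure [simp]: "space hyp_measure = ball 0 1"
  by (simp add: hyp_measure_def)

lemma sets_hyp_measure: "sets hyp_measure = sets (lebesgue_on (ball 0 1))"
  by (simp add: hyp_measure_def)

lemma borel_measurable_lebesgue_on_ball: "g \<in> borel_measurable borel \<Longrightarrow> g \<in> borel_measurable (lebesgue_on (ball 0 1))"
  by (rule measurable_restrict_space1[OF measurable_completion]) simp

lemma borel_measurable_hyp_measure: "g \<in> borel_measurable borel \<Longrightarrow> g \<in> borel_measurable hyp_measure"
  by (subst measurable_cong_sets[OF sets_hyp_measure refl]) (rule borel_measurable_lebesgue_on_ball)

text \<open>The density is positive on the ball, so being null there means the same as for Lebesgue
  measure.\<close>

lemma AE_hyp_measure: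
  fixes P :: "real ^ 'n \<Rightarrow> bool"
  shows "(AE x in hyp_measure. P x) \<longleftrightarrow> (AE x in lebesgue. norm x < 1 \<longrightarrow> P x)"
proof -
  have "(\<lambda>x::real^'n. ennreal (conf x ^ CARD('n))) \<in> borel_measurable (lebesgue_on (ball 0 1))"
    by (intro borel_measurable_lebesgue_on_ball) measurable
  then have "(AE x in hyp_measure. P x) \<longleftrightarrow> (AE x::real^'n in lebesgue_on (ball 0 1). 0 < ennreal (conf x ^ CARD('n)) \<longrightarrow> P x)"
    unfolding hyp_measure_conf by (rule AE_density)
  also have "\<dots> \<longleftrightarrow> (AE x::real^'n in lebesgue. x \<in> ball 0 1 \<longrightarrow> 0 < ennreal (conf x ^ CARD('n)) \<longrightarrow> P x)"
    by (rule AE_restrict_space_iff) auto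
  also have "\<dots> \<longleftrightarrow> (AE x in lebesgue. norm x < 1 \<longrightarrow> P x)"
    by (intro AE_cong) (auto simp: conf_pos)
  finally show ?thesis .
qed

lemma AE_hyp_measure_lborel:
  "(AE x in lborel. norm x < 1 \<longrightarrow> P x) \<Longrightarrow> (AE x in hyp_measure. P x)"
  unfolding AE_hyp_measure by (rule AE_completion)

lemma AE_hyp_measure_nonzero: "AE x in hyp_measure. x \<noteq> 0"
  by (rule AE_hyp_measure_lborel) (use AE_lborel_singleton[of 0] in auto)

lemma
  fixes g :: "real ^ 'n \<Rightarrow> real"
  assumes g: "g \<in> borel_measurable borel"
  shows integral_hyp_measure: "integral\<^sup>L hyp_measure g = (\<integral>x. indicator (ball 0 1) x * (conf x ^ CARD('n) * g x) \<partial>lborel)"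
    and integrable_hyp_measure: "integrable hyp_measure g \<longleftrightarrow> integrable lborel (\<lambda>x. indicator (ball 0 1) x * (conf x ^ CARD('n) * g x))"
proof -
  note g[measurable]
  have [measurable]: "ball (0::real^'n) 1 \<in> sets borel" by simp
  have m: "(\<lambda>x::real^'n. conf x ^ CARD('n)) \<in> borel_measurable (lebesgue_on (ball 0 1))"
    by (intro borel_measurable_lebesgue_on_ball) measurable
  have nn: "AE x::real^'n in lebesgue_on (ball 0 1). 0 \<le> conf x ^ CARD('n)"
    by (rule AE_I2) (auto intro!: zero_le_power less_imp_le[OF conf_pos])
  have gm: "g \<in> borel_measurable (lebesgue_on (ball 0 1))" by (rule borel_measurable_lebesgue_on_ball[OF g])
  have bm: "(\<lambda>x. indicator (ball 0 1) x *\<^sub>R (conf x ^ CARD('n) * g x)) \<in> borel_measurable (lborel :: (real^'n) measure)"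
    by measurable
  have "integral\<^sup>L hyp_measure g = (\<integral>x. conf x ^ CARD('n) * g x \<partial>lebesgue_on (ball 0 1))"
    unfolding hyp_measure_conf by (rule integral_real_density[OF m nn gm])
  also have "\<dots> = (\<integral>x. indicator (ball 0 1) x *\<^sub>R (conf x ^ CARD('n) * g x) \<partial>lebesgue)"
    by (rule integral_restrict_space) auto
  also have "\<dots> = (\<integral>x. indicator (ball 0 1) x *\<^sub>R (conf x ^ CARD('n) * g x) \<partial>lborel)"
    by (rule integral_completion[OF bm])
  finally show "integral\<^sup>L hyp_measure g = (\<integral>x. indicator (ball 0 1) x * (conf x ^ CARD('n) * g x) \<partial>lborel)" by simp
  have "integrable hyp_measure g \<longleftrightarrow> integrable (lebesgue_on (ball 0 1)) (\<lambda>x. conf x ^ CARD('n) * g x)"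
    unfolding hyp_measure_conf by (rule integrable_real_density[OF m nn gm])
  also have "\<dots> \<longleftrightarrow> integrable lebesgue (\<lambda>x. indicator (ball 0 1) x *\<^sub>R (conf x ^ CARD('n) * g x))"
    by (rule integrable_restrict_space) auto
  also have "\<dots> \<longleftrightarrow> integrable lborel (\<lambda>x. indicator (ball 0 1) x *\<^sub>R (conf x ^ CARD('n) * g x))"
    by (rule integrable_completion[OF bm])
  finally show "integrable hyp_measure g \<longleftrightarrow> integrable lborel (\<lambda>x. indicator (ball 0 1) x * (conf x ^ CARD('n) * g x))" by simp
qed

lemma integrable_hyp_measure_bounded_support:
  fixes h :: "real ^ 'n \<Rightarrow> real"
  assumes m: "h \<in> borel_measurable borel" and R: "0 \<le> R" "R < 1"
    and z: "\<And>x. R < norm x \<Longrightarrow> h x = 0" and B: "\<And>x. \<bar>h x\<bar> \<le> B"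
  shows "integrable hyp_measure h"
  unfolding integrable_hyp_measure[OF m]
proof (rule integrable_bounded_support)
  note m[measurable]
  have [measurable]: "ball (0::real^'n) 1 \<in> sets borel" by simp
  show "(\<lambda>x. indicator (ball 0 1) x * (conf x ^ CARD('n) * h x)) \<in> borel_measurable borel"
    by measurable
  show "indicator (ball 0 1) x * (conf x ^ CARD('n) * h x) = 0" if "R < norm x" for x
    using z[OF that] by simp
  show "norm (indicator (ball 0 1) x * (conf x ^ CARD('n) * h x)) \<le> (2 / (1 - R\<^sup>2)) ^ CARD('n) * B" for x
  proof (cases "norm x \<le> R")
    case True
    then have x: "norm x < 1" using R by simp
    have "R\<^sup>2 < 1" using R by (simp add: abs_square_less_1)
    then have "conf x ^ CARD('n) * \<bar>h x\<bar> \<le> (2 / (1 - R\<^sup>2)) ^ CARD('n) * B"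
      using conf_mono[OF True R(2)] conf_pos[OF x] B[of x] by (intro mult_mono power_mono) auto
    then show ?thesis using x conf_pos[OF x] by (simp add: abs_mult)
  next
    case False
    have "B \<ge> 0" using B[of 0] by linarith
    moreover have "R\<^sup>2 < 1" using R by (simp add: abs_square_less_1)
    ultimately show ?thesis using z False by simp
  qed
qed

section \<open>Orthonormal frames\<close>

text \<open>
  Tangent vectors are expressed in the orthonormal frame obtained by scaling the standard one, which turns
  the Riemannian inner product into the Euclidean one: \<open>frame\<close> takes the coordinates of a field, and \<open>fgrad g\<close> is
  the Riemannian gradient of a function with Euclidean gradient \<open>g\<close>.
\<close>

definition frame :: "(real ^ 'n \<Rightarrow> real ^ 'n) \<Rightarrow> real ^ 'n \<Rightarrow> real ^ 'n" where
  "frame G x = conf x *\<^sub>R G x"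

lemma hyp_inner_frame: "hyp_inner x (G x) (H x) = frame G x \<bullet> frame H x"
  by (simp add: hyp_inner_def frame_def conf_def power2_eq_square)

lemma hyp_norm_frame: "hyp_norm x (G x) = norm (frame G x)"
  unfolding hyp_norm_def hyp_inner_frame by (simp add: norm_eq_sqrt_inner)

lemma field_norm_frame: "field_norm G = sqrt (\<integral>x. (norm (frame G x))\<^sup>2 \<partial>hyp_measure)"
  by (simp add: field_norm_def hyp_norm_frame)

lemma euclidean_grad_C1_grad:
  assumes "C1_grad \<phi> g" shows "euclidean_grad \<phi> = g"
proof
  fix x
  have "frechet_derivative \<phi> (at x) = (\<lambda>h. g x \<bullet> h)"
    by (rule frechet_derivative_at[symmetric]) (rule C1_gradD(1)[OF assms])
  then show "euclidean_grad \<phi> x = g x"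
    by (simp add: euclidean_grad_def vec_eq_iff inner_axis)
qed

definition fgrad :: "(real ^ 'n \<Rightarrow> real ^ 'n) \<Rightarrow> real ^ 'n \<Rightarrow> real ^ 'n" where
  "fgrad g x = (1 / conf x) *\<^sub>R g x"

lemma frame_hyp_grad:
  assumes "C1_grad \<phi> g" shows "frame (hyp_grad \<phi>) x = fgrad g x"
  by (simp add: frame_def hyp_grad_def fgrad_def euclidean_grad_C1_grad[OF assms] conf_def power2_eq_square)

lemma C1_ballD:
  assumes "C1_ball \<phi> g"
  obtains R where "0 < R" "R < 1" "\<And>x. R \<le> norm x \<Longrightarrow> \<phi> x = 0" "\<And>x. R < norm x \<Longrightarrow> g x = 0" "C1_grad \<phi> g"
proof -
  obtain R where R: "0 < R" "R < 1" "\<forall>x. R \<le> norm x \<longrightarrow> \<phi> x = 0" and C: "C1_grad \<phi> g"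
    using assms unfolding C1_ball_def by blast
  show thesis
  proof (rule that[OF R(1,2) _ _ C])
    show z: "\<phi> x = 0" if "R \<le> norm x" for x using R(3) that by blast
    show "g x = 0" if "R < norm x" for x using C1_grad_eq_0[OF C z that] .
  qed
qed

lemma fgrad_measurable: "g \<in> borel_measurable borel \<Longrightarrow> fgrad g \<in> borel_measurable borel"
  unfolding fgrad_def[abs_def] by measurable

lemma C1_ball_sq_integrable:
  fixes \<phi> :: "real ^ 'n \<Rightarrow> real"
  assumes C: "C1_ball \<phi> g"
  shows "sq_integrable hyp_measure \<phi>" "sq_integrable hyp_measure (fgrad g)"
proof -
  obtain R where R: "0 < R" "R < 1" and z: "\<And>x. R \<le> norm x \<Longrightarrow> \<phi> x = 0" and gz: "\<And>x. R < norm x \<Longrightarrow> g x = 0"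
    and C1: "C1_grad \<phi> g" by (rule C1_ballD[OF C]) blast
  note m[measurable] = C1_gradD(4,5)[OF C1]
  obtain B where B: "B > 0" "\<And>x. norm (\<phi> x) \<le> B"
    using bounded_continuous_support[OF C1_gradD(3)[OF C1], of R] z by auto
  obtain B' where B': "B' > 0" "\<And>x. norm (g x) \<le> B'"
    using bounded_continuous_support[OF C1_gradD(2)[OF C1], of R] gz by auto
  show "sq_integrable hyp_measure \<phi>"
    unfolding sq_integrable_def
  proof
    show "integrable hyp_measure (\<lambda>x. (norm (\<phi> x))\<^sup>2)"
      by (rule integrable_hyp_measure_bounded_support[of _ R "B\<^sup>2"])
        (use R z B in \<open>auto simp: abs_le_square_iff[symmetric] intro!: power_mono\<close>)
  qed (intro borel_measurable_hyp_measure m)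
  show "sq_integrable hyp_measure (fgrad g)"
    unfolding sq_integrable_def
  proof
    show "integrable hyp_measure (\<lambda>x. (norm (fgrad g x))\<^sup>2)"
    proof (rule integrable_hyp_measure_bounded_support[of _ R "B'\<^sup>2"])
      show "\<bar>(norm (fgrad g x))\<^sup>2\<bar> \<le> B'\<^sup>2" for x
      proof (cases "norm x \<le> R")
        case True
        then have "norm x < 1" using R(2) by linarith
        then have "1 / conf x \<le> 1" "1 / conf x \<ge> 0" using conf_ge_2[of x] by auto
        then have "norm (fgrad g x) \<le> 1 * B'" unfolding fgrad_def norm_scaleR using B'(2)[of x]
          by (intro mult_mono) auto
        then show ?thesis by (simp add: power_mono)
      qed (use gz B' in \<open>simp add: fgrad_def\<close>)
    qed (use R gz fgrad_measurable[OF m(1)] in \<open>auto simp: fgrad_def\<close>)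
  qed (intro borel_measurable_hyp_measure fgrad_measurable m)
qed

section \<open>The Hardy and Poincare inequalities\<close>

text \<open>The pointwise inequality is integrated, and its divergence term drops out. The shift
  \<open>e\<close> keeps the weight C1 at the origin, so that integration by parts applies on the
  whole ball.\<close>

lemma Hardy_regularized:
  fixes \<phi> :: "real ^ 'n \<Rightarrow> real"
  assumes N: "CARD('n) \<ge> 3" and C: "C1_ball \<phi> g" and e: "e > 0"
  shows "integrable hyp_measure (\<lambda>x. (\<phi> x)\<^sup>2 / ((norm x)\<^sup>2 + e))"
    and "(\<integral>x. (\<phi> x)\<^sup>2 / ((norm x)\<^sup>2 + e) \<partial>hyp_measure) \<le> 16 * (\<integral>x. (norm (fgrad g x))\<^sup>2 \<partial>hyp_measure)"
proof -
  obtain R where R: "0 < R" "R < 1" and z: "\<And>x. R \<le> norm x \<Longrightarrow> \<phi> x = 0" and gz: "\<And>x. R < norm x \<Longrightarrow> g x = 0"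
    and C1: "C1_grad \<phi> g" by (rule C1_ballD[OF C]) blast
  note m[measurable] = C1_gradD(4,5)[OF C1]
  define k where "k = CARD('n) - 1"
  have k: "k \<ge> 2" "CARD('n) = k + 1" using N by (auto simp: k_def)
  obtain B where B: "B > 0" "\<And>x. norm (\<phi> x) \<le> B"
    using bounded_continuous_support[OF C1_gradD(3)[OF C1], of R] z by auto
  show int1: "integrable hyp_measure (\<lambda>x. (\<phi> x)\<^sup>2 / ((norm x)\<^sup>2 + e))"
  proof (rule integrable_hyp_measure_bounded_support[of _ R "B\<^sup>2 / e"])
    show "\<bar>(\<phi> x)\<^sup>2 / ((norm x)\<^sup>2 + e)\<bar> \<le> B\<^sup>2 / e" for x
    proof -
      have "\<bar>\<phi> x\<bar> ^ 2 \<le> B\<^sup>2" using B(2)[of x] by (intro power_mono) auto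
      then show ?thesis using e by (auto intro!: frac_le)
    qed
  qed (use R z in auto)
  \<comment> \<open>The exponent is \<open>N - 1\<close> because differentiating the weight produces
    one more factor \<open>2 / (1 - s)\<close>, which then matches the volume density.\<close>
  define \<beta> where "\<beta> s = (2 / (1 - s)) ^ k / (s + e)" for s :: real
  define \<beta>' where "\<beta>' s = \<beta> s * (k / (1 - s) - 1 / (s + e))" for s :: real
  have d\<beta>: "(\<beta> has_real_derivative \<beta>' s) (at s)" if "0 \<le> s" "s < 1" for s
    unfolding \<beta>'_def \<beta>_def[abs_def] using Hardy_weight_deriv[of s e k] that e k by simp
  \<comment> \<open>\<open>b v\<close> is the component in direction \<open>v\<close> of the field
    \<open>\<beta> (x \<bullet> x) *\<^sub>R x\<close>, and \<open>gb v\<close> is the gradient of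
    that component.\<close>
  define b where "b v x = \<beta> (x \<bullet> x) * (x \<bullet> v)" for v x :: "real^'n"
  define gb where "gb v x = (2 * \<beta>' (x \<bullet> x) * (x \<bullet> v)) *\<^sub>R x + \<beta> (x \<bullet> x) *\<^sub>R v" for v x :: "real^'n"
  have xx: "x \<bullet> x < 1" "0 \<le> x \<bullet> x" if "norm x < 1" for x :: "real^'n"
    using that by (simp_all add: dot_square_norm abs_square_less_1)
  have db: "(b v has_derivative (\<lambda>h. gb v x \<bullet> h)) (at x)" if x: "norm x < 1" for v x
  proof -
    have 1: "((\<lambda>x. x \<bullet> x) has_derivative (\<lambda>h. 2 * (x \<bullet> h))) (at x)"
      by (auto intro!: derivative_eq_intros simp: inner_commute)
    have "((\<lambda>x. \<beta> (x \<bullet> x)) has_derivative (\<lambda>h. \<beta>' (x \<bullet> x) * (2 * (x \<bullet> h)))) (at x)"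
      using has_derivative_compose[OF 1, of \<beta> "\<lambda>h. \<beta>' (x \<bullet> x) * h"] d\<beta>[OF xx(2,1)[OF x]]
      by (simp add: has_field_derivative_def)
    from has_derivative_mult[OF this, of "\<lambda>x. x \<bullet> v" "\<lambda>h. h \<bullet> v"]
    show ?thesis unfolding b_def[abs_def] gb_def
      by (rule has_derivative_eq_rhs)
        (auto intro!: derivative_eq_intros simp: fun_eq_iff inner_add_left inner_commute algebra_simps)
  qed
  have cgb: "continuous_on (ball 0 1) (gb v)" for v
  proof -
    have "\<forall>x::real^'n\<in>ball 0 1. 1 - x \<bullet> x \<noteq> 0" "\<forall>x::real^'n\<in>ball 0 1. x \<bullet> x + e \<noteq> 0"
      using xx e by (force, smt (verit) mem_ball_0 inner_ge_zero)
    then show ?thesis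
      unfolding gb_def[abs_def] \<beta>'_def \<beta>_def by (intro continuous_intros) auto
  qed
  have C2: "C1_grad (\<lambda>x. (\<phi> x)\<^sup>2) (\<lambda>x. (2 * \<phi> x) *\<^sub>R g x)"
    unfolding C1_grad_def
  proof (intro conjI allI)
    show "((\<lambda>x. (\<phi> x)\<^sup>2) has_derivative (\<lambda>h. ((2 * \<phi> x) *\<^sub>R g x) \<bullet> h)) (at x)" for x
      using has_derivative_power[OF C1_gradD(1)[OF C1, of x], of 2] by (simp add: mult_ac)
    show "continuous_on UNIV (\<lambda>x. (2 * \<phi> x) *\<^sub>R g x)"
      by (intro continuous_intros C1_gradD[OF C1])
  qed
  define T where "T v x = (b v x *\<^sub>R ((2 * \<phi> x) *\<^sub>R g x) + (\<phi> x)\<^sup>2 *\<^sub>R gb v x) \<bullet> v" for v x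
  have CT: "C1_grad (\<lambda>x. (\<phi> x)\<^sup>2 * b v x) (\<lambda>x. b v x *\<^sub>R ((2 * \<phi> x) *\<^sub>R g x) + (\<phi> x)\<^sup>2 *\<^sub>R gb v x)" for v
    by (rule C1_grad_mult_ball[OF C2 _ R(2) db cgb]) (use z in auto)
  have T: "integrable lborel (T v)" "(\<integral>x. T v x \<partial>lborel) = 0" for v
    unfolding T_def using integral_partial_derivative_eq_0[OF CT, of R v v] z by auto
  \<comment> \<open>\<open>S\<close> is the divergence of the field multiplied by the square of
    \<open>\<phi>\<close>, assembled from directional derivatives along the basis.\<close>
  define S where "S x = (\<Sum>v\<in>Basis. T v x)" for x
  have S: "integrable lborel S" "(\<integral>x. S x \<partial>lborel) = 0"
    unfolding S_def using T by auto
  have S_eq: "S x = \<beta> (x \<bullet> x) * (2 * \<phi> x * (g x \<bullet> x)) + (\<phi> x)\<^sup>2 * (2 * \<beta>' (x \<bullet> x) * (x \<bullet> x) + (real k + 1) * \<beta> (x \<bullet> x))" for x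
  proof -
    have "S x = (\<Sum>v\<in>Basis. 2 * \<phi> x * \<beta> (x \<bullet> x) * ((g x \<bullet> v) * (x \<bullet> v)) + ((\<phi> x)\<^sup>2 * 2 * \<beta>' (x \<bullet> x)) * ((x \<bullet> v) * (x \<bullet> v)) + (\<phi> x)\<^sup>2 * \<beta> (x \<bullet> x))"
      unfolding S_def T_def b_def gb_def
      by (intro sum.cong) (auto simp: inner_add_left algebra_simps)
    also have "\<dots> = 2 * \<phi> x * \<beta> (x \<bullet> x) * (g x \<bullet> x) + ((\<phi> x)\<^sup>2 * 2 * \<beta>' (x \<bullet> x)) * (x \<bullet> x) + (real k + 1) * ((\<phi> x)\<^sup>2 * \<beta> (x \<bullet> x))"
      using k by (simp add: sum.distrib flip: sum_distrib_left euclidean_inner)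
    finally show ?thesis by (simp add: algebra_simps)
  qed
  define V where "V x = indicator (ball 0 1) x * (conf x ^ CARD('n) * ((\<phi> x)\<^sup>2 / ((norm x)\<^sup>2 + e)))" for x
  define E where "E x = indicator (ball 0 1) x * (conf x ^ CARD('n) * (norm (fgrad g x))\<^sup>2)" for x
  have VE: "1/4 * V x \<le> S x + 4 * E x" for x
  proof (cases "norm x < 1")
    case True
    note s = xx[OF True]
    have cx: "conf x = 2 / (1 - x \<bullet> x)" by (simp add: conf_def dot_square_norm)
    have "\<bar>g x \<bullet> x\<bar> \<le> norm (g x) * sqrt (x \<bullet> x)"
      using Cauchy_Schwarz_ineq2[of "g x" x] by (simp add: norm_eq_sqrt_inner)
    from Hardy_pointwise[OF s(2,1) e k(1) this, of "\<phi> x"]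
    have *: "1/4 * ((\<phi> x)\<^sup>2 * (conf x ^ (k+1) / (x \<bullet> x + e))) \<le> S x + 4 * (conf x ^ (k-1) * (norm (g x))\<^sup>2)"
      unfolding S_eq \<beta>'_def \<beta>_def cx .
    have "conf x ^ (k+1) * (1 / conf x)\<^sup>2 = conf x ^ (k-1)"
    proof -
      obtain j where "k = Suc j" using k by (cases k) auto
      then show ?thesis using conf_pos[OF True] by (simp add: power2_eq_square)
    qed
    have "E x = conf x ^ (k-1) * (norm (g x))\<^sup>2"
    proof -
      have "(norm (fgrad g x))\<^sup>2 = (1 / conf x)\<^sup>2 * (norm (g x))\<^sup>2"
        by (simp add: fgrad_def power_mult_distrib power_divide)
      then show ?thesis
        using True \<open>conf x ^ (k+1) * (1 / conf x)\<^sup>2 = conf x ^ (k-1)\<close>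
        by (simp only: E_def k mult.assoc[symmetric]) simp
    qed
    moreover have "V x = (\<phi> x)\<^sup>2 * (conf x ^ (k+1) / (x \<bullet> x + e))"
      using True by (simp add: V_def k dot_square_norm)
    ultimately show ?thesis using * by simp
  next
    case False
    then have "\<phi> x = 0" "g x = 0" using z gz R by auto
    then show ?thesis using False by (simp add: V_def E_def S_eq)
  qed
  have iV: "integrable lborel V" "(\<integral>x. V x \<partial>lborel) = (\<integral>x. (\<phi> x)\<^sup>2 / ((norm x)\<^sup>2 + e) \<partial>hyp_measure)"
    using int1 unfolding V_def by (subst (asm) integrable_hyp_measure, measurable) (subst integral_hyp_measure, measurable)
  have gm: "(\<lambda>x. (norm (fgrad g x))\<^sup>2) \<in> borel_measurable borel" using fgrad_measurable[OF m(1)] by measurable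
  have iE: "integrable lborel E" "(\<integral>x. E x \<partial>lborel) = (\<integral>x. (norm (fgrad g x))\<^sup>2 \<partial>hyp_measure)"
    using C1_ball_sq_integrable(2)[OF C] integrable_hyp_measure[OF gm] integral_hyp_measure[OF gm]
    unfolding E_def sq_integrable_def by auto
  have "(\<integral>x. 1/4 * V x \<partial>lborel) \<le> (\<integral>x. S x + 4 * E x \<partial>lborel)"
    by (rule integral_mono) (use VE iV iE S in auto)
  then show "(\<integral>x. (\<phi> x)\<^sup>2 / ((norm x)\<^sup>2 + e) \<partial>hyp_measure) \<le> 16 * (\<integral>x. (norm (fgrad g x))\<^sup>2 \<partial>hyp_measure)"
    using iV iE S by simp
qed

text \<open>Fatou's lemma removes the regularization. As \<open>norm x < 1\<close>, dividing by
  \<open>norm x\<close> only increases the integrand, so the Poincare inequality holds with the same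
  constant; it makes energy-Cauchy sequences Cauchy in L2.\<close>

lemma Hardy_Poincare:
  fixes \<phi> :: "real ^ 'n \<Rightarrow> real"
  assumes N: "CARD('n) \<ge> 3" and C: "C1_ball \<phi> g"
  shows "sq_integrable hyp_measure (\<lambda>x. \<phi> x / norm x)"
    and "(\<integral>x. (\<phi> x / norm x)\<^sup>2 \<partial>hyp_measure) \<le> 16 * (\<integral>x. (norm (fgrad g x))\<^sup>2 \<partial>hyp_measure)"
    and "(\<integral>x. (\<phi> x)\<^sup>2 \<partial>hyp_measure) \<le> 16 * (\<integral>x. (norm (fgrad g x))\<^sup>2 \<partial>hyp_measure)"
proof -
  have C1: "C1_grad \<phi> g" using C by (simp add: C1_ball_def)
  note C1_gradD(5)[OF C1, measurable]
  have m2: "(\<lambda>x. \<phi> x / norm x) \<in> borel_measurable hyp_measure"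
    by (intro borel_measurable_hyp_measure) measurable
  define D where "D = (\<integral>x. (norm (fgrad g x))\<^sup>2 \<partial>hyp_measure)"
  have D: "D \<ge> 0" unfolding D_def by simp
  define a where "a n x = (\<phi> x)\<^sup>2 / ((norm x)\<^sup>2 + 1 / real (Suc n))" for n and x :: "real^'n"
  have am[measurable]: "a n \<in> borel_measurable hyp_measure" for n
    unfolding a_def by (intro borel_measurable_hyp_measure) measurable
  have "(\<integral>\<^sup>+x. ennreal ((\<phi> x / norm x)\<^sup>2) \<partial>hyp_measure) = (\<integral>\<^sup>+x. liminf (\<lambda>n. ennreal (a n x)) \<partial>hyp_measure)"
  proof (rule nn_integral_cong_AE)
    show "AE x in hyp_measure. ennreal ((\<phi> x / norm x)\<^sup>2) = liminf (\<lambda>n. ennreal (a n x))"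
      using AE_hyp_measure_nonzero
    proof eventually_elim
      case (elim x)
      have "(\<lambda>n. a n x) \<longlonglongrightarrow> (\<phi> x)\<^sup>2 / ((norm x)\<^sup>2 + 0)"
        unfolding a_def using elim LIMSEQ_inverse_real_of_nat by (intro tendsto_intros) (auto simp: inverse_eq_divide)
      then have "(\<lambda>n. ennreal (a n x)) \<longlonglongrightarrow> ennreal ((\<phi> x / norm x)\<^sup>2)"
        by (intro tendsto_ennrealI) (simp add: power_divide)
      then show ?case by (rule lim_imp_Liminf[OF trivial_limit_sequentially, symmetric])
    qed
  qed
  also have "\<dots> \<le> liminf (\<lambda>n. \<integral>\<^sup>+x. ennreal (a n x) \<partial>hyp_measure)"
    by (rule nn_integral_liminf) simp
  also have "\<dots> \<le> ennreal (16 * D)"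
  proof (rule Liminf_le)
    show "\<forall>\<^sub>F n in sequentially. (\<integral>\<^sup>+x. ennreal (a n x) \<partial>hyp_measure) \<le> ennreal (16 * D)"
    proof (rule always_eventually, rule allI)
      fix n
      have e: "1 / real (Suc n) > 0" by simp
      have "integrable hyp_measure (a n)"
        unfolding a_def using Hardy_regularized(1)[OF N C e] .
      moreover have "(\<integral>x. a n x \<partial>hyp_measure) \<le> 16 * D"
        unfolding a_def D_def by (rule Hardy_regularized(2)[OF N C e])
      ultimately show "(\<integral>\<^sup>+x. ennreal (a n x) \<partial>hyp_measure) \<le> ennreal (16 * D)"
        by (subst nn_integral_eq_integral) (auto intro!: ennreal_leI, simp add: a_def)
    qed
  qed simp
  finally have b: "(\<integral>\<^sup>+x. ennreal ((\<phi> x / norm x)\<^sup>2) \<partial>hyp_measure) \<le> ennreal (16 * D)" .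
  have i: "integrable hyp_measure (\<lambda>x. (\<phi> x / norm x)\<^sup>2)"
    using m2 le_less_trans[OF b] by (intro integrableI_bounded) auto
  then show "sq_integrable hyp_measure (\<lambda>x. \<phi> x / norm x)"
    using m2 by (simp add: sq_integrable_def power_divide)
  show c: "(\<integral>x. (\<phi> x / norm x)\<^sup>2 \<partial>hyp_measure) \<le> 16 * D"
    using b i D by (subst (asm) nn_integral_eq_integral) auto
  have "(\<integral>x. (\<phi> x)\<^sup>2 \<partial>hyp_measure) \<le> (\<integral>x. (\<phi> x / norm x)\<^sup>2 \<partial>hyp_measure)"
  proof (rule integral_mono_AE)
    show "integrable hyp_measure (\<lambda>x. (\<phi> x)\<^sup>2)"
      using C1_ball_sq_integrable(1)[OF C] by (simp add: sq_integrable_def)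
    show "AE x in hyp_measure. (\<phi> x)\<^sup>2 \<le> (\<phi> x / norm x)\<^sup>2"
      using AE_hyp_measure_nonzero AE_space
    proof eventually_elim
      case (elim x)
      have "(norm x)\<^sup>2 \<le> 1" using elim by (simp add: abs_square_le_1)
      then have "(\<phi> x)\<^sup>2 * (norm x)\<^sup>2 \<le> (\<phi> x)\<^sup>2 * 1" by (intro mult_left_mono) auto
      then show ?case using elim by (simp add: power_divide field_simps)
    qed
  qed (rule i)
  then show "(\<integral>x. (\<phi> x)\<^sup>2 \<partial>hyp_measure) \<le> 16 * D" using c by simp
qed

section \<open>Radial functions\<close>

text \<open>The area of the sphere of radius \<open>r\<close>, continued by 0 so that it is a
  density on the whole line.\<close>

definition radial_density :: "nat \<Rightarrow> real \<Rightarrow> real" where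
  "radial_density N r = (if r > 0 then unit_ball_vol (real N) * N * r ^ (N - 1) else 0)"

lemma radial_density_measurable[measurable]: "radial_density N \<in> borel_measurable borel"
  unfolding radial_density_def[abs_def] by measurable

lemma radial_density_nonneg: "radial_density N r \<ge> 0"
  by (simp add: radial_density_def)

lemma nn_integral_radial_density:
  assumes "N > 0"
  shows "(\<integral>\<^sup>+r. ennreal (radial_density N r) * indicator {..a} r \<partial>lborel) = ennreal (if a \<ge> 0 then unit_ball_vol (real N) * a ^ N else 0)"
proof (cases "a \<ge> 0")
  case True
  have "(\<integral>\<^sup>+r. ennreal (radial_density N r) * indicator {..a} r \<partial>lborel)
    = (\<integral>\<^sup>+r. ennreal (unit_ball_vol (real N) * N * r ^ (N - 1)) * indicator {0..a} r \<partial>lborel)"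
    by (rule nn_integral_cong_AE, rule eventually_mono[OF AE_lborel_singleton[of 0]])
       (auto simp: radial_density_def indicator_def)
  also have "\<dots> = ennreal (unit_ball_vol (real N) * a ^ N - unit_ball_vol (real N) * 0 ^ N)"
    using True by (intro nn_integral_FTC_Icc) (auto intro!: derivative_eq_intros)
  finally show ?thesis using True assms by simp
next
  case False
  have "(\<integral>\<^sup>+r. ennreal (radial_density N r) * indicator {..a} r \<partial>lborel) = (\<integral>\<^sup>+r. 0 \<partial>(lborel :: real measure))"
    using False by (intro nn_integral_cong) (auto simp: radial_density_def indicator_def)
  then show ?thesis using False by simp
qed

lemma measure_eqI_atMost:
  fixes P Q :: "real measure"
  assumes sets: "sets P = sets borel" "sets Q = sets borel"
    and eq: "\<And>a. emeasure P {..a} = emeasure Q {..a}" and fin: "\<And>a. emeasure P {..a} \<noteq> \<infinity>"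
  shows "P = Q"
proof (rule measure_eqI_generator_eq[where E="range atMost" and \<Omega>=UNIV and A="\<lambda>i. {..real i}"])
  show "Int_stable (range (atMost :: real \<Rightarrow> _))"
    by (auto simp: Int_stable_def intro!: image_eqI[where x="min _ _"])
  have "sets (borel :: real measure) = sigma_sets UNIV (range atMost)"
    by (subst borel_eq_atMost) (simp add: image_def)
  then show "sets P = sigma_sets UNIV (range atMost)" "sets Q = sigma_sets UNIV (range atMost)"
    using sets by auto
  show "(\<Union>i. {..real i}) = UNIV"
    by (auto intro: real_arch_simple)
qed (use eq fin in auto)

text \<open>Polar coordinates for radial integrands: both measures give a half-line the volume of
  the ball of that radius, so no surface measure enters.\<close>

lemma distr_lborel_norm:
  "distr lborel borel (norm :: real ^ 'n \<Rightarrow> real) = density lborel (\<lambda>r. ennreal (radial_density CARD('n) r))"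
proof (rule measure_eqI_atMost)
  have e: "emeasure (distr lborel borel (norm :: real ^ 'n \<Rightarrow> real)) {..a}
    = ennreal (if a \<ge> 0 then unit_ball_vol (real CARD('n)) * a ^ CARD('n) else 0)" for a
  proof -
    have "emeasure (distr lborel borel (norm :: real ^ 'n \<Rightarrow> real)) {..a} = emeasure lborel (norm -` {..a} :: (real^'n) set)"
      by (subst emeasure_distr) auto
    also have "(norm -` {..a} :: (real^'n) set) = (if a \<ge> 0 then cball 0 a else {})"
      by (auto simp: vimage_def intro: order_trans[OF norm_ge_zero])
    finally show ?thesis by (auto simp: emeasure_cball)
  qed
  show "emeasure (distr lborel borel (norm :: real ^ 'n \<Rightarrow> real)) {..a}
    = emeasure (density lborel (\<lambda>r. ennreal (radial_density CARD('n) r))) {..a}" for a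
    unfolding e using nn_integral_radial_density[of "CARD('n)" a] by (subst emeasure_density) auto
  show "emeasure (distr lborel borel (norm :: real ^ 'n \<Rightarrow> real)) {..a} \<noteq> \<infinity>" for a
    unfolding e by simp
qed auto

lemma
  fixes k :: "real \<Rightarrow> real"
  assumes [measurable]: "k \<in> borel_measurable borel"
  shows integrable_norm: "integrable lborel (\<lambda>x::real^'n. k (norm x)) \<longleftrightarrow> integrable lborel (\<lambda>r. radial_density CARD('n) r * k r)"
    and integral_norm: "(\<integral>x. k (norm (x::real^'n)) \<partial>lborel) = (\<integral>r. radial_density CARD('n) r * k r \<partial>lborel)"
proof -
  have "integrable lborel (\<lambda>x::real^'n. k (norm x)) \<longleftrightarrow> integrable (distr lborel borel (norm :: real ^ 'n \<Rightarrow> real)) k"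
    by (subst integrable_distr_eq) auto
  also have "\<dots> \<longleftrightarrow> integrable lborel (\<lambda>r. radial_density CARD('n) r * k r)"
    unfolding distr_lborel_norm by (subst integrable_real_density) (auto simp: radial_density_nonneg)
  finally show "integrable lborel (\<lambda>x::real^'n. k (norm x)) \<longleftrightarrow> integrable lborel (\<lambda>r. radial_density CARD('n) r * k r)" .
  have "(\<integral>x. k (norm (x::real^'n)) \<partial>lborel) = (\<integral>r. k r \<partial>distr lborel borel (norm :: real ^ 'n \<Rightarrow> real))"
    by (subst integral_distr) auto
  also have "\<dots> = (\<integral>r. radial_density CARD('n) r * k r \<partial>lborel)"
    unfolding distr_lborel_norm by (subst integral_real_density) (auto simp: radial_density_nonneg)
  finally show "(\<integral>x. k (norm (x::real^'n)) \<partial>lborel) = (\<integral>r. radial_density CARD('n) r * k r \<partial>lborel)" .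
qed

text \<open>The positive and the negative part of \<open>\<xi>\<close> are densities of two measures
  whose images under the norm agree on half-lines and hence coincide. This is how a nonradial
  function is integrated against radial weights when only its integrals over balls are
  known.\<close>

lemma integral_radial_mult_eq_0:
  fixes \<xi> :: "'a::euclidean_space \<Rightarrow> real"
  assumes \<xi>: "integrable lborel \<xi>"
    and eq: "\<And>a. (\<integral>x. indicator {..a} (norm x) * \<xi> x \<partial>lborel) = 0"
    and k: "k \<in> borel_measurable borel" and int: "integrable lborel (\<lambda>x. k (norm x) * \<xi> x)"
  shows "(\<integral>x. k (norm x) * \<xi> x \<partial>lborel) = 0"
proof -
  note k[measurable]
  have m[measurable]: "\<xi> \<in> borel_measurable borel" using \<xi> by auto
  have [measurable]: "norm -` {..a} \<in> sets (borel :: 'a measure)" for a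
  proof -
    have "norm -` {..a} = cball (0::'a) a" by auto
    then show ?thesis by simp
  qed
  define P where "P = distr (density lborel (\<lambda>x. ennreal (max 0 (\<xi> x)))) borel norm"
  define Q where "Q = distr (density lborel (\<lambda>x. ennreal (max 0 (- \<xi> x)))) borel norm"
  have intP: "integrable lborel (\<lambda>x. indicator {..a} (norm x) * max 0 (\<xi> x))"
    and intQ: "integrable lborel (\<lambda>x. indicator {..a} (norm x) * max 0 (- \<xi> x))" for a
    by (rule Bochner_Integration.integrable_bound[OF \<xi>]; auto simp: indicator_def)+
  have eP: "emeasure P {..a} = ennreal (\<integral>x. indicator {..a} (norm x) * max 0 (\<xi> x) \<partial>lborel)" for a
  proof -
    have "emeasure P {..a} = (\<integral>\<^sup>+x. ennreal (max 0 (\<xi> x)) * indicator (norm -` {..a}) x \<partial>lborel)"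
      unfolding P_def by (simp add: emeasure_distr emeasure_density)
    also have "\<dots> = (\<integral>\<^sup>+x. ennreal (indicator {..a} (norm x) * max 0 (\<xi> x)) \<partial>lborel)"
      by (intro nn_integral_cong) (auto simp: indicator_def)
    finally show ?thesis using intP[of a] by (subst (asm) nn_integral_eq_integral) auto
  qed
  have eQ: "emeasure Q {..a} = ennreal (\<integral>x. indicator {..a} (norm x) * max 0 (- \<xi> x) \<partial>lborel)" for a
  proof -
    have "emeasure Q {..a} = (\<integral>\<^sup>+x. ennreal (max 0 (- \<xi> x)) * indicator (norm -` {..a}) x \<partial>lborel)"
      unfolding Q_def by (simp add: emeasure_distr emeasure_density)
    also have "\<dots> = (\<integral>\<^sup>+x. ennreal (indicator {..a} (norm x) * max 0 (- \<xi> x)) \<partial>lborel)"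
      by (intro nn_integral_cong) (auto simp: indicator_def)
    finally show ?thesis using intQ[of a] by (subst (asm) nn_integral_eq_integral) auto
  qed
  have "P = Q"
  proof (rule measure_eqI_atMost)
    show "emeasure P {..a} = emeasure Q {..a}" for a
    proof -
      have "(\<integral>x. indicator {..a} (norm x) * \<xi> x \<partial>lborel) =
        (\<integral>x. indicator {..a} (norm x) * max 0 (\<xi> x) \<partial>lborel) - (\<integral>x. indicator {..a} (norm x) * max 0 (- \<xi> x) \<partial>lborel)"
      proof -
        have pw: "indicator {..a} (norm x) * \<xi> x = indicator {..a} (norm x) * max 0 (\<xi> x) - indicator {..a} (norm x) * max 0 (- \<xi> x)" for x
          by (cases "\<xi> x \<ge> 0") (auto simp: max_def)
        show ?thesis unfolding pw by (rule Bochner_Integration.integral_diff[OF intP intQ])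
      qed
      then show ?thesis using eq[of a] unfolding eP eQ by simp
    qed
  qed (auto simp: P_def Q_def eP[unfolded P_def])
  moreover have "(\<integral>r. k r \<partial>P) = (\<integral>x. max 0 (\<xi> x) * k (norm x) \<partial>lborel)"
    unfolding P_def by (subst integral_distr) (auto simp: integral_real_density)
  moreover have "(\<integral>r. k r \<partial>Q) = (\<integral>x. max 0 (- \<xi> x) * k (norm x) \<partial>lborel)"
    unfolding Q_def by (subst integral_distr) (auto simp: integral_real_density)
  moreover have "(\<integral>x. k (norm x) * \<xi> x \<partial>lborel) =
    (\<integral>x. max 0 (\<xi> x) * k (norm x) \<partial>lborel) - (\<integral>x. max 0 (- \<xi> x) * k (norm x) \<partial>lborel)"
  proof (subst Bochner_Integration.integral_diff[symmetric])
    show "integrable lborel (\<lambda>x. max 0 (\<xi> x) * k (norm x))"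
      by (rule Bochner_Integration.integrable_bound[OF int]) (auto simp: abs_mult max_def mult.commute mult_nonpos_nonneg)
    show "integrable lborel (\<lambda>x. max 0 (- \<xi> x) * k (norm x))"
      by (rule Bochner_Integration.integrable_bound[OF int]) (auto simp: abs_mult max_def mult.commute mult_nonpos_nonneg)
    show "(\<integral>x. k (norm x) * \<xi> x \<partial>lborel) = (\<integral>x. max 0 (\<xi> x) * k (norm x) - max 0 (- \<xi> x) * k (norm x) \<partial>lborel)"
      by (intro Bochner_Integration.integral_cong refl) (auto simp: max_def)
  qed
  ultimately show ?thesis by simp
qed

section \<open>Radial profiles, their decay and their equicontinuity\<close>

text \<open>The condition at 0 makes \<open>\<eta> (norm x)\<close> C1 at the origin. Profiles live
  on the whole line so that derivatives are two-sided; only nonnegative arguments matter.\<close>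

definition radial_C1 :: "(real \<Rightarrow> real) \<Rightarrow> (real \<Rightarrow> real) \<Rightarrow> bool" where
  "radial_C1 \<eta> \<eta>' \<longleftrightarrow> (\<forall>r. (\<eta> has_real_derivative \<eta>' r) (at r)) \<and> continuous_on UNIV \<eta>' \<and> \<eta>' 0 = 0 \<and>
     (\<exists>R. 0 < R \<and> R < 1 \<and> (\<forall>r\<ge>R. \<eta> r = 0))"

text \<open>The Euclidean gradient of a radial function. At the origin the formula yields the zero
  vector, which is correct when \<open>\<eta>' 0 = 0\<close>.\<close>

definition rgrad :: "(real \<Rightarrow> real) \<Rightarrow> real ^ 'n \<Rightarrow> real ^ 'n" where
  "rgrad \<eta>' x = (\<eta>' (norm x) / norm x) *\<^sub>R x"

lemma norm_rgrad: "\<eta>' 0 = 0 \<Longrightarrow> norm (rgrad \<eta>' x) = \<bar>\<eta>' (norm x)\<bar>"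
  by (cases "x = 0") (auto simp: rgrad_def)

lemma radial_C1_grad:
  fixes \<eta> :: "real \<Rightarrow> real"
  assumes "radial_C1 \<eta> \<eta>'"
  shows "C1_ball (\<lambda>x::real^'n. \<eta> (norm x)) (rgrad \<eta>')"
proof -
  have d: "(\<eta> has_real_derivative \<eta>' r) (at r)" for r using assms by (auto simp: radial_C1_def)
  have c: "continuous_on UNIV \<eta>'" and z: "\<eta>' 0 = 0" using assms by (auto simp: radial_C1_def)
  have dx: "((\<lambda>x::real^'n. \<eta> (norm x)) has_derivative (\<lambda>h. rgrad \<eta>' x \<bullet> h)) (at x)" for x
  proof (cases "x = 0")
    case True
    have "((\<lambda>t. (\<eta> (0 + t) - \<eta> 0) / t) \<longlongrightarrow> 0) (at 0)"
      using d[of 0] z by (simp add: DERIV_def)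
    moreover have "filterlim (norm :: real^'n \<Rightarrow> real) (at 0) (at 0)"
      by (auto simp: filterlim_at eventually_at_filter intro!: tendsto_norm_zero)
    ultimately have "((\<lambda>h::real^'n. (\<eta> (0 + norm h) - \<eta> 0) / norm h) \<longlongrightarrow> 0) (at 0)"
      by (rule filterlim_compose)
    then have "((\<lambda>h::real^'n. norm ((\<eta> (0 + norm h) - \<eta> 0) / norm h)) \<longlongrightarrow> 0) (at 0)"
      by (rule tendsto_norm_zero)
    then show ?thesis using True z by (simp add: has_derivative_at rgrad_def)
  next
    case False
    have "((\<lambda>x. \<eta> (norm x)) has_derivative (\<lambda>h. \<eta>' (norm x) * (h \<bullet> sgn x))) (at x)"
      using has_derivative_compose[OF has_derivative_norm[OF False], of \<eta> "\<lambda>h. \<eta>' (norm x) * h"] d[of "norm x"]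
      by (simp add: has_field_derivative_def)
    then show ?thesis
      by (rule has_derivative_eq_rhs) (auto simp: rgrad_def sgn_div_norm fun_eq_iff inner_commute divide_inverse mult.assoc)
  qed
  have "isCont (rgrad \<eta>') x" for x :: "real^'n"
  proof (cases "x = 0")
    case True
    have "((\<lambda>x::real^'n. \<eta>' (norm x)) \<longlongrightarrow> \<eta>' (norm (0::real^'n))) (at 0)"
      using c by (intro isCont_tendsto_compose[where g=\<eta>'] tendsto_norm tendsto_ident_at) (auto simp: continuous_on_eq_continuous_at)
    then have "((\<lambda>x::real^'n. norm (rgrad \<eta>' x)) \<longlongrightarrow> 0) (at 0)"
      using z by (simp add: norm_rgrad tendsto_rabs_zero_iff)
    then show ?thesis using True z by (simp add: isCont_def tendsto_norm_zero_iff rgrad_def[of _ 0])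
  next
    case False
    have "isCont \<eta>' (norm x)" using c by (simp add: continuous_on_eq_continuous_at)
    then have "isCont (\<lambda>x. \<eta>' (norm x)) x" by (rule isCont_o2[OF continuous_norm[OF continuous_ident]])
    then show ?thesis unfolding rgrad_def[abs_def] using False by (intro continuous_intros) auto
  qed
  then have "continuous_on UNIV (rgrad \<eta>' :: real^'n \<Rightarrow> _)" by (simp add: continuous_on_eq_continuous_at)
  then show ?thesis using dx assms by (auto simp: C1_ball_def C1_grad_def radial_C1_def)
qed

text \<open>The increment is the integral of \<open>\<eta>'\<close>. Splitting
  \<open>\<eta>'\<close> as
  \<open>(\<eta>' t * sqrt (t ^ (N - 1))) * (1 / sqrt (t ^ (N - 1)))\<close> and applying
  Cauchy-Schwarz isolates the Euclidean energy of the shell, which the hyperbolic energy dominates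
  because \<open>conf x ^ (N - 2)\<close> is at least 1.\<close>

lemma radial_oscillation:
  fixes \<eta> :: "real \<Rightarrow> real"
  assumes N: "CARD('n) \<ge> 3" and \<eta>: "radial_C1 \<eta> \<eta>'" and s: "0 < s" "s \<le> r" "r < 1"
  shows "(\<eta> r - \<eta> s)\<^sup>2 \<le> (\<integral>x. (norm (fgrad (rgrad \<eta>') (x :: real ^ 'n)))\<^sup>2 \<partial>hyp_measure) / (unit_ball_vol (real CARD('n)) * CARD('n))
    * (\<integral>t. indicator {s..r} t / t ^ (CARD('n) - 1) \<partial>lborel)"
proof -
  define N where "N = CARD('n)"
  define \<kappa> where "\<kappa> = unit_ball_vol (real N) * N"
  have N3: "N \<ge> 3" and \<kappa>: "\<kappa> > 0" using N by (auto simp: \<kappa>_def N_def)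
  define D where "D = (\<integral>x. (norm (fgrad (rgrad \<eta>') (x :: real ^ 'n)))\<^sup>2 \<partial>hyp_measure)"
  have d: "(\<eta> has_real_derivative \<eta>' r) (at r)" for r using \<eta> by (auto simp: radial_C1_def)
  have c: "continuous_on UNIV \<eta>'" and z: "\<eta>' 0 = 0" using \<eta> by (auto simp: radial_C1_def)
  have [measurable]: "\<eta>' \<in> borel_measurable borel" using c by (rule borel_measurable_continuous_onI)
  have C: "C1_ball (\<lambda>x::real^'n. \<eta> (norm x)) (rgrad \<eta>')" by (rule radial_C1_grad[OF \<eta>])
  define f where "f t = indicator {s..r} t * (\<eta>' t * sqrt (t ^ (N-1)))" for t :: real
  define g where "g t = indicator {s..r} t / sqrt (t ^ (N-1))" for t :: real
  have ic: "integrable lborel (\<lambda>t::real. indicator {s..r} t * k t)" if "continuous_on {s..r} k" for k :: "real \<Rightarrow> real"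
    using borel_integrable_compact[OF _ that] by (simp add: mult.commute indicator_def if_distrib cong: if_cong)
  have pos: "t > 0" if "t \<in> {s..r}" for t using that s by auto
  have f2: "(norm (f t))\<^sup>2 = indicator {s..r} t * ((\<eta>' t)\<^sup>2 * t ^ (N-1))" for t
    using pos[of t] by (auto simp: f_def indicator_def power_mult_distrib)
  have g2: "(norm (g t))\<^sup>2 = indicator {s..r} t * (1 / t ^ (N-1))" for t
    using pos[of t] by (auto simp: g_def indicator_def power_divide)
  have fg: "f t \<bullet> g t = \<eta>' t * indicator {s..r} t" for t
    using pos[of t] by (auto simp: f_def g_def indicator_def)
  have sf: "sq_integrable lborel f" unfolding sq_integrable_def f2
    by (intro conjI ic continuous_intros continuous_on_subset[OF c]) (auto simp: f_def[abs_def])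
  have sg: "sq_integrable lborel g" unfolding sq_integrable_def g2
    using pos by (intro conjI ic continuous_intros) (auto simp: g_def[abs_def] dest: pos)
  have "\<eta> r - \<eta> s = (\<integral>t. f t \<bullet> g t \<partial>lborel)"
    unfolding fg using s d c
    by (subst integral_FTC_Icc_real[where F=\<eta>]) (auto simp: continuous_on_eq_continuous_at)
  then have "\<bar>\<eta> r - \<eta> s\<bar> \<le> sqrt (\<integral>t. (norm (f t))\<^sup>2 \<partial>lborel) * sqrt (\<integral>t. (norm (g t))\<^sup>2 \<partial>lborel)"
    using integral_Cauchy_Schwarz[OF sf sg] by simp
  then have "\<bar>\<eta> r - \<eta> s\<bar>\<^sup>2 \<le> (sqrt (\<integral>t. (norm (f t))\<^sup>2 \<partial>lborel) * sqrt (\<integral>t. (norm (g t))\<^sup>2 \<partial>lborel))\<^sup>2"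
    by (intro power_mono) auto
  then have 1: "(\<eta> r - \<eta> s)\<^sup>2 \<le> (\<integral>t. (norm (f t))\<^sup>2 \<partial>lborel) * (\<integral>t. (norm (g t))\<^sup>2 \<partial>lborel)"
    by (simp add: power_mult_distrib)
  have 2: "\<kappa> * (\<integral>t. (norm (f t))\<^sup>2 \<partial>lborel) \<le> D"
  proof -
    have e: "\<kappa> * (norm (f t))\<^sup>2 = radial_density N t * (indicator {s..r} t * (\<eta>' t)\<^sup>2)" for t
      unfolding f2 using pos[of t] by (auto simp: radial_density_def \<kappa>_def indicator_def)
    have m: "(\<lambda>t. indicator {s..r} t * (\<eta>' t)\<^sup>2) \<in> borel_measurable borel" by measurable
    have i: "integrable lborel (\<lambda>x::real^'n. indicator {s..r} (norm x) * (\<eta>' (norm x))\<^sup>2)"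
      unfolding integrable_norm[OF m, where 'n='n] N_def[symmetric] e[symmetric]
      using sf by (auto simp: sq_integrable_def)
    have gm: "(\<lambda>x. (norm (fgrad (rgrad \<eta>') (x::real^'n)))\<^sup>2) \<in> borel_measurable borel"
      using fgrad_measurable[OF C1_gradD(4), of "\<lambda>x::real^'n. \<eta> (norm x)" "rgrad \<eta>'"] C by (auto simp: C1_ball_def)
    have iD: "integrable lborel (\<lambda>x::real^'n. indicator (ball 0 1) x * (conf x ^ CARD('n) * (norm (fgrad (rgrad \<eta>') x))\<^sup>2))"
      using C1_ball_sq_integrable(2)[OF C] unfolding sq_integrable_def integrable_hyp_measure[OF gm] by blast
    have "\<kappa> * (\<integral>t. (norm (f t))\<^sup>2 \<partial>lborel) = (\<integral>t. radial_density N t * (indicator {s..r} t * (\<eta>' t)\<^sup>2) \<partial>lborel)"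
      unfolding e[symmetric] by simp
    also have "\<dots> = (\<integral>x. indicator {s..r} (norm (x::real^'n)) * (\<eta>' (norm x))\<^sup>2 \<partial>lborel)"
      unfolding integral_norm[OF m, where 'n='n] N_def ..
    also have "\<dots> \<le> (\<integral>x. indicator (ball 0 1) (x::real^'n) * (conf x ^ CARD('n) * (norm (fgrad (rgrad \<eta>') x))\<^sup>2) \<partial>lborel)"
    proof (rule integral_mono[OF i iD])
      fix x :: "real^'n"
      show "indicator {s..r} (norm x) * (\<eta>' (norm x))\<^sup>2 \<le> indicator (ball 0 1) x * (conf x ^ CARD('n) * (norm (fgrad (rgrad \<eta>') x))\<^sup>2)"
      proof (cases "norm x < 1")
        case True
        have c2: "conf x \<ge> 2" by (rule conf_ge_2[OF True])
        have "conf x ^ CARD('n) * (norm (fgrad (rgrad \<eta>') x))\<^sup>2 = conf x ^ (N-2) * (\<eta>' (norm x))\<^sup>2"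
        proof -
          define j where "j = N - 2"
          then have j: "N = j + 2" using N3 by simp
          have "(norm (fgrad (rgrad \<eta>') x))\<^sup>2 = (\<eta>' (norm x))\<^sup>2 / (conf x)\<^sup>2"
            using z by (simp add: fgrad_def norm_rgrad power_divide)
          then show ?thesis unfolding N_def[symmetric] using c2 by (simp add: j power_add power2_eq_square)
        qed
        moreover have "1 * (\<eta>' (norm x))\<^sup>2 \<le> conf x ^ (N-2) * (\<eta>' (norm x))\<^sup>2"
          using c2 by (intro mult_right_mono one_le_power) auto
        moreover have "0 \<le> conf x ^ (N-2) * (\<eta>' (norm x))\<^sup>2" using c2 by simp
        ultimately show ?thesis using True by (auto simp: indicator_def)
      next
        case False
        then show ?thesis using s by (auto simp: indicator_def)
      qed
    qed
    also have "\<dots> = D" unfolding D_def integral_hyp_measure[OF gm] ..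
    finally show ?thesis .
  qed
  have 3: "(\<integral>t. (norm (g t))\<^sup>2 \<partial>lborel) = (\<integral>t. indicator {s..r} t / t ^ (N-1) \<partial>lborel)"
    unfolding g2 by simp
  have "(\<eta> r - \<eta> s)\<^sup>2 \<le> (D / \<kappa>) * (\<integral>t. (norm (g t))\<^sup>2 \<partial>lborel)"
    using 2 \<kappa> by (intro order_trans[OF 1] mult_right_mono) (auto simp: field_simps)
  then show ?thesis unfolding 3 D_def \<kappa>_def N_def .
qed

text \<open>For equicontinuity the integrand of the oscillation estimate is bounded by its value at
  \<open>s\<close>. For the decay bound the integral is computed exactly, up to a radius
  \<open>R\<close> at which the profile vanishes.\<close>

lemma radial_bounds:
  fixes \<eta> :: "real \<Rightarrow> real"
  assumes N: "CARD('n) \<ge> 3" and \<eta>: "radial_C1 \<eta> \<eta>'"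
  defines "A \<equiv> (\<integral>x. (norm (fgrad (rgrad \<eta>') (x :: real ^ 'n)))\<^sup>2 \<partial>hyp_measure) / (unit_ball_vol (real CARD('n)) * CARD('n))"
  shows "0 < s \<Longrightarrow> s \<le> r \<Longrightarrow> r < 1 \<Longrightarrow> (\<eta> r - \<eta> s)\<^sup>2 \<le> A * ((r - s) / s ^ (CARD('n) - 1))"
    and "0 < s \<Longrightarrow> s < 1 \<Longrightarrow> (\<eta> s)\<^sup>2 \<le> A / s ^ (CARD('n) - 2)"
proof -
  have A: "A \<ge> 0" unfolding A_def by (intro divide_nonneg_nonneg mult_nonneg_nonneg) auto
  \<comment> \<open>This turns \<open>N - 1\<close> and \<open>N - 2\<close> into
    \<open>j + 2\<close> and \<open>j + 1\<close>, free of truncated subtraction.\<close>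
  define j where "j = CARD('n) - 3"
  have j: "CARD('n) = j + 3" using N by (simp add: j_def)
  have osc: "(\<eta> r - \<eta> s)\<^sup>2 \<le> A * (\<integral>t. indicator {s..r} t / t ^ (j + 2) \<partial>lborel)" if "0 < s" "s \<le> r" "r < 1" for r s
    using radial_oscillation[OF N \<eta> that] unfolding A_def by (simp add: j)
  have int: "integrable lborel (\<lambda>t. indicator {s..r} t / t ^ (j + 2))" if "0 < s" for r s :: real
  proof -
    have "integrable lborel (\<lambda>t. indicator {s..r} t *\<^sub>R (1 / t ^ (j + 2)))"
      using that by (intro borel_integrable_compact continuous_intros) auto
    then show ?thesis by simp
  qed
  show "(\<eta> r - \<eta> s)\<^sup>2 \<le> A * ((r - s) / s ^ (CARD('n) - 1))" if s: "0 < s" "s \<le> r" "r < 1"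
  proof -
    have "(\<integral>t. indicator {s..r} t / t ^ (j + 2) \<partial>lborel) \<le> (\<integral>t. indicator {s..r} t / s ^ (j + 2) \<partial>lborel)"
    proof (rule integral_mono[OF int[OF s(1)]])
      show "integrable lborel (\<lambda>t. indicator {s..r} t / s ^ (j + 2))"
        using s by (intro integrable_divide integrable_real_indicator) auto
      show "indicator {s..r} t / t ^ (j + 2) \<le> indicator {s..r} t / s ^ (j + 2)" for t
      proof (cases "t \<in> {s..r}")
        case True
        then have "s ^ (j + 2) \<le> t ^ (j + 2)" using s by (intro power_mono) auto
        then have "1 / t ^ (j + 2) \<le> 1 / s ^ (j + 2)" using s True by (intro divide_left_mono mult_pos_pos zero_less_power) auto
        then show ?thesis using True by (simp del: power_add_numeral power_Suc)
      qed simp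
    qed
    also have "\<dots> = (r - s) / s ^ (j + 2)" using s by simp
    finally have "A * (\<integral>t. indicator {s..r} t / t ^ (j + 2) \<partial>lborel) \<le> A * ((r - s) / s ^ (j + 2))"
      using A by (rule mult_left_mono)
    then show ?thesis using osc[OF s] by (simp add: j)
  qed
  show "(\<eta> s)\<^sup>2 \<le> A / s ^ (CARD('n) - 2)" if s: "0 < s" "s < 1"
  proof -
    obtain R where R: "0 < R" "R < 1" "\<And>r. R \<le> r \<Longrightarrow> \<eta> r = 0" using \<eta> by (auto simp: radial_C1_def)
    show ?thesis
    proof (cases "R \<le> s")
      case True
      then show ?thesis using R A s by simp
    next
      case False
      have "(\<integral>t. indicator {s..R} t / t ^ (j + 2) \<partial>lborel) = (\<integral>t. (1 / t ^ (j + 2)) * indicator {s..R} t \<partial>lborel)"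
        by simp
      also have "\<dots> = - 1 / ((real j + 1) * R ^ (j + 1)) - (- 1 / ((real j + 1) * s ^ (j + 1)))"
      proof (rule integral_FTC_Icc_real)
        fix t assume t: "s \<le> t" "t \<le> R"
        then have t0: "t \<noteq> 0" using s by simp
        have "((\<lambda>t. t ^ (j + 1)) has_real_derivative (real (j + 1) * t ^ j)) (at t)"
          using DERIV_pow[of "j + 1" t] by simp
        from DERIV_cdivide[OF DERIV_minus[OF DERIV_inverse_fun[OF this]], of "real j + 1"] t0
        have "((\<lambda>t. - inverse (t ^ (j + 1)) / (real j + 1)) has_real_derivative
            - (- (inverse (t ^ (j + 1)) * (real (j + 1) * t ^ j) * inverse (t ^ (j + 1)))) / (real j + 1)) (at t)"
          by (simp only: power_eq_0_iff simp_thms power_one_right power_Suc) (simp add: mult_ac)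
        also have "- (- (inverse (t ^ (j + 1)) * (real (j + 1) * t ^ j) * inverse (t ^ (j + 1)))) / (real j + 1) = 1 / t ^ (j + 2)"
        proof -
          have "- (- (inverse (t * P) * (c * P) * inverse (t * P))) / c = 1 / (t * t * P)" if "P \<noteq> 0" "c \<noteq> 0" for P c
            using t0 that by (simp add: field_simps)
          from this[of "t ^ j" "real j + 1"] show ?thesis using t0 by (simp add: mult_ac add.commute)
        qed
        also have "(\<lambda>t. - inverse (t ^ (j + 1)) / (real j + 1)) = (\<lambda>t. - 1 / ((real j + 1) * t ^ (j + 1)))"
          by (auto simp: fun_eq_iff divide_inverse mult.commute)
        finally show "((\<lambda>t. - 1 / ((real j + 1) * t ^ (j + 1))) has_real_derivative 1 / t ^ (j + 2)) (at t)" .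
        show "isCont (\<lambda>t. 1 / t ^ (j + 2)) t" using t0 by (intro continuous_intros) auto
      qed (use False in auto)
      also have "\<dots> \<le> 1 / ((real j + 1) * s ^ (j + 1))" using R by simp
      also have "\<dots> \<le> 1 / s ^ (j + 1)" using s by (intro divide_left_mono) auto
      finally have "A * (\<integral>t. indicator {s..R} t / t ^ (j + 2) \<partial>lborel) \<le> A * (1 / s ^ (j + 1))"
        using A by (rule mult_left_mono)
      then show ?thesis using osc[of s R] s R False by (simp add: j)
    qed
  qed
qed

section \<open>Integrability of weights and compactness of radial sequences\<close>

lemma integrable_powr_near_0:
  fixes a :: real assumes "a > - 1"
  shows "integrable lborel (\<lambda>r. indicator {0..c} r * r powr a)"
proof (cases "c \<ge> 0")
  case True
  have "(\<integral>\<^sup>+r. ennreal (r powr a) * indicator {0..c} r \<partial>lborel) = ennreal (c powr (a+1) / (a+1))"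
    by (rule nn_integral_has_integral_lebesgue'[OF _ has_integral_powr_from_0[OF assms True]]) auto
  then have "(\<integral>\<^sup>+r. ennreal (norm (indicator {0..c} r * r powr a)) \<partial>lborel) < \<infinity>"
    by (subst nn_integral_cong[where v="\<lambda>r. ennreal (r powr a) * indicator {0..c} r"]) (auto simp: indicator_def)
  then show ?thesis by (intro integrableI_bounded) auto
qed simp

lemma integrable_norm_powr:
  assumes "p < real CARD('n)"
  shows "integrable hyp_measure (\<lambda>x::real^'n. indicator {..1/2} (norm x) * norm x powr (- p))"
proof -
  let ?k = "\<lambda>r. indicator {..1/2} r * r powr (- p) :: real"
  have N: "CARD('n) > 0" by simp
  have e: "radial_density CARD('n) r * ?k r = (unit_ball_vol (real CARD('n)) * CARD('n)) * (indicator {0..1/2} r * r powr (real CARD('n) - 1 - p))" for r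
  proof (cases "0 < r \<and> r \<le> 1/2")
    case True
    have "r ^ (CARD('n) - 1) * r powr (- p) = r powr (real CARD('n) - 1 - p)"
      using True N by (simp add: powr_realpow[symmetric] powr_add[symmetric] of_nat_diff)
    then show ?thesis using True by (simp add: radial_density_def)
  next
    case False
    then show ?thesis by (auto simp: radial_density_def indicator_def)
  qed
  have "integrable lborel (\<lambda>x::real^'n. ?k (norm x))"
    by (subst integrable_norm, measurable) (unfold e, intro integrable_mult_right integrable_powr_near_0, use assms in simp)
  then have i: "integrable lborel (\<lambda>x::real^'n. (8/3) ^ CARD('n) * ?k (norm x))" by (rule integrable_mult_right)
  have m: "(\<lambda>x::real^'n. ?k (norm x)) \<in> borel_measurable borel" by measurable
  have [measurable]: "ball (0::real^'n) 1 \<in> sets borel" by simp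
  show ?thesis unfolding integrable_hyp_measure[OF m]
  proof (rule Bochner_Integration.integrable_bound[OF i])
    show "AE x::real^'n in lborel. norm (indicator (ball 0 1) x * (conf x ^ CARD('n) * ?k (norm x))) \<le> norm ((8/3) ^ CARD('n) * ?k (norm x))"
    proof (rule AE_I2)
      fix x :: "real^'n"
      show "norm (indicator (ball 0 1) x * (conf x ^ CARD('n) * ?k (norm x))) \<le> norm ((8/3) ^ CARD('n) * ?k (norm x))"
      proof (cases "norm x \<le> 1/2")
        case True
        \<comment> \<open>\<open>2 / (1 - 1/4)\<close> is the value of \<open>conf\<close> on the
          sphere of radius 1/2.\<close>
        have "conf x \<le> 8/3" using conf_mono[OF True] by (simp add: power2_eq_square)
        moreover have "conf x > 0" using True by (intro conf_pos) simp
        ultimately have "conf x ^ CARD('n) * norm x powr (- p) \<le> (8/3) ^ CARD('n) * norm x powr (- p)"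
          by (intro mult_right_mono power_mono) auto
        then show ?thesis using True \<open>conf x > 0\<close> by (simp add: abs_mult)
      qed simp
    qed
  qed (measurable)
qed

text \<open>Within radius 1/2 the function \<open>a\<close> is bounded and the power is integrable;
  outside it the power is at most \<open>2 powr p\<close> and \<open>a\<close> is
  integrable.\<close>

lemma integrable_radial_weight:
  fixes a :: "real ^ 'n \<Rightarrow> real"
  assumes a: "integrable hyp_measure a" and b: "AE x in hyp_measure. 0 \<le> a x \<and> a x \<le> C"
    and p: "0 \<le> p" "p < real CARD('n)"
  shows "integrable hyp_measure (\<lambda>x. a x * norm x powr (- p))"
proof (rule Bochner_Integration.integrable_bound)
  show "integrable hyp_measure (\<lambda>x. \<bar>C\<bar> * (indicator {..1/2} (norm x) * norm x powr (- p)) + 2 powr p * a x)"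
    by (intro Bochner_Integration.integrable_add integrable_mult_right integrable_norm_powr a p)
  have "(\<lambda>x::real^'n. norm x powr (- p)) \<in> borel_measurable hyp_measure"
    by (rule borel_measurable_hyp_measure) measurable
  then show "(\<lambda>x. a x * norm x powr (- p)) \<in> borel_measurable hyp_measure"
    using a by (intro borel_measurable_times) auto
  show "AE x in hyp_measure. norm (a x * norm x powr (- p)) \<le> norm (\<bar>C\<bar> * (indicator {..1/2} (norm x) * norm x powr (- p)) + 2 powr p * a x)"
    using b
  proof eventually_elim
    case (elim x)
    show ?case
    proof (cases "norm x \<le> 1/2")
      case True
      have "a x * norm x powr (- p) \<le> \<bar>C\<bar> * norm x powr (- p)" using elim by (intro mult_right_mono) auto
      moreover have "0 \<le> 2 powr p * a x" "0 \<le> a x * norm x powr (- p)" using elim by auto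
      ultimately show ?thesis using True by simp
    next
      case False
      have "norm x powr (- p) \<le> (1/2) powr (- p)" using False p by (intro powr_mono2') auto
      also have "(1/2) powr (- p) = 2 powr p" by (simp add: powr_minus powr_divide)
      finally have "a x * norm x powr (- p) \<le> a x * 2 powr p" using elim by (intro mult_left_mono) auto
      then show ?thesis using False elim by (simp add: mult.commute)
    qed
  qed
qed

text \<open>An Arzela-Ascoli argument: a diagonal subsequence converges at all rational radii, and
  the local equicontinuity from the energy bound extends convergence to the other radii. Only
  pointwise convergence is extracted.\<close>

lemma radial_pointwise_subsequence:
  assumes N: "CARD('n) \<ge> 3" and \<eta>: "\<And>n. radial_C1 (\<eta> n) (\<eta>' n)"
    and D: "\<And>n. (\<integral>x. (norm (fgrad (rgrad (\<eta>' n)) (x :: real ^ 'n)))\<^sup>2 \<partial>hyp_measure) \<le> 1"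
  shows "\<exists>k U. strict_mono k \<and> U \<in> borel_measurable borel \<and> (\<forall>t. 0 < t \<and> t < 1 \<longrightarrow> (\<lambda>n. \<eta> (k n :: nat) t) \<longlonglongrightarrow> U t)"
proof -
  define N where "N = CARD('n)"
  define A where "A = 1 / (unit_ball_vol (real CARD('n)) * CARD('n))"
  have A: "A > 0" by (simp add: A_def)
  have AD: "(\<integral>x. (norm (fgrad (rgrad (\<eta>' n)) (x :: real ^ 'n)))\<^sup>2 \<partial>hyp_measure) / (unit_ball_vol (real CARD('n)) * CARD('n)) \<le> A" for n
    unfolding A_def by (intro divide_right_mono D) auto
  have b1: "(\<eta> n r - \<eta> n s)\<^sup>2 \<le> A * ((r - s) / s ^ (N - 1))" if s: "0 < s" "s \<le> r" "r < 1" for n r s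
  proof -
    have "(r - s) / s ^ (N - 1) \<ge> 0" using s by auto
    from radial_bounds(1)[OF N \<eta>[of n] s] mult_right_mono[OF AD[of n] this[unfolded N_def]]
    show ?thesis unfolding N_def by (rule order_trans)
  qed
  have b2: "(\<eta> n s)\<^sup>2 \<le> A / s ^ (N - 2)" if s: "0 < s" "s < 1" for n s
  proof -
    have "s ^ (N - 2) \<ge> 0" using s by auto
    from radial_bounds(2)[OF N \<eta>[of n] s] divide_right_mono[OF AD[of n] this[unfolded N_def]]
    show ?thesis unfolding N_def by (rule order_trans)
  qed
  \<comment> \<open>The factor \<open>sqrt (t ^ (N - 2))\<close> compensates the growth at the
    origin, so that one bound serves all rational radii.\<close>
  obtain k where k: "strict_mono (k::nat\<Rightarrow>nat)"
    and kl: "\<And>t. t \<in> \<rat> \<inter> {0<..<1} \<Longrightarrow> \<exists>l. (\<lambda>n. \<eta> (k n) t * sqrt (t ^ (N - 2))) \<longlonglongrightarrow> l"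
  proof (rule function_convergent_subsequence[of "\<rat> \<inter> {0<..<1}" "\<lambda>n t. \<eta> n t * sqrt (t ^ (N - 2))" "sqrt A"])
    show "countable (\<rat> \<inter> {0<..<1::real})" by (intro countable_Int1 countable_rat)
    fix n and t :: real assume t: "t \<in> \<rat> \<inter> {0<..<1}"
    then have "(\<eta> n t)\<^sup>2 \<le> A / t ^ (N - 2)" using b2[of t n] by auto
    moreover have "t ^ (N - 2) > 0" using t by simp
    ultimately have "(\<eta> n t * sqrt (t ^ (N - 2)))\<^sup>2 \<le> A" by (simp add: power_mult_distrib pos_le_divide_eq)
    then have "sqrt ((\<eta> n t * sqrt (t ^ (N - 2)))\<^sup>2) \<le> sqrt A" by (rule real_sqrt_le_mono)
    then show "norm (\<eta> n t * sqrt (t ^ (N - 2))) \<le> sqrt A" by simp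
  qed blast
  have kr: "Cauchy (\<lambda>n. \<eta> (k n) t)" if t: "t \<in> \<rat>" "0 < t" "t < 1" for t
  proof -
    obtain l where "(\<lambda>n. \<eta> (k n) t * sqrt (t ^ (N - 2))) \<longlonglongrightarrow> l" using kl[of t] t by auto
    then have "(\<lambda>n. \<eta> (k n) t * sqrt (t ^ (N - 2)) / sqrt (t ^ (N - 2))) \<longlonglongrightarrow> l / sqrt (t ^ (N - 2))"
      using t by (intro tendsto_intros) auto
    then have "convergent (\<lambda>n. \<eta> (k n) t)" using t by (auto simp: convergent_def)
    then show ?thesis by (simp add: Cauchy_convergent_iff)
  qed
  have kc: "convergent (\<lambda>n. \<eta> (k n) t)" if t: "0 < t" "t < 1" for t
    unfolding Cauchy_convergent_iff[symmetric]
  proof (rule metric_CauchyI)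
    fix e :: real assume e: "e > 0"
    define B where "B = (t / 2) ^ (N - 1)"
    have B: "B > 0" using t by (simp add: B_def)
    \<comment> \<open>The first entry keeps \<open>s\<close> above \<open>t / 2\<close>, hence
      \<open>s ^ (N - 1)\<close> above \<open>B\<close>; the second makes the oscillation bound at
      most half of \<open>(e / 3)\<^sup>2\<close>.\<close>
    define d where "d = min (t / 2) ((e / 3)\<^sup>2 * B / (2 * A))"
    have d: "d > 0" using t e B A by (simp add: d_def)
    obtain s where s: "s \<in> \<rat>" "t - d < s" "s < t" using Rats_dense_in_real[of "t - d" t] d by auto
    have st: "t / 2 \<le> s" using s by (simp add: d_def)
    have close: "\<bar>\<eta> m t - \<eta> m s\<bar> < e / 3" for m
    proof -
      have "(\<eta> m t - \<eta> m s)\<^sup>2 \<le> A * ((t - s) / s ^ (N - 1))" using s st t by (intro b1) auto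
      also have "\<dots> \<le> A * ((t - s) / B)"
        unfolding B_def using s st t A by (intro mult_left_mono divide_left_mono power_mono) auto
      also have "\<dots> < (e / 3)\<^sup>2"
      proof -
        have "t - s < (e / 3)\<^sup>2 * B / (2 * A)" using s by (simp add: d_def)
        then have "A * (t - s) < (e / 3)\<^sup>2 * B / 2" using A by (simp add: field_simps)
        also have "\<dots> < (e / 3)\<^sup>2 * B" using e B by simp
        finally show ?thesis using B by (simp add: field_simps)
      qed
      finally have "\<bar>\<eta> m t - \<eta> m s\<bar>\<^sup>2 < (e / 3)\<^sup>2" by simp
      then show ?thesis by (rule power_less_imp_less_base) (use e in simp)
    qed
    have "Cauchy (\<lambda>n. \<eta> (k n) s)" using s st t by (intro kr) auto
    then obtain M where M: "\<And>m n. m \<ge> M \<Longrightarrow> n \<ge> M \<Longrightarrow> dist (\<eta> (k m) s) (\<eta> (k n) s) < e / 3"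
      using metric_CauchyD[of _ "e / 3"] e by (metis divide_pos_pos zero_less_numeral)
    show "\<exists>M. \<forall>m\<ge>M. \<forall>n\<ge>M. dist (\<eta> (k m) t) (\<eta> (k n) t) < e"
    proof (intro exI allI impI)
      fix m n assume "m \<ge> M" "n \<ge> M"
      then have "\<bar>\<eta> (k m) s - \<eta> (k n) s\<bar> < e / 3" using M by (simp add: dist_real_def)
      then show "dist (\<eta> (k m) t) (\<eta> (k n) t) < e"
        using close[of "k m"] close[of "k n"] unfolding dist_real_def by linarith
    qed
  qed
  define U where "U t = lim (\<lambda>n. \<eta> (k n) t)" for t
  have [measurable]: "\<eta> n \<in> borel_measurable borel" for n
    using \<eta>[of n] unfolding radial_C1_def
    by (intro borel_measurable_continuous_onI DERIV_continuous_on[where D="\<eta>' n"]) (auto intro: DERIV_subset)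
  have "U \<in> borel_measurable borel" unfolding U_def[abs_def] by measurable
  moreover have "(\<lambda>n. \<eta> (k n) t) \<longlonglongrightarrow> U t" if "0 < t" "t < 1" for t
    using kc[OF that] unfolding U_def by (simp add: convergent_LIMSEQ_iff)
  ultimately show ?thesis using k by blast
qed

section \<open>Approximation by test functions\<close>

text \<open>
  The derivatives of \<open>exp (- \<kappa> / (t * (1 - t)))\<close> on the unit interval: the pair \<open>(P, m)\<close> encodes the
  rational prefactor \<open>P / (t * (1 - t)) ^ m\<close>.
\<close>

definition bump :: "real \<Rightarrow> real poly \<times> nat \<Rightarrow> real \<Rightarrow> real" where
  "bump \<kappa> Pm t = (if 0 < t \<and> t < 1 then poly (fst Pm) t / (t * (1 - t)) ^ snd Pm * exp (- \<kappa> / (t * (1 - t))) else 0)"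

text \<open>The derivative of prefactor times exponential over the common denominator
  \<open>(t * (1 - t)) ^ (m + 2)\<close>. The polynomial \<open>[:0, 1, -1:]\<close> is
  \<open>t * (1 - t)\<close> and \<open>[:1, -2:]\<close> is its derivative.\<close>

definition bump_next :: "real \<Rightarrow> real poly \<times> nat \<Rightarrow> real poly \<times> nat" where
  "bump_next \<kappa> Pm = (pderiv (fst Pm) * [:0, 1, -1:] ^ 2 - smult (of_nat (snd Pm)) (fst Pm * [:1, -2:] * [:0, 1, -1:])
     + smult \<kappa> (fst Pm * [:1, -2:]), snd Pm + 2)"

lemma power_le_fact_exp:
  fixes x :: real assumes "x \<ge> 0" shows "x ^ n \<le> fact n * exp x"
proof -
  have s: "(\<lambda>n. x ^ n /\<^sub>R fact n) sums exp x" by (rule exp_converges)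
  have "(\<Sum>i\<in>{n}. x ^ i /\<^sub>R fact i) \<le> (\<Sum>i. x ^ i /\<^sub>R fact i)"
    using s assms by (intro sum_le_suminf) (auto simp: sums_iff)
  then have "x ^ n / fact n \<le> exp x" using s by (simp add: sums_iff divide_inverse mult.commute)
  then show ?thesis by (simp add: field_simps)
qed

lemma has_real_derivative_zero_quadratic:
  fixes f :: "real \<Rightarrow> real"
  assumes "\<And>t. \<bar>t - a\<bar> < 1 \<Longrightarrow> \<bar>f t\<bar> \<le> C * (t - a)\<^sup>2" "f a = 0"
  shows "(f has_real_derivative 0) (at a)"
  unfolding DERIV_def
proof (rule Lim_null_comparison)
  show "\<forall>\<^sub>F h in at 0. norm ((f (a + h) - f a) / h) \<le> C * \<bar>h\<bar>"
    unfolding eventually_at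
  proof (intro exI[of _ 1] conjI ballI impI)
    fix h :: real assume h: "h \<noteq> 0 \<and> dist h 0 < 1"
    then have "\<bar>f (a + h)\<bar> \<le> C * h\<^sup>2" using assms(1)[of "a + h"] by simp
    then have "\<bar>f (a + h)\<bar> / \<bar>h\<bar> \<le> C * h\<^sup>2 / \<bar>h\<bar>" by (intro divide_right_mono) auto
    also have "\<dots> = C * \<bar>h\<bar>" using h by (simp add: power2_eq_square abs_if)
    finally show "norm ((f (a + h) - f a) / h) \<le> C * \<bar>h\<bar>" using assms(2) by simp
  qed auto
  show "((\<lambda>h. C * \<bar>h\<bar>) \<longlongrightarrow> 0) (at 0)" by (auto intro!: tendsto_eq_intros)
qed

text \<open>A single term of the exponential series, of order \<open>m + 2\<close>, cancels the
  denominator with two powers to spare. This quadratic flatness forces the derivative 0 at both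
  endpoints.\<close>

lemma bump_bound:
  assumes \<kappa>: "\<kappa> > 0" shows "\<exists>C\<ge>0. \<forall>t. 0 < t \<and> t < 1 \<longrightarrow> \<bar>bump \<kappa> Pm t\<bar> \<le> C * (t * (1 - t))\<^sup>2"
proof -
  obtain P m where Pm: "Pm = (P, m)" by force
  have "continuous_on {0..1::real} (poly P)" by (intro continuous_intros)
  then have "bounded (poly P ` {0..1})" by (intro compact_imp_bounded compact_continuous_image) auto
  then obtain B where B: "\<forall>y\<in>poly P ` {0..1}. norm y \<le> B" unfolding bounded_iff by (elim exE)
  then have B0: "B \<ge> 0" by (metis atLeastAtMost_iff imageI norm_ge_zero order_refl order_trans zero_le_one)
  define C where "C = B * (fact (m + 2) / \<kappa> ^ (m + 2))"
  have "\<bar>bump \<kappa> Pm t\<bar> \<le> C * (t * (1 - t))\<^sup>2" if t: "0 < t" "t < 1" for t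
  proof -
    define w where "w = t * (1 - t)"
    have w: "w > 0" using t by (simp add: w_def)
    have "(\<kappa> / w) ^ (m + 2) \<le> fact (m + 2) * exp (\<kappa> / w)" using w \<kappa> by (intro power_le_fact_exp) auto
    then have "exp (- \<kappa> / w) * (\<kappa> / w) ^ (m + 2) \<le> exp (- \<kappa> / w) * (fact (m + 2) * exp (\<kappa> / w))"
      by (intro mult_left_mono) auto
    also have "\<dots> = fact (m + 2)" by (simp add: exp_minus field_simps)
    finally have e: "exp (- \<kappa> / w) / w ^ m \<le> fact (m + 2) / \<kappa> ^ (m + 2) * w\<^sup>2"
      using w \<kappa> by (simp add: power_divide field_simps power_add power2_eq_square)
    have "\<bar>poly P t\<bar> \<le> B" using B t by auto
    then have "\<bar>poly P t\<bar> * (exp (- \<kappa> / w) / w ^ m) \<le> B * (fact (m + 2) / \<kappa> ^ (m + 2) * w\<^sup>2)"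
      using e w B0 by (intro mult_mono) auto
    moreover have "\<bar>bump \<kappa> Pm t\<bar> = \<bar>poly P t\<bar> * (exp (- \<kappa> / w) / w ^ m)"
      using t w by (simp add: bump_def Pm abs_mult w_def)
    ultimately show ?thesis unfolding C_def w_def[symmetric] by (simp only: mult.assoc)
  qed
  moreover have "C \<ge> 0" using B0 \<kappa> by (simp add: C_def)
  ultimately show ?thesis by blast
qed

lemma bump_has_derivative:
  assumes \<kappa>: "\<kappa> > 0" shows "(bump \<kappa> Pm has_real_derivative bump \<kappa> (bump_next \<kappa> Pm) t) (at t)"
proof -
  obtain P m where Pm: "Pm = (P, m)" by force
  obtain C where C: "C \<ge> 0" "\<And>t. 0 < t \<Longrightarrow> t < 1 \<Longrightarrow> \<bar>bump \<kappa> Pm t\<bar> \<le> C * (t * (1 - t))\<^sup>2"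
    using bump_bound[OF \<kappa>, of Pm] by blast
  consider "0 < t" "t < 1" | "t < 0 \<or> t > 1" | "t = 0" | "t = 1" by linarith
  then show ?thesis
  proof cases
    case 1
    define w where "w t = t * (1 - t)" for t :: real
    have w: "w t > 0" using 1 by (simp add: w_def)
    have dw: "(w has_real_derivative (1 - 2 * t)) (at t)" unfolding w_def[abs_def]
      by (auto intro!: derivative_eq_intros)
    have dm: "((\<lambda>t. w t ^ m) has_real_derivative (m * w t ^ m * (1 - 2 * t) / w t)) (at t)"
    proof (cases m)
      case (Suc k)
      then show ?thesis using DERIV_power[OF dw, of m] w by (simp add: mult_ac)
    qed simp
    have de: "((\<lambda>t. exp (- \<kappa> / w t)) has_real_derivative (exp (- \<kappa> / w t) * (\<kappa> * (1 - 2 * t) / (w t)\<^sup>2))) (at t)"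
      using w by (auto intro!: derivative_eq_intros dw simp: power2_eq_square)
    have "((\<lambda>t. poly P t / w t ^ m * exp (- \<kappa> / w t)) has_real_derivative
      ((poly (pderiv P) t * w t ^ m - poly P t * (m * w t ^ m * (1 - 2 * t) / w t)) / (w t ^ m * w t ^ m) * exp (- \<kappa> / w t)
        + exp (- \<kappa> / w t) * (\<kappa> * (1 - 2 * t) / (w t)\<^sup>2) * (poly P t / w t ^ m))) (at t)"
      using w by (intro DERIV_mult DERIV_divide poly_DERIV dm de) auto
    also have "((poly (pderiv P) t * w t ^ m - poly P t * (m * w t ^ m * (1 - 2 * t) / w t)) / (w t ^ m * w t ^ m) * exp (- \<kappa> / w t)
        + exp (- \<kappa> / w t) * (\<kappa> * (1 - 2 * t) / (w t)\<^sup>2) * (poly P t / w t ^ m)) =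
      (poly (pderiv P) t * (w t)\<^sup>2 - m * (poly P t * (1 - 2 * t) * w t) + \<kappa> * (poly P t * (1 - 2 * t))) / w t ^ (m + 2) * exp (- \<kappa> / w t)"
    proof -
      have "(p' * M - p * (c * M * v / W)) / (M * M) * E + E * (\<kappa> * v / W\<^sup>2) * (p / M) =
        (p' * W\<^sup>2 - c * (p * v * W) + \<kappa> * (p * v)) / (M * W\<^sup>2) * E" if "M \<noteq> 0" "W \<noteq> 0" for p p' M W E v c :: real
        using that by (simp add: field_simps power2_eq_square)
      from this[of "w t ^ m" "w t"] w show ?thesis by (simp only: power_add) auto
    qed
    also have "\<dots> = bump \<kappa> (bump_next \<kappa> Pm) t"
    proof -
      have "poly [:0, 1, -1:] t = w t" "poly [:1, -2:] t = 1 - 2 * t" by (simp_all add: w_def algebra_simps)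
      then have "poly (fst (bump_next \<kappa> Pm)) t = poly (pderiv P) t * (w t)\<^sup>2 - m * (poly P t * (1 - 2 * t) * w t) + \<kappa> * (poly P t * (1 - 2 * t))"
        by (simp only: bump_next_def Pm fst_conv snd_conv poly_add poly_diff poly_mult poly_smult poly_power)
      moreover have "snd (bump_next \<kappa> Pm) = m + 2" by (simp add: bump_next_def Pm)
      ultimately show ?thesis using 1 by (simp only: bump_def w_def) simp
    qed
    finally have "((\<lambda>t. poly P t / w t ^ m * exp (- \<kappa> / w t)) has_real_derivative bump \<kappa> (bump_next \<kappa> Pm) t) (at t)" .
    then show ?thesis
      by (rule has_field_derivative_transform_within_open[of _ _ _ "{0<..<1}"]) (use 1 in \<open>auto simp: bump_def Pm w_def\<close>)
  next
    case 2
    have "((\<lambda>_. 0) has_real_derivative 0) (at t)" by simp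
    then have "(bump \<kappa> Pm has_real_derivative 0) (at t)"
      by (rule has_field_derivative_transform_within_open[of _ _ _ "{..<0} \<union> {1<..}"]) (use 2 in \<open>auto simp: bump_def\<close>)
    then show ?thesis using 2 by (auto simp: bump_def)
  next
    case 3
    have "(bump \<kappa> Pm has_real_derivative 0) (at 0)"
    proof (rule has_real_derivative_zero_quadratic[of _ _ C])
      fix s :: real assume "\<bar>s - 0\<bar> < 1"
      show "\<bar>bump \<kappa> Pm s\<bar> \<le> C * (s - 0)\<^sup>2"
      proof (cases "0 < s \<and> s < 1")
        case True
        then have "s * (1 - s) \<le> s * 1" by (intro mult_left_mono) auto
        then have "(s * (1 - s))\<^sup>2 \<le> s\<^sup>2" using True by (intro power_mono) auto
        from mult_left_mono[OF this C(1)] C(2)[of s] True show ?thesis by simp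
      qed (auto simp: bump_def C)
    qed (simp add: bump_def)
    then show ?thesis using 3 by (simp add: bump_def)
  next
    case 4
    have "(bump \<kappa> Pm has_real_derivative 0) (at 1)"
    proof (rule has_real_derivative_zero_quadratic[of _ _ C])
      fix s :: real assume "\<bar>s - 1\<bar> < 1"
      show "\<bar>bump \<kappa> Pm s\<bar> \<le> C * (s - 1)\<^sup>2"
      proof (cases "0 < s \<and> s < 1")
        case True
        then have "s * (1 - s) \<le> 1 * (1 - s)" by (intro mult_right_mono) auto
        then have "(s * (1 - s))\<^sup>2 \<le> (1 - s)\<^sup>2" using True by (intro power_mono) auto
        also have "\<dots> = (s - 1)\<^sup>2" by (simp add: power2_commute)
        finally have "(s * (1 - s))\<^sup>2 \<le> (s - 1)\<^sup>2" .
        from mult_left_mono[OF this C(1)] C(2)[of s] True show ?thesis by simp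
      qed (auto simp: bump_def C)
    qed (simp add: bump_def)
    then show ?thesis using 4 by (simp add: bump_def)
  qed
qed

definition deriv_chain :: "(nat \<Rightarrow> real \<Rightarrow> real) \<Rightarrow> bool" where
  "deriv_chain D \<longleftrightarrow> (\<forall>n t. (D n has_real_derivative D (Suc n) t) (at t))"

lemma deriv_chain_bump:
  assumes "\<kappa> > 0" shows "deriv_chain (\<lambda>n t. c ^ n * bump \<kappa> ((bump_next \<kappa> ^^ n) Pm) (c * (t - d)))"
  unfolding deriv_chain_def
proof (intro allI)
  fix n t
  have "((\<lambda>t. bump \<kappa> ((bump_next \<kappa> ^^ n) Pm) (c * (t - d))) has_real_derivative
      bump \<kappa> (bump_next \<kappa> ((bump_next \<kappa> ^^ n) Pm)) (c * (t - d)) * c) (at t)"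
    by (rule DERIV_chain2[where f="bump \<kappa> ((bump_next \<kappa> ^^ n) Pm)" and g="\<lambda>t. c * (t - d)", OF bump_has_derivative[OF assms]])
      (auto intro!: derivative_eq_intros)
  from DERIV_cmult[OF this, of "c ^ n"]
  show "((\<lambda>t. c ^ n * bump \<kappa> ((bump_next \<kappa> ^^ n) Pm) (c * (t - d))) has_real_derivative
      c ^ Suc n * bump \<kappa> ((bump_next \<kappa> ^^ Suc n) Pm) (c * (t - d))) (at t)"
    by (simp add: mult_ac)
qed

text \<open>Letting each factor carry its own order of differentiation \<open>a i\<close> makes the
  class closed under partial derivatives: the one in direction \<open>l\<close> raises
  \<open>a l\<close> by one. Hence the induction over \<open>k\<close> with \<open>a\<close>
  arbitrary.\<close>

lemma C_k_tensor:
  fixes D :: "'n::finite \<Rightarrow> nat \<Rightarrow> real \<Rightarrow> real"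
  assumes D: "\<And>i. deriv_chain (D i)"
  shows "C_k k (\<lambda>x::real^'n. \<Prod>i\<in>UNIV. D i (a i) (x $ i))"
proof (induction k arbitrary: a)
  have d: "((\<lambda>x::real^'n. \<Prod>i\<in>UNIV. D i (a i) (x $ i)) has_derivative
    (\<lambda>h. \<Sum>i\<in>UNIV. (D i (Suc (a i)) (x $ i) * h $ i) * (\<Prod>j\<in>UNIV - {i}. D j (a j) (x $ j)))) (at x)" for a x
  proof (rule has_derivative_prod)
    fix i :: 'n
    have "((\<lambda>x::real^'n. x $ i) has_derivative (\<lambda>h. h $ i)) (at x)"
      by (rule bounded_linear_imp_has_derivative[OF bounded_linear_vec_nth])
    from has_derivative_compose[OF this, of "D i (a i)" "\<lambda>h. D i (Suc (a i)) (x $ i) * h"] D[of i]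
    show "((\<lambda>x::real^'n. D i (a i) (x $ i)) has_derivative (\<lambda>h. D i (Suc (a i)) (x $ i) * h $ i)) (at x)"
      by (simp add: deriv_chain_def has_field_derivative_def)
  qed
  have diff: "(\<lambda>x::real^'n. \<Prod>i\<in>UNIV. D i (a i) (x $ i)) differentiable_on UNIV" for a
    unfolding differentiable_on_def differentiable_def using d by auto
  {
    case 0
    show ?case using diff[of a] by (simp add: differentiable_imp_continuous_on)
  next
    case (Suc k)
    have "euclidean_grad (\<lambda>x::real^'n. \<Prod>i\<in>UNIV. D i (a i) (x $ i)) x $ l = (\<Prod>i\<in>UNIV. D i ((a(l := Suc (a l))) i) (x $ i))" for x l
    proof -
      have "frechet_derivative (\<lambda>x::real^'n. \<Prod>i\<in>UNIV. D i (a i) (x $ i)) (at x) =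
        (\<lambda>h. \<Sum>i\<in>UNIV. (D i (Suc (a i)) (x $ i) * h $ i) * (\<Prod>j\<in>UNIV - {i}. D j (a j) (x $ j)))"
        by (rule frechet_derivative_at[symmetric, OF d])
      then have "euclidean_grad (\<lambda>x::real^'n. \<Prod>i\<in>UNIV. D i (a i) (x $ i)) x $ l =
        (\<Sum>i\<in>UNIV. (D i (Suc (a i)) (x $ i) * axis l 1 $ i) * (\<Prod>j\<in>UNIV - {i}. D j (a j) (x $ j)))"
        by (simp only: euclidean_grad_def vec_lambda_beta)
      also have "\<dots> = (\<Sum>i\<in>UNIV. (if i = l then D i (Suc (a i)) (x $ i) * (\<Prod>j\<in>UNIV - {i}. D j (a j) (x $ j)) else 0))"
        by (intro sum.cong) (auto simp: axis_def)
      also have "\<dots> = D l (Suc (a l)) (x $ l) * (\<Prod>j\<in>UNIV - {l}. D j (a j) (x $ j))" by simp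
      also have "\<dots> = (\<Prod>i\<in>UNIV. D i ((a(l := Suc (a l))) i) (x $ i))"
        by (subst prod.remove[of UNIV l]) auto
      finally show ?thesis .
    qed
    then show ?case using diff[of a] Suc.IH by simp
  }
qed

lemma C1_grad_euclidean_grad:
  assumes "\<And>k. C_k k \<phi>" shows "C1_grad \<phi> (euclidean_grad \<phi>)"
  unfolding C1_grad_def
proof (intro conjI allI)
  fix x
  have "\<phi> differentiable_on UNIV" using assms[of 1] by simp
  then have d: "(\<phi> has_derivative frechet_derivative \<phi> (at x)) (at x)"
    by (simp add: differentiable_on_def frechet_derivative_works)
  then interpret linear "frechet_derivative \<phi> (at x)" by (rule has_derivative_linear)
  have "frechet_derivative \<phi> (at x) h = euclidean_grad \<phi> x \<bullet> h" for h
  proof -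
    have "frechet_derivative \<phi> (at x) h = frechet_derivative \<phi> (at x) (\<Sum>i\<in>UNIV. h $ i *\<^sub>R axis i 1)"
      by (simp add: basis_expansion flip: scalar_mult_eq_scaleR)
    also have "\<dots> = (\<Sum>i\<in>UNIV. h $ i * frechet_derivative \<phi> (at x) (axis i 1))"
      by (simp add: sum scale)
    also have "\<dots> = euclidean_grad \<phi> x \<bullet> h"
      by (simp add: inner_vec_def euclidean_grad_def mult.commute)
    finally show ?thesis .
  qed
  then show "(\<phi> has_derivative (\<lambda>h. euclidean_grad \<phi> x \<bullet> h)) (at x)" using d by presburger
next
  have "continuous_on UNIV (\<lambda>x. euclidean_grad \<phi> x $ i)" for i
    using assms[of "Suc 0"] by simp
  then have "continuous_on UNIV (\<lambda>x. \<chi> i. euclidean_grad \<phi> x $ i)" by (rule continuous_on_vec_lambda)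
  then show "continuous_on UNIV (euclidean_grad \<phi>)" by simp
qed

lemma test_function_C1_ball:
  assumes "test_function \<phi>" shows "C1_ball \<phi> (euclidean_grad \<phi>)"
proof -
  let ?S = "closure {x. \<phi> x \<noteq> 0}"
  have S: "compact ?S" "?S \<subseteq> ball 0 1" using assms by (auto simp: test_function_def)
  have "\<exists>R. 0 < R \<and> R < 1 \<and> ?S \<subseteq> ball 0 R"
  proof (cases "?S = {}")
    case True
    then show ?thesis by (intro exI[of _ "1/2"]) auto
  next
    case False
    obtain y where y: "y \<in> ?S" "\<And>x. x \<in> ?S \<Longrightarrow> norm x \<le> norm y"
      using continuous_attains_sup[OF S(1) False, of norm] by (auto intro: continuous_intros)
    then have "norm y < 1" using S by auto
    moreover have "norm x < (norm y + 1) / 2" if "x \<in> ?S" for x using y(2)[OF that] \<open>norm y < 1\<close> by simp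
    moreover have "norm y \<ge> 0" by simp
    \<comment> \<open>Halfway between the farthest point of the compact support and the unit
      sphere.\<close>
    ultimately show ?thesis by (intro exI[of _ "(norm y + 1) / 2"] conjI subsetI) (simp_all del: norm_ge_zero)
  qed
  then obtain R where R: "0 < R" "R < 1" "?S \<subseteq> ball 0 R" by (elim exE conjE)
  have "\<phi> x = 0" if "R \<le> norm x" for x
  proof (rule ccontr)
    assume "\<phi> x \<noteq> 0"
    then have "x \<in> ?S" by (intro subsetD[OF closure_subset]) simp
    then have "x \<in> ball 0 R" using R(3) by (rule subsetD[rotated])
    then show False using that by simp
  qed
  then show ?thesis using R C1_grad_euclidean_grad[of \<phi>] assms by (auto simp: C1_ball_def test_function_def)
qed

section \<open>Mollification\<close>

text \<open>The convolution of \<open>\<phi>\<close> and \<open>\<rho>\<close> when the box contains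
  the support of \<open>\<phi>\<close>. Integrating over a fixed box brings it under the Leibniz
  rule for parameter integrals.\<close>

definition conv_on :: "real ^ 'n \<Rightarrow> real ^ 'n \<Rightarrow> (real ^ 'n \<Rightarrow> real) \<Rightarrow> (real ^ 'n \<Rightarrow> real) \<Rightarrow> real ^ 'n \<Rightarrow> real" where
  "conv_on a b \<phi> \<rho> x = integral (cbox a b) (\<lambda>z. \<phi> z * \<rho> (x - z))"

lemma C1_grad_conv_on:
  fixes \<phi> \<rho> :: "real ^ 'n \<Rightarrow> real"
  assumes \<phi>: "continuous_on UNIV \<phi>" and \<rho>: "C1_grad \<rho> g"
  shows "C1_grad (conv_on a b \<phi> \<rho>) (\<lambda>x. integral (cbox a b) (\<lambda>z. \<phi> z *\<^sub>R g (x - z)))"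
proof -
  note cg = C1_gradD(2)[OF \<rho>] and c\<rho> = C1_gradD(3)[OF \<rho>]
  have cg2: "continuous_on S (\<lambda>p. g (u p - v p))" if "continuous_on S u" "continuous_on S v" for S :: "'z::topological_space set" and u v
    using that by (intro continuous_on_compose2[OF cg] continuous_intros) auto
  have c\<rho>2: "continuous_on S (\<lambda>p. \<rho> (u p - v p))" if "continuous_on S u" "continuous_on S v" for S :: "'z::topological_space set" and u v
    using that by (intro continuous_on_compose2[OF c\<rho>] continuous_intros) auto
  have c\<phi>2: "continuous_on S (\<lambda>p. \<phi> (u p))" if "continuous_on S u" for S :: "'z::topological_space set" and u
    using that by (intro continuous_on_compose2[OF \<phi>]) auto
  have int: "(\<lambda>z. \<phi> z *\<^sub>R g (x - z)) integrable_on cbox a b" for x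
    by (intro integrable_continuous continuous_intros cg2 c\<phi>2)
  have "(conv_on a b \<phi> \<rho> has_derivative (\<lambda>h. integral (cbox a b) (\<lambda>z. \<phi> z *\<^sub>R g (x - z)) \<bullet> h)) (at x)" for x
  proof -
    have "((\<lambda>x. integral (cbox a b) (\<lambda>z. \<phi> z * \<rho> (x - z))) has_derivative
      blinfun_apply (integral (cbox a b) (\<lambda>z. \<phi> z *\<^sub>R blinfun_inner_right (g (x - z))))) (at x within UNIV)"
    proof (rule leibniz_rule)
      fix x z :: "real^'n"
      have "((\<lambda>x. x - z) has_derivative (\<lambda>h. h)) (at x)" by (auto intro!: derivative_eq_intros)
      from has_derivative_compose[OF this C1_gradD(1)[OF \<rho>]]
      have "((\<lambda>x. \<phi> z * \<rho> (x - z)) has_derivative (\<lambda>h. \<phi> z * (g (x - z) \<bullet> h))) (at x)"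
        by (rule has_derivative_mult_right)
      then show "((\<lambda>x. \<phi> z * \<rho> (x - z)) has_derivative blinfun_apply (\<phi> z *\<^sub>R blinfun_inner_right (g (x - z)))) (at x within UNIV)"
        by (rule has_derivative_eq_rhs) (auto simp: fun_eq_iff blinfun.scaleR_left)
    next
      show "(\<lambda>z. \<phi> z * \<rho> (x - z)) integrable_on cbox a b" for x
        by (intro integrable_continuous continuous_intros c\<rho>2 c\<phi>2)
      show "continuous_on (UNIV \<times> cbox a b) (\<lambda>(x, z). \<phi> z *\<^sub>R blinfun_inner_right (g (x - z)))"
        unfolding split_beta by (intro continuous_intros bounded_linear.continuous_on[OF bounded_linear_blinfun_inner_right] cg2 c\<phi>2)
    qed auto
    moreover have "blinfun_apply (integral (cbox a b) (\<lambda>z. \<phi> z *\<^sub>R blinfun_inner_right (g (x - z)))) = (\<lambda>h. integral (cbox a b) (\<lambda>z. \<phi> z *\<^sub>R g (x - z)) \<bullet> h)"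
    proof -
      have "integral (cbox a b) (blinfun_inner_right \<circ> (\<lambda>z. \<phi> z *\<^sub>R g (x - z))) = blinfun_inner_right (integral (cbox a b) (\<lambda>z. \<phi> z *\<^sub>R g (x - z)))"
        by (rule integral_linear[OF int bounded_linear_blinfun_inner_right])
      moreover have "blinfun_inner_right \<circ> (\<lambda>z. \<phi> z *\<^sub>R g (x - z)) = (\<lambda>z. \<phi> z *\<^sub>R blinfun_inner_right (g (x - z)))"
        by (rule ext, rule blinfun_eqI) (simp add: blinfun.scaleR_left)
      ultimately have e: "integral (cbox a b) (\<lambda>z. \<phi> z *\<^sub>R blinfun_inner_right (g (x - z))) = blinfun_inner_right (integral (cbox a b) (\<lambda>z. \<phi> z *\<^sub>R g (x - z)))"
        by (simp only:)
      show ?thesis unfolding e blinfun_inner_right.rep_eq by (rule refl)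
    qed
    ultimately show ?thesis unfolding conv_on_def[abs_def] by simp
  qed
  moreover have "continuous_on UNIV (\<lambda>x. integral (cbox a b) (\<lambda>z. \<phi> z *\<^sub>R g (x - z)))"
    by (rule integral_continuous_on_param) (unfold split_beta, intro continuous_intros cg2 c\<phi>2)
  ultimately show ?thesis by (simp add: C1_grad_def)
qed

text \<open>All derivatives fall on the second factor, so continuity of the first is enough and the
  induction runs over \<open>\<rho>\<close>.\<close>

lemma C_k_conv_on:
  fixes \<phi> \<rho> :: "real ^ 'n \<Rightarrow> real"
  assumes \<phi>: "continuous_on UNIV \<phi>" and \<rho>: "\<And>k. C_k k \<rho>"
  shows "C_k k (conv_on a b \<phi> \<rho>)"
  using \<rho>
proof (induction k arbitrary: \<rho>)
  case 0
  show ?case unfolding C_k.simps by (rule C1_gradD(3)[OF C1_grad_conv_on[OF \<phi> C1_grad_euclidean_grad[OF 0]]])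
next
  case (Suc k)
  note C = C1_grad_conv_on[OF \<phi> C1_grad_euclidean_grad[OF Suc.prems], of a b]
  have cg: "continuous_on UNIV (euclidean_grad \<rho>)" by (rule C1_gradD(2)[OF C1_grad_euclidean_grad[OF Suc.prems]])
  have int: "(\<lambda>z. \<phi> z *\<^sub>R euclidean_grad \<rho> (x - z)) integrable_on cbox a b" for x
    by (intro integrable_continuous continuous_intros continuous_on_compose2[OF cg] continuous_on_subset[OF \<phi>]) auto
  have "(\<lambda>x. euclidean_grad (conv_on a b \<phi> \<rho>) x $ i) = conv_on a b \<phi> (\<lambda>x. euclidean_grad \<rho> x $ i)" for i
    unfolding euclidean_grad_C1_grad[OF C] conv_on_def
    using integral_linear[OF int bounded_linear_vec_nth[of i]] by (simp add: o_def fun_eq_iff)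
  moreover have "C_k k (conv_on a b \<phi> (\<lambda>x. euclidean_grad \<rho> x $ i))" for i
    by (rule Suc.IH) (use Suc.prems[of "Suc _"] in simp)
  moreover have "conv_on a b \<phi> \<rho> differentiable_on UNIV"
    using C1_gradD(1)[OF C] by (auto simp: differentiable_on_def differentiable_def)
  ultimately show ?case by simp
qed

text \<open>Read in one order the convolution is smooth because \<open>\<rho>\<close> is; read in
  the other, its gradient is an average of the gradient of \<open>\<phi>\<close>. The approximation
  below needs both readings.\<close>

lemma conv_on_commute:
  fixes \<phi> \<rho> :: "real ^ 'n \<Rightarrow> real"
  assumes \<phi>: "continuous_on UNIV \<phi>" "\<And>z. z \<notin> cbox a b \<Longrightarrow> \<phi> z = 0"
    and \<rho>: "continuous_on UNIV \<rho>" "\<And>z. z \<notin> cbox c d \<Longrightarrow> \<rho> z = 0"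
  shows "conv_on a b \<phi> \<rho> x = conv_on c d \<rho> \<phi> x"
proof -
  have eq: "conv_on a b \<phi> \<rho> x = (\<integral>z. \<phi> z * \<rho> (x - z) \<partial>lborel)"
    if \<phi>: "continuous_on UNIV \<phi>" "\<And>z. z \<notin> cbox a b \<Longrightarrow> \<phi> z = 0" and \<rho>: "continuous_on UNIV \<rho>" for \<phi> \<rho> a b
  proof -
    have "continuous_on (cbox a b) (\<lambda>z. \<phi> z * \<rho> (x - z))"
      by (intro continuous_intros continuous_on_subset[OF \<phi>(1)] continuous_on_compose2[OF \<rho>]) auto
    then have i: "integrable lborel (\<lambda>z. indicator (cbox a b) z *\<^sub>R (\<phi> z * \<rho> (x - z)))"
      by (intro borel_integrable_compact) auto
    have e: "indicator (cbox a b) z *\<^sub>R (\<phi> z * \<rho> (x - z)) = \<phi> z * \<rho> (x - z)" for z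
      using \<phi>(2)[of z] by (cases "z \<in> cbox a b") auto
    have "integral UNIV (\<lambda>z. \<phi> z * \<rho> (x - z)) = (\<integral>z. \<phi> z * \<rho> (x - z) \<partial>lborel)"
      using i unfolding e by (rule integral_lborel)
    moreover have "integral (cbox a b) (\<lambda>z. \<phi> z * \<rho> (x - z)) = integral UNIV (\<lambda>z. \<phi> z * \<rho> (x - z))"
      by (rule integral_spike_set) (auto simp: \<phi>(2) intro: negligible_subset[of "{}"])
    ultimately show ?thesis by (simp add: conv_on_def)
  qed
  have m: "(\<lambda>z. \<phi> z * \<rho> (x - z)) \<in> borel_measurable borel"
    by (intro borel_measurable_continuous_onI continuous_intros \<phi>(1) continuous_on_compose2[OF \<rho>(1)]) auto
  have L: "lborel = distr lborel borel (\<lambda>y::real^'n. x - y)"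
    using lborel_affine[of "-1" x] by (simp add: density_1)
  have "(\<integral>z. \<phi> z * \<rho> (x - z) \<partial>lborel) = (\<integral>z. \<phi> z * \<rho> (x - z) \<partial>distr lborel borel (\<lambda>y. x - y))"
    by (subst L) (rule refl)
  also have "\<dots> = (\<integral>y. \<phi> (x - y) * \<rho> (x - (x - y)) \<partial>lborel)"
    by (rule integral_distr) (use m in auto)
  finally show ?thesis
    using eq[OF \<phi> \<rho>(1)] eq[OF \<rho> \<phi>(1)] by (simp add: mult.commute)
qed

lemma uniform_continuity_support:
  fixes g :: "'a::euclidean_space \<Rightarrow> 'b::real_normed_vector"
  assumes c: "continuous_on UNIV g" and z: "\<And>x. 1 \<le> norm x \<Longrightarrow> g x = 0" and e: "e > 0"
  shows "\<exists>d>0. \<forall>x y. norm y \<le> d \<longrightarrow> norm (g (x - y) - g x) \<le> e"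
proof -
  \<comment> \<open>Radius 3 leaves room for shifts of length at most 1 of points with norm at most
    2; farther out both values vanish.\<close>
  have "uniformly_continuous_on (cball 0 3) g"
    by (intro compact_uniformly_continuous continuous_on_subset[OF c]) auto
  then obtain d where d: "d > 0" "\<And>x x'. x \<in> cball 0 3 \<Longrightarrow> x' \<in> cball 0 3 \<Longrightarrow> dist x' x < d \<Longrightarrow> dist (g x') (g x) < e"
    using e unfolding uniformly_continuous_on_def by metis
  define d' where "d' = min (d / 2) 1"
  have d': "d' > 0" "d' < d" "d' \<le> 1" using d(1) by (auto simp: d'_def)
  have "norm (g (x - y) - g x) \<le> e" if y: "norm y \<le> d'" for x y
  proof (cases "norm x \<le> 2")
    case True
    have "norm (x - y) \<le> norm x + norm y" by (rule norm_triangle_ineq4)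
    then have "norm (x - y) \<le> 3" using True y d' by linarith
    then have "dist (g (x - y)) (g x) < e"
      using True y d' by (intro d(2)) (auto simp: dist_norm norm_minus_commute)
    then show ?thesis by (simp add: dist_norm)
  next
    case False
    have "norm x \<le> norm (x - y) + norm y" by (metis diff_add_cancel norm_triangle_ineq)
    then have "1 \<le> norm (x - y)" "1 \<le> norm x" using False y d' by auto
    then show ?thesis using z e by simp
  qed
  then show ?thesis using d' by blast
qed

lemma bump_one_pos: "0 < t \<Longrightarrow> t < 1 \<Longrightarrow> bump \<kappa> (1, 0) t > 0"
  by (simp add: bump_def)

lemma bump_eq_0: "\<not> (0 < t \<and> t < 1) \<Longrightarrow> bump \<kappa> Pm t = 0"
  unfolding bump_def by (simp only: if_False)

text \<open>Positive exactly on the open box when \<open>a $ i < b $ i\<close> for all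
  \<open>i\<close>. With \<open>\<kappa> = 1\<close> it serves as mollifier; as
  \<open>\<kappa>\<close> tends to 0 it tends to the indicator of the box, which closability
  uses.\<close>

definition box_bump :: "real \<Rightarrow> real ^ 'n \<Rightarrow> real ^ 'n \<Rightarrow> real ^ 'n \<Rightarrow> real" where
  "box_bump \<kappa> a b x = (\<Prod>i\<in>UNIV. bump \<kappa> (1, 0) ((x $ i - a $ i) / (b $ i - a $ i)))"

lemma C_k_box_bump:
  assumes \<kappa>: "\<kappa> > 0" shows "C_k k (box_bump \<kappa> a b :: real ^ 'n \<Rightarrow> real)"
proof -
  have "deriv_chain (\<lambda>n t. (1 / (b $ i - a $ i)) ^ n * bump \<kappa> ((bump_next \<kappa> ^^ n) (1, 0)) (1 / (b $ i - a $ i) * (t - a $ i)))" for i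
    by (rule deriv_chain_bump[OF \<kappa>])
  from C_k_tensor[where D="\<lambda>i n t. (1 / (b $ i - a $ i)) ^ n * bump \<kappa> ((bump_next \<kappa> ^^ n) (1, 0)) (1 / (b $ i - a $ i) * (t - a $ i))" and a="\<lambda>_. 0", OF this]
  show ?thesis unfolding box_bump_def[abs_def] by simp
qed

lemma box_bump_nonneg: "box_bump \<kappa> a b x \<ge> 0"
  unfolding box_bump_def by (intro prod_nonneg ballI) (auto simp: bump_def)

lemma box_bump_eq_0:
  fixes a b :: "real ^ 'n"
  assumes ab: "\<And>i. a $ i < b $ i" and x: "x \<notin> box a b"
  shows "box_bump \<kappa> a b x = 0"
proof -
  obtain i where "\<not> (a $ i < x $ i \<and> x $ i < b $ i)" using x by (auto simp: mem_box_cart)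
  then have "bump \<kappa> (1, 0) ((x $ i - a $ i) / (b $ i - a $ i)) = 0"
    using ab[of i] by (intro bump_eq_0) (auto simp: field_simps)
  then show ?thesis unfolding box_bump_def by (intro prod_zero) auto
qed

lemma box_bump_pos:
  fixes a b :: "real ^ 'n"
  assumes x: "x \<in> box a b" shows "box_bump \<kappa> a b x > 0"
  unfolding box_bump_def
proof (rule prod_pos)
  fix i :: 'n
  have "a $ i < x $ i" "x $ i < b $ i" using x by (auto simp: mem_box_cart)
  then show "bump \<kappa> (1, 0) ((x $ i - a $ i) / (b $ i - a $ i)) > 0"
    by (intro bump_one_pos) (auto simp: field_simps)
qed

lemma integrable_hyp_measure_cball: "0 \<le> R \<Longrightarrow> R < 1 \<Longrightarrow> integrable hyp_measure (\<lambda>x::real^'n. indicator (cball 0 R) x :: real)"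
  by (rule integrable_hyp_measure_bounded_support[of _ R 1]) (auto simp: indicator_def)

text \<open>After mollification at a small scale the gradient is uniformly close to
  \<open>g\<close>, and the supports remain in a ball of radius below 1, where the measure is finite
  and \<open>fgrad\<close> only shrinks vectors.\<close>

lemma test_function_approximation:
  fixes \<phi> :: "real ^ 'n \<Rightarrow> real"
  assumes C: "C1_ball \<phi> g" and e: "e > 0"
  shows "\<exists>\<psi>. test_function \<psi> \<and> (\<integral>x. (norm (fgrad (euclidean_grad \<psi>) x - fgrad g x))\<^sup>2 \<partial>hyp_measure) < e"
proof -
  obtain R where R: "0 < R" "R < 1" and z: "\<And>x. R \<le> norm x \<Longrightarrow> \<phi> x = 0" and gz: "\<And>x. R < norm x \<Longrightarrow> g x = 0"
    and C1: "C1_grad \<phi> g" by (rule C1_ballD[OF C]) blast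
  note cg = C1_gradD(2)[OF C1] and c\<phi> = C1_gradD(3)[OF C1]
  define R' where "R' = (1 + R) / 2"
  have R': "R < R'" "R' < 1" "0 < R'" using R by (auto simp: R'_def)
  define K where "K = (\<integral>x. indicator (cball 0 R') (x::real^'n) \<partial>hyp_measure :: real)"
  have K: "K \<ge> 0" unfolding K_def by (intro Bochner_Integration.integral_nonneg) auto
  \<comment> \<open>Chosen so that \<open>\<epsilon>\<^sup>2\<close> times the measure
    \<open>K\<close> of the supporting ball stays below \<open>e\<close>.\<close>
  define \<epsilon> where "\<epsilon> = sqrt (e / (K + 1))"
  have \<epsilon>: "\<epsilon> > 0" using e K by (simp add: \<epsilon>_def)
  have "\<epsilon>\<^sup>2 * K < e"
  proof -
    have "\<epsilon>\<^sup>2 = e / (K + 1)" using e K by (simp add: \<epsilon>_def)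
    then have "\<epsilon>\<^sup>2 * K + \<epsilon>\<^sup>2 = e" using K by (simp add: field_simps)
    moreover have "\<epsilon>\<^sup>2 > 0" using \<epsilon> by simp
    ultimately show ?thesis by linarith
  qed
  obtain d0 where d0: "d0 > 0" "\<And>x y. norm y \<le> d0 \<Longrightarrow> norm (g (x - y) - g x) \<le> \<epsilon>"
    using uniform_continuity_support[OF cg _ \<epsilon>] gz R by force
  define d where "d = min d0 (R' - R)"
  have d: "d > 0" "d \<le> d0" "R + d \<le> R'" using d0 R' by (auto simp: d_def)
  \<comment> \<open>The norm is at most the sum of the coordinates, so the box of side
    \<open>d / N\<close> lies within distance \<open>d\<close> of its corner 0.\<close>
  define \<delta> where "\<delta> = d / CARD('n)"
  have \<delta>: "\<delta> > 0" using d by (simp add: \<delta>_def)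
  define o' :: "real ^ 'n" where "o' = (\<chi> i. \<delta>)"
  have nd: "norm y \<le> d" if "y \<in> cbox 0 o'" for y :: "real^'n"
  proof -
    have "norm y \<le> (\<Sum>i\<in>UNIV. \<bar>y $ i\<bar>)" by (rule norm_le_l1_cart)
    also have "\<dots> \<le> (\<Sum>i\<in>(UNIV::'n set). \<delta>)"
    proof (rule sum_mono)
      fix i
      have "0 \<le> y $ i \<and> y $ i \<le> \<delta>" using that by (simp add: mem_box_cart o'_def)
      then show "\<bar>y $ i\<bar> \<le> \<delta>" by simp
    qed
    also have "\<dots> = d" by (simp add: \<delta>_def)
    finally show ?thesis .
  qed
  define \<rho> where "\<rho> = (box_bump 1 0 o' :: real ^ 'n \<Rightarrow> real)"
  have \<rho>k: "C_k k \<rho>" for k unfolding \<rho>_def by (rule C_k_box_bump) simp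
  have c\<rho>: "continuous_on UNIV \<rho>" by (rule C1_gradD(3)[OF C1_grad_euclidean_grad[OF \<rho>k]])
  have o'i: "(0::real^'n) $ i < o' $ i" for i using \<delta> by (simp add: o'_def)
  have \<rho>0: "\<rho> x \<ge> 0" for x unfolding \<rho>_def by (rule box_bump_nonneg)
  have \<rho>z: "\<rho> x = 0" if "x \<notin> cbox 0 o'" for x
    unfolding \<rho>_def by (rule box_bump_eq_0[OF o'i]) (use that box_subset_cbox in blast)
  define m where "m = integral (cbox 0 o') \<rho>"
  have int\<rho>: "\<rho> integrable_on cbox 0 o'" by (intro integrable_continuous continuous_on_subset[OF c\<rho>]) auto
  have m: "m > 0"
  proof -
    have x0: "(o' /\<^sub>R 2) \<in> box 0 o'" using \<delta> by (simp add: mem_box_cart o'_def)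
    then have "\<rho> (o' /\<^sub>R 2) > 0" unfolding \<rho>_def by (rule box_bump_pos)
    moreover have "(o' /\<^sub>R 2) \<in> cbox 0 o'" using x0 box_subset_cbox by blast
    moreover have "continuous_on (cbox 0 o') \<rho>" by (intro continuous_on_subset[OF c\<rho>]) auto
    moreover have "box 0 o' \<noteq> {}" using x0 by blast
    ultimately have "m \<noteq> 0" unfolding m_def using integral_cbox_eq_0_iff[of 0 o' \<rho>] \<rho>0 by force
    moreover have "m \<ge> 0" unfolding m_def by (rule Henstock_Kurzweil_Integration.integral_nonneg[OF int\<rho> \<rho>0])
    ultimately show ?thesis by simp
  qed
  \<comment> \<open>The mass of \<open>\<rho>\<close> is divided out of \<open>\<phi>\<close>
    instead, so that \<open>\<rho>\<close> keeps its product form.\<close>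
  define \<phi>' where "\<phi>' x = \<phi> x / m" for x
  define g' where "g' x = (1 / m) *\<^sub>R g x" for x
  have C1': "C1_grad \<phi>' g'"
    unfolding C1_grad_def
  proof (intro conjI allI)
    show "(\<phi>' has_derivative (\<lambda>h. g' x \<bullet> h)) (at x)" for x
      unfolding \<phi>'_def g'_def using has_derivative_mult_right[OF C1_gradD(1)[OF C1, of x], of "1 / m"] by simp
    show "continuous_on UNIV g'" unfolding g'_def by (intro continuous_intros cg)
  qed
  note c\<phi>' = C1_gradD(3)[OF C1'] and cg' = C1_gradD(2)[OF C1']
  define u :: "real ^ 'n" where "u = (\<chi> i. 1)"
  have \<phi>'z: "\<phi>' x = 0" if "x \<notin> cbox (- u) u" for x
  proof -
    have "\<not> (\<forall>i. \<bar>x $ i\<bar> \<le> 1)"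
    proof
      assume a: "\<forall>i. \<bar>x $ i\<bar> \<le> 1"
      have "(- u) $ i \<le> x $ i \<and> x $ i \<le> u $ i" for i
        using spec[OF a, of i] by (simp add: u_def abs_le_iff)
      then show False using that by (simp add: mem_box_cart)
    qed
    then obtain i where "\<not> \<bar>x $ i\<bar> \<le> 1" by (elim not_all[THEN iffD1, THEN exE])
    then have "1 \<le> norm x" using component_le_norm_cart[of x i] by linarith
    then show ?thesis using z R by (simp add: \<phi>'_def)
  qed
  define \<psi> where "\<psi> = conv_on (- u) u \<phi>' \<rho>"
  have \<psi>k: "C_k k \<psi>" for k unfolding \<psi>_def by (rule C_k_conv_on[OF c\<phi>' \<rho>k])
  have \<psi>eq: "\<psi> = conv_on 0 o' \<rho> \<phi>'"
    unfolding \<psi>_def by (rule ext, rule conv_on_commute[OF c\<phi>' \<phi>'z c\<rho> \<rho>z])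
  define G where "G x = integral (cbox 0 o') (\<lambda>y. \<rho> y *\<^sub>R g' (x - y))" for x
  have CG: "C1_grad \<psi> G" unfolding \<psi>eq G_def[abs_def] by (rule C1_grad_conv_on[OF c\<rho> C1'])
  have \<psi>z: "\<psi> x = 0" if x: "R' \<le> norm x" for x
  proof -
    have "\<rho> y * \<phi>' (x - y) = 0" if y: "y \<in> cbox 0 o'" for y
    proof -
      have "norm x \<le> norm (x - y) + norm y" by (metis diff_add_cancel norm_triangle_ineq)
      then have "R \<le> norm (x - y)" using nd[OF y] d x by linarith
      then show ?thesis using z by (simp add: \<phi>'_def)
    qed
    then show ?thesis unfolding \<psi>eq conv_on_def by (subst integral_cong[where g="\<lambda>_. 0"]) auto
  qed
  have test: "test_function \<psi>"
  proof -
    have "{x. \<psi> x \<noteq> 0} \<subseteq> cball 0 R'"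
    proof
      fix x assume "x \<in> {x. \<psi> x \<noteq> 0}"
      then have "\<not> R' \<le> norm x" using \<psi>z[of x] by (intro notI) simp
      then show "x \<in> cball 0 R'" by simp
    qed
    then have cl: "closure {x. \<psi> x \<noteq> 0} \<subseteq> cball 0 R'" by (intro closure_minimal) auto
    then have "bounded (closure {x. \<psi> x \<noteq> 0})" by (rule bounded_subset[OF bounded_cball])
    then have "compact (closure {x. \<psi> x \<noteq> 0})" by (simp add: compact_eq_bounded_closed)
    moreover have "closure {x. \<psi> x \<noteq> 0} \<subseteq> ball 0 1" using cl R' by auto
    ultimately show ?thesis using \<psi>k by (simp add: test_function_def)
  qed
  have Gg: "norm (G x - g x) \<le> \<epsilon>" for x
  proof -
    have i1: "(\<lambda>y. \<rho> y *\<^sub>R g' (x - y)) integrable_on cbox 0 o'"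
      by (intro integrable_continuous continuous_intros continuous_on_subset[OF c\<rho>] continuous_on_compose2[OF cg']) auto
    have i2: "(\<lambda>y. \<rho> y *\<^sub>R g' x) integrable_on cbox 0 o'"
      by (intro integrable_continuous continuous_intros continuous_on_subset[OF c\<rho>]) auto
    have "integral (cbox 0 o') (\<lambda>y. \<rho> y *\<^sub>R g' x) = m *\<^sub>R g' x"
      unfolding m_def using integral_linear[OF int\<rho> bounded_linear_scaleR_left[of "g' x"]] by (simp add: o_def)
    also have "\<dots> = g x" using m by (simp add: g'_def)
    finally have "G x - g x = integral (cbox 0 o') (\<lambda>y. \<rho> y *\<^sub>R g' (x - y) - \<rho> y *\<^sub>R g' x)"
      unfolding G_def using Henstock_Kurzweil_Integration.integral_diff[OF i1 i2] by simp
    also have "norm \<dots> \<le> integral (cbox 0 o') (\<lambda>y. \<rho> y * (\<epsilon> / m))"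
    proof (rule Henstock_Kurzweil_Integration.integral_norm_bound_integral)
      show "(\<lambda>y. \<rho> y *\<^sub>R g' (x - y) - \<rho> y *\<^sub>R g' x) integrable_on cbox 0 o'"
        by (rule integrable_diff[OF i1 i2])
      show "(\<lambda>y. \<rho> y * (\<epsilon> / m)) integrable_on cbox 0 o'" by (rule integrable_on_mult_left[OF int\<rho>])
      fix y assume y: "y \<in> cbox 0 o'"
      have "norm (g (x - y) - g x) \<le> \<epsilon>" using nd[OF y] d by (intro d0(2)) simp
      moreover have "\<rho> y *\<^sub>R g' (x - y) - \<rho> y *\<^sub>R g' x = (\<rho> y / m) *\<^sub>R (g (x - y) - g x)"
        by (simp add: g'_def scaleR_diff_right)
      ultimately show "norm (\<rho> y *\<^sub>R g' (x - y) - \<rho> y *\<^sub>R g' x) \<le> \<rho> y * (\<epsilon> / m)"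
        using m \<rho>0[of y] by (simp add: mult_left_mono divide_right_mono)
    qed
    also have "\<dots> = \<epsilon>" using m by (simp add: m_def)
    finally show ?thesis .
  qed
  have EG: "euclidean_grad \<psi> = G" by (rule euclidean_grad_C1_grad[OF CG])
  have Gz: "G x = 0" if "R' < norm x" for x by (rule C1_grad_eq_0[OF CG \<psi>z that])
  have "(\<integral>x. (norm (fgrad G x - fgrad g x))\<^sup>2 \<partial>hyp_measure) \<le> (\<integral>x. \<epsilon>\<^sup>2 * indicator (cball 0 R') (x::real^'n) \<partial>hyp_measure)"
  proof (rule integral_mono)
    have "C1_ball \<psi> G" using CG \<psi>z R' by (auto simp: C1_ball_def)
    then show "integrable hyp_measure (\<lambda>x. (norm (fgrad G x - fgrad g x))\<^sup>2)"
      using sq_integrable_diff[OF C1_ball_sq_integrable(2) C1_ball_sq_integrable(2)[OF C]] by (auto simp: sq_integrable_def)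
    show "integrable hyp_measure (\<lambda>x::real^'n. \<epsilon>\<^sup>2 * indicator (cball 0 R') x)"
      using integrable_hyp_measure_cball[of R'] R' by (intro integrable_mult_right) auto
    fix x :: "real^'n" assume x: "x \<in> space hyp_measure"
    show "(norm (fgrad G x - fgrad g x))\<^sup>2 \<le> \<epsilon>\<^sup>2 * indicator (cball 0 R') x"
    proof (cases "norm x \<le> R'")
      case True
      have c2: "conf x \<ge> 2" using x by (intro conf_ge_2) simp
      have "fgrad G x - fgrad g x = (1 / conf x) *\<^sub>R (G x - g x)" by (simp add: fgrad_def scaleR_diff_right)
      then have "norm (fgrad G x - fgrad g x) = (1 / conf x) * norm (G x - g x)" using c2 by simp
      also have "\<dots> \<le> 1 * \<epsilon>" using c2 Gg[of x] by (intro mult_mono) auto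
      finally show ?thesis using True by (simp add: power_mono)
    next
      case False
      then show ?thesis using Gz[of x] gz[of x] R' by (simp add: fgrad_def)
    qed
  qed
  also have "\<dots> = \<epsilon>\<^sup>2 * K" unfolding K_def by simp
  also have "\<dots> < e" by fact
  finally show ?thesis using test EG by blast
qed

text \<open>The densities given by the positive and the negative part of \<open>Z\<close> agree on
  boxes, an intersection-stable generator, hence everywhere. Testing on the set where one part is
  positive, where the other vanishes, shows that both are null.\<close>

lemma AE_zero_of_box_integrals:
  fixes Z :: "'a::euclidean_space \<Rightarrow> real"
  assumes Z: "integrable lborel Z" and box: "\<And>a b. (\<integral>x. indicator (box a b) x * Z x \<partial>lborel) = 0"
  shows "AE x in lborel. Z x = 0"
proof -
  have [measurable]: "Z \<in> borel_measurable borel" using Z by auto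
  define P where "P = density lborel (\<lambda>x. ennreal (max 0 (Z x)))"
  define Q where "Q = density lborel (\<lambda>x. ennreal (max 0 (- Z x)))"
  have bm: "box a b \<in> sets borel" for a b :: 'a by simp
  have i1: "integrable lborel (\<lambda>x. indicator (box a b) x * max 0 (Z x))"
    and i2: "integrable lborel (\<lambda>x. indicator (box a b) x * max 0 (- Z x))" for a b
    using bm[of a b] by (auto intro!: Bochner_Integration.integrable_bound[OF Z] AE_I2 abs_ge_self abs_ge_minus_self simp: indicator_def)
  have eP: "emeasure P (box a b) = ennreal (\<integral>x. indicator (box a b) x * max 0 (Z x) \<partial>lborel)" for a b
  proof -
    have "emeasure P (box a b) = (\<integral>\<^sup>+x. ennreal (indicator (box a b) x * max 0 (Z x)) \<partial>lborel)"
      unfolding P_def by (subst emeasure_density) (auto intro!: nn_integral_cong simp: indicator_def)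
    then show ?thesis using i1[of a b] by (subst (asm) nn_integral_eq_integral) auto
  qed
  have eQ: "emeasure Q (box a b) = ennreal (\<integral>x. indicator (box a b) x * max 0 (- Z x) \<partial>lborel)" for a b
  proof -
    have "emeasure Q (box a b) = (\<integral>\<^sup>+x. ennreal (indicator (box a b) x * max 0 (- Z x)) \<partial>lborel)"
      unfolding Q_def by (subst emeasure_density) (auto intro!: nn_integral_cong simp: indicator_def)
    then show ?thesis using i2[of a b] by (subst (asm) nn_integral_eq_integral) auto
  qed
  have "P = Q"
  proof (rule measure_eqI_generator_eq[where E="range (\<lambda>(a, b). box a b)" and \<Omega>=UNIV and A="\<lambda>n. box (- (real n *\<^sub>R One)) (real n *\<^sub>R One)"])
    show "Int_stable (range (\<lambda>(a, b). box a b :: 'a set))"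
      by (auto simp: Int_stable_def box_Int_box)
    show "emeasure P X = emeasure Q X" if X': "X \<in> range (\<lambda>(a, b). box a b :: 'a set)" for X
    proof -
      obtain a b where X: "X = box a b" using X' by auto
      have pw: "indicator (box a b) x * Z x = indicator (box a b) x * max 0 (Z x) - indicator (box a b) x * max 0 (- Z x)" for x
        by (cases "Z x \<ge> 0") (auto simp: max_def)
      have "(\<integral>x. indicator (box a b) x * Z x \<partial>lborel) = (\<integral>x. indicator (box a b) x * max 0 (Z x) \<partial>lborel) - (\<integral>x. indicator (box a b) x * max 0 (- Z x) \<partial>lborel)"
        unfolding pw by (rule Bochner_Integration.integral_diff[OF i1 i2])
      then show ?thesis unfolding X eP eQ using box[of a b] by simp
    qed
    have "sets (borel :: 'a measure) = sigma_sets UNIV (range (\<lambda>(a, b). box a b))"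
      by (subst borel_eq_box) simp
    then show "sets P = sigma_sets UNIV (range (\<lambda>(a, b). box a b))" "sets Q = sigma_sets UNIV (range (\<lambda>(a, b). box a b))"
      by (simp_all add: P_def Q_def)
    show "(\<Union>n::nat. box (- (real n *\<^sub>R One)) (real n *\<^sub>R One)) = (UNIV :: 'a set)" by (rule UN_box_eq_UNIV)
    show "range (\<lambda>n. box (- (real n *\<^sub>R One)) (real n *\<^sub>R One)) \<subseteq> range (\<lambda>(a, b). box a b :: 'a set)" by auto
    show "emeasure P (box (- (real n *\<^sub>R One)) (real n *\<^sub>R One)) \<noteq> \<infinity>" for n unfolding eP by simp
  qed auto
  have ae: "AE x in lborel. F x = 0"
    if F: "F \<in> borel_measurable borel" "\<And>x. F x = max 0 (F x)"
      and eq: "density lborel (\<lambda>x. ennreal (F x)) = density lborel (\<lambda>x. ennreal (H x))"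
      and H: "H \<in> borel_measurable borel" "\<And>x. F x > 0 \<Longrightarrow> H x = 0" for F H :: "'a \<Rightarrow> real"
  proof -
    note F(1)[measurable] H(1)[measurable]
    define A where "A = {x. F x > 0}"
    have A[measurable]: "A \<in> sets borel" unfolding A_def by measurable
    have "(\<integral>\<^sup>+x. ennreal (F x) * indicator A x \<partial>lborel) = (\<integral>\<^sup>+x. ennreal (H x) * indicator A x \<partial>lborel)"
      using arg_cong[OF eq, of "\<lambda>M. emeasure M A"] by (simp add: emeasure_density)
    also have "\<dots> = (\<integral>\<^sup>+x. 0 \<partial>(lborel :: 'a measure))"
      by (intro nn_integral_cong) (auto simp: A_def indicator_def H(2))
    finally have "(\<integral>\<^sup>+x. ennreal (F x) * indicator A x \<partial>lborel) = 0" by simp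
    moreover have "(\<lambda>x. ennreal (F x) * indicator A x) \<in> borel_measurable lborel" by measurable
    ultimately have "AE x in lborel. ennreal (F x) * indicator A x = 0"
      using nn_integral_0_iff_AE by blast
    then show ?thesis
    proof eventually_elim
      case (elim x)
      then have "\<not> F x > 0" by (auto simp: A_def indicator_def)
      then show ?case using F(2)[of x] by simp
    qed
  qed
  have "AE x in lborel. max 0 (Z x) = 0"
    by (rule ae[where H="\<lambda>x. max 0 (- Z x)"]) (use \<open>P = Q\<close> in \<open>auto simp: P_def Q_def\<close>)
  moreover have "AE x in lborel. max 0 (- Z x) = 0"
    by (rule ae[where H="\<lambda>x. max 0 (Z x)"]) (use \<open>P = Q\<close>[symmetric] in \<open>auto simp: P_def Q_def\<close>)
  ultimately show ?thesis
    by eventually_elim (auto simp: max_def split: if_splits)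
qed

section \<open>The Sobolev space\<close>

text \<open>Elements of the completion and their gradients are only Lebesgue measurable, so here the
  completed measure is kept.\<close>

lemma
  fixes g :: "real ^ 'n \<Rightarrow> real"
  assumes g: "g \<in> borel_measurable hyp_measure"
  shows integral_hyp_measure_lebesgue: "integral\<^sup>L hyp_measure g = (\<integral>x. indicator (ball 0 1) x * (conf x ^ CARD('n) * g x) \<partial>lebesgue)"
    and integrable_hyp_measure_lebesgue: "integrable hyp_measure g \<longleftrightarrow> integrable lebesgue (\<lambda>x. indicator (ball 0 1) x * (conf x ^ CARD('n) * g x))"
proof -
  have m: "(\<lambda>x::real^'n. conf x ^ CARD('n)) \<in> borel_measurable (lebesgue_on (ball 0 1))"
    by (intro borel_measurable_lebesgue_on_ball) measurable
  have nn: "AE x::real^'n in lebesgue_on (ball 0 1). 0 \<le> conf x ^ CARD('n)"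
    by (rule AE_I2) (auto intro!: zero_le_power less_imp_le[OF conf_pos])
  have gm: "g \<in> borel_measurable (lebesgue_on (ball 0 1))"
    using g by (subst (asm) measurable_cong_sets[OF sets_hyp_measure refl])
  have "integral\<^sup>L hyp_measure g = (\<integral>x. conf x ^ CARD('n) * g x \<partial>lebesgue_on (ball 0 1))"
    unfolding hyp_measure_conf by (rule integral_real_density[OF m nn gm])
  also have "\<dots> = (\<integral>x. indicator (ball 0 1) x *\<^sub>R (conf x ^ CARD('n) * g x) \<partial>lebesgue)"
    by (rule integral_restrict_space) auto
  finally show "integral\<^sup>L hyp_measure g = (\<integral>x. indicator (ball 0 1) x * (conf x ^ CARD('n) * g x) \<partial>lebesgue)" by simp
  have "integrable hyp_measure g \<longleftrightarrow> integrable (lebesgue_on (ball 0 1)) (\<lambda>x. conf x ^ CARD('n) * g x)"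
    unfolding hyp_measure_conf by (rule integrable_real_density[OF m nn gm])
  also have "\<dots> \<longleftrightarrow> integrable lebesgue (\<lambda>x. indicator (ball 0 1) x *\<^sub>R (conf x ^ CARD('n) * g x))"
    by (rule integrable_restrict_space) auto
  finally show "integrable hyp_measure g \<longleftrightarrow> integrable lebesgue (\<lambda>x. indicator (ball 0 1) x * (conf x ^ CARD('n) * g x))" by simp
qed

lemma integrable_hyp_measure_bounded_density:
  fixes h :: "real ^ 'n \<Rightarrow> real"
  assumes m: "h \<in> borel_measurable borel" and C: "\<And>x. norm x < 1 \<Longrightarrow> \<bar>conf x ^ CARD('n) * h x\<bar> \<le> C"
  shows "integrable hyp_measure h"
  unfolding integrable_hyp_measure[OF m]
proof (rule integrable_bounded_support)
  note m[measurable]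
  have [measurable]: "ball (0::real^'n) 1 \<in> sets borel" by simp
  show "(\<lambda>x. indicator (ball 0 1) x * (conf x ^ CARD('n) * h x)) \<in> borel_measurable borel" by measurable
  show "indicator (ball 0 1) x * (conf x ^ CARD('n) * h x) = 0" if "1 < norm x" for x using that by simp
  have "C \<ge> 0" using C[of 0] by simp
  then show "norm (indicator (ball 0 1) x * (conf x ^ CARD('n) * h x)) \<le> C" for x
    using C[of x] by (cases "norm x < 1") auto
qed

lemma tendsto_box_bump:
  fixes a b :: "real ^ 'n"
  assumes ab: "\<And>i. a $ i < b $ i"
  shows "(\<lambda>k. box_bump (1 / real (Suc k)) a b x) \<longlonglongrightarrow> indicator (box a b) x"
proof (cases "x \<in> box a b")
  case True
  have "(\<lambda>k. bump (1 / real (Suc k)) (1, 0) ((x $ i - a $ i) / (b $ i - a $ i))) \<longlonglongrightarrow> 1" for i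
  proof -
    define t where "t = (x $ i - a $ i) / (b $ i - a $ i)"
    have "a $ i < x $ i" "x $ i < b $ i" using True by (auto simp: mem_box_cart)
    then have t: "0 < t" "t < 1" by (auto simp: t_def field_simps)
    have "(\<lambda>k. - (1 / real (Suc k)) / (t * (1 - t))) \<longlonglongrightarrow> - 0 / (t * (1 - t))"
      using t LIMSEQ_inverse_real_of_nat by (intro tendsto_intros) (auto simp: inverse_eq_divide)
    then have "(\<lambda>k. exp (- (1 / real (Suc k)) / (t * (1 - t)))) \<longlonglongrightarrow> exp (- 0 / (t * (1 - t)))"
      by (rule tendsto_exp)
    then show ?thesis using t unfolding t_def[symmetric] bump_def by simp
  qed
  then have "(\<lambda>k. box_bump (1 / real (Suc k)) a b x) \<longlonglongrightarrow> (\<Prod>i\<in>(UNIV :: 'n set). 1)"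
    unfolding box_bump_def by (intro tendsto_prod) auto
  then show ?thesis using True by simp
next
  case False
  then show ?thesis using box_bump_eq_0[OF ab False] by simp
qed

lemma box_bump_le_1:
  assumes "\<kappa> > 0" shows "box_bump \<kappa> a b x \<le> 1"
  unfolding box_bump_def
proof (rule prod_le_1, intro conjI)
  fix i
  let ?t = "(x $ i - a $ i) / (b $ i - a $ i)"
  show "0 \<le> bump \<kappa> (1, 0) ?t" by (auto simp: bump_def)
  show "bump \<kappa> (1, 0) ?t \<le> 1"
  proof (cases "0 < ?t \<and> ?t < 1")
    case True
    then have "- \<kappa> / (?t * (1 - ?t)) \<le> 0" using assms by (intro divide_nonpos_nonneg mult_nonneg_nonneg) auto
    then show ?thesis using True by (simp add: bump_def)
  qed (simp add: bump_eq_0)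
qed

text \<open>Integration by parts against smooth fields moves the derivative off
  \<open>\<phi> n\<close>, whose L2 norm tends to 0; so \<open>Y\<close> is orthogonal to these
  fields. Letting the smooth factor tend to the indicator of a box gives vanishing box integrals for
  each component of \<open>Y\<close>.\<close>

lemma fgrad_limit_eq_0:
  fixes \<phi> :: "nat \<Rightarrow> real ^ 'n \<Rightarrow> real"
  assumes N: "CARD('n) \<ge> 3" and C: "\<And>n. C1_ball (\<phi> n) (g n)"
    and Y: "sq_integrable hyp_measure Y"
    and \<phi>0: "(\<lambda>n. \<integral>x. (\<phi> n x)\<^sup>2 \<partial>hyp_measure) \<longlonglongrightarrow> 0"
    and gY: "(\<lambda>n. \<integral>x. (norm (fgrad (g n) x - Y x))\<^sup>2 \<partial>hyp_measure) \<longlonglongrightarrow> 0"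
  shows "AE x in hyp_measure. Y x = 0"
proof -
  define j where "j = CARD('n) - 3"
  have j: "CARD('n) = j + 3" using N by (simp add: j_def)
  have Ym[measurable]: "Y \<in> borel_measurable hyp_measure" using Y by (auto simp: sq_integrable_def)
  \<comment> \<open>The exponent is \<open>N - 1\<close>: together with the factor
    \<open>1 / conf x\<close> in \<open>fgrad\<close> it cancels the volume density and leaves the
    Euclidean partial derivative.\<close>
  define v where "v i = (\<lambda>x::real^'n. (1 / conf x ^ (j + 2)) *\<^sub>R (axis i 1 :: real ^ 'n))" for i
  have vm: "v i \<in> borel_measurable borel" for i unfolding v_def by measurable
  have bnd: "1 / conf x ^ k \<le> 1" "0 < 1 / conf x ^ k" if "norm x < 1" for x :: "real^'n" and k
    using conf_ge_2[OF that] by (auto simp: divide_le_eq_1)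
  have sv: "sq_integrable hyp_measure (\<lambda>x. c x *\<^sub>R v i x)"
    if c: "c \<in> borel_measurable borel" "\<And>x. \<bar>c x\<bar> \<le> 1" for c i
    unfolding sq_integrable_def
  proof
    note c(1)[measurable]
    show "(\<lambda>x. c x *\<^sub>R v i x) \<in> borel_measurable hyp_measure" using vm[of i] by (intro borel_measurable_hyp_measure) measurable
    show "integrable hyp_measure (\<lambda>x. (norm (c x *\<^sub>R v i x))\<^sup>2)"
    proof (rule integrable_hyp_measure_bounded_density[where C=1])
      show "(\<lambda>x. (norm (c x *\<^sub>R v i x))\<^sup>2) \<in> borel_measurable borel" using vm[of i] by measurable
      fix x :: "real^'n" assume x: "norm x < 1"
      have cp: "conf x > 0" by (rule conf_pos[OF x])
      have "conf x ^ CARD('n) * (norm (c x *\<^sub>R v i x))\<^sup>2 = (c x)\<^sup>2 * (1 / conf x ^ (j + 1))"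
        using cp by (simp add: v_def j power_mult_distrib power_divide field_simps power_add power2_eq_square power3_eq_cube)
      also have "\<dots> \<le> 1 * 1" using c(2)[of x] bnd[OF x, of "j + 1"] by (intro mult_mono) (auto simp: abs_square_le_1)
      finally show "\<bar>conf x ^ CARD('n) * (norm (c x *\<^sub>R v i x))\<^sup>2\<bar> \<le> 1" using cp by (simp add: abs_mult)
    qed
  qed
  have bump0: "(\<integral>x. Y x \<bullet> (box_bump \<kappa> a b x *\<^sub>R v i x) \<partial>hyp_measure) = 0" if \<kappa>: "\<kappa> > 0" for \<kappa> a b i
  proof -
    define \<beta> where "\<beta> = (box_bump \<kappa> a b :: real ^ 'n \<Rightarrow> real)"
    define h where "h = euclidean_grad \<beta>"
    have C\<beta>: "C1_grad \<beta> h" unfolding h_def \<beta>_def by (intro C1_grad_euclidean_grad C_k_box_bump \<kappa>)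
    note m\<beta>[measurable] = C1_gradD(4,5)[OF C\<beta>]
    have \<beta>1: "\<bar>\<beta> x\<bar> \<le> 1" for x unfolding \<beta>_def using box_bump_nonneg[of \<kappa> a b x] box_bump_le_1[OF \<kappa>, of a b x] by simp
    have "compact (h ` cball 0 1)" by (intro compact_continuous_image continuous_on_subset[OF C1_gradD(2)[OF C\<beta>]]) auto
    then have "bounded (h ` cball 0 1)" by (rule compact_imp_bounded)
    then obtain B where B': "\<forall>y\<in>h ` cball 0 1. norm y \<le> B" unfolding bounded_iff by (elim exE)
    have B: "norm (h x) \<le> B" if "norm x < 1" for x using B' that by simp
    \<comment> \<open>Divided by the volume density, so that pairing with \<open>\<phi> n\<close> is
      the Euclidean integral of \<open>\<phi> n\<close> against a partial derivative of the
      bump.\<close>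
    define S where "S x = (h x $ i) / conf x ^ (j + 3)" for x
    have [measurable]: "(\<lambda>x. h x $ i) \<in> borel_measurable borel"
      by (intro borel_measurable_continuous_onI continuous_intros C1_gradD(2)[OF C\<beta>])
    have Sm: "S \<in> borel_measurable borel" unfolding S_def[abs_def] by measurable
    have S: "sq_integrable hyp_measure S" unfolding sq_integrable_def
    proof
      show "S \<in> borel_measurable hyp_measure" by (rule borel_measurable_hyp_measure[OF Sm])
      show "integrable hyp_measure (\<lambda>x. (norm (S x))\<^sup>2)"
      proof (rule integrable_hyp_measure_bounded_density[where C="B\<^sup>2"])
        show "(\<lambda>x. (norm (S x))\<^sup>2) \<in> borel_measurable borel" using Sm by measurable
        fix x :: "real^'n" assume x: "norm x < 1"
        have cp: "conf x > 0" by (rule conf_pos[OF x])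
        have hb: "(h x $ i)\<^sup>2 \<le> B\<^sup>2"
        proof -
          have "\<bar>h x $ i\<bar> \<le> B" using component_le_norm_cart[of "h x" i] B[OF x] by linarith
          then have "\<bar>h x $ i\<bar>\<^sup>2 \<le> B\<^sup>2" by (intro power_mono) auto
          then show ?thesis by simp
        qed
        have "conf x ^ CARD('n) * (norm (S x))\<^sup>2 = (h x $ i)\<^sup>2 * (1 / conf x ^ (j + 3))"
          using cp by (simp add: S_def j power_divide field_simps power_add power2_eq_square power3_eq_cube)
        also have "\<dots> \<le> B\<^sup>2 * 1" using hb bnd[OF x, of "j + 3"] by (intro mult_mono) auto
        finally show "\<bar>conf x ^ CARD('n) * (norm (S x))\<^sup>2\<bar> \<le> B\<^sup>2" using cp by (simp add: abs_mult)
      qed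
    qed
    have T: "sq_integrable hyp_measure (\<lambda>x. \<beta> x *\<^sub>R v i x)" using sv[OF m\<beta>(2) \<beta>1] .
    have ibp: "(\<integral>x. fgrad (g n) x \<bullet> (\<beta> x *\<^sub>R v i x) \<partial>hyp_measure) = - (\<integral>x. \<phi> n x \<bullet> S x \<partial>hyp_measure)" for n
    proof -
      obtain R where R: "0 < R" "R < 1" and z: "\<And>x. R \<le> norm x \<Longrightarrow> \<phi> n x = 0" and gz: "\<And>x. R < norm x \<Longrightarrow> g n x = 0"
        and C1: "C1_grad (\<phi> n) (g n)" by (rule C1_ballD[OF C]) blast
      note m1[measurable] = C1_gradD(4,5)[OF C1]
      have CT: "C1_grad (\<lambda>x. \<phi> n x * \<beta> x) (\<lambda>x. \<beta> x *\<^sub>R g n x + \<phi> n x *\<^sub>R h x)"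
        by (rule C1_grad_mult_ball[OF C1 z R(2) C1_gradD(1)[OF C\<beta>] continuous_on_subset[OF C1_gradD(2)[OF C\<beta>]]]) auto
      have 0: "(\<integral>x. (\<beta> x *\<^sub>R g n x + \<phi> n x *\<^sub>R h x) \<bullet> axis i 1 \<partial>lborel) = 0"
        by (rule integral_partial_derivative_eq_0(2)[OF CT, of R]) (use z in simp)
      have i1: "integrable lborel (\<lambda>x. \<beta> x * g n x $ i)"
        by (rule integrable_continuous_support[of _ R])
          (use gz in \<open>auto intro!: continuous_intros C1_gradD(2)[OF C1] C1_gradD(3)[OF C\<beta>]\<close>)
      have i2: "integrable lborel (\<lambda>x. \<phi> n x * h x $ i)"
        by (rule integrable_continuous_support[of _ R])
          (use z in \<open>auto intro!: continuous_intros C1_gradD(3)[OF C1] C1_gradD(2)[OF C\<beta>]\<close>)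
      have s: "(\<integral>x. \<beta> x * g n x $ i \<partial>lborel) + (\<integral>x. \<phi> n x * h x $ i \<partial>lborel) = 0"
        using 0 by (simp add: inner_add_left inner_axis Bochner_Integration.integral_add[OF i1 i2])
      have "(\<integral>x. fgrad (g n) x \<bullet> (\<beta> x *\<^sub>R v i x) \<partial>hyp_measure) = (\<integral>x. \<beta> x * g n x $ i \<partial>lborel)"
      proof (subst integral_hyp_measure)
        show "(\<lambda>x. fgrad (g n) x \<bullet> (\<beta> x *\<^sub>R v i x)) \<in> borel_measurable borel"
          using fgrad_measurable[OF m1(1)] vm[of i] by measurable
        show "(\<integral>x. indicator (ball 0 1) x * (conf x ^ CARD('n) * (fgrad (g n) x \<bullet> (\<beta> x *\<^sub>R v i x))) \<partial>lborel) = (\<integral>x. \<beta> x * g n x $ i \<partial>lborel)"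
        proof (rule Bochner_Integration.integral_cong[OF refl])
          fix x :: "real^'n"
          show "indicator (ball 0 1) x * (conf x ^ CARD('n) * (fgrad (g n) x \<bullet> (\<beta> x *\<^sub>R v i x))) = \<beta> x * g n x $ i"
          proof (cases "norm x < 1")
            case True
            then show ?thesis using conf_pos[OF True] by (simp add: fgrad_def v_def j inner_axis power_add power3_eq_cube power2_eq_square)
          next
            case False
            then show ?thesis using gz R by simp
          qed
        qed
      qed
      moreover have "(\<integral>x. \<phi> n x \<bullet> S x \<partial>hyp_measure) = (\<integral>x. \<phi> n x * h x $ i \<partial>lborel)"
      proof (subst integral_hyp_measure)
        show "(\<lambda>x. \<phi> n x \<bullet> S x) \<in> borel_measurable borel" using Sm by measurable
        show "(\<integral>x. indicator (ball 0 1) x * (conf x ^ CARD('n) * (\<phi> n x \<bullet> S x)) \<partial>lborel) = (\<integral>x. \<phi> n x * h x $ i \<partial>lborel)"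
        proof (rule Bochner_Integration.integral_cong[OF refl])
          fix x :: "real^'n"
          show "indicator (ball 0 1) x * (conf x ^ CARD('n) * (\<phi> n x \<bullet> S x)) = \<phi> n x * h x $ i"
          proof (cases "norm x < 1")
            case True
            then show ?thesis using conf_pos[OF True] by (simp add: S_def j)
          next
            case False
            then show ?thesis using z R by simp
          qed
        qed
      qed
      ultimately show ?thesis using s by linarith
    qed
    have "(\<lambda>n. \<integral>x. fgrad (g n) x \<bullet> (\<beta> x *\<^sub>R v i x) \<partial>hyp_measure) \<longlonglongrightarrow> (\<integral>x. Y x \<bullet> (\<beta> x *\<^sub>R v i x) \<partial>hyp_measure)"
      by (rule tendsto_integral_inner[OF C1_ball_sq_integrable(2)[OF C] Y T gY])
    moreover have "(\<lambda>n. \<integral>x. \<phi> n x \<bullet> S x \<partial>hyp_measure) \<longlonglongrightarrow> (\<integral>x. 0 \<bullet> S x \<partial>hyp_measure)"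
      by (rule tendsto_integral_inner[OF C1_ball_sq_integrable(1)[OF C] _ S]) (use \<phi>0 in \<open>auto simp: sq_integrable_def\<close>)
    then have "(\<lambda>n. - (\<integral>x. \<phi> n x \<bullet> S x \<partial>hyp_measure)) \<longlonglongrightarrow> 0" using tendsto_minus by fastforce
    ultimately have "(\<integral>x. Y x \<bullet> (\<beta> x *\<^sub>R v i x) \<partial>hyp_measure) = 0"
      unfolding ibp by (rule LIMSEQ_unique)
    then show ?thesis unfolding \<beta>_def .
  qed
  have box0: "(\<integral>x. indicator (box a b) x * (Y x \<bullet> v i x) \<partial>hyp_measure) = 0" for a b i
  proof (cases "\<forall>i. a $ i < b $ i")
    case True
    have iv: "integrable hyp_measure (\<lambda>x. Y x \<bullet> v i x)"
      using sq_integrable_inner[OF Y sv[of "\<lambda>_. 1" i]] by simp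
    have vmM[measurable]: "v i \<in> borel_measurable hyp_measure" by (rule borel_measurable_hyp_measure[OF vm])
    have bb[measurable]: "box_bump (1 / real (Suc k)) a b \<in> borel_measurable hyp_measure" for k
      by (intro borel_measurable_hyp_measure C1_gradD(5)[OF C1_grad_euclidean_grad] C_k_box_bump) simp
    have ib[measurable]: "(\<lambda>x. indicator (box a b) x :: real) \<in> borel_measurable hyp_measure"
      by (intro borel_measurable_hyp_measure) auto
    have "(\<lambda>k. \<integral>x. box_bump (1 / real (Suc k)) a b x * (Y x \<bullet> v i x) \<partial>hyp_measure) \<longlonglongrightarrow> (\<integral>x. indicator (box a b) x * (Y x \<bullet> v i x) \<partial>hyp_measure)"
    proof (rule integral_dominated_convergence[where w="\<lambda>x. \<bar>Y x \<bullet> v i x\<bar>"])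
      show "AE x in hyp_measure. (\<lambda>k. box_bump (1 / real (Suc k)) a b x * (Y x \<bullet> v i x)) \<longlonglongrightarrow> indicator (box a b) x * (Y x \<bullet> v i x)"
        using True by (intro AE_I2 tendsto_intros tendsto_box_bump) auto
      show "AE x in hyp_measure. norm (box_bump (1 / real (Suc k)) a b x * (Y x \<bullet> v i x)) \<le> \<bar>Y x \<bullet> v i x\<bar>" for k
      proof (rule AE_I2)
        fix x
        have "\<bar>box_bump (1 / real (Suc k)) a b x\<bar> \<le> 1"
          using box_bump_nonneg[of "1 / real (Suc k)" a b x] box_bump_le_1[of "1 / real (Suc k)" a b x] by simp
        then show "norm (box_bump (1 / real (Suc k)) a b x * (Y x \<bullet> v i x)) \<le> \<bar>Y x \<bullet> v i x\<bar>"
          by (simp add: abs_mult mult_left_le_one_le)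
      qed
    qed (use iv in \<open>auto simp del: of_nat_Suc\<close>)
    moreover have "(\<integral>x. box_bump (1 / real (Suc k)) a b x * (Y x \<bullet> v i x) \<partial>hyp_measure) = 0" for k
      using bump0[of "1 / real (Suc k)" a b i] by (simp del: of_nat_Suc)
    ultimately show ?thesis by (simp add: LIMSEQ_const_iff)
  next
    case False
    then obtain i where "\<not> a $ i < b $ i" by blast
    then have "x \<notin> box a b" for x
      using less_trans[of "a $ i" "x $ i" "b $ i"] unfolding mem_box_cart by blast
    then show ?thesis by simp
  qed
  have "AE x in hyp_measure. Y x $ i = 0" for i
  proof -
    define Z where "Z x = indicator (ball 0 1) x * (conf x ^ CARD('n) * (Y x \<bullet> v i x))" for x
    have iv: "integrable hyp_measure (\<lambda>x. Y x \<bullet> v i x)"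
      using sq_integrable_inner[OF Y sv[of "\<lambda>_. 1" i]] by simp
    then have mv: "(\<lambda>x. Y x \<bullet> v i x) \<in> borel_measurable hyp_measure" by auto
    have Z: "integrable lebesgue Z" unfolding Z_def using iv integrable_hyp_measure_lebesgue[OF mv] by blast
    \<comment> \<open>The box criterion concerns \<open>lborel\<close>, whereas \<open>Z\<close> is
      merely Lebesgue measurable; a Borel modification bridges the gap.\<close>
    obtain Z' where Z': "Z' \<in> borel_measurable lborel" "AE x in lborel. Z x = Z' x"
      using completion_ex_borel_measurable_real[of Z lborel] Z by auto
    have Z'm[measurable]: "Z' \<in> borel_measurable borel" using Z' by simp
    have ZZ': "AE x in lebesgue. Z x = Z' x" by (rule AE_completion[OF Z'(2)])
    have Z'l: "Z' \<in> borel_measurable lebesgue" by (rule measurable_completion) (use Z' in simp)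
    have "integrable lebesgue Z'" by (rule integrable_cong_AE_imp[OF Z Z'l]) (use ZZ' in auto)
    then have iZ': "integrable lborel Z'" using integrable_completion[OF Z'(1)] by blast
    have "AE x in lborel. Z' x = 0"
    proof (rule AE_zero_of_box_integrals[OF iZ'])
      fix a b :: "real^'n"
      have bm: "(\<lambda>x. indicator (box a b) x * Z' x) \<in> borel_measurable lborel" by measurable
      have im: "(\<lambda>x. indicator (box a b) x * (Y x \<bullet> v i x)) \<in> borel_measurable hyp_measure"
        by (intro borel_measurable_times mv borel_measurable_hyp_measure) auto
      have "(\<integral>x. indicator (box a b) x * Z' x \<partial>lborel) = (\<integral>x. indicator (box a b) x * Z' x \<partial>lebesgue)"
        by (rule integral_completion[OF bm, symmetric])
      also have "\<dots> = (\<integral>x. indicator (box a b) x * Z x \<partial>lebesgue)"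
      proof (rule integral_cong_AE)
        show "(\<lambda>x. indicator (box a b) x * Z' x) \<in> borel_measurable lebesgue" by (rule measurable_completion[OF bm])
        show "(\<lambda>x. indicator (box a b) x * Z x) \<in> borel_measurable lebesgue"
          using Z by (intro borel_measurable_times) (auto intro: measurable_completion)
      qed (use ZZ' in auto)
      also have "\<dots> = (\<integral>x. indicator (ball 0 1) x * (conf x ^ CARD('n) * (indicator (box a b) x * (Y x \<bullet> v i x))) \<partial>lebesgue)"
        by (intro Bochner_Integration.integral_cong refl) (simp add: Z_def)
      also have "\<dots> = (\<integral>x. indicator (box a b) x * (Y x \<bullet> v i x) \<partial>hyp_measure)"
        by (rule integral_hyp_measure_lebesgue[OF im, symmetric])
      finally show "(\<integral>x. indicator (box a b) x * Z' x \<partial>lborel) = 0" unfolding box0 .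
    qed
    then have "AE x in lebesgue. Z' x = 0" by (rule AE_completion)
    then have "AE x in lebesgue. norm x < 1 \<longrightarrow> Y x $ i = 0"
      using ZZ'
    proof eventually_elim
      case (elim x)
      show ?case
      proof
        assume x: "norm x < 1"
        have "Y x \<bullet> v i x = 0" using elim x conf_pos[OF x] by (simp add: Z_def)
        then show "Y x $ i = 0" using conf_pos[OF x] by (simp add: v_def inner_axis)
      qed
    qed
    then show ?thesis unfolding AE_hyp_measure .
  qed
  then have "AE x in hyp_measure. \<forall>i. Y x $ i = 0" by (rule eventually_all_finite)
  then show ?thesis by eventually_elim (simp add: vec_eq_iff)
qed

lemma C1_ball_diff:
  assumes "C1_ball \<phi> g" "C1_ball \<psi> h"
  shows "C1_ball (\<lambda>x. \<phi> x - \<psi> x) (\<lambda>x. g x - h x)"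
proof -
  obtain R where R: "0 < R" "R < 1" "\<And>x. R \<le> norm x \<Longrightarrow> \<phi> x = 0" and 1: "C1_grad \<phi> g"
    by (rule C1_ballD[OF assms(1)]) blast
  obtain S where S: "0 < S" "S < 1" "\<And>x. S \<le> norm x \<Longrightarrow> \<psi> x = 0" and 2: "C1_grad \<psi> h"
    by (rule C1_ballD[OF assms(2)]) blast
  show ?thesis unfolding C1_ball_def
    using C1_grad_diff[OF 1 2] R S by (intro conjI exI[of _ "max R S"]) auto
qed

lemma fgrad_diff: "fgrad (\<lambda>x. g x - h x) x = fgrad g x - fgrad h x"
  by (simp add: fgrad_def scaleR_diff_right)

lemma in_L2_iff: "in_L2 u \<longleftrightarrow> sq_integrable hyp_measure u"
  by (simp add: in_L2_def sq_integrable_def)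

lemma conf_measurable_hyp[measurable]: "conf \<in> borel_measurable hyp_measure"
  by (rule borel_measurable_hyp_measure) measurable

lemma field_in_L2_frame: "field_in_L2 G \<Longrightarrow> sq_integrable hyp_measure (frame G)"
  unfolding field_in_L2_def sq_integrable_def hyp_norm_frame frame_def[abs_def] by auto

lemma field_norm_grad_diff:
  assumes "C1_grad \<phi> g" "C1_grad \<psi> h"
  shows "field_norm (hyp_grad (\<lambda>x. \<phi> x - \<psi> x)) = sqrt (\<integral>x. (norm (fgrad g x - fgrad h x))\<^sup>2 \<partial>hyp_measure)"
  unfolding field_norm_frame frame_hyp_grad[OF C1_grad_diff[OF assms]] fgrad_diff ..

lemma field_norm_hyp_grad_diff:
  assumes "C1_grad \<phi> g"
  shows "field_norm (\<lambda>x. hyp_grad \<phi> x - G x) = sqrt (\<integral>x. (norm (fgrad g x - frame G x))\<^sup>2 \<partial>hyp_measure)"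
proof -
  have "frame (\<lambda>x. hyp_grad \<phi> x - G x) x = fgrad g x - frame G x" for x
    using frame_hyp_grad[OF assms, of x] by (simp add: frame_def scaleR_diff_right)
  then show ?thesis unfolding field_norm_frame by simp
qed

section \<open>Existence and uniqueness of the gradient on the completion\<close>

lemma sqrt_tendsto_0_iff:
  assumes "\<And>n. 0 \<le> a n" shows "(\<lambda>n. sqrt (a n)) \<longlonglongrightarrow> 0 \<longleftrightarrow> a \<longlonglongrightarrow> 0"
proof
  assume "(\<lambda>n. sqrt (a n)) \<longlonglongrightarrow> 0"
  from tendsto_power[OF this, of 2] show "a \<longlonglongrightarrow> 0" using assms by simp
next
  assume "a \<longlonglongrightarrow> 0"
  from tendsto_real_sqrt[OF this] show "(\<lambda>n. sqrt (a n)) \<longlonglongrightarrow> 0" by simp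
qed

lemma is_H12_gradD:
  assumes "is_H12_grad u G"
  obtains \<phi> where "\<And>n. test_function (\<phi> n)" "sq_integrable hyp_measure u" "sq_integrable hyp_measure (frame G)"
    "(\<lambda>n. \<integral>x. (norm (\<phi> n x - u x))\<^sup>2 \<partial>hyp_measure) \<longlonglongrightarrow> 0"
    "(\<lambda>n. \<integral>x. (norm (fgrad (euclidean_grad (\<phi> n)) x - frame G x))\<^sup>2 \<partial>hyp_measure) \<longlonglongrightarrow> 0"
proof -
  obtain \<phi> where G: "field_in_L2 G" and t: "\<And>n. test_function (\<phi> n)" and u: "L2_tendsto \<phi> u"
    and l: "(\<lambda>n. field_norm (\<lambda>x. hyp_grad (\<phi> n) x - G x)) \<longlonglongrightarrow> 0"
    using assms unfolding is_H12_grad_def by blast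
  have C: "C1_grad (\<phi> n) (euclidean_grad (\<phi> n))" for n using test_function_C1_ball[OF t[of n]] by (simp add: C1_ball_def)
  show thesis
  proof (rule that[OF t _ field_in_L2_frame[OF G]])
    show "sq_integrable hyp_measure u" using u by (simp add: L2_tendsto_def in_L2_iff)
    show "(\<lambda>n. \<integral>x. (norm (\<phi> n x - u x))\<^sup>2 \<partial>hyp_measure) \<longlonglongrightarrow> 0" using u by (simp add: L2_tendsto_def)
    show "(\<lambda>n. \<integral>x. (norm (fgrad (euclidean_grad (\<phi> n)) x - frame G x))\<^sup>2 \<partial>hyp_measure) \<longlonglongrightarrow> 0"
      using l unfolding field_norm_hyp_grad_diff[OF C] by (subst (asm) sqrt_tendsto_0_iff) auto
  qed
qed

text \<open>The difference of two approximating sequences tends to 0 in L2 while its gradients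
  converge, so closability applies. This makes the choice in \<open>H12_grad\<close>
  harmless.\<close>

lemma is_H12_grad_unique:
  fixes u :: "real ^ 'n \<Rightarrow> real"
  assumes N: "CARD('n) \<ge> 3" and G: "is_H12_grad u G" and H: "is_H12_grad u H"
  shows "AE x in hyp_measure. frame G x = frame H x"
proof -
  obtain \<phi> where \<phi>: "\<And>n. test_function (\<phi> n)" and u: "sq_integrable hyp_measure u" and sG: "sq_integrable hyp_measure (frame G)"
    and \<phi>u: "(\<lambda>n. \<integral>x. (norm (\<phi> n x - u x))\<^sup>2 \<partial>hyp_measure) \<longlonglongrightarrow> 0"
    and \<phi>G: "(\<lambda>n. \<integral>x. (norm (fgrad (euclidean_grad (\<phi> n)) x - frame G x))\<^sup>2 \<partial>hyp_measure) \<longlonglongrightarrow> 0"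
    by (rule is_H12_gradD[OF G]) blast
  obtain \<psi> where \<psi>: "\<And>n. test_function (\<psi> n)" and sH: "sq_integrable hyp_measure (frame H)"
    and \<psi>u: "(\<lambda>n. \<integral>x. (norm (\<psi> n x - u x))\<^sup>2 \<partial>hyp_measure) \<longlonglongrightarrow> 0"
    and \<psi>H: "(\<lambda>n. \<integral>x. (norm (fgrad (euclidean_grad (\<psi> n)) x - frame H x))\<^sup>2 \<partial>hyp_measure) \<longlonglongrightarrow> 0"
    by (rule is_H12_gradD[OF H]) blast
  note C\<phi> = test_function_C1_ball[OF \<phi>] and C\<psi> = test_function_C1_ball[OF \<psi>]
  have C: "C1_ball (\<lambda>x. \<phi> n x - \<psi> n x) (\<lambda>x. euclidean_grad (\<phi> n) x - euclidean_grad (\<psi> n) x)" for n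
    by (rule C1_ball_diff[OF C\<phi> C\<psi>])
  have "AE x in hyp_measure. frame G x - frame H x = 0"
  proof (rule fgrad_limit_eq_0[OF N C sq_integrable_diff[OF sG sH]])
    have "(\<lambda>n. \<integral>x. (norm (\<phi> n x - \<psi> n x))\<^sup>2 \<partial>hyp_measure) \<longlonglongrightarrow> 0"
      by (rule norm_sq_limit_triangle[where g="\<lambda>n. u", OF C1_ball_sq_integrable(1)[OF C\<phi>] u C1_ball_sq_integrable(1)[OF C\<psi>] \<phi>u])
        (use \<psi>u in \<open>simp add: power2_commute\<close>)
    then show "(\<lambda>n. \<integral>x. (\<phi> n x - \<psi> n x)\<^sup>2 \<partial>hyp_measure) \<longlonglongrightarrow> 0" by simp
    have a: "sq_integrable hyp_measure (fgrad (\<lambda>x. euclidean_grad (\<phi> n) x - euclidean_grad (\<psi> n) x))" for n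
      by (rule C1_ball_sq_integrable(2)[OF C])
    show "(\<lambda>n. \<integral>x. (norm (fgrad (\<lambda>x. euclidean_grad (\<phi> n) x - euclidean_grad (\<psi> n) x) x - (frame G x - frame H x)))\<^sup>2 \<partial>hyp_measure) \<longlonglongrightarrow> 0"
    proof (rule norm_sq_limit_triangle[where g="\<lambda>n x. frame G x - fgrad (euclidean_grad (\<psi> n)) x", OF a sq_integrable_diff[OF sG C1_ball_sq_integrable(2)[OF C\<psi>]] sq_integrable_diff[OF sG sH]])
      show "(\<lambda>n. \<integral>x. (norm (fgrad (\<lambda>x. euclidean_grad (\<phi> n) x - euclidean_grad (\<psi> n) x) x - (frame G x - fgrad (euclidean_grad (\<psi> n)) x)))\<^sup>2 \<partial>hyp_measure) \<longlonglongrightarrow> 0"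
        using \<phi>G by (simp add: fgrad_diff)
      show "(\<lambda>n. \<integral>x. (norm (frame G x - fgrad (euclidean_grad (\<psi> n)) x - (frame G x - frame H x)))\<^sup>2 \<partial>hyp_measure) \<longlonglongrightarrow> 0"
        using \<psi>H by (simp add: norm_minus_commute)
    qed
  qed
  then show ?thesis by simp
qed

text \<open>The second form gives the quotients by \<open>norm x\<close> an L2 limit, through which
  elements of the completion are later paired with the source term.\<close>

lemma L2_Cauchy_Hardy:
  fixes \<phi> :: "nat \<Rightarrow> real ^ 'n \<Rightarrow> real"
  assumes N: "CARD('n) \<ge> 3" and C: "\<And>n. C1_ball (\<phi> n) (g n)" and f: "L2_Cauchy hyp_measure (\<lambda>n. fgrad (g n))"
  shows "L2_Cauchy hyp_measure \<phi>" and "L2_Cauchy hyp_measure (\<lambda>n x. \<phi> n x / norm x)"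
proof -
  note D = C1_ball_diff[OF C C]
  show "L2_Cauchy hyp_measure \<phi>"
    by (rule L2_Cauchy_dominated[OF f, of 16]) (use Hardy_Poincare(3)[OF N D] in \<open>simp_all add: fgrad_diff\<close>)
  show "L2_Cauchy hyp_measure (\<lambda>n x. \<phi> n x / norm x)"
    by (rule L2_Cauchy_dominated[OF f, of 16])
      (use Hardy_Poincare(2)[OF N D] in \<open>simp_all add: fgrad_diff diff_divide_distrib\<close>)
qed

lemma L2_complete_hyp_measure:
  fixes s :: "nat \<Rightarrow> real ^ 'n \<Rightarrow> 'b::euclidean_space"
  assumes s: "\<And>n. sq_integrable hyp_measure (s n)" and C: "L2_Cauchy hyp_measure s"
  obtains Y where "sq_integrable hyp_measure Y" "(\<lambda>n. \<integral>x. (norm (s n x - Y x))\<^sup>2 \<partial>hyp_measure) \<longlonglongrightarrow> 0"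
proof -
  \<comment> \<open>The hyperbolic measure is infinite; with this \<open>\<theta>\<close>, the
    volume density times \<open>\<theta>\<^sup>2\<close> is at most 1, hence integrable over the
    ball.\<close>
  define \<theta> where "\<theta> x = 1 / conf x ^ CARD('n)" for x :: "real^'n"
  have \<theta>m: "\<theta> \<in> borel_measurable borel" unfolding \<theta>_def[abs_def] by measurable
  have "sq_integrable hyp_measure \<theta>"
    unfolding sq_integrable_def
  proof
    show "integrable hyp_measure (\<lambda>x. (norm (\<theta> x))\<^sup>2)"
    proof (rule integrable_hyp_measure_bounded_density[where C=1])
      fix x :: "real^'n" assume x: "norm x < 1"
      have c: "conf x \<ge> 2" by (rule conf_ge_2[OF x])
      have "conf x ^ CARD('n) * (norm (\<theta> x))\<^sup>2 = 1 / conf x ^ CARD('n)"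
        using c by (simp add: \<theta>_def power2_eq_square)
      moreover have "1 / conf x ^ CARD('n) \<le> 1" using c by (simp add: divide_le_eq_1)
      ultimately show "\<bar>conf x ^ CARD('n) * (norm (\<theta> x))\<^sup>2\<bar> \<le> 1" using c by (simp add: abs_mult)
    qed (use \<theta>m in measurable)
  qed (rule borel_measurable_hyp_measure[OF \<theta>m])
  moreover have "\<theta> x > 0" if "x \<in> space hyp_measure" for x
    using conf_pos[of x] that by (simp add: \<theta>_def)
  ultimately obtain Y where "sq_integrable hyp_measure Y" "(\<lambda>n. \<integral>x. (norm (s n x - Y x))\<^sup>2 \<partial>hyp_measure) \<longlonglongrightarrow> 0"
    using L2_complete[OF s C, of \<theta>] by blast
  then show thesis by (rule that)
qed

lemma is_H12_grad_of_limit: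
  fixes u :: "real ^ 'n \<Rightarrow> real"
  assumes t: "\<And>n. test_function (\<phi> n)" and L: "L2_tendsto \<phi> u" and Y: "sq_integrable hyp_measure Y"
    and lim: "(\<lambda>n. \<integral>x. (norm (fgrad (euclidean_grad (\<phi> n)) x - Y x))\<^sup>2 \<partial>hyp_measure) \<longlonglongrightarrow> 0"
  shows "is_H12_grad u (\<lambda>x. (1 / conf x) *\<^sub>R Y x)"
proof -
  define G where "G x = (1 / conf x) *\<^sub>R Y x" for x
  have fG: "frame G x = Y x" if "norm x < 1" for x using conf_pos[OF that] by (simp add: frame_def G_def)
  have Ym[measurable]: "Y \<in> borel_measurable hyp_measure" using Y by (simp add: sq_integrable_def)
  have Cg: "C1_grad (\<phi> n) (euclidean_grad (\<phi> n))" for n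
    using test_function_C1_ball[OF t[of n]] by (simp add: C1_ball_def)
  have "is_H12_grad u G"
    unfolding is_H12_grad_def
  proof (intro conjI exI[of _ \<phi>] allI t L)
    show "field_in_L2 G" unfolding field_in_L2_def hyp_norm_frame
    proof
      show "G \<in> borel_measurable hyp_measure" unfolding G_def by measurable
      have "integrable hyp_measure (\<lambda>x. (norm (Y x))\<^sup>2)" using Y by (simp add: sq_integrable_def)
      then show "integrable hyp_measure (\<lambda>x. (norm (frame G x))\<^sup>2)"
        by (subst Bochner_Integration.integrable_cong[OF refl, of _ _ "\<lambda>x. (norm (Y x))\<^sup>2"]) (auto simp: fG)
    qed
    have "(\<integral>x. (norm (fgrad (euclidean_grad (\<phi> n)) x - frame G x))\<^sup>2 \<partial>hyp_measure) =
        (\<integral>x. (norm (fgrad (euclidean_grad (\<phi> n)) x - Y x))\<^sup>2 \<partial>hyp_measure)" for n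
      by (rule Bochner_Integration.integral_cong) (auto simp: fG)
    then show "(\<lambda>n. field_norm (\<lambda>x. hyp_grad (\<phi> n) x - G x)) \<longlonglongrightarrow> 0"
      unfolding field_norm_hyp_grad_diff[OF Cg] using lim by (subst sqrt_tendsto_0_iff) auto
  qed
  then show ?thesis by (simp add: G_def[abs_def])
qed

lemma dirichlet_Cauchy_iff:
  fixes \<phi> :: "nat \<Rightarrow> real ^ 'n \<Rightarrow> real"
  assumes "\<And>n. C1_grad (\<phi> n) (g n)"
  shows "dirichlet_Cauchy \<phi> \<longleftrightarrow> L2_Cauchy hyp_measure (\<lambda>n. fgrad (g n))"
  unfolding dirichlet_Cauchy_def L2_Cauchy_def field_norm_grad_diff[OF assms assms]
proof
  let ?I = "\<lambda>m n. \<integral>x. (norm (fgrad (g m) x - fgrad (g n) x))\<^sup>2 \<partial>hyp_measure"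
  assume l: "\<forall>e>0. \<exists>M. \<forall>m\<ge>M. \<forall>n\<ge>M. sqrt (?I m n) < e"
  show "\<forall>e>0. \<exists>K. \<forall>m\<ge>K. \<forall>n\<ge>K. ?I m n < e"
  proof (intro allI impI)
    fix e :: real assume "e > 0"
    then have "sqrt e > 0" by simp
    from l[rule_format, OF this] show "\<exists>K. \<forall>m\<ge>K. \<forall>n\<ge>K. ?I m n < e" unfolding real_sqrt_less_iff .
  qed
next
  let ?I = "\<lambda>m n. \<integral>x. (norm (fgrad (g m) x - fgrad (g n) x))\<^sup>2 \<partial>hyp_measure"
  assume r: "\<forall>e>0. \<exists>K. \<forall>m\<ge>K. \<forall>n\<ge>K. ?I m n < e"
  show "\<forall>e>0. \<exists>M. \<forall>m\<ge>M. \<forall>n\<ge>M. sqrt (?I m n) < e"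
  proof (intro allI impI)
    fix e :: real assume e: "e > 0"
    then have "e\<^sup>2 > 0" by simp
    then obtain K where "\<forall>m\<ge>K. \<forall>n\<ge>K. ?I m n < e\<^sup>2" using r by (elim allE[of _ "e\<^sup>2"] impE) auto
    then show "\<exists>M. \<forall>m\<ge>M. \<forall>n\<ge>M. sqrt (?I m n) < e"
      using e by (intro exI[of _ K] allI impI real_less_lsqrt) auto
  qed
qed

text \<open>The gradients of the defining sequence are Cauchy and converge by completeness, so the
  choice in \<open>H12_grad\<close> is made from a nonempty set.\<close>

lemma H12_approximation:
  fixes u :: "real ^ 'n \<Rightarrow> real"
  assumes u: "u \<in> H12"
  shows "is_H12_grad u (H12_grad u)"
proof -
  obtain \<phi> where t: "\<And>n. test_function (\<phi> n)" and D: "dirichlet_Cauchy \<phi>" and L: "L2_tendsto \<phi> u"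
    using u unfolding H12_def by blast
  note C = test_function_C1_ball[OF t]
  have Cg: "C1_grad (\<phi> n) (euclidean_grad (\<phi> n))" for n using C[of n] by (simp add: C1_ball_def)
  obtain Y where "sq_integrable hyp_measure Y"
    "(\<lambda>n. \<integral>x. (norm (fgrad (euclidean_grad (\<phi> n)) x - Y x))\<^sup>2 \<partial>hyp_measure) \<longlonglongrightarrow> 0"
    by (rule L2_complete_hyp_measure[OF C1_ball_sq_integrable(2)[OF C] D[unfolded dirichlet_Cauchy_iff[OF Cg]]])
  from is_H12_grad_of_limit[OF t L this] show ?thesis
    unfolding H12_grad_def by (rule someI[of "is_H12_grad u"])
qed

text \<open>Radial approximants are only C1. Each is replaced by a test function whose energy
  distance to it is controlled by \<open>1 / Suc n\<close>, and the Poincare inequality carries the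
  closeness over to L2.\<close>

lemma H12_limit:
  fixes u :: "real ^ 'n \<Rightarrow> real"
  assumes N: "CARD('n) \<ge> 3" and C: "\<And>n. C1_ball (\<phi> n) (g n)"
    and Y: "sq_integrable hyp_measure Y" and u: "sq_integrable hyp_measure u"
    and gY: "(\<lambda>n. \<integral>x. (norm (fgrad (g n) x - Y x))\<^sup>2 \<partial>hyp_measure) \<longlonglongrightarrow> 0"
    and \<phi>u: "(\<lambda>n. \<integral>x. (norm (\<phi> n x - u x))\<^sup>2 \<partial>hyp_measure) \<longlonglongrightarrow> 0"
  shows "u \<in> H12" and "AE x in hyp_measure. frame (H12_grad u) x = Y x"
proof -
  have "\<exists>\<psi>. \<forall>n. test_function (\<psi> n) \<and>
      (\<integral>x. (norm (fgrad (euclidean_grad (\<psi> n)) x - fgrad (g n) x))\<^sup>2 \<partial>hyp_measure) < 1 / real (Suc n)"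
    by (intro choice allI test_function_approximation[OF C]) simp
  then obtain \<psi> where t: "\<And>n. test_function (\<psi> n)"
    and \<psi>: "\<And>n. (\<integral>x. (norm (fgrad (euclidean_grad (\<psi> n)) x - fgrad (g n) x))\<^sup>2 \<partial>hyp_measure) < 1 / real (Suc n)"
    by blast
  define h where "h n = euclidean_grad (\<psi> n)" for n
  have Ch: "C1_ball (\<psi> n) (h n)" for n unfolding h_def by (rule test_function_C1_ball[OF t])
  have Cg: "C1_grad (\<psi> n) (h n)" for n using Ch[of n] by (simp add: C1_ball_def)
  note s1 = C1_ball_sq_integrable(1)[OF Ch] and s2 = C1_ball_sq_integrable(2)[OF Ch]
    and r1 = C1_ball_sq_integrable(1)[OF C] and r2 = C1_ball_sq_integrable(2)[OF C]
  have inv0: "(\<lambda>n. 1 / real (Suc n)) \<longlonglongrightarrow> 0" using LIMSEQ_inverse_real_of_nat by (simp add: inverse_eq_divide)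
  have hg: "(\<lambda>n. \<integral>x. (norm (fgrad (h n) x - fgrad (g n) x))\<^sup>2 \<partial>hyp_measure) \<longlonglongrightarrow> 0"
    by (rule tendsto_sandwich[OF _ _ tendsto_const inv0])
      (use \<psi> in \<open>auto simp: h_def intro!: always_eventually less_imp_le\<close>)
  have hY: "(\<lambda>n. \<integral>x. (norm (fgrad (h n) x - Y x))\<^sup>2 \<partial>hyp_measure) \<longlonglongrightarrow> 0"
    by (rule norm_sq_limit_triangle[OF s2 r2 Y hg gY])
  have "(\<lambda>n. \<integral>x. (norm (\<psi> n x - \<phi> n x))\<^sup>2 \<partial>hyp_measure) \<longlonglongrightarrow> 0"
  proof (rule tendsto_sandwich[OF _ _ tendsto_const])
    show "\<forall>\<^sub>F n in sequentially. (\<integral>x. (norm (\<psi> n x - \<phi> n x))\<^sup>2 \<partial>hyp_measure)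
        \<le> 16 * (\<integral>x. (norm (fgrad (h n) x - fgrad (g n) x))\<^sup>2 \<partial>hyp_measure)"
      using Hardy_Poincare(3)[OF N C1_ball_diff[OF Ch C]] by (intro always_eventually allI) (simp add: fgrad_diff)
    show "(\<lambda>n. 16 * (\<integral>x. (norm (fgrad (h n) x - fgrad (g n) x))\<^sup>2 \<partial>hyp_measure)) \<longlonglongrightarrow> 0"
      using tendsto_mult_left[OF hg, of 16] by simp
  qed simp
  then have \<psi>u: "(\<lambda>n. \<integral>x. (norm (\<psi> n x - u x))\<^sup>2 \<partial>hyp_measure) \<longlonglongrightarrow> 0"
    by (rule norm_sq_limit_triangle[OF s1 r1 u _ \<phi>u])
  have L2: "L2_tendsto \<psi> u" using u \<psi>u by (simp add: L2_tendsto_def in_L2_iff)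
  have "dirichlet_Cauchy \<psi>"
    unfolding dirichlet_Cauchy_iff[OF Cg] by (rule L2_Cauchy_of_limit[OF s2 Y hY])
  then show H: "u \<in> H12" unfolding H12_def using t L2 by blast
  have "AE x in hyp_measure. frame (H12_grad u) x = frame (\<lambda>x. (1 / conf x) *\<^sub>R Y x) x"
    by (rule is_H12_grad_unique[OF N H12_approximation[OF H] is_H12_grad_of_limit[OF t L2 Y hY[unfolded h_def]]])
  then show "AE x in hyp_measure. frame (H12_grad u) x = Y x"
    using AE_space
  proof eventually_elim
    case (elim x)
    then show ?case using conf_pos[of x] by (simp add: frame_def)
  qed
qed

section \<open>Radial representatives and spherical means\<close>

text \<open>Each closed piece is cut into compact ones, and continuous images of compact sets are
  compact.\<close>

lemma fsigma_norm_image_borel: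
  fixes C :: "'a::euclidean_space set"
  assumes "fsigma C" shows "norm ` C \<in> sets borel"
  using assms
proof (cases rule: fsigma.cases)
  case (1 F)
  have "norm ` C = (\<Union>n. \<Union>m::nat. norm ` (F n \<inter> cball 0 (real m)))"
  proof
    show "norm ` C \<subseteq> (\<Union>n. \<Union>m::nat. norm ` (F n \<inter> cball 0 (real m)))"
    proof
      fix r assume "r \<in> norm ` C"
      then obtain x where x: "x \<in> C" "r = norm x" by blast
      then obtain n where n: "x \<in> F n" using 1 by blast
      obtain m where "norm x \<le> real m" using real_arch_simple by blast
      then have "x \<in> F n \<inter> cball 0 (real m)" using n by simp
      then show "r \<in> (\<Union>n. \<Union>m::nat. norm ` (F n \<inter> cball 0 (real m)))" using x by blast
    qed
    show "(\<Union>n. \<Union>m::nat. norm ` (F n \<inter> cball 0 (real m))) \<subseteq> norm ` C" using 1 by blast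
  qed
  moreover have "norm ` (F n \<inter> cball 0 (real m)) \<in> sets borel" for n and m :: nat
  proof -
    have "closed (F n)" using 1 by blast
    then have "compact (F n \<inter> cball 0 (real m))" by (intro closed_Int_compact compact_cball)
    then have "compact (norm ` (F n \<inter> cball 0 (real m)))" by (intro compact_continuous_image continuous_intros)
    then show ?thesis by (intro borel_closed compact_imp_closed)
  qed
  ultimately show ?thesis by auto
qed

text \<open>Recovers a nonnegative number from its position relative to the rational levels, so a
  profile can be rebuilt from countably many superlevel sets.\<close>

lemma SUP_rational_below:
  fixes k :: real
  assumes "k \<ge> 0"
  shows "(SUP c\<in>\<rat> \<inter> {0..}. ennreal c * indicator {r. c < r} k) = ennreal k"
proof (rule SUP_eqI)
  show "ennreal c * indicator {r. c < r} k \<le> ennreal k" if "c \<in> \<rat> \<inter> {0..}" for c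
    by (auto simp: indicator_def intro: ennreal_leI)
  fix y assume y: "\<And>c. c \<in> \<rat> \<inter> {0..} \<Longrightarrow> ennreal c * indicator {r. c < r} k \<le> y"
  show "ennreal k \<le> y"
  proof (rule dense_le)
    fix x assume x: "x < ennreal k"
    then have "x \<noteq> top" by auto
    then obtain x' where x': "x = ennreal x'" "0 \<le> x'" by (cases x) auto
    then have "x' < k" using x by (simp add: ennreal_less_iff)
    then obtain c where c: "c \<in> \<rat>" "x' < c" "c < k" using Rats_dense_in_real by blast
    then have "ennreal c * indicator {r. c < r} k \<le> y" using x' by (intro y) auto
    then have "ennreal c \<le> y" using c by simp
    then show "x \<le> y" using c x' by (meson ennreal_leI less_imp_le order_trans)
  qed
qed

text \<open>
  The profile \<open>h\<close> itself need not be measurable. Superlevel sets of \<open>\<alpha>\<close> contain \<open>F\<^sub>\<sigma>\<close> sets of full measure,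
  and the images of these under the norm are Borel.
\<close>

lemma radial_borel_representative:
  fixes \<alpha> :: "real ^ 'n \<Rightarrow> real"
  assumes m: "\<alpha> \<in> borel_measurable hyp_measure" and h: "AE x in hyp_measure. \<alpha> x = h (norm x)"
    and b: "AE x in hyp_measure. 0 \<le> \<alpha> x \<and> \<alpha> x \<le> C" and C: "C \<ge> 0"
  shows "\<exists>H. H \<in> borel_measurable borel \<and> (\<forall>r. 0 \<le> H r \<and> H r \<le> C) \<and> (AE x in hyp_measure. \<alpha> x = H (norm x))"
proof -
  define k where "k r = max 0 (min C (h r))" for r
  have k: "0 \<le> k r" "k r \<le> C" for r using C by (auto simp: k_def)
  have "AE x in hyp_measure. \<alpha> x = k (norm x)"
    using h b by eventually_elim (auto simp: k_def)
  then have \<alpha>k: "AE x in lebesgue. norm x < 1 \<longrightarrow> \<alpha> x = k (norm x)" unfolding AE_hyp_measure .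
  then obtain Z where Z: "{x \<in> space lebesgue. \<not> (norm x < 1 \<longrightarrow> \<alpha> x = k (norm x))} \<subseteq> Z" "Z \<in> null_sets lebesgue"
    by (auto elim!: AE_E intro: that simp: null_sets_def)
  have ex: "\<exists>E T. E \<in> sets borel \<and> T \<in> null_sets lebesgue \<and> (\<forall>x::real^'n. norm x < 1 \<and> x \<notin> T \<longrightarrow> (norm x \<in> E \<longleftrightarrow> c < k (norm x)))" for c
  proof -
    define S where "S = {x::real^'n. norm x < 1 \<and> c < k (norm x)}"
    define A where "A = {x \<in> space hyp_measure. c < \<alpha> x}"
    have "A \<in> sets hyp_measure" unfolding A_def using m by measurable
    then have A: "A \<in> sets lebesgue" unfolding sets_hyp_measure by (subst (asm) sets_restrict_space_iff) auto
    \<comment> \<open>\<open>S\<close> is defined through the profile, yet it differs from the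
      measurable set \<open>A\<close> only inside the null set \<open>Z\<close>; completeness of
      Lebesgue measure makes it measurable.\<close>
    have "S = (A - Z) \<union> (S \<inter> Z)" using Z(1) by (auto simp: S_def A_def)
    moreover have "S \<inter> Z \<in> null_sets lebesgue" by (rule null_sets_completion_subset[OF _ Z(2)]) auto
    ultimately have "S \<in> sets lebesgue" using A Z(2) by (metis sets.Diff sets.Un null_setsD2)
    then obtain D T where D: "fsigma D" "T \<in> null_sets lebesgue" "D \<union> T = S"
      by (rule lebesgue_set_almost_fsigma) blast
    have "norm x \<in> norm ` D \<longleftrightarrow> c < k (norm x)" if x: "norm x < 1" "x \<notin> T" for x
    proof
      assume "norm x \<in> norm ` D"
      then obtain y where "y \<in> D" "norm x = norm y" by blast
      then show "c < k (norm x)" using D(3) by (auto simp: S_def)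
    next
      assume "c < k (norm x)"
      then have "x \<in> S" using x by (simp add: S_def)
      then show "norm x \<in> norm ` D" using D(3) x by blast
    qed
    then show ?thesis using fsigma_norm_image_borel[OF D(1)] D(2) by blast
  qed
  then obtain E T where E: "\<And>c. E c \<in> sets borel" and T: "\<And>c. T c \<in> null_sets lebesgue"
    and ET: "\<And>c x. norm (x::real^'n) < 1 \<Longrightarrow> x \<notin> T c \<Longrightarrow> (norm x \<in> E c \<longleftrightarrow> c < k (norm x))"
    by metis
  define G where "G r = (SUP c\<in>\<rat> \<inter> {0..}. ennreal c * indicator (E c) r)" for r
  have cQ: "countable (\<rat> \<inter> {0::real..})" by (intro countable_Int1 countable_rat)
  have Gm[measurable]: "G \<in> borel_measurable borel"
    unfolding G_def[abs_def] using E by (intro borel_measurable_SUP[OF cQ]) auto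
  \<comment> \<open>At exceptional radii \<open>G\<close> may be infinite or exceed
    \<open>C\<close>; \<open>enn2real\<close> and \<open>min\<close> still give a value in the
    required range.\<close>
  define H where "H r = min C (enn2real (G r))" for r
  have "H \<in> borel_measurable borel" unfolding H_def[abs_def] by measurable
  moreover have "0 \<le> H r \<and> H r \<le> C" for r using C by (simp add: H_def)
  moreover have "AE x in hyp_measure. \<alpha> x = H (norm x)"
    unfolding AE_hyp_measure
  proof -
    have "(\<Union>c\<in>\<rat> \<inter> {0..}. T c) \<in> null_sets lebesgue" using T by (intro null_sets_UN' cQ) auto
    then have "AE x in lebesgue. x \<notin> (\<Union>c\<in>\<rat> \<inter> {0..}. T c)" by (rule AE_not_in)
    then show "AE x in lebesgue. norm x < 1 \<longrightarrow> \<alpha> x = H (norm x)"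
      using \<alpha>k
    proof eventually_elim
      case (elim x)
      show ?case
      proof
        assume x: "norm x < 1"
        have "G (norm x) = (SUP c\<in>\<rat> \<inter> {0..}. ennreal c * indicator {r. c < r} (k (norm x)))"
          unfolding G_def
        proof (rule SUP_cong[OF refl])
          fix c :: real assume "c \<in> \<rat> \<inter> {0..}"
          then have "x \<notin> T c" using elim(1) by blast
          from ET[OF x this] show "ennreal c * indicator (E c) (norm x) = ennreal c * indicator {r. c < r} (k (norm x))"
            by (simp add: indicator_def)
        qed
        also have "\<dots> = ennreal (k (norm x))" by (rule SUP_rational_below[OF k(1)])
        finally show "\<alpha> x = H (norm x)" using elim(2) x k[of "norm x"] by (simp add: H_def)
      qed
    qed
  qed
  ultimately show ?thesis by blast
qed

section \<open>Averages over balls and spherical means\<close>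

text \<open>The ball of radius \<open>r\<close> is rescaled to the unit ball, so that
  \<open>r\<close> sits in the integrand; there is no division by the volume. The weight
  \<open>a\<close> is there to collect the monomials that differentiation in \<open>r\<close>
  produces.\<close>

definition ball_avg :: "(real ^ 'n \<Rightarrow> real) \<Rightarrow> (real ^ 'n \<Rightarrow> real) \<Rightarrow> real \<Rightarrow> real" where
  "ball_avg a \<psi> r = (\<integral>y. indicator (cball 0 1) y * (a y * \<psi> (r *\<^sub>R y)) \<partial>lborel)"

text \<open>The chain rule pulls a coordinate \<open>y $ j\<close> out of each derivative. It is
  absorbed into the weight, so the formula can be iterated.\<close>

lemma ball_avg_derivative:
  fixes \<psi> :: "real ^ 'n \<Rightarrow> real"
  assumes C: "C1_grad \<psi> g" and a[measurable]: "a \<in> borel_measurable borel" and a1: "\<And>y. norm y \<le> 1 \<Longrightarrow> \<bar>a y\<bar> \<le> 1"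
  shows "(ball_avg a \<psi> has_real_derivative (\<Sum>j\<in>UNIV. ball_avg (\<lambda>y. a y * y $ j) (\<lambda>x. g x $ j) r)) (at r)"
proof -
  note m[measurable] = C1_gradD(4,5)[OF C]
  have [measurable]: "cball (0::real^'n) 1 \<in> sets borel" by simp
  have vm[measurable]: "(\<lambda>x::real^'n. x $ j) \<in> borel_measurable borel" for j
    by (intro borel_measurable_continuous_onI continuous_intros)
  have bb: "\<exists>B\<ge>0. \<forall>x\<in>cball 0 (\<bar>r\<bar> + 1). norm (G x) \<le> B" if "continuous_on UNIV G" for G :: "real^'n \<Rightarrow> 'b::real_normed_vector"
  proof -
    have "bounded (G ` cball 0 (\<bar>r\<bar> + 1))"
      by (intro compact_imp_bounded compact_continuous_image continuous_on_subset[OF that]) auto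
    then obtain B where B: "\<forall>y\<in>G ` cball 0 (\<bar>r\<bar> + 1). norm y \<le> B" unfolding bounded_iff by (elim exE)
    have "0 \<le> norm (G 0)" by simp
    also have "norm (G 0) \<le> B" using B by simp
    finally show ?thesis using B by blast
  qed
  have tin: "t *\<^sub>R y \<in> cball 0 (\<bar>r\<bar> + 1)" if t: "\<bar>t - r\<bar> < 1" and y: "norm y \<le> 1" for t and y :: "real^'n"
  proof -
    have "\<bar>t\<bar> * norm y \<le> (\<bar>r\<bar> + 1) * 1" using t y by (intro mult_mono) auto
    then show ?thesis by simp
  qed
  have int: "integrable lborel (\<lambda>y. indicator (cball 0 1) y * (b y * G (t *\<^sub>R y)))"
    if t: "\<bar>t - r\<bar> < 1" and b: "b \<in> borel_measurable borel" "\<And>y. norm y \<le> 1 \<Longrightarrow> \<bar>b y\<bar> \<le> 1" and G: "continuous_on UNIV G"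
    for t b and G :: "real^'n \<Rightarrow> real"
  proof -
    obtain B where B: "B \<ge> 0" "\<forall>x\<in>cball 0 (\<bar>r\<bar> + 1). norm (G x) \<le> B" using bb[OF G] by blast
    note b(1)[measurable] borel_measurable_continuous_onI[OF G, measurable]
    show ?thesis
    proof (rule integrable_bounded_support[of _ 1 B])
      show "norm (indicator (cball 0 1) y * (b y * G (t *\<^sub>R y))) \<le> B" for y
      proof (cases "norm y \<le> 1")
        case True
        then have "\<bar>b y\<bar> * \<bar>G (t *\<^sub>R y)\<bar> \<le> 1 * B" using B tin[OF t True] b(2)[OF True] by (intro mult_mono) auto
        then show ?thesis using True by (simp add: abs_mult)
      qed (use B in simp)
      show "(\<lambda>y. indicator (cball 0 1) y * (b y * G (t *\<^sub>R y))) \<in> borel_measurable borel" by measurable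
    qed simp
  qed
  obtain B where B: "B \<ge> 0" "\<forall>x\<in>cball 0 (\<bar>r\<bar> + 1). norm (g x) \<le> B" using bb[OF C1_gradD(2)[OF C]] by blast
  have der: "((\<lambda>t. indicator (cball 0 1) y * (a y * \<psi> (t *\<^sub>R y))) has_real_derivative
      indicator (cball 0 1) y * (a y * (g (t *\<^sub>R y) \<bullet> y))) (at t)" for t y
  proof -
    have "((\<lambda>t. \<psi> (t *\<^sub>R y)) has_derivative (\<lambda>h. g (t *\<^sub>R y) \<bullet> (h *\<^sub>R y))) (at t)"
      by (rule has_derivative_compose[where f="\<lambda>t. t *\<^sub>R y" and g=\<psi>, OF _ C1_gradD(1)[OF C]])
        (auto intro!: derivative_eq_intros)
    then have "((\<lambda>t. \<psi> (t *\<^sub>R y)) has_real_derivative (g (t *\<^sub>R y) \<bullet> y)) (at t)"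
      by (simp add: has_field_derivative_def mult_commute_abs)
    then show ?thesis by (intro DERIV_cmult)
  qed
  have "AE y in lborel. \<forall>t. \<bar>t - r\<bar> < 1 \<longrightarrow> \<bar>indicator (cball 0 1) y * (a y * (g (t *\<^sub>R y) \<bullet> y))\<bar> \<le> B * indicator (cball (0::real^'n) 1) y"
  proof (intro AE_I2 allI impI)
    fix y t assume t: "\<bar>t - r\<bar> < 1"
    show "\<bar>indicator (cball 0 1) y * (a y * (g (t *\<^sub>R y) \<bullet> y))\<bar> \<le> B * indicator (cball (0::real^'n) 1) y"
    proof (cases "norm y \<le> 1")
      case True
      have "\<bar>g (t *\<^sub>R y) \<bullet> y\<bar> \<le> norm (g (t *\<^sub>R y)) * norm y" by (rule Cauchy_Schwarz_ineq2)
      also have "\<dots> \<le> B * 1" using B tin[OF t True] True by (intro mult_mono) auto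
      finally have "\<bar>a y\<bar> * \<bar>g (t *\<^sub>R y) \<bullet> y\<bar> \<le> 1 * B" using a1[OF True] by (intro mult_mono) auto
      then show ?thesis using True by (simp add: abs_mult)
    qed simp
  qed
  note bd = this
  have "(ball_avg a \<psi> has_real_derivative (\<integral>y. indicator (cball 0 1) y * (a y * (g (r *\<^sub>R y) \<bullet> y)) \<partial>lborel)) (at r)"
    unfolding ball_avg_def[abs_def]
  proof (rule has_real_derivative_lebesgue_integral(2)[OF zero_less_one])
    show "integrable lborel (\<lambda>y. indicator (cball 0 1) y * (a y * \<psi> (t *\<^sub>R y)))" if "\<bar>t - r\<bar> < 1" for t
      by (rule int[OF that a a1 C1_gradD(3)[OF C]])
    show "integrable lborel (\<lambda>y::real^'n. B * indicator (cball 0 1) y)"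
      by (auto intro!: integrable_mult_right integrable_real_indicator simp: emeasure_lborel_cball_finite[unfolded infinity_ennreal_def])
  qed (rule der bd)+
  also have "(\<integral>y. indicator (cball 0 1) y * (a y * (g (r *\<^sub>R y) \<bullet> y)) \<partial>lborel)
    = (\<integral>y. (\<Sum>j\<in>UNIV. indicator (cball 0 1) y * (a y * y $ j * g (r *\<^sub>R y) $ j)) \<partial>lborel)"
    by (intro Bochner_Integration.integral_cong refl) (simp add: inner_vec_def sum_distrib_left mult_ac)
  also have "\<dots> = (\<Sum>j\<in>UNIV. ball_avg (\<lambda>y. a y * y $ j) (\<lambda>x. g x $ j) r)"
    unfolding ball_avg_def
  proof (rule Bochner_Integration.integral_sum)
    fix j
    show "integrable lborel (\<lambda>y. indicator (cball 0 1) y * (a y * y $ j * g (r *\<^sub>R y) $ j))"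
    proof (rule int[of r "\<lambda>y. a y * y $ j" "\<lambda>x. g x $ j"])
      show "\<bar>a y * y $ j\<bar> \<le> 1" if "norm y \<le> 1" for y
      proof -
        have "\<bar>a y\<bar> * \<bar>y $ j\<bar> \<le> 1 * 1" using a1[OF that] component_le_norm_cart[of y j] that by (intro mult_mono) auto
        then show ?thesis by (simp add: abs_mult)
      qed
    qed (auto intro!: continuous_intros C1_gradD(2)[OF C])
  qed
  finally show ?thesis .
qed

lemma integral_cball_scaling:
  fixes \<psi> :: "real ^ 'n \<Rightarrow> real"
  assumes c: "continuous_on UNIV \<psi>" and a: "a \<ge> 0"
  shows "(\<integral>x. indicator {..a} (norm x) * \<psi> x \<partial>lborel) = a ^ CARD('n) * ball_avg (\<lambda>_. 1) \<psi> a"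
proof (cases "a = 0")
  case True
  have "AE x in lborel. indicator {..a} (norm x) * \<psi> x = 0"
    using AE_lborel_singleton[of "0::real^'n"] by eventually_elim (auto simp: True indicator_def)
  then show ?thesis using True by (subst integral_eq_zero_AE) auto
next
  case False
  then have a: "a > 0" using a by simp
  have [measurable]: "\<psi> \<in> borel_measurable borel" by (rule borel_measurable_continuous_onI[OF c])
  have L: "(lborel :: (real^'n) measure) = density (distr lborel borel (\<lambda>x. a *\<^sub>R x)) (\<lambda>_. ennreal (a ^ CARD('n)))"
    using lborel_affine[of a "0::real^'n"] a by simp
  have "(\<integral>x. indicator {..a} (norm x) * \<psi> x \<partial>lborel)
    = (\<integral>x. a ^ CARD('n) * (indicator {..a} (norm x) * \<psi> x) \<partial>distr lborel borel (\<lambda>x::real^'n. a *\<^sub>R x))"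
    by (subst L, subst integral_real_density) (use a in auto)
  also have "\<dots> = (\<integral>y. a ^ CARD('n) * (indicator {..a} (norm (a *\<^sub>R y)) * \<psi> (a *\<^sub>R y)) \<partial>lborel)"
    by (rule integral_distr) auto
  also have "\<dots> = (\<integral>y. a ^ CARD('n) * (indicator (cball 0 1) y * (1 * \<psi> (a *\<^sub>R y))) \<partial>lborel)"
    using a by (intro Bochner_Integration.integral_cong refl) (auto simp: indicator_def)
  finally show ?thesis by (simp add: ball_avg_def)
qed

text \<open>By \<open>der\<close>, the integrals of \<open>\<psi>\<close> and of
  \<open>\<mu> (norm x)\<close> over balls have the same derivative in the radius, hence they agree
  on all balls. The difference is then orthogonal to every admissible radial weight.\<close>

lemma radial_mean_integral:
  fixes \<psi> :: "real ^ 'n \<Rightarrow> real"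
  assumes c: "continuous_on UNIV \<psi>" and z: "\<And>x. R < norm x \<Longrightarrow> \<psi> x = 0"
    and c\<mu>: "continuous_on UNIV \<mu>" and z\<mu>: "\<And>r. R < r \<Longrightarrow> \<mu> r = 0"
    and der: "\<And>r. ((\<lambda>r. r ^ CARD('n) * ball_avg (\<lambda>_. 1) \<psi> r) has_real_derivative
      unit_ball_vol (real CARD('n)) * CARD('n) * r ^ (CARD('n) - 1) * \<mu> r) (at r)"
    and k: "k \<in> borel_measurable borel"
    and i1: "integrable lborel (\<lambda>x. k (norm x) * \<psi> x)" and i2: "integrable lborel (\<lambda>x::real^'n. k (norm x) * \<mu> (norm x))"
  shows "(\<integral>x. k (norm x) * \<psi> x \<partial>lborel) = (\<integral>x. k (norm (x::real^'n)) * \<mu> (norm x) \<partial>lborel)"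
proof -
  have [measurable]: "\<psi> \<in> borel_measurable borel" "\<mu> \<in> borel_measurable borel"
    using c c\<mu> by (auto intro: borel_measurable_continuous_onI)
  have c\<mu>n: "continuous_on UNIV (\<lambda>x::real^'n. \<mu> (norm x))"
    by (rule continuous_on_compose2[OF c\<mu>]) (auto intro!: continuous_intros)
  have i\<psi>: "integrable lborel \<psi>" by (rule integrable_continuous_support[OF c z])
  have i\<mu>: "integrable lborel (\<lambda>x::real^'n. \<mu> (norm x))" by (rule integrable_continuous_support[OF c\<mu>n z\<mu>])
  have cut: "integrable lborel (\<lambda>x. indicator {..a} (norm x) * G x)" if G: "integrable lborel G" for a and G :: "real^'n \<Rightarrow> real"
  proof (rule Bochner_Integration.integrable_bound[OF G])
    have [measurable]: "G \<in> borel_measurable borel" using G by auto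
    show "(\<lambda>x. indicator {..a} (norm x) * G x) \<in> borel_measurable lborel" by measurable
  qed (auto simp: indicator_def)
  have eq: "(\<integral>x. indicator {..a} (norm x) * \<psi> x \<partial>lborel) = (\<integral>x. indicator {..a} (norm (x::real^'n)) * \<mu> (norm x) \<partial>lborel)" for a
  proof (cases "a \<ge> 0")
    case True
    let ?f = "\<lambda>r. unit_ball_vol (real CARD('n)) * CARD('n) * r ^ (CARD('n) - 1) * \<mu> r"
    have "(\<integral>x. indicator {..a} (norm (x::real^'n)) * \<mu> (norm x) \<partial>lborel) = (\<integral>r. radial_density CARD('n) r * (indicator {..a} r * \<mu> r) \<partial>lborel)"
      by (rule integral_norm) measurable
    also have "\<dots> = (\<integral>r. ?f r * indicator {0..a} r \<partial>lborel)"
    proof (rule integral_cong_AE)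
      show "AE r in lborel. radial_density CARD('n) r * (indicator {..a} r * \<mu> r) = ?f r * indicator {0..a} r"
        using AE_lborel_singleton[of "0::real"] by eventually_elim (auto simp: radial_density_def indicator_def)
    qed measurable
    also have "\<dots> = a ^ CARD('n) * ball_avg (\<lambda>_. 1) \<psi> a - 0 ^ CARD('n) * ball_avg (\<lambda>_. 1) \<psi> 0"
      using True der c\<mu> by (intro integral_FTC_Icc_real) (auto intro!: continuous_intros simp: continuous_on_eq_continuous_at)
    finally show ?thesis using integral_cball_scaling[OF c True] by simp
  next
    case False
    have "\<not> norm x \<le> a" for x :: "real^'n" using False norm_ge_zero[of x] by linarith
    then show ?thesis by (simp add: indicator_def)
  qed
  have "(\<integral>x. k (norm x) * (\<psi> x - \<mu> (norm x)) \<partial>lborel) = 0"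
  proof (rule integral_radial_mult_eq_0[OF _ _ k])
    show "integrable lborel (\<lambda>x. \<psi> x - \<mu> (norm x))" using i\<psi> i\<mu> by (rule Bochner_Integration.integrable_diff)
    show "(\<integral>x. indicator {..a} (norm x) * (\<psi> x - \<mu> (norm x)) \<partial>lborel) = 0" for a
      unfolding right_diff_distrib
      using Bochner_Integration.integral_diff[OF cut[OF i\<psi>, of a] cut[OF i\<mu>, of a]] eq[of a] by simp
    show "integrable lborel (\<lambda>x. k (norm x) * (\<psi> x - \<mu> (norm x)))"
      using Bochner_Integration.integrable_diff[OF i1 i2] by (simp add: right_diff_distrib)
  qed
  then show ?thesis using Bochner_Integration.integral_diff[OF i1 i2] by (simp add: right_diff_distrib)
qed

lemma ball_avg_odd: "ball_avg (\<lambda>y::real^'n. y $ j) (\<lambda>_. c) r = 0"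
proof -
  define I where "I = (\<integral>y. indicator (cball 0 1) y * ((y::real^'n) $ j * c) \<partial>lborel)"
  have [measurable]: "cball (0::real^'n) 1 \<in> sets borel" by simp
  have [measurable]: "(\<lambda>x::real^'n. x $ j) \<in> borel_measurable borel"
    by (intro borel_measurable_continuous_onI continuous_intros)
  have L: "(lborel :: (real^'n) measure) = distr lborel borel uminus"
    using lborel_affine[of "-1" "0::real^'n"] by (simp add: density_1)
  have "I = (\<integral>y. indicator (cball 0 1) y * ((y::real^'n) $ j * c) \<partial>distr lborel borel uminus)"
    unfolding I_def by (subst L) (rule refl)
  also have "\<dots> = (\<integral>y. indicator (cball 0 1) (- y) * ((- y::real^'n) $ j * c) \<partial>lborel)"
    by (rule integral_distr) measurable
  also have "\<dots> = (\<integral>y. - (indicator (cball 0 1) y * ((y::real^'n) $ j * c)) \<partial>lborel)"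
    by (intro Bochner_Integration.integral_cong refl) (auto simp: indicator_def)
  also have "\<dots> = - I" by (simp add: I_def)
  finally show ?thesis by (simp add: ball_avg_def I_def)
qed

lemma C_k_grad_component: "(\<And>k. C_k k \<phi>) \<Longrightarrow> C_k k (\<lambda>x. euclidean_grad \<phi> x $ j)"
  using C_k.simps(2) by blast

text \<open>
  The spherical mean \<open>\<eta>\<close> is defined without surface integrals, as the function for which
  \<open>\<kappa> r ^ (N - 1) * \<eta> r\<close> is the derivative of the integral of \<open>\<phi>\<close> over the ball of radius \<open>r\<close>,
  \<open>\<kappa>\<close> being the area of the unit sphere.
\<close>

lemma spherical_mean:
  fixes \<phi> :: "real ^ 'n \<Rightarrow> real"
  assumes \<phi>: "test_function \<phi>"
  obtains \<eta> \<eta>' where "radial_C1 \<eta> \<eta>'"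
    "\<And>k. k \<in> borel_measurable borel \<Longrightarrow> integrable lborel (\<lambda>x. k (norm x) * \<phi> x) \<Longrightarrow>
       integrable lborel (\<lambda>x::real^'n. k (norm x) * \<eta> (norm x)) \<Longrightarrow>
       (\<integral>x. k (norm x) * \<phi> x \<partial>lborel) = (\<integral>x. k (norm (x::real^'n)) * \<eta> (norm x) \<partial>lborel)"
    "\<And>k. k \<in> borel_measurable borel \<Longrightarrow> integrable lborel (\<lambda>x. k (norm x) * (euclidean_grad \<phi> x \<bullet> x)) \<Longrightarrow>
       integrable lborel (\<lambda>x::real^'n. k (norm x) * (norm x * \<eta>' (norm x))) \<Longrightarrow>
       (\<integral>x. k (norm x) * (euclidean_grad \<phi> x \<bullet> x) \<partial>lborel) = (\<integral>x. k (norm (x::real^'n)) * (norm x * \<eta>' (norm x)) \<partial>lborel)"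
proof -
  define N where "N = CARD('n)"
  define \<kappa> where "\<kappa> = unit_ball_vol (real N) * N"
  have N: "N > 0" and \<kappa>: "\<kappa> > 0" by (auto simp: \<kappa>_def N_def)
  obtain R where R: "0 < R" "R < 1" and z: "\<And>x. R \<le> norm x \<Longrightarrow> \<phi> x = 0" and gz: "\<And>x. R < norm x \<Longrightarrow> euclidean_grad \<phi> x = 0"
    by (rule C1_ballD[OF test_function_C1_ball[OF \<phi>]]) blast
  have s0: "C_k k \<phi>" for k using \<phi> by (simp add: test_function_def)
  define D where "D j = (\<lambda>x. euclidean_grad \<phi> x $ j)" for j
  have s1: "C_k k (D j)" for k j unfolding D_def by (rule C_k_grad_component[OF s0])
  define DD where "DD j l = (\<lambda>x. euclidean_grad (D j) x $ l)" for j l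
  have s2: "C_k k (DD j l)" for k j l unfolding DD_def by (rule C_k_grad_component[OF s1])
  define P where "P = ball_avg (\<lambda>_. 1) \<phi>"
  define P1 where "P1 r = (\<Sum>j\<in>UNIV. ball_avg (\<lambda>y. y $ j) (D j) r)" for r
  define P2 where "P2 r = (\<Sum>j\<in>UNIV. \<Sum>l\<in>UNIV. ball_avg (\<lambda>y. y $ j * y $ l) (DD j l) r)" for r
  \<comment> \<open>\<open>P1\<close>, \<open>P2\<close> and \<open>P3\<close> are the successive
    derivatives of \<open>P\<close>; \<open>P3\<close> serves only to make \<open>P2\<close>
    continuous.\<close>
  define P3 where "P3 r = (\<Sum>j\<in>UNIV. \<Sum>l\<in>UNIV. \<Sum>m\<in>UNIV. ball_avg (\<lambda>y. y $ j * y $ l * y $ m) (\<lambda>x. euclidean_grad (DD j l) x $ m) r)" for r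
  have vm[measurable]: "(\<lambda>x::real^'n. x $ j) \<in> borel_measurable borel" for j
    by (intro borel_measurable_continuous_onI continuous_intros)
  have v1: "\<bar>y $ j\<bar> \<le> 1" if "norm y \<le> 1" for y :: "real^'n" and j
    using component_le_norm_cart[of y j] that by linarith
  have v2: "\<bar>y $ j * y $ l\<bar> \<le> 1" if "norm y \<le> 1" for y :: "real^'n" and j l
  proof -
    have "\<bar>y $ j\<bar> * \<bar>y $ l\<bar> \<le> 1 * 1" using v1[OF that] by (intro mult_mono) auto
    then show ?thesis by (simp add: abs_mult)
  qed
  have dP: "(P has_real_derivative P1 r) (at r)" for r
    using ball_avg_derivative[OF C1_grad_euclidean_grad[OF s0], of "\<lambda>_. 1" r] by (simp add: P_def P1_def D_def)
  have dP1: "(P1 has_real_derivative P2 r) (at r)" for r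
    unfolding P1_def[abs_def] P2_def DD_def
    by (intro DERIV_sum ball_avg_derivative[OF C1_grad_euclidean_grad[OF s1]] vm v1)
  have dP2: "(P2 has_real_derivative P3 r) (at r)" for r
    unfolding P2_def[abs_def] P3_def
    by (intro DERIV_sum ball_avg_derivative[OF C1_grad_euclidean_grad[OF s2]] borel_measurable_times vm v2)
  have cP: "continuous_on UNIV P" "continuous_on UNIV P1" "continuous_on UNIV P2"
    by (rule DERIV_continuous_on[OF dP] DERIV_continuous_on[OF dP1] DERIV_continuous_on[OF dP2])+
  \<comment> \<open>At radius 0 the integrand is an odd function of \<open>y\<close>; this supplies
    the condition at the origin in \<open>radial_C1\<close>.\<close>
  have P10: "P1 0 = 0"
  proof -
    have "ball_avg (\<lambda>y. y $ j) (D j) 0 = ball_avg (\<lambda>y. y $ j) (\<lambda>_. D j 0) 0" for j by (simp add: ball_avg_def)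
    then show ?thesis by (simp add: P1_def ball_avg_odd)
  qed
  \<comment> \<open>The derivative of \<open>r ^ N * P r\<close> is
    \<open>r ^ (N - 1) * (r * P1 r + N * P r)\<close>. Cancelling
    \<open>\<kappa> * r ^ (N - 1)\<close> algebraically avoids a division by zero at the
    origin.\<close>
  define \<eta> where "\<eta> r = (r * P1 r + N * P r) / \<kappa>" for r
  define \<eta>' where "\<eta>' r = ((N + 1) * P1 r + r * P2 r) / \<kappa>" for r
  have d\<eta>: "(\<eta> has_real_derivative \<eta>' r) (at r)" for r
    unfolding \<eta>_def[abs_def] \<eta>'_def using \<kappa>
    by (auto intro!: derivative_eq_intros dP dP1 simp: field_simps)
  have c\<eta>: "continuous_on UNIV \<eta>" unfolding \<eta>_def[abs_def] using \<kappa> by (intro continuous_intros cP) auto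
  have c\<eta>': "continuous_on UNIV \<eta>'" unfolding \<eta>'_def[abs_def] using \<kappa> by (intro continuous_intros cP) auto
  obtain n where n: "N = Suc n" using N by (cases N) auto
  have dA: "((\<lambda>r. r ^ N * P r) has_real_derivative \<kappa> * r ^ (N - 1) * \<eta> r) (at r)" for r
  proof -
    have "((\<lambda>r. r ^ N * P r) has_real_derivative (real N * r ^ n) * P r + P1 r * r ^ N) (at r)"
      using DERIV_mult[OF DERIV_pow[of N r] dP[of r]] by (simp add: n)
    also have "(real N * r ^ n) * P r + P1 r * r ^ N = \<kappa> * r ^ (N - 1) * \<eta> r"
    proof -
      have "\<kappa> * \<eta> r = r * P1 r + N * P r" using \<kappa> by (simp add: \<eta>_def)
      then have "\<kappa> * r ^ (N - 1) * \<eta> r = r ^ (N - 1) * (r * P1 r + N * P r)" by (simp add: mult_ac)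
      then show ?thesis by (simp add: n algebra_simps)
    qed
    finally show ?thesis .
  qed
  \<comment> \<open>For nonnegative \<open>r\<close>, the function on the left is the integral of
    \<open>\<nabla>\<phi> x \<bullet> x\<close> over the ball of radius \<open>r\<close>, so
    \<open>r * \<eta>' r\<close> is the spherical mean of that function.\<close>
  have dB: "((\<lambda>r. r ^ N * (r * P1 r)) has_real_derivative \<kappa> * r ^ (N - 1) * (r * \<eta>' r)) (at r)" for r
  proof -
    have "((\<lambda>r. r ^ (N + 1) * P1 r) has_real_derivative (real (N + 1) * r ^ N) * P1 r + P2 r * r ^ (N + 1)) (at r)"
      using DERIV_mult[OF DERIV_pow[of "N + 1" r] dP1[of r]] by simp
    also have "(real (N + 1) * r ^ N) * P1 r + P2 r * r ^ (N + 1) = \<kappa> * r ^ (N - 1) * (r * \<eta>' r)"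
    proof -
      have "\<kappa> * \<eta>' r = (N + 1) * P1 r + r * P2 r" using \<kappa> by (simp add: \<eta>'_def)
      then have "\<kappa> * r ^ (N - 1) * (r * \<eta>' r) = r ^ (N - 1) * (r * ((N + 1) * P1 r + r * P2 r))" by (simp add: mult_ac)
      then show ?thesis by (simp add: n algebra_simps)
    qed
    also have "(\<lambda>r. r ^ (N + 1) * P1 r) = (\<lambda>r. r ^ N * (r * P1 r))" by (auto simp: fun_eq_iff mult_ac)
    finally show ?thesis .
  qed
  have c\<phi>: "continuous_on UNIV \<phi>" by (rule C1_gradD(3)[OF C1_grad_euclidean_grad[OF s0]])
  have cg: "continuous_on UNIV (euclidean_grad \<phi>)" by (rule C1_gradD(2)[OF C1_grad_euclidean_grad[OF s0]])
  have \<eta>z: "\<eta> r = 0" if r: "R < r" for r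
  proof -
    \<comment> \<open>Beyond the support the integral over the ball no longer changes, so its
      derivative, and with it the mean, vanishes.\<close>
    have const: "a ^ N * P a = (\<integral>x. \<phi> x \<partial>lborel)" if a: "R < a" for a
    proof -
      have "a ^ N * P a = (\<integral>x. indicator {..a} (norm x) * \<phi> x \<partial>lborel)"
        using integral_cball_scaling[OF c\<phi>, of a] a R by (simp add: P_def N_def)
      also have "\<dots> = (\<integral>x. \<phi> x \<partial>lborel)"
        using z a by (intro Bochner_Integration.integral_cong refl) (auto simp: indicator_def)
      finally show ?thesis .
    qed
    have "((\<lambda>r. r ^ N * P r) has_real_derivative 0) (at r)"
      by (rule has_field_derivative_transform_within_open[of "\<lambda>_. \<integral>x. \<phi> x \<partial>lborel" _ _ "{R<..}"]) (use r const in auto)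
    from DERIV_unique[OF this dA[of r]] show ?thesis using \<kappa> R r by auto
  qed
  have \<eta>'z: "\<eta>' r = 0" if r: "R < r" for r
  proof -
    have "(\<eta> has_real_derivative 0) (at r)"
      by (rule has_field_derivative_transform_within_open[of "\<lambda>_. 0" _ _ "{R<..}"]) (use r \<eta>z in auto)
    from DERIV_unique[OF this d\<eta>[of r]] show ?thesis by simp
  qed
  have rad: "radial_C1 \<eta> \<eta>'" unfolding radial_C1_def
  proof (intro conjI allI exI[of _ "(1 + R) / 2"] impI)
    show "\<eta>' 0 = 0" by (simp add: \<eta>'_def P10)
    show "\<eta> r = 0" if "(1 + R) / 2 \<le> r" for r using that R by (intro \<eta>z) auto
  qed (use d\<eta> c\<eta>' R in auto)
  show thesis
  proof (rule that[OF rad])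
    fix k :: "real \<Rightarrow> real" assume k: "k \<in> borel_measurable borel" "integrable lborel (\<lambda>x. k (norm x) * \<phi> x)"
      "integrable lborel (\<lambda>x::real^'n. k (norm x) * \<eta> (norm x))"
    show "(\<integral>x. k (norm x) * \<phi> x \<partial>lborel) = (\<integral>x. k (norm (x::real^'n)) * \<eta> (norm x) \<partial>lborel)"
      by (rule radial_mean_integral[OF c\<phi> _ c\<eta> \<eta>z dA[unfolded P_def \<kappa>_def N_def] k]) (use z in auto)
  next
    fix k :: "real \<Rightarrow> real" assume k: "k \<in> borel_measurable borel" "integrable lborel (\<lambda>x. k (norm x) * (euclidean_grad \<phi> x \<bullet> x))"
      "integrable lborel (\<lambda>x::real^'n. k (norm x) * (norm x * \<eta>' (norm x)))"
    have B: "ball_avg (\<lambda>_. 1) (\<lambda>x. euclidean_grad \<phi> x \<bullet> x) r = r * P1 r" for r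
    proof -
      have i: "integrable lborel (\<lambda>y. indicator (cball 0 1) y * (y $ j * D j (r *\<^sub>R y)))" for j
      proof -
        have "continuous_on (cball 0 1) (\<lambda>y. y $ j * D j (r *\<^sub>R y))"
          unfolding D_def by (intro continuous_intros continuous_on_compose2[OF cg]) auto
        from borel_integrable_compact[OF compact_cball this] show ?thesis by simp
      qed
      have "ball_avg (\<lambda>_. 1) (\<lambda>x. euclidean_grad \<phi> x \<bullet> x) r = (\<integral>y. r * (\<Sum>j\<in>UNIV. indicator (cball 0 1) y * (y $ j * D j (r *\<^sub>R y))) \<partial>lborel)"
        unfolding ball_avg_def by (intro Bochner_Integration.integral_cong refl) (simp add: inner_vec_def D_def sum_distrib_left mult_ac)
      also have "\<dots> = r * (\<Sum>j\<in>UNIV. \<integral>y. indicator (cball 0 1) y * (y $ j * D j (r *\<^sub>R y)) \<partial>lborel)"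
        by (subst integral_mult_right_zero, subst Bochner_Integration.integral_sum[OF i]) (rule refl)
      finally show ?thesis by (simp add: P1_def ball_avg_def)
    qed
    show "(\<integral>x. k (norm x) * (euclidean_grad \<phi> x \<bullet> x) \<partial>lborel) = (\<integral>x. k (norm (x::real^'n)) * (norm x * \<eta>' (norm x)) \<partial>lborel)"
    proof (rule radial_mean_integral[where R=R and \<mu>="\<lambda>r. r * \<eta>' r"])
      show "continuous_on UNIV (\<lambda>x. euclidean_grad \<phi> x \<bullet> x)" by (intro continuous_intros cg)
      show "continuous_on UNIV (\<lambda>r. r * \<eta>' r)" by (intro continuous_intros c\<eta>')
      show "((\<lambda>r. r ^ CARD('n) * ball_avg (\<lambda>_. 1) (\<lambda>x. euclidean_grad \<phi> x \<bullet> x) r) has_real_derivative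
        unit_ball_vol (real CARD('n)) * CARD('n) * r ^ (CARD('n) - 1) * (r * \<eta>' r)) (at r)" for r
        unfolding B using dB[of r] by (simp add: N_def \<kappa>_def)
    qed (use gz \<eta>'z k in auto)
  qed
qed

section \<open>The radial variational problem\<close>

lemma radial_C1_linear:
  assumes "radial_C1 \<eta> \<eta>'" "radial_C1 \<zeta> \<zeta>'"
  shows "radial_C1 (\<lambda>r. c * \<eta> r + d * \<zeta> r) (\<lambda>r. c * \<eta>' r + d * \<zeta>' r)"
proof -
  obtain R S where R: "0 < R" "R < 1" "\<And>r. R \<le> r \<Longrightarrow> \<eta> r = 0" and S: "0 < S" "S < 1" "\<And>r. S \<le> r \<Longrightarrow> \<zeta> r = 0"
    using assms unfolding radial_C1_def by blast
  show ?thesis unfolding radial_C1_def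
  proof (intro conjI allI exI[of _ "max R S"] impI)
    show "((\<lambda>r. c * \<eta> r + d * \<zeta> r) has_real_derivative c * \<eta>' r + d * \<zeta>' r) (at r)" for r
      using assms unfolding radial_C1_def by (intro DERIV_add DERIV_cmult) auto
    show "continuous_on UNIV (\<lambda>r. c * \<eta>' r + d * \<zeta>' r)"
      using assms unfolding radial_C1_def by (intro continuous_intros) auto
  qed (use assms R S in \<open>auto simp: radial_C1_def\<close>)
qed

lemma radial_C1_continuous: "radial_C1 \<eta> \<eta>' \<Longrightarrow> continuous_on UNIV \<eta>"
  unfolding radial_C1_def by (intro DERIV_continuous_on[where D=\<eta>']) auto

lemma radial_C1_measurable: "radial_C1 \<eta> \<eta>' \<Longrightarrow> \<eta> \<in> borel_measurable borel"
  by (intro borel_measurable_continuous_onI radial_C1_continuous)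

lemma radial_C1_bounded:
  assumes "radial_C1 \<eta> \<eta>'" shows "\<exists>B\<ge>0. \<forall>r. 0 < r \<and> r < 1 \<longrightarrow> \<bar>\<eta> r\<bar> \<le> B"
proof -
  have "bounded (\<eta> ` {0..1})"
    by (intro compact_imp_bounded compact_continuous_image continuous_on_subset[OF radial_C1_continuous[OF assms]]) auto
  then obtain B where B: "\<forall>y\<in>\<eta> ` {0..1}. norm y \<le> B" unfolding bounded_iff by (elim exE)
  then have B': "\<bar>\<eta> r\<bar> \<le> B" if "0 \<le> r" "r \<le> 1" for r using that by simp
  then have "B \<ge> 0" using abs_ge_zero[of "\<eta> 0"] B'[of 0] by linarith
  then show ?thesis using B' by (intro exI[of _ B]) auto
qed

lemma fgrad_rgrad_linear: "fgrad (rgrad (\<lambda>r. c * \<eta>' r + d * \<zeta>' r)) x = c *\<^sub>R fgrad (rgrad \<eta>') x + d *\<^sub>R fgrad (rgrad \<zeta>') x"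
  by (simp add: fgrad_def rgrad_def add_divide_distrib scaleR_add_left scaleR_add_right mult_ac)

lemma sq_integrable_fgrad_rgrad:
  "radial_C1 \<eta> \<eta>' \<Longrightarrow> sq_integrable hyp_measure (fgrad (rgrad \<eta>') :: real ^ 'n \<Rightarrow> _)"
  by (rule C1_ball_sq_integrable(2)[OF radial_C1_grad])

text \<open>The problem for a Borel radial coefficient with bounds valid at every radius; the given
  \<open>\<alpha>\<close> is replaced by such an \<open>a\<close> at the end.\<close>

locale radial_problem =
  fixes f H :: "real \<Rightarrow> real" and q Cf CH :: real and a :: "real ^ 'n \<Rightarrow> real"
  assumes N: "CARD('n) \<ge> 3"
    and f_cont: "continuous_on UNIV f"
    and q: "2 < q" "q < 2 * real CARD('n) / (real CARD('n) - 2)"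
    and f_bound: "\<And>t. \<bar>f t\<bar> \<le> Cf * (1 + \<bar>t\<bar> powr (q - 1))"
    and H_borel: "H \<in> borel_measurable borel"
    and H_bounds: "\<And>r. 0 \<le> H r" "\<And>r. H r \<le> CH"
    and a_eq: "a = (\<lambda>x. H (norm x))"
    and a_int: "integrable hyp_measure a"
begin

text \<open>The second branch is the oriented integral, so that \<open>F\<close> is a primitive on
  the whole line.\<close>

definition "F t = (if t \<ge> 0 then integral {0..t} f else - integral {t..0} f)"
text \<open>The exponent of blow-up at the origin that finite energy allows: half of the
  \<open>N - 2\<close> in the squared decay bound.\<close>

definition "p0 = (real CARD('n) - 2) / 2"
text \<open>The common majorant of the nonlinear terms, up to constants. It is integrable because
  \<open>p0 * q < N\<close>, the subcriticality of \<open>q\<close>.\<close>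

definition "W x = a x * norm x powr (- (p0 * q))"
text \<open>Contains the C1 profiles of energy at most 1 for \<open>K = K0\<close> and, unlike them,
  is stable under pointwise limits that are Borel.\<close>

definition "adm K v \<longleftrightarrow> v \<in> borel_measurable borel \<and> (\<forall>r. 0 < r \<and> r < 1 \<longrightarrow> \<bar>v r\<bar> \<le> K * r powr (- p0))"
definition "Psi v = (\<integral>x. a x * F (v (norm x)) \<partial>hyp_measure)"
definition "E \<eta>' = (fgrad (rgrad \<eta>') :: real ^ 'n \<Rightarrow> real ^ 'n)"
definition "Dir \<eta>' = (\<integral>x. (norm (E \<eta>' x))\<^sup>2 \<partial>hyp_measure)"
text \<open>The root is the constant of the radial decay bound at energy 1. Being at least 1 lets
  the constant term of the growth condition be absorbed into the power.\<close>

definition "K0 = max 1 (sqrt (1 / (unit_ball_vol (real CARD('n)) * CARD('n))))"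
text \<open>Bounds the nonlinear functional on the unit ball; the factor 2 comes from absorbing the
  constant term of the growth condition.\<close>

definition "C0 = 2 * Cf * K0 powr q * (\<integral>x. W x \<partial>hyp_measure)"

section \<open>Estimates for the nonlinear functional\<close>

lemma Cf_nonneg: "Cf \<ge> 0"
proof -
  have "0 \<le> \<bar>f 0\<bar>" by simp
  also have "\<dots> \<le> Cf * (1 + \<bar>0\<bar> powr (q - 1))" by (rule f_bound)
  finally show ?thesis by simp
qed

lemma p0_pos: "p0 > 0" using N by (simp add: p0_def)

lemma p0_q: "0 \<le> p0 * q" "p0 * q < real CARD('n)"
proof -
  have n: "real CARD('n) - 2 > 0" using N by simp
  show "0 \<le> p0 * q" using p0_pos q by simp
  have "q * (real CARD('n) - 2) < 2 * real CARD('n)" using q(2) n by (simp add: pos_less_divide_eq)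
  then show "p0 * q < real CARD('n)" by (simp add: p0_def field_simps)
qed

lemma a_nonneg: "0 \<le> a x" and a_le: "a x \<le> CH"
  using H_bounds by (auto simp: a_eq)

lemma a_borel[measurable]: "a \<in> borel_measurable borel"
  unfolding a_eq using H_borel by measurable

lemma W_int: "integrable hyp_measure W"
  unfolding W_def[abs_def] by (rule integrable_radial_weight[OF a_int _ p0_q]) (use a_nonneg a_le in auto)

lemma W_nonneg: "0 \<le> W x" by (simp add: W_def a_nonneg)

lemma K0_ge_1: "K0 \<ge> 1" by (simp add: K0_def)

lemma C0_nonneg: "C0 \<ge> 0"
  unfolding C0_def using Cf_nonneg W_nonneg by (intro mult_nonneg_nonneg Bochner_Integration.integral_nonneg) auto

lemma F_deriv: "(F has_real_derivative f t) (at t)"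
proof -
  \<comment> \<open>A base point to the left of both \<open>t\<close> and 0, so that one formula
    describes \<open>F\<close> near \<open>t\<close> whatever the sign of \<open>t\<close>.\<close>
  define c where "c = min t 0 - 1"
  have int: "f integrable_on {u..v}" for u v
    by (intro integrable_continuous_interval continuous_on_subset[OF f_cont]) auto
  have c: "c \<le> 0" "c < t" by (auto simp: c_def)
  have F: "F x = integral {c..x} f - integral {c..0} f" if "x > c" for x
  proof (cases "x \<ge> 0")
    case True
    then show ?thesis
      using Henstock_Kurzweil_Integration.integral_combine[of c 0 x f] int c by (simp add: F_def)
  next
    case False
    then show ?thesis
      using Henstock_Kurzweil_Integration.integral_combine[of c x 0 f] int that by (simp add: F_def)
  qed
  note t = c(2)
  have "((\<lambda>x. integral {c..x} f) has_real_derivative f t) (at t within {c..t + 1})"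
    by (rule integral_has_real_derivative) (use t in \<open>auto intro: continuous_on_subset[OF f_cont]\<close>)
  then have "((\<lambda>x. integral {c..x} f) has_real_derivative f t) (at t)"
    using t by (simp add: at_within_Icc_at)
  then have "((\<lambda>x. integral {c..x} f - integral {c..0} f) has_real_derivative f t) (at t)"
    by (auto intro!: derivative_eq_intros)
  then show ?thesis
    by (rule has_field_derivative_transform_within_open[of _ _ _ "{c<..}"]) (use t F in auto)
qed

lemma F_0: "F 0 = 0" by (simp add: F_def)

lemma F_borel[measurable]: "F \<in> borel_measurable borel"
  by (intro borel_measurable_continuous_onI DERIV_continuous_on[where D=f]) (use F_deriv in auto)

lemma f_borel[measurable]: "f \<in> borel_measurable borel"
  by (rule borel_measurable_continuous_onI[OF f_cont])

lemma f_le: assumes "1 \<le> X" "\<bar>t\<bar> \<le> X" shows "\<bar>f t\<bar> \<le> 2 * Cf * X powr (q - 1)"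
proof -
  have "\<bar>t\<bar> powr (q - 1) \<le> X powr (q - 1)" using assms q by (intro powr_mono2) auto
  moreover have "1 \<le> X powr (q - 1)" using assms q by (intro ge_one_powr_ge_zero) auto
  ultimately have "Cf * (1 + \<bar>t\<bar> powr (q - 1)) \<le> Cf * (2 * X powr (q - 1))" using Cf_nonneg by (intro mult_left_mono) auto
  then show ?thesis using f_bound[of t] by simp
qed

lemma F_le: assumes X: "1 \<le> X" "\<bar>t\<bar> \<le> X" shows "\<bar>F t\<bar> \<le> 2 * Cf * X powr q"
proof -
  have "norm (F t - F 0) \<le> (2 * Cf * X powr (q - 1)) * norm (t - 0)"
  proof (rule field_differentiable_bound[where S="{-X..X}" and f'=f])
    show "(F has_field_derivative f z) (at z within {- X..X})" for z by (rule has_field_derivative_at_within[OF F_deriv])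
    show "norm (f z) \<le> 2 * Cf * X powr (q - 1)" if "z \<in> {-X..X}" for z using f_le[OF X(1), of z] that by auto
  qed (use X in auto)
  also have "\<dots> \<le> (2 * Cf * X powr (q - 1)) * X" using X Cf_nonneg by (intro mult_left_mono) auto
  also have "\<dots> = 2 * Cf * X powr q"
  proof -
    have "X powr q = X powr (q - 1) * X" using powr_add[of X "q - 1" 1] X by simp
    then show ?thesis by simp
  qed
  finally show ?thesis by (simp add: F_0)
qed

lemma weight_ge_1: "0 < r \<Longrightarrow> r < 1 \<Longrightarrow> 1 \<le> r powr (- p0)"
  using p0_pos powr_mono2'[of "- p0" r 1] by simp

lemma adm_X:
  assumes K: "K \<ge> 1" and r: "0 < r" "r < 1"
  shows "1 \<le> K * r powr (- p0)" "(K * r powr (- p0)) powr q = K powr q * r powr (- (p0 * q))"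
proof -
  have "1 * 1 \<le> K * r powr (- p0)" using K weight_ge_1[OF r] by (intro mult_mono) auto
  then show "1 \<le> K * r powr (- p0)" by simp
  show "(K * r powr (- p0)) powr q = K powr q * r powr (- (p0 * q))"
    using K r by (simp add: powr_mult powr_powr)
qed

lemma AE_ball_punctured: "AE x::real^'n in hyp_measure. 0 < norm x \<and> norm x < 1"
  using AE_hyp_measure_nonzero AE_space by eventually_elim auto

lemma Psi_dominated:
  assumes v: "adm K v" and K: "K \<ge> 1"
  shows "AE x in hyp_measure. \<bar>a x * F (v (norm x))\<bar> \<le> 2 * Cf * K powr q * W x"
  using AE_ball_punctured
proof eventually_elim
  case (elim x)
  then have "\<bar>F (v (norm x))\<bar> \<le> 2 * Cf * (K * norm x powr (- p0)) powr q"
    using v by (intro F_le adm_X(1)[OF K]) (auto simp: adm_def)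
  also have "\<dots> = 2 * Cf * (K powr q * norm x powr (- (p0 * q)))" using adm_X(2)[OF K] elim by simp
  finally have "a x * \<bar>F (v (norm x))\<bar> \<le> a x * (2 * Cf * (K powr q * norm x powr (- (p0 * q))))"
    by (intro mult_left_mono a_nonneg)
  then show ?case by (simp add: W_def abs_mult a_nonneg mult_ac)
qed

lemma Psi_measurable:
  assumes "v \<in> borel_measurable borel"
  shows "(\<lambda>x. a x * F (v (norm x))) \<in> borel_measurable hyp_measure"
proof -
  note assms[measurable]
  show ?thesis by (intro borel_measurable_hyp_measure) measurable
qed

lemma Psi_integrable:
  assumes v: "adm K v" and K: "K \<ge> 1"
  shows "integrable hyp_measure (\<lambda>x. a x * F (v (norm x)))"
proof (rule Bochner_Integration.integrable_bound[where f="\<lambda>x. 2 * Cf * K powr q * W x"])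
  show "integrable hyp_measure (\<lambda>x. 2 * Cf * K powr q * W x)" by (intro integrable_mult_right W_int)
  show "(\<lambda>x. a x * F (v (norm x))) \<in> borel_measurable hyp_measure"
    using v by (intro Psi_measurable) (simp add: adm_def)
  show "AE x in hyp_measure. norm (a x * F (v (norm x))) \<le> norm (2 * Cf * K powr q * W x)"
    using Psi_dominated[OF assms] by eventually_elim auto
qed

lemma Psi_le:
  assumes v: "adm K0 v" shows "\<bar>Psi v\<bar> \<le> C0"
proof -
  have "\<bar>Psi v\<bar> \<le> (\<integral>x. \<bar>a x * F (v (norm x))\<bar> \<partial>hyp_measure)" unfolding Psi_def by (rule integral_abs_bound)
  also have "\<dots> \<le> (\<integral>x. 2 * Cf * K0 powr q * W x \<partial>hyp_measure)"
    using Psi_integrable[OF v K0_ge_1] Psi_dominated[OF v K0_ge_1] W_int by (intro integral_mono_AE) auto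
  also have "\<dots> = C0" by (simp add: C0_def)
  finally show ?thesis .
qed

lemma Psi_tendsto:
  assumes v: "\<And>n. adm K (v n)" and K: "K \<ge> 1" and u: "u \<in> borel_measurable borel"
    and lim: "\<And>r. 0 < r \<Longrightarrow> r < 1 \<Longrightarrow> (\<lambda>n. v n r) \<longlonglongrightarrow> u r"
  shows "(\<lambda>n. Psi (v n)) \<longlonglongrightarrow> Psi u"
  unfolding Psi_def
proof (rule integral_dominated_convergence[where w="\<lambda>x. 2 * Cf * K powr q * W x"])
  show "(\<lambda>x. a x * F (u (norm x))) \<in> borel_measurable hyp_measure" by (rule Psi_measurable[OF u])
  show "(\<lambda>x. a x * F (v n (norm x))) \<in> borel_measurable hyp_measure" for n
    using v[of n] by (intro Psi_measurable) (simp add: adm_def)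
  show "integrable hyp_measure (\<lambda>x. 2 * Cf * K powr q * W x)" by (intro integrable_mult_right W_int)
  show "AE x in hyp_measure. (\<lambda>n. a x * F (v n (norm x))) \<longlonglongrightarrow> a x * F (u (norm x))"
    using AE_ball_punctured
  proof eventually_elim
    case (elim x)
    have "isCont F (u (norm x))" by (rule DERIV_isCont[OF F_deriv])
    then show ?case using elim lim by (intro tendsto_intros isCont_tendsto_compose[of _ F]) auto
  qed
  show "AE x in hyp_measure. norm (a x * F (v n (norm x))) \<le> 2 * Cf * K powr q * W x" for n
    using Psi_dominated[OF v[of n] K] by simp
qed

lemma adm_radial:
  assumes \<eta>: "radial_C1 \<eta> \<eta>'" and D: "Dir \<eta>' \<le> 1" shows "adm K0 \<eta>"
  unfolding adm_def
proof (intro conjI allI impI radial_C1_measurable[OF \<eta>])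
  fix r :: real assume r: "0 < r \<and> r < 1"
  define \<kappa> where "\<kappa> = unit_ball_vol (real CARD('n)) * CARD('n)"
  have \<kappa>: "\<kappa> > 0" by (simp add: \<kappa>_def)
  have "(\<eta> r)\<^sup>2 \<le> Dir \<eta>' / \<kappa> / r ^ (CARD('n) - 2)"
    using radial_bounds(2)[OF N \<eta>] r unfolding Dir_def E_def \<kappa>_def by simp
  also have "\<dots> \<le> 1 / \<kappa> / r ^ (CARD('n) - 2)"
    using D \<kappa> r by (intro divide_right_mono) auto
  also have "\<dots> = (sqrt (1 / \<kappa>) * r powr (- p0))\<^sup>2"
  proof -
    have e: "- p0 + - p0 = - real (CARD('n) - 2)" using N by (simp add: p0_def of_nat_diff)
    have "(r powr (- p0))\<^sup>2 = r powr (- real (CARD('n) - 2))"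
      unfolding power2_eq_square e[symmetric] by (rule powr_add[symmetric])
    also have "\<dots> = inverse (r ^ (CARD('n) - 2))"
      using r powr_realpow[of r "CARD('n) - 2"] by (simp only: powr_minus)
    finally have r2: "(r powr (- p0))\<^sup>2 = inverse (r ^ (CARD('n) - 2))" .
    have "(sqrt (1 / \<kappa>))\<^sup>2 = 1 / \<kappa>" using \<kappa> by (intro real_sqrt_pow2) simp
    then show ?thesis unfolding power_mult_distrib r2 by (simp only: divide_inverse)
  qed
  finally have "\<bar>\<eta> r\<bar> \<le> \<bar>sqrt (1 / \<kappa>) * r powr (- p0)\<bar>" by (rule abs_le_square_iff[THEN iffD2])
  also have "\<dots> = sqrt (1 / \<kappa>) * r powr (- p0)"
    using \<kappa> by (intro abs_of_nonneg mult_nonneg_nonneg real_sqrt_ge_zero) auto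
  also have "\<dots> \<le> K0 * r powr (- p0)" unfolding K0_def \<kappa>_def by (intro mult_right_mono) auto
  finally show "\<bar>\<eta> r\<bar> \<le> K0 * r powr (- p0)" .
qed

text \<open>On the unit interval \<open>r powr (- p0)\<close> is at least 1, so a bounded
  perturbation only enlarges the constant.\<close>

lemma adm_add_bounded:
  assumes v: "adm K v" and \<eta>: "\<eta> \<in> borel_measurable borel" "\<And>r. 0 < r \<Longrightarrow> r < 1 \<Longrightarrow> \<bar>\<eta> r\<bar> \<le> B"
    and t: "\<bar>t\<bar> \<le> 1"
  shows "adm (K + B) (\<lambda>r. v r + t * \<eta> r)"
  unfolding adm_def
proof (intro conjI allI impI)
  show "(\<lambda>r. v r + t * \<eta> r) \<in> borel_measurable borel" using v \<eta> by (auto simp: adm_def)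
  fix r :: real assume r: "0 < r \<and> r < 1"
  have "\<bar>t * \<eta> r\<bar> \<le> 1 * B" unfolding abs_mult using t \<eta>(2)[of r] r by (intro mult_mono) auto
  also have "B \<ge> 0" using \<eta>(2)[of r] r by auto
  then have "1 * B \<le> B * r powr (- p0)" using weight_ge_1[of r] r mult_left_mono[of 1 "r powr (- p0)" B] by simp
  finally have "\<bar>t * \<eta> r\<bar> \<le> B * r powr (- p0)" .
  moreover have "\<bar>v r\<bar> \<le> K * r powr (- p0)" using v r by (simp add: adm_def)
  ultimately show "\<bar>v r + t * \<eta> r\<bar> \<le> (K + B) * r powr (- p0)" by (simp add: distrib_right)
qed

lemma Psi_has_derivative:
  assumes u: "adm K0 u" and \<eta>: "radial_C1 \<eta> \<eta>'"
  shows "integrable hyp_measure (\<lambda>x. a x * f (u (norm x)) * \<eta> (norm x))"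
    and "((\<lambda>t. Psi (\<lambda>r. u r + t * \<eta> r)) has_real_derivative (\<integral>x. a x * f (u (norm x)) * \<eta> (norm x) \<partial>hyp_measure)) (at 0)"
proof -
  obtain B where B: "B \<ge> 0" "\<And>r. 0 < r \<Longrightarrow> r < 1 \<Longrightarrow> \<bar>\<eta> r\<bar> \<le> B" using radial_C1_bounded[OF \<eta>] by blast
  define K where "K = K0 + B"
  have K: "K \<ge> 1" using K0_ge_1 B by (simp add: K_def)
  have adm: "adm K (\<lambda>r. u r + t * \<eta> r)" if "\<bar>t - 0\<bar> < 1" for t
    unfolding K_def by (rule adm_add_bounded[OF u radial_C1_measurable[OF \<eta>] B(2)]) (use that in auto)
  have der: "((\<lambda>t. a x * F (u (norm x) + t * \<eta> (norm x))) has_real_derivative a x * f (u (norm x) + t * \<eta> (norm x)) * \<eta> (norm x)) (at t)" for t x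
    by (auto intro!: derivative_eq_intros DERIV_chain2[OF F_deriv])
  have bd: "AE x in hyp_measure. \<forall>t. \<bar>t - 0\<bar> < 1 \<longrightarrow> \<bar>a x * f (u (norm x) + t * \<eta> (norm x)) * \<eta> (norm x)\<bar> \<le> 2 * Cf * K powr q * B * W x"
    using AE_ball_punctured
  proof eventually_elim
    case (elim x)
    show ?case
    proof (intro allI impI)
      fix t :: real assume t: "\<bar>t - 0\<bar> < 1"
      define X where "X = K * norm x powr (- p0)"
      have X1: "1 \<le> X" using adm_X(1)[OF K] elim by (simp add: X_def)
      have "\<bar>f (u (norm x) + t * \<eta> (norm x))\<bar> \<le> 2 * Cf * X powr (q - 1)"
        using adm[OF t] elim by (intro f_le X1) (auto simp: adm_def X_def)
      \<comment> \<open>As \<open>X\<close> is at least 1, raising the exponent from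
        \<open>q - 1\<close> to \<open>q\<close> is harmless and allows the same majorant
        \<open>W\<close>.\<close>
      also have "\<dots> \<le> 2 * Cf * X powr q" using X1 Cf_nonneg by (intro mult_left_mono powr_mono) auto
      also have "\<dots> = 2 * Cf * (K powr q * norm x powr (- (p0 * q)))" unfolding X_def using adm_X(2)[OF K] elim by simp
      finally have "a x * \<bar>f (u (norm x) + t * \<eta> (norm x))\<bar> * \<bar>\<eta> (norm x)\<bar>
          \<le> a x * (2 * Cf * (K powr q * norm x powr (- (p0 * q)))) * B"
        using B elim a_nonneg Cf_nonneg by (intro mult_mono mult_left_mono mult_nonneg_nonneg) auto
      then show "\<bar>a x * f (u (norm x) + t * \<eta> (norm x)) * \<eta> (norm x)\<bar> \<le> 2 * Cf * K powr q * B * W x"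
        by (simp add: abs_mult a_nonneg W_def mult_ac)
    qed
  qed
  have iW: "integrable hyp_measure (\<lambda>x. 2 * Cf * K powr q * B * W x)" by (intro integrable_mult_right W_int)
  note DUI = has_real_derivative_lebesgue_integral[where d=1 and ?t0.0=0 and M="hyp_measure :: (real^'n) measure"
      and F="\<lambda>t x. a x * F (u (norm x) + t * \<eta> (norm x))"
      and F'="\<lambda>t x. a x * f (u (norm x) + t * \<eta> (norm x)) * \<eta> (norm x)"
      and B="\<lambda>x. 2 * Cf * K powr q * B * W x", OF zero_less_one Psi_integrable[OF adm K] der bd iW]
  show "integrable hyp_measure (\<lambda>x. a x * f (u (norm x)) * \<eta> (norm x))" using DUI(1) by simp
  show "((\<lambda>t. Psi (\<lambda>r. u r + t * \<eta> r)) has_real_derivative (\<integral>x. a x * f (u (norm x)) * \<eta> (norm x) \<partial>hyp_measure)) (at 0)"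
    using DUI(2) unfolding Psi_def by simp
qed

end

section \<open>Minimization on the unit ball\<close>

context radial_problem
begin

definition "J l \<eta> \<eta>' = Dir \<eta>' / 2 - l * Psi \<eta>"

lemma sq_E: "radial_C1 \<eta> \<eta>' \<Longrightarrow> sq_integrable hyp_measure (E \<eta>')"
  unfolding E_def by (rule sq_integrable_fgrad_rgrad)

lemma E_linear: "E (\<lambda>r. c * \<eta>' r + d * \<zeta>' r) x = c *\<^sub>R E \<eta>' x + d *\<^sub>R E \<zeta>' x"
  unfolding E_def by (rule fgrad_rgrad_linear)

lemma Dir_nonneg: "Dir \<eta>' \<ge> 0"
  unfolding Dir_def by simp

lemma J_lower: "radial_C1 \<eta> \<eta>' \<Longrightarrow> Dir \<eta>' \<le> 1 \<Longrightarrow> l \<ge> 0 \<Longrightarrow> - (l * C0) \<le> J l \<eta> \<eta>'"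
proof -
  assume a: "radial_C1 \<eta> \<eta>'" "Dir \<eta>' \<le> 1" "l \<ge> 0"
  have "l * Psi \<eta> \<le> l * C0" using Psi_le[OF adm_radial[OF a(1,2)]] a(3) by (intro mult_left_mono) auto
  then show ?thesis using Dir_nonneg[of \<eta>'] by (simp add: J_def)
qed

lemma Dir_midpoint:
  assumes "radial_C1 \<eta> \<eta>'" "radial_C1 \<zeta> \<zeta>'"
  shows "Dir (\<lambda>r. 1/2 * \<eta>' r + 1/2 * \<zeta>' r) = (1/2) * Dir \<eta>' + (1/2) * Dir \<zeta>' - (1/4) * (\<integral>x. (norm (E \<eta>' x - E \<zeta>' x))\<^sup>2 \<partial>hyp_measure)"
  unfolding Dir_def E_linear by (rule integral_norm_sq_midpoint[OF sq_E[OF assms(1)] sq_E[OF assms(2)]])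

text \<open>Otherwise there are pairs of indices tending to infinity whose gradients stay apart.
  Their midpoints are competitors with the same limit of \<open>Psi\<close>, and by the
  parallelogram law they would lie below the infimum by a fixed amount.\<close>

lemma minimizing_sequence_Cauchy:
  assumes l: "l > 0" and \<eta>: "\<And>n. radial_C1 (\<eta> n) (\<eta>' n)" and D: "\<And>n. Dir (\<eta>' n) \<le> 1"
    and m: "\<And>\<zeta> \<zeta>'. radial_C1 \<zeta> \<zeta>' \<Longrightarrow> Dir \<zeta>' \<le> 1 \<Longrightarrow> m \<le> J l \<zeta> \<zeta>'"
    and Jm: "(\<lambda>n. J l (\<eta> n) (\<eta>' n)) \<longlonglongrightarrow> m"
    and U: "U \<in> borel_measurable borel" and lim: "\<And>r. 0 < r \<Longrightarrow> r < 1 \<Longrightarrow> (\<lambda>n. \<eta> n r) \<longlonglongrightarrow> U r"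
  shows "L2_Cauchy hyp_measure (\<lambda>n. E (\<eta>' n))"
proof (rule ccontr)
  define d where "d i j = (\<integral>x. (norm (E (\<eta>' i) x - E (\<eta>' j) x))\<^sup>2 \<partial>hyp_measure)" for i j
  assume "\<not> ?thesis"
  then obtain e where e: "e > 0" "\<forall>K. \<exists>i\<ge>K. \<exists>j\<ge>K. \<not> d i j < e"
    unfolding L2_Cauchy_def d_def by blast
  then have "\<forall>K. \<exists>p. fst p \<ge> K \<and> snd p \<ge> K \<and> e \<le> d (fst p) (snd p)"
    by (metis fst_conv snd_conv not_less)
  then obtain p where p: "\<And>K. fst (p K) \<ge> K" "\<And>K. snd (p K) \<ge> K" "\<And>K. e \<le> d (fst (p K)) (snd (p K))"
    by metis
  define i j where "i K = fst (p K)" and "j K = snd (p K)" for K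
  have fi: "filterlim i at_top sequentially" and fj: "filterlim j at_top sequentially"
    unfolding i_def j_def by (rule filterlim_at_top_mono[OF filterlim_ident]; use p in simp)+
  define \<mu> \<mu>' where "\<mu> K r = 1/2 * \<eta> (i K) r + 1/2 * \<eta> (j K) r" and "\<mu>' K r = 1/2 * \<eta>' (i K) r + 1/2 * \<eta>' (j K) r" for K r
  have \<mu>: "radial_C1 (\<mu> K) (\<mu>' K)" for K
    unfolding \<mu>_def[abs_def] \<mu>'_def[abs_def] by (rule radial_C1_linear[OF \<eta> \<eta>])
  have D\<mu>: "Dir (\<mu>' K) = (1/2) * Dir (\<eta>' (i K)) + (1/2) * Dir (\<eta>' (j K)) - (1/4) * d (i K) (j K)" for K
    unfolding \<mu>'_def[abs_def] d_def by (rule Dir_midpoint[OF \<eta> \<eta>])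
  have d0: "d i j \<ge> 0" for i j unfolding d_def by simp
  have D1: "Dir (\<mu>' K) \<le> 1" for K
    using D\<mu>[of K] D[of "i K"] D[of "j K"] d0[of "i K" "j K"] by linarith
  have P: "(\<lambda>n. Psi (\<eta> n)) \<longlonglongrightarrow> Psi U"
    by (rule Psi_tendsto[OF adm_radial[OF \<eta> D] K0_ge_1 U lim])
  have P\<mu>: "(\<lambda>K. Psi (\<mu> K)) \<longlonglongrightarrow> Psi U"
  proof (rule Psi_tendsto[OF adm_radial[OF \<mu> D1] K0_ge_1 U])
    fix r :: real assume r: "0 < r" "r < 1"
    have "(\<lambda>K. 1/2 * \<eta> (i K) r + 1/2 * \<eta> (j K) r) \<longlonglongrightarrow> 1/2 * U r + 1/2 * U r"
      by (intro tendsto_intros filterlim_compose[OF lim[OF r] fi] filterlim_compose[OF lim[OF r] fj])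
    then show "(\<lambda>K. \<mu> K r) \<longlonglongrightarrow> U r" by (simp add: \<mu>_def)
  qed
  \<comment> \<open>The inequality \<open>m \<le> J l (\<mu> K) (\<mu>' K)\<close> solved for the
    distance; it enters with coefficient 1/4 in \<open>Dir\<close> and 1/8 in \<open>J\<close>,
    hence the factor 8.\<close>
  define B where "B K = 8 * ((J l (\<eta> (i K)) (\<eta>' (i K)) + l * Psi (\<eta> (i K)) + J l (\<eta> (j K)) (\<eta>' (j K)) + l * Psi (\<eta> (j K))) / 2 - l * Psi (\<mu> K) - m)" for K
  have "e \<le> B K" for K
  proof -
    have "m \<le> J l (\<mu> K) (\<mu>' K)" by (rule m[OF \<mu> D1])
    then have "d (i K) (j K) \<le> B K" unfolding B_def J_def D\<mu> by (simp add: field_simps)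
    then show ?thesis using p(3)[of K] by (simp add: i_def j_def)
  qed
  moreover have "B \<longlonglongrightarrow> 8 * ((m + l * Psi U + m + l * Psi U) / 2 - l * Psi U - m)"
    unfolding B_def[abs_def]
    by (intro tendsto_intros filterlim_compose[OF Jm fi] filterlim_compose[OF Jm fj]
        filterlim_compose[OF P fi] filterlim_compose[OF P fj] P\<mu>) auto
  moreover have "8 * ((m + l * Psi U + m + l * Psi U) / 2 - l * Psi U - m) = 0" by (simp add: field_simps)
  ultimately have "e \<le> 0" by (metis LIMSEQ_le_const)
  then show False using e by simp
qed

text \<open>The limit \<open>U\<close> need not be a C1 profile, so \<open>J\<close> is not
  evaluated at it: the limit gradient \<open>Y\<close> supplies its energy, and the pair
  \<open>U\<close>, \<open>Y\<close> attains the infimum. The competitor of negative energy gives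
  \<open>m < 0\<close>.\<close>

lemma minimizer:
  assumes l: "l > 0" and neg: "radial_C1 \<zeta>0 \<zeta>0'" "Dir \<zeta>0' \<le> 1" "J l \<zeta>0 \<zeta>0' < 0"
  obtains \<eta> \<eta>' U Y m where "\<And>n. radial_C1 (\<eta> n) (\<eta>' n)" "\<And>n. Dir (\<eta>' n) \<le> 1"
    "adm K0 U" "\<And>r. 0 < r \<Longrightarrow> r < 1 \<Longrightarrow> (\<lambda>n. \<eta> n r) \<longlonglongrightarrow> U r"
    "sq_integrable hyp_measure Y" "(\<lambda>n. \<integral>x. (norm (E (\<eta>' n) x - Y x))\<^sup>2 \<partial>hyp_measure) \<longlonglongrightarrow> 0"
    "(\<integral>x. (norm (Y x))\<^sup>2 \<partial>hyp_measure) / 2 - l * Psi U = m" "m < 0"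
    "(\<integral>x. (norm (Y x))\<^sup>2 \<partial>hyp_measure) \<le> 2 * l * C0"
    "\<And>\<zeta> \<zeta>'. radial_C1 \<zeta> \<zeta>' \<Longrightarrow> Dir \<zeta>' \<le> 1 \<Longrightarrow> m \<le> J l \<zeta> \<zeta>'"
proof -
  define V where "V = {J l \<zeta> \<zeta>' | \<zeta> \<zeta>'. radial_C1 \<zeta> \<zeta>' \<and> Dir \<zeta>' \<le> 1}"
  define m where "m = Inf V"
  have bdd: "bdd_below V" unfolding V_def using J_lower l by (intro bdd_belowI[of _ "- (l * C0)"]) auto
  have J0: "J l \<zeta>0 \<zeta>0' \<in> V" unfolding V_def using neg by blast
  have m_le: "m \<le> J l \<zeta> \<zeta>'" if "radial_C1 \<zeta> \<zeta>'" "Dir \<zeta>' \<le> 1" for \<zeta> \<zeta>'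
    unfolding m_def by (rule cInf_lower[OF _ bdd]) (use that in \<open>auto simp: V_def\<close>)
  have m_neg: "m < 0" using m_le[OF neg(1,2)] neg(3) by linarith
  have "\<exists>p. radial_C1 (fst p) (snd p) \<and> Dir (snd p) \<le> 1 \<and> J l (fst p) (snd p) < m + 1 / real (Suc n)" for n
  proof -
    have "\<exists>v\<in>V. v < m + 1 / real (Suc n)" unfolding m_def by (rule cInf_lessD) (use J0 in auto)
    then show ?thesis unfolding V_def by force
  qed
  then obtain p where p: "\<And>n. radial_C1 (fst (p n)) (snd (p n))" "\<And>n. Dir (snd (p n)) \<le> 1"
    "\<And>n. J l (fst (p n)) (snd (p n)) < m + 1 / real (Suc n)" by metis
  obtain k U where k: "strict_mono (k :: nat \<Rightarrow> nat)" and U: "U \<in> borel_measurable borel"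
    and lim: "\<And>t. 0 < t \<Longrightarrow> t < 1 \<Longrightarrow> (\<lambda>n. fst (p (k n)) t) \<longlonglongrightarrow> U t"
    using radial_pointwise_subsequence[where \<eta>="\<lambda>n. fst (p n)" and \<eta>'="\<lambda>n. snd (p n)", OF N p(1) p(2)[unfolded Dir_def E_def]]
    by blast
  define \<eta> \<eta>' where "\<eta> n = fst (p (k n))" and "\<eta>' n = snd (p (k n))" for n
  have \<eta>: "radial_C1 (\<eta> n) (\<eta>' n)" and D: "Dir (\<eta>' n) \<le> 1" for n using p by (auto simp: \<eta>_def \<eta>'_def)
  have lim': "(\<lambda>n. \<eta> n r) \<longlonglongrightarrow> U r" if "0 < r" "r < 1" for r using lim[OF that] by (simp add: \<eta>_def)
  have Jm: "(\<lambda>n. J l (\<eta> n) (\<eta>' n)) \<longlonglongrightarrow> m"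
  proof (rule tendsto_sandwich[OF _ _ tendsto_const])
    show "\<forall>\<^sub>F n in sequentially. m \<le> J l (\<eta> n) (\<eta>' n)" by (intro always_eventually allI m_le \<eta> D)
    have "J l (\<eta> n) (\<eta>' n) \<le> m + 1 / real (Suc n)" for n
    proof -
      have "J l (\<eta> n) (\<eta>' n) < m + 1 / real (Suc (k n))" using p(3)[of "k n"] by (simp add: \<eta>_def \<eta>'_def)
      also have "\<dots> \<le> m + 1 / real (Suc n)" using seq_suble[OF k, of n] by (intro add_left_mono divide_left_mono) auto
      finally show ?thesis by simp
    qed
    then show "\<forall>\<^sub>F n in sequentially. J l (\<eta> n) (\<eta>' n) \<le> m + 1 / real (Suc n)" by (intro always_eventually allI)
    have "(\<lambda>n. m + 1 / real (Suc n)) \<longlonglongrightarrow> m + 0"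
      using LIMSEQ_inverse_real_of_nat by (intro tendsto_intros) (simp add: inverse_eq_divide)
    then show "(\<lambda>n. m + 1 / real (Suc n)) \<longlonglongrightarrow> m" by simp
  qed
  have Cau: "L2_Cauchy hyp_measure (\<lambda>n. E (\<eta>' n))"
    by (rule minimizing_sequence_Cauchy[OF l \<eta> D m_le Jm U lim'])
  obtain Y where Y: "sq_integrable hyp_measure Y" "(\<lambda>n. \<integral>x. (norm (E (\<eta>' n) x - Y x))\<^sup>2 \<partial>hyp_measure) \<longlonglongrightarrow> 0"
    using L2_complete_hyp_measure[OF sq_E[OF \<eta>] Cau] by blast
  have U_adm: "adm K0 U" unfolding adm_def
  proof (intro conjI U allI impI)
    fix r :: real assume r: "0 < r \<and> r < 1"
    have "\<bar>\<eta> n r\<bar> \<le> K0 * r powr (- p0)" for n using adm_radial[OF \<eta> D, of n] r by (simp add: adm_def)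
    then show "\<bar>U r\<bar> \<le> K0 * r powr (- p0)"
      using r by (intro LIMSEQ_le_const2[OF tendsto_rabs[OF lim']]) auto
  qed
  have Dl: "(\<lambda>n. Dir (\<eta>' n)) \<longlonglongrightarrow> (\<integral>x. (norm (Y x))\<^sup>2 \<partial>hyp_measure)"
    unfolding Dir_def by (rule tendsto_integral_norm_sq[OF sq_E[OF \<eta>] Y])
  have P: "(\<lambda>n. Psi (\<eta> n)) \<longlonglongrightarrow> Psi U"
    by (rule Psi_tendsto[OF adm_radial[OF \<eta> D] K0_ge_1 U lim'])
  have "(\<lambda>n. J l (\<eta> n) (\<eta>' n)) \<longlonglongrightarrow> (\<integral>x. (norm (Y x))\<^sup>2 \<partial>hyp_measure) / 2 - l * Psi U"
    unfolding J_def by (intro tendsto_intros Dl P) auto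
  then have eq: "(\<integral>x. (norm (Y x))\<^sup>2 \<partial>hyp_measure) / 2 - l * Psi U = m" using Jm by (rule LIMSEQ_unique)
  have "l * Psi U \<le> l * C0" using Psi_le[OF U_adm] l by (intro mult_left_mono) auto
  \<comment> \<open>Half of this energy equals \<open>m + l * Psi U\<close>, and \<open>m\<close> is
    negative.\<close>
  then have "(\<integral>x. (norm (Y x))\<^sup>2 \<partial>hyp_measure) \<le> 2 * l * C0" using eq m_neg by simp
  then show thesis using that[OF \<eta> D U_adm lim' Y eq m_neg _ m_le] by blast
qed

text \<open>A variation \<open>U + t \<zeta>\<close> is not itself a competitor, but
  \<open>\<eta> n + t \<zeta>\<close> is one for large \<open>n\<close>, and \<open>J\<close> there
  tends to \<open>G t\<close>. So \<open>G\<close> has an interior local minimum at 0.\<close>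

lemma Euler_Lagrange:
  assumes l: "l > 0" and small: "l * (4 * (C0 + 1)) \<le> 1"
    and \<eta>: "\<And>n. radial_C1 (\<eta> n) (\<eta>' n)" and D: "\<And>n. Dir (\<eta>' n) \<le> 1"
    and U: "adm K0 U" and lim: "\<And>r. 0 < r \<Longrightarrow> r < 1 \<Longrightarrow> (\<lambda>n. \<eta> n r) \<longlonglongrightarrow> U r"
    and Y: "sq_integrable hyp_measure Y" and EY: "(\<lambda>n. \<integral>x. (norm (E (\<eta>' n) x - Y x))\<^sup>2 \<partial>hyp_measure) \<longlonglongrightarrow> 0"
    and eq: "(\<integral>x. (norm (Y x))\<^sup>2 \<partial>hyp_measure) / 2 - l * Psi U = m"
    and Y_le: "(\<integral>x. (norm (Y x))\<^sup>2 \<partial>hyp_measure) \<le> 2 * l * C0"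
    and m_le: "\<And>\<zeta> \<zeta>'. radial_C1 \<zeta> \<zeta>' \<Longrightarrow> Dir \<zeta>' \<le> 1 \<Longrightarrow> m \<le> J l \<zeta> \<zeta>'"
    and \<zeta>: "radial_C1 \<zeta> \<zeta>'"
  shows "(\<integral>x. Y x \<bullet> E \<zeta>' x \<partial>hyp_measure) = l * (\<integral>x. a x * f (U (norm x)) * \<zeta> (norm x) \<partial>hyp_measure)"
proof -
  obtain B where B: "B \<ge> 0" "\<And>r. 0 < r \<Longrightarrow> r < 1 \<Longrightarrow> \<bar>\<zeta> r\<bar> \<le> B" using radial_C1_bounded[OF \<zeta>] by blast
  define A0 A1 A2 where "A0 = (\<integral>x. (norm (Y x))\<^sup>2 \<partial>hyp_measure)" and "A1 = (\<integral>x. Y x \<bullet> E \<zeta>' x \<partial>hyp_measure)"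
    and "A2 = (\<integral>x. (norm (E \<zeta>' x))\<^sup>2 \<partial>hyp_measure)"
  define Q where "Q t = A0 + 2 * t * A1 + t\<^sup>2 * A2" for t
  define G where "G t = Q t / 2 - l * Psi (\<lambda>r. U r + t * \<zeta> r)" for t
  \<comment> \<open>The smallness of \<open>l\<close> enters here: the limit energy is at most 1/2,
    so the constraint is inactive for small \<open>t\<close>.\<close>
  have "2 * l * C0 \<le> 1 / 2"
  proof -
    have "2 * l * C0 \<le> l * (4 * (C0 + 1)) / 2" using l by (simp add: field_simps)
    then show ?thesis using small by linarith
  qed
  then have Q0: "Q 0 < 1" using Y_le by (simp add: Q_def A0_def)
  have "isCont Q 0" unfolding Q_def[abs_def] by (intro continuous_intros)
  then have "\<forall>\<^sub>F t in at 0. Q t < 1" using Q0 unfolding isCont_def by (rule order_tendstoD)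
  then obtain d where d: "d > 0" "\<And>t. t \<noteq> 0 \<Longrightarrow> \<bar>t\<bar> < d \<Longrightarrow> Q t < 1"
    unfolding eventually_at by (auto simp: dist_real_def)
  have Qd: "Q t < 1" if "\<bar>t\<bar> < d" for t using d(2)[of t] that Q0 by (cases "t = 0") auto
  \<comment> \<open>Below \<open>d\<close> the constraint holds in the limit; below 1 the perturbed
    profiles stay admissible with a common constant.\<close>
  have min: "G 0 \<le> G t" if t: "\<bar>t\<bar> < min d 1" for t
  proof -
    define \<mu> \<mu>' where "\<mu> n r = 1 * \<eta> n r + t * \<zeta> r" and "\<mu>' n r = 1 * \<eta>' n r + t * \<zeta>' r" for n r
    have \<mu>: "radial_C1 (\<mu> n) (\<mu>' n)" for n
      unfolding \<mu>_def[abs_def] \<mu>'_def[abs_def] by (rule radial_C1_linear[OF \<eta> \<zeta>])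
    have E\<mu>: "E (\<mu>' n) x = E (\<eta>' n) x + t *\<^sub>R E \<zeta>' x" for n x
      unfolding \<mu>'_def[abs_def] E_linear by simp
    have sY: "sq_integrable hyp_measure (\<lambda>x. Y x + t *\<^sub>R E \<zeta>' x)"
      by (intro sq_integrable_add Y sq_integrable_scaleR sq_E[OF \<zeta>])
    have "(\<lambda>n. Dir (\<mu>' n)) \<longlonglongrightarrow> (\<integral>x. (norm (Y x + t *\<^sub>R E \<zeta>' x))\<^sup>2 \<partial>hyp_measure)"
      unfolding Dir_def using EY by (intro tendsto_integral_norm_sq[OF sq_E[OF \<mu>] sY]) (simp add: E\<mu>)
    also have "(\<integral>x. (norm (Y x + t *\<^sub>R E \<zeta>' x))\<^sup>2 \<partial>hyp_measure) = Q t"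
      unfolding integral_norm_sq_add_scaleR[OF Y sq_E[OF \<zeta>]] Q_def A0_def A1_def A2_def ..
    finally have DQ: "(\<lambda>n. Dir (\<mu>' n)) \<longlonglongrightarrow> Q t" .
    have P: "(\<lambda>n. Psi (\<mu> n)) \<longlonglongrightarrow> Psi (\<lambda>r. U r + t * \<zeta> r)"
    proof (rule Psi_tendsto[where K="K0 + B"])
      show "adm (K0 + B) (\<mu> n)" for n
        using adm_add_bounded[OF adm_radial[OF \<eta>[of n] D[of n]] radial_C1_measurable[OF \<zeta>] B(2), of t] t by (simp add: \<mu>_def[abs_def])
      show "1 \<le> K0 + B" using K0_ge_1 B by simp
      show "(\<lambda>r. U r + t * \<zeta> r) \<in> borel_measurable borel"
        using U radial_C1_measurable[OF \<zeta>] by (auto simp: adm_def)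
      show "(\<lambda>n. \<mu> n r) \<longlonglongrightarrow> U r + t * \<zeta> r" if "0 < r" "r < 1" for r
        unfolding \<mu>_def using lim[OF that] by (auto intro!: tendsto_intros)
    qed
    have "(\<lambda>n. J l (\<mu> n) (\<mu>' n)) \<longlonglongrightarrow> G t" unfolding J_def G_def by (intro tendsto_intros DQ P) auto
    moreover have "\<forall>\<^sub>F n in sequentially. m \<le> J l (\<mu> n) (\<mu>' n)"
    proof -
      have "Q t < 1" using t by (intro Qd) simp
      then have "\<forall>\<^sub>F n in sequentially. Dir (\<mu>' n) < 1" by (rule order_tendstoD(2)[OF DQ])
      then show ?thesis by eventually_elim (intro m_le \<mu> less_imp_le)
    qed
    ultimately have "m \<le> G t" by (rule tendsto_lowerbound) simp
    moreover have "G 0 = m" using eq by (simp add: G_def Q_def A0_def)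
    ultimately show ?thesis by simp
  qed
  have "(Q has_real_derivative 2 * A1) (at 0)" unfolding Q_def[abs_def]
    by (auto intro!: derivative_eq_intros)
  then have dG: "(G has_real_derivative 2 * A1 / 2 - l * (\<integral>x. a x * f (U (norm x)) * \<zeta> (norm x) \<partial>hyp_measure)) (at 0)"
    unfolding G_def[abs_def] by (intro DERIV_diff DERIV_cdivide DERIV_cmult Psi_has_derivative(2)[OF U \<zeta>])
  have "2 * A1 / 2 - l * (\<integral>x. a x * f (U (norm x)) * \<zeta> (norm x) \<partial>hyp_measure) = 0"
    by (rule DERIV_local_min[OF dG, of "min d 1"]) (use d min in auto)
  then show ?thesis by (simp add: A1_def)
qed

end

section \<open>Weak solutions\<close>

text \<open>The volume density is radial and is absorbed into the weight. A radial gradient is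
  parallel to \<open>x\<close>, so its pairing with the gradient of \<open>\<phi>\<close> involves
  only \<open>\<nabla>\<phi> x \<bullet> x\<close>.\<close>

lemma spherical_mean_hyp:
  fixes \<phi> :: "real ^ 'n \<Rightarrow> real"
  assumes \<phi>: "test_function \<phi>"
  obtains \<eta> \<eta>' where "radial_C1 \<eta> \<eta>'"
    "\<And>k. k \<in> borel_measurable borel \<Longrightarrow> integrable hyp_measure (\<lambda>x. k (norm x) * \<phi> x) \<Longrightarrow>
       integrable hyp_measure (\<lambda>x::real^'n. k (norm x) * \<eta> (norm x)) \<Longrightarrow>
       (\<integral>x. k (norm x) * \<phi> x \<partial>hyp_measure) = (\<integral>x. k (norm (x::real^'n)) * \<eta> (norm x) \<partial>hyp_measure)"
    "\<And>\<zeta> \<zeta>'. radial_C1 \<zeta> \<zeta>' \<Longrightarrow> (\<integral>x. fgrad (rgrad \<zeta>') x \<bullet> fgrad (euclidean_grad \<phi>) x \<partial>hyp_measure) =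
       (\<integral>x. fgrad (rgrad \<zeta>') (x :: real^'n) \<bullet> fgrad (rgrad \<eta>') x \<partial>hyp_measure)"
proof -
  obtain \<eta> \<eta>' where \<eta>: "radial_C1 \<eta> \<eta>'"
    and m1: "\<And>k. k \<in> borel_measurable borel \<Longrightarrow> integrable lborel (\<lambda>x. k (norm x) * \<phi> x) \<Longrightarrow>
       integrable lborel (\<lambda>x::real^'n. k (norm x) * \<eta> (norm x)) \<Longrightarrow>
       (\<integral>x. k (norm x) * \<phi> x \<partial>lborel) = (\<integral>x. k (norm (x::real^'n)) * \<eta> (norm x) \<partial>lborel)"
    and m2: "\<And>k. k \<in> borel_measurable borel \<Longrightarrow> integrable lborel (\<lambda>x. k (norm x) * (euclidean_grad \<phi> x \<bullet> x)) \<Longrightarrow>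
       integrable lborel (\<lambda>x::real^'n. k (norm x) * (norm x * \<eta>' (norm x))) \<Longrightarrow>
       (\<integral>x. k (norm x) * (euclidean_grad \<phi> x \<bullet> x) \<partial>lborel) = (\<integral>x. k (norm (x::real^'n)) * (norm x * \<eta>' (norm x)) \<partial>lborel)"
    by (rule spherical_mean[OF \<phi>]) blast
  define c where "c r = 2 / (1 - r\<^sup>2)" for r :: real
  have c: "conf x = c (norm x)" for x :: "real^'n" by (simp add: conf_def c_def)
  have cm[measurable]: "c \<in> borel_measurable borel" unfolding c_def[abs_def] by measurable
  have C: "C1_ball \<phi> (euclidean_grad \<phi>)" by (rule test_function_C1_ball[OF \<phi>])
  have Cg: "C1_grad \<phi> (euclidean_grad \<phi>)" using C by (simp add: C1_ball_def)
  note \<phi>m[measurable] = C1_gradD(5)[OF Cg] and gm[measurable] = C1_gradD(4)[OF Cg]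
  note \<eta>m[measurable] = radial_C1_measurable[OF \<eta>]
  have ind: "indicator (ball 0 1) x = (indicator {..<1} (norm x) :: real)" for x :: "real^'n" by (simp add: indicator_def)
  show thesis
  proof (rule that[OF \<eta>])
    fix k :: "real \<Rightarrow> real" assume k[measurable]: "k \<in> borel_measurable borel"
      and i: "integrable hyp_measure (\<lambda>x. k (norm x) * \<phi> x)" "integrable hyp_measure (\<lambda>x::real^'n. k (norm x) * \<eta> (norm x))"
    define k' where "k' r = indicator {..<1} r * (c r ^ CARD('n) * k r)" for r
    have k': "k' \<in> borel_measurable borel" unfolding k'_def[abs_def] by measurable
    have e1: "indicator (ball 0 1) x * (conf x ^ CARD('n) * (k (norm x) * \<phi> x)) = k' (norm x) * \<phi> x" for x :: "real^'n"
      by (simp add: k'_def ind c)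
    have e2: "indicator (ball 0 1) x * (conf x ^ CARD('n) * (k (norm x) * \<eta> (norm x))) = k' (norm x) * \<eta> (norm x)" for x :: "real^'n"
      by (simp add: k'_def ind c)
    have b: "(\<lambda>x. k (norm x) * \<phi> x) \<in> borel_measurable borel" "(\<lambda>x::real^'n. k (norm x) * \<eta> (norm x)) \<in> borel_measurable borel"
      by measurable
    show "(\<integral>x. k (norm x) * \<phi> x \<partial>hyp_measure) = (\<integral>x. k (norm (x::real^'n)) * \<eta> (norm x) \<partial>hyp_measure)"
      using m1[OF k'] i unfolding integral_hyp_measure[OF b(1)] integral_hyp_measure[OF b(2)]
        integrable_hyp_measure[OF b(1)] integrable_hyp_measure[OF b(2)] e1 e2 by blast
  next
    fix \<zeta> \<zeta>' assume \<zeta>: "radial_C1 \<zeta> \<zeta>'"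
    have [measurable]: "\<zeta>' \<in> borel_measurable borel" "\<eta>' \<in> borel_measurable borel"
      using \<zeta> \<eta> by (auto intro!: borel_measurable_continuous_onI simp: radial_C1_def)
    have rm: "rgrad \<zeta>' \<in> borel_measurable (borel :: (real^'n) measure)" "rgrad \<eta>' \<in> borel_measurable (borel :: (real^'n) measure)"
      unfolding rgrad_def[abs_def] by measurable
    note fm[measurable] = fgrad_measurable[OF rm(1)] fgrad_measurable[OF rm(2)] fgrad_measurable[OF gm]
    \<comment> \<open>Two factors \<open>1 / c r\<close> come from the two gradients, and
      \<open>\<zeta>' r / r\<close> is the multiple of \<open>x\<close> in
      \<open>rgrad\<close>.\<close>
    define k' where "k' r = indicator {..<1} r * (c r ^ CARD('n) * ((1 / c r)\<^sup>2 * (\<zeta>' r / r)))" for r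
    have k': "k' \<in> borel_measurable borel" unfolding k'_def[abs_def] by measurable
    have e1: "indicator (ball 0 1) x * (conf x ^ CARD('n) * (fgrad (rgrad \<zeta>') x \<bullet> fgrad (euclidean_grad \<phi>) x))
        = k' (norm x) * (euclidean_grad \<phi> x \<bullet> x)" for x :: "real^'n"
      by (simp add: k'_def ind c fgrad_def rgrad_def power2_eq_square inner_commute[of x])
    have e2: "indicator (ball 0 1) x * (conf x ^ CARD('n) * (fgrad (rgrad \<zeta>') x \<bullet> fgrad (rgrad \<eta>') x))
        = k' (norm x) * (norm x * \<eta>' (norm x))" for x :: "real^'n"
      by (simp add: k'_def ind c fgrad_def rgrad_def power2_eq_square dot_square_norm)
    have b: "(\<lambda>x. fgrad (rgrad \<zeta>') x \<bullet> fgrad (euclidean_grad \<phi>) x) \<in> borel_measurable borel"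
      "(\<lambda>x::real^'n. fgrad (rgrad \<zeta>') x \<bullet> fgrad (rgrad \<eta>') x) \<in> borel_measurable borel"
      by measurable
    note s = sq_integrable_fgrad_rgrad[OF \<zeta>]
    have i: "integrable hyp_measure (\<lambda>x. fgrad (rgrad \<zeta>') x \<bullet> fgrad (euclidean_grad \<phi>) x)"
      "integrable hyp_measure (\<lambda>x::real^'n. fgrad (rgrad \<zeta>') x \<bullet> fgrad (rgrad \<eta>') x)"
      by (intro sq_integrable_inner s C1_ball_sq_integrable(2)[OF C] sq_integrable_fgrad_rgrad[OF \<eta>])+
    show "(\<integral>x. fgrad (rgrad \<zeta>') x \<bullet> fgrad (euclidean_grad \<phi>) x \<partial>hyp_measure) =
       (\<integral>x. fgrad (rgrad \<zeta>') (x :: real^'n) \<bullet> fgrad (rgrad \<eta>') x \<partial>hyp_measure)"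
      using m2[OF k'] i unfolding integral_hyp_measure[OF b(1)] integral_hyp_measure[OF b(2)]
        integrable_hyp_measure[OF b(1)] integrable_hyp_measure[OF b(2)] e1 e2 by blast
  qed
qed

lemma SO_invariant_radial: "SO_invariant (\<lambda>x::real^'n. U (norm x))"
  unfolding SO_invariant_def
proof (intro allI impI AE_I2)
  fix g :: "real^'n^'n" and x :: "real^'n"
  assume "rotation_matrix g"
  then have g: "orthogonal_matrix g" by (simp add: rotation_matrix_def)
  then have "g ** matrix_inv g = mat 1 \<and> matrix_inv g ** g = mat 1"
    unfolding matrix_inv_def orthogonal_matrix_def by (intro someI[of "\<lambda>A. g ** A = mat 1 \<and> A ** g = mat 1" "transpose g"]) blast
  then have "g *v (matrix_inv g *v x) = x" by (simp only: matrix_vector_mul_assoc matrix_vector_mul_lid)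
  moreover have "norm (g *v (matrix_inv g *v x)) = norm (matrix_inv g *v x)"
    using g by (intro orthogonal_transformation_norm[of "\<lambda>v. g *v v"]) (simp add: orthogonal_transformation_matrix)
  ultimately show "U (norm (matrix_inv g *v x)) = U (norm x)" by simp
qed

lemma has_real_derivative_max_0_power2: "((\<lambda>s. (max 0 s)\<^sup>2) has_real_derivative 2 * max 0 s) (at (s::real))"
proof (cases s "0::real" rule: linorder_cases)
  case less
  have "((\<lambda>s::real. 0) has_real_derivative 2 * max 0 s) (at s)" using less by simp
  then show ?thesis by (rule has_field_derivative_transform_within_open[of _ _ _ "{..<0}"]) (use less in auto)
next
  case greater
  have "((\<lambda>s::real. s\<^sup>2) has_real_derivative 2 * max 0 s) (at s)" using greater by (auto intro!: derivative_eq_intros)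
  then show ?thesis by (rule has_field_derivative_transform_within_open[of _ _ _ "{0<..}"]) (use greater in auto)
next
  case equal
  have "((\<lambda>s::real. (max 0 s)\<^sup>2) has_real_derivative 0) (at 0)"
  proof (rule has_real_derivative_zero_quadratic)
    show "\<bar>(max 0 t)\<^sup>2\<bar> \<le> 1 * (t - 0)\<^sup>2" for t :: real by (cases "t \<ge> 0") (simp_all add: max_absorb1 max_absorb2)
  qed simp
  then show ?thesis using equal by simp
qed

text \<open>Squaring the positive part makes the profile C1 at \<open>R\<close>. It is positive at
  every radius below \<open>R\<close>, which the construction of a competitor of negative energy
  exploits.\<close>

lemma radial_C1_bump:
  assumes R: "0 < R" "R < 1"
  shows "radial_C1 (\<lambda>r. (max 0 (R\<^sup>2 - r\<^sup>2))\<^sup>2) (\<lambda>r. - 4 * r * max 0 (R\<^sup>2 - r\<^sup>2))"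
  unfolding radial_C1_def
proof (intro conjI allI exI[of _ R] impI)
  fix r :: real
  have "((\<lambda>r. R\<^sup>2 - r\<^sup>2) has_real_derivative - 2 * r) (at r)" by (auto intro!: derivative_eq_intros)
  from DERIV_chain2[OF has_real_derivative_max_0_power2 this]
  show "((\<lambda>r. (max 0 (R\<^sup>2 - r\<^sup>2))\<^sup>2) has_real_derivative - 4 * r * max 0 (R\<^sup>2 - r\<^sup>2)) (at r)" by (simp add: mult_ac)
next
  fix r :: real assume "R \<le> r"
  then have "R\<^sup>2 \<le> r\<^sup>2" using R by (intro power_mono) auto
  then show "(max 0 (R\<^sup>2 - r\<^sup>2))\<^sup>2 = 0" by simp
qed (use R in \<open>auto intro!: continuous_intros\<close>)

section \<open>The source term as a bounded functional\<close>

context radial_problem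
begin

text \<open>By growth and decay the square of \<open>f (U r) * r\<close> is at most a multiple of a
  power of \<open>r\<close> with exponent \<open>- (2 * p0 * (q - 1) - 2)\<close>, and
  \<open>2 * p0 * (q - 1) - 2 = 2 * p0 * q - N\<close> is below \<open>N\<close>. Paired with the
  Hardy inequality, this makes the source continuous for the energy norm.\<close>

lemma source_sq_integrable:
  assumes U: "adm K0 U"
  shows "sq_integrable hyp_measure (\<lambda>x. a x * f (U (norm x)) * norm x)"
proof -
  \<comment> \<open>The weight lemma wants a nonnegative exponent; on the unit interval enlarging
    the exponent only weakens the bound.\<close>
  define s where "s = max 0 (2 * (p0 * (q - 1)) - 2)"
  define D where "D = 2 * Cf * K0 powr (q - 1)"
  have D0: "D \<ge> 0" unfolding D_def using Cf_nonneg by simp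
  have s: "0 \<le> s" "s < real CARD('n)"
    using p0_q(2) N by (auto simp: s_def p0_def field_simps)
  have i: "integrable hyp_measure (\<lambda>x. CH * D\<^sup>2 * (a x * norm x powr (- s)))"
    by (intro integrable_mult_right integrable_radial_weight[OF a_int _ s]) (use a_nonneg a_le in auto)
  have [measurable]: "U \<in> borel_measurable borel" using U by (simp add: adm_def)
  have m: "(\<lambda>x. a x * f (U (norm x)) * norm x) \<in> borel_measurable hyp_measure"
    by (intro borel_measurable_hyp_measure) measurable
  have "integrable hyp_measure (\<lambda>x. (norm (a x * f (U (norm x)) * norm x))\<^sup>2)"
  proof (rule Bochner_Integration.integrable_bound[OF i])
    show "(\<lambda>x. (norm (a x * f (U (norm x)) * norm x))\<^sup>2) \<in> borel_measurable hyp_measure" using m by measurable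
    show "AE x in hyp_measure. norm ((norm (a x * f (U (norm x)) * norm x))\<^sup>2) \<le> norm (CH * D\<^sup>2 * (a x * norm x powr (- s)))"
      using AE_ball_punctured
    proof eventually_elim
      case (elim x)
      define r where "r = norm x"
      have r: "0 < r" "r < 1" using elim by (auto simp: r_def)
      have "\<bar>f (U r)\<bar> \<le> 2 * Cf * (K0 * r powr (- p0)) powr (q - 1)"
        using U r by (intro f_le adm_X(1)[OF K0_ge_1]) (auto simp: adm_def)
      also have "\<dots> = D * r powr (- (p0 * (q - 1)))"
        using r K0_ge_1 by (simp add: D_def powr_mult powr_powr)
      finally have "(f (U r))\<^sup>2 \<le> (D * r powr (- (p0 * (q - 1))))\<^sup>2"
        using D0 by (intro abs_le_square_iff[THEN iffD1]) simp
      then have "(f (U r))\<^sup>2 * r\<^sup>2 \<le> (D * r powr (- (p0 * (q - 1))))\<^sup>2 * r\<^sup>2" by (intro mult_right_mono) auto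
      also have "\<dots> = D\<^sup>2 * r powr (- (2 * (p0 * (q - 1)) - 2))"
      proof -
        have "(r powr (- (p0 * (q - 1))))\<^sup>2 * r\<^sup>2 = (r powr (- (p0 * (q - 1))) * r powr (- (p0 * (q - 1)))) * r powr 2"
          using r by (simp add: power2_eq_square powr_numeral)
        also have "\<dots> = r powr (- (2 * (p0 * (q - 1)) - 2))" unfolding powr_add[symmetric] by (simp add: algebra_simps)
        finally show ?thesis by (simp add: power_mult_distrib mult_ac)
      qed
      also have "\<dots> \<le> D\<^sup>2 * r powr (- s)" using r by (intro mult_left_mono powr_mono') (auto simp: s_def)
      finally have *: "(f (U r))\<^sup>2 * r\<^sup>2 \<le> D\<^sup>2 * r powr (- s)" .
      \<comment> \<open>One factor \<open>a x\<close> is bounded by \<open>CH\<close>; the other one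
        carries the integrability.\<close>
      have "(a x * a x) * ((f (U r))\<^sup>2 * r\<^sup>2) \<le> (CH * a x) * (D\<^sup>2 * r powr (- s))"
        by (rule mult_mono[OF mult_right_mono[OF a_le a_nonneg] *])
          (use a_nonneg[of x] a_le[of x] in \<open>auto intro: mult_nonneg_nonneg\<close>)
      moreover have "(norm (a x * f (U (norm x)) * norm x))\<^sup>2 = (a x * a x) * ((f (U r))\<^sup>2 * r\<^sup>2)"
        by (simp add: r_def power_mult_distrib power2_eq_square)
      moreover have "CH * D\<^sup>2 * (a x * norm x powr (- s)) = (CH * a x) * (D\<^sup>2 * r powr (- s))" by (simp add: r_def)
      ultimately have le: "(norm (a x * f (U (norm x)) * norm x))\<^sup>2 \<le> CH * D\<^sup>2 * (a x * norm x powr (- s))" by (simp only:)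
      have "norm ((norm (a x * f (U (norm x)) * norm x))\<^sup>2) = (norm (a x * f (U (norm x)) * norm x))\<^sup>2"
        unfolding real_norm_def by (rule abs_of_nonneg) simp
      also note le
      also have "CH * D\<^sup>2 * (a x * norm x powr (- s)) \<le> norm (CH * D\<^sup>2 * (a x * norm x powr (- s)))"
        unfolding real_norm_def by (rule abs_ge_self)
      finally show ?case .
    qed
  qed
  then show ?thesis using m by (simp add: sq_integrable_def)
qed

text \<open>The factor \<open>norm x\<close> is moved from \<open>\<phi>\<close> to the source, so
  that both factors are in L2. A separate \<open>Z\<close> is used because for elements of the
  completion the quotient arises as an L2 limit.\<close>

lemma source_pairing:
  assumes U: "adm K0 U" and \<phi>: "\<phi> \<in> borel_measurable hyp_measure" and Z: "sq_integrable hyp_measure Z"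
    and eq: "AE x in hyp_measure. \<phi> x = norm x * Z x"
  shows "integrable hyp_measure (\<lambda>x. a x * f (U (norm x)) * \<phi> x)"
    and "(\<integral>x. a x * f (U (norm x)) * \<phi> x \<partial>hyp_measure) = (\<integral>x. (a x * f (U (norm x)) * norm x) \<bullet> Z x \<partial>hyp_measure)"
proof -
  have [measurable]: "U \<in> borel_measurable borel" using U by (simp add: adm_def)
  have "(\<lambda>x. a x * f (U (norm x))) \<in> borel_measurable hyp_measure"
    by (intro borel_measurable_hyp_measure) measurable
  then have m: "(\<lambda>x. a x * f (U (norm x)) * \<phi> x) \<in> borel_measurable hyp_measure" using \<phi> by (rule borel_measurable_times)
  have i: "integrable hyp_measure (\<lambda>x. (a x * f (U (norm x)) * norm x) \<bullet> Z x)"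
    by (rule sq_integrable_inner[OF source_sq_integrable[OF U] Z])
  have e: "AE x in hyp_measure. a x * f (U (norm x)) * \<phi> x = (a x * f (U (norm x)) * norm x) \<bullet> Z x"
    using eq by eventually_elim simp
  show "integrable hyp_measure (\<lambda>x. a x * f (U (norm x)) * \<phi> x)"
    using integrable_cong_AE[OF m borel_measurable_integrable[OF i] e] i by simp
  show "(\<integral>x. a x * f (U (norm x)) * \<phi> x \<partial>hyp_measure) = (\<integral>x. (a x * f (U (norm x)) * norm x) \<bullet> Z x \<partial>hyp_measure)"
    by (rule integral_cong_AE[OF m borel_measurable_integrable[OF i] e])
qed

lemma source_pairing_C1:
  assumes U: "adm K0 U" and C: "C1_ball \<phi> (g :: real^'n \<Rightarrow> real^'n)"
  shows "integrable hyp_measure (\<lambda>x. a x * f (U (norm x)) * \<phi> x)"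
    and "(\<integral>x. a x * f (U (norm x)) * \<phi> x \<partial>hyp_measure) = (\<integral>x. (a x * f (U (norm x)) * norm x) \<bullet> (\<phi> x / norm x) \<partial>hyp_measure)"
proof -
  have m: "\<phi> \<in> borel_measurable hyp_measure" using C1_ball_sq_integrable(1)[OF C] by (simp add: sq_integrable_def)
  have e: "AE x in hyp_measure. \<phi> x = norm x * (\<phi> x / norm x)"
    using AE_hyp_measure_nonzero by eventually_elim simp
  show "integrable hyp_measure (\<lambda>x. a x * f (U (norm x)) * \<phi> x)"
    "(\<integral>x. a x * f (U (norm x)) * \<phi> x \<partial>hyp_measure) = (\<integral>x. (a x * f (U (norm x)) * norm x) \<bullet> (\<phi> x / norm x) \<partial>hyp_measure)"
    using source_pairing[OF U m Hardy_Poincare(1)[OF N C] e] by auto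
qed

text \<open>Both sides see \<open>\<phi>\<close> only through its spherical mean
  \<open>\<zeta>\<close>: the left because \<open>Y\<close> is a limit of radial gradients, the
  right because its coefficient is radial.\<close>

lemma weak_form_test_function:
  assumes l: "l > 0" and U: "adm K0 U" and \<eta>: "\<And>n. radial_C1 (\<eta> n) (\<eta>' n)"
    and Y: "sq_integrable hyp_measure Y" and EY: "(\<lambda>n. \<integral>x. (norm (E (\<eta>' n) x - Y x))\<^sup>2 \<partial>hyp_measure) \<longlonglongrightarrow> 0"
    and EL: "\<And>\<zeta> \<zeta>'. radial_C1 \<zeta> \<zeta>' \<Longrightarrow> (\<integral>x. Y x \<bullet> E \<zeta>' x \<partial>hyp_measure) = l * (\<integral>x. a x * f (U (norm x)) * \<zeta> (norm x) \<partial>hyp_measure)"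
    and \<phi>: "test_function \<phi>"
  shows "(\<integral>x. Y x \<bullet> fgrad (euclidean_grad \<phi>) x \<partial>hyp_measure) = l * (\<integral>x. a x * f (U (norm x)) * \<phi> x \<partial>hyp_measure)"
proof -
  have C: "C1_ball \<phi> (euclidean_grad \<phi>)" by (rule test_function_C1_ball[OF \<phi>])
  obtain \<zeta> \<zeta>' where \<zeta>: "radial_C1 \<zeta> \<zeta>'"
    and m1: "\<And>k. k \<in> borel_measurable borel \<Longrightarrow> integrable hyp_measure (\<lambda>x. k (norm x) * \<phi> x) \<Longrightarrow>
       integrable hyp_measure (\<lambda>x::real^'n. k (norm x) * \<zeta> (norm x)) \<Longrightarrow>
       (\<integral>x. k (norm x) * \<phi> x \<partial>hyp_measure) = (\<integral>x. k (norm (x::real^'n)) * \<zeta> (norm x) \<partial>hyp_measure)"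
    and m2: "\<And>\<mu> \<mu>'. radial_C1 \<mu> \<mu>' \<Longrightarrow> (\<integral>x. fgrad (rgrad \<mu>') x \<bullet> fgrad (euclidean_grad \<phi>) x \<partial>hyp_measure) =
       (\<integral>x. fgrad (rgrad \<mu>') (x :: real^'n) \<bullet> fgrad (rgrad \<zeta>') x \<partial>hyp_measure)"
    by (rule spherical_mean_hyp[OF \<phi>]) blast
  have "(\<lambda>n. \<integral>x. E (\<eta>' n) x \<bullet> fgrad (euclidean_grad \<phi>) x \<partial>hyp_measure) \<longlonglongrightarrow> (\<integral>x. Y x \<bullet> fgrad (euclidean_grad \<phi>) x \<partial>hyp_measure)"
    by (rule tendsto_integral_inner[OF sq_E[OF \<eta>] Y C1_ball_sq_integrable(2)[OF C] EY])
  moreover have "(\<lambda>n. \<integral>x. E (\<eta>' n) x \<bullet> fgrad (euclidean_grad \<phi>) x \<partial>hyp_measure) \<longlonglongrightarrow> (\<integral>x. Y x \<bullet> E \<zeta>' x \<partial>hyp_measure)"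
    using tendsto_integral_inner[OF sq_E[OF \<eta>] Y sq_E[OF \<zeta>] EY] m2[OF \<eta>] by (simp add: E_def)
  ultimately have "(\<integral>x. Y x \<bullet> fgrad (euclidean_grad \<phi>) x \<partial>hyp_measure) = (\<integral>x. Y x \<bullet> E \<zeta>' x \<partial>hyp_measure)"
    by (rule LIMSEQ_unique)
  also have "\<dots> = l * (\<integral>x. a x * f (U (norm x)) * \<zeta> (norm x) \<partial>hyp_measure)" by (rule EL[OF \<zeta>])
  also have "(\<integral>x. a x * f (U (norm x)) * \<zeta> (norm x) \<partial>hyp_measure) = (\<integral>x. a x * f (U (norm x)) * \<phi> x \<partial>hyp_measure)"
  proof -
    note [measurable] = H_borel
    have [measurable]: "U \<in> borel_measurable borel" using U by (simp add: adm_def)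
    have k: "(\<lambda>r. H r * f (U r)) \<in> borel_measurable borel" by measurable
    show ?thesis
      using m1[OF k] source_pairing_C1(1)[OF U C] source_pairing_C1(1)[OF U radial_C1_grad[OF \<zeta>]] by (simp add: a_eq)
  qed
  finally show ?thesis .
qed

text \<open>Density of test functions in the energy norm. The left side passes to the limit by
  convergence of gradients; the right side does because the quotients \<open>\<omega> n\<close>,
  Cauchy by the Hardy inequality, converge in L2.\<close>

lemma weak_form_H12:
  assumes U: "adm K0 U" and Y: "sq_integrable hyp_measure Y"
    and test: "\<And>\<phi>. test_function \<phi> \<Longrightarrow> (\<integral>x. Y x \<bullet> fgrad (euclidean_grad \<phi>) x \<partial>hyp_measure) = l * (\<integral>x. a x * f (U (norm x)) * \<phi> x \<partial>hyp_measure)"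
    and v: "v \<in> H12"
  shows "integrable hyp_measure (\<lambda>x. a x * f (U (norm x)) * v x)"
    and "(\<integral>x. Y x \<bullet> frame (H12_grad v) x \<partial>hyp_measure) = l * (\<integral>x. a x * f (U (norm x)) * v x \<partial>hyp_measure)"
proof -
  obtain \<psi> where t: "\<And>n. test_function (\<psi> n)" and sv: "sq_integrable hyp_measure v"
    and sG: "sq_integrable hyp_measure (frame (H12_grad v))"
    and \<psi>v: "(\<lambda>n. \<integral>x. (norm (\<psi> n x - v x))\<^sup>2 \<partial>hyp_measure) \<longlonglongrightarrow> 0"
    and \<psi>G: "(\<lambda>n. \<integral>x. (norm (fgrad (euclidean_grad (\<psi> n)) x - frame (H12_grad v) x))\<^sup>2 \<partial>hyp_measure) \<longlonglongrightarrow> 0"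
    by (rule is_H12_gradD[OF H12_approximation[OF v]]) blast
  note C = test_function_C1_ball[OF t]
  have sg: "sq_integrable hyp_measure (fgrad (euclidean_grad (\<psi> n)))" for n by (rule C1_ball_sq_integrable(2)[OF C])
  have s\<psi>: "sq_integrable hyp_measure (\<psi> n)" for n by (rule C1_ball_sq_integrable(1)[OF C])
  define \<omega> where "\<omega> n x = \<psi> n x / norm x" for n x
  have s\<omega>: "sq_integrable hyp_measure (\<omega> n)" for n unfolding \<omega>_def[abs_def] by (rule Hardy_Poincare(1)[OF N C])
  have Cau: "L2_Cauchy hyp_measure \<omega>" unfolding \<omega>_def[abs_def]
    by (rule L2_Cauchy_Hardy(2)[OF N C L2_Cauchy_of_limit[OF sg sG \<psi>G]])
  obtain Z where Z: "sq_integrable hyp_measure Z" and \<omega>Z: "(\<lambda>n. \<integral>x. (norm (\<omega> n x - Z x))\<^sup>2 \<partial>hyp_measure) \<longlonglongrightarrow> 0"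
    by (rule L2_complete_hyp_measure[where s=\<omega>, OF s\<omega> Cau]) blast
  define V where "V x = norm x * Z x" for x
  have nm: "(\<lambda>x::real^'n. norm x) \<in> borel_measurable hyp_measure" by (intro borel_measurable_hyp_measure) measurable
  have Zm: "Z \<in> borel_measurable hyp_measure" using Z by (simp add: sq_integrable_def)
  have sV: "sq_integrable hyp_measure V"
    unfolding sq_integrable_def
  proof
    show m: "V \<in> borel_measurable hyp_measure" unfolding V_def[abs_def] using nm Zm by (rule borel_measurable_times)
    show "integrable hyp_measure (\<lambda>x. (norm (V x))\<^sup>2)"
    proof (rule Bochner_Integration.integrable_bound)
      show "integrable hyp_measure (\<lambda>x. (norm (Z x))\<^sup>2)" using Z by (simp add: sq_integrable_def)
      show "(\<lambda>x. (norm (V x))\<^sup>2) \<in> borel_measurable hyp_measure" using m by measurable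
      show "AE x in hyp_measure. norm ((norm (V x))\<^sup>2) \<le> norm ((norm (Z x))\<^sup>2)"
        using AE_ball_punctured
      proof eventually_elim
        case (elim x)
        have "\<bar>V x\<bar> \<le> \<bar>Z x\<bar>" unfolding V_def abs_mult using elim by (intro mult_left_le_one_le) auto
        then show ?case by (simp add: abs_le_square_iff)
      qed
    qed
  qed
  have "(\<lambda>n. \<integral>x. (norm (\<psi> n x - V x))\<^sup>2 \<partial>hyp_measure) \<longlonglongrightarrow> 0"
  proof (rule tendsto_sandwich[OF _ _ tendsto_const \<omega>Z])
    show "\<forall>\<^sub>F n in sequentially. (\<integral>x. (norm (\<psi> n x - V x))\<^sup>2 \<partial>hyp_measure) \<le> (\<integral>x. (norm (\<omega> n x - Z x))\<^sup>2 \<partial>hyp_measure)"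
    proof (intro always_eventually allI, rule integral_mono_AE)
      fix n
      show "integrable hyp_measure (\<lambda>x. (norm (\<psi> n x - V x))\<^sup>2)" "integrable hyp_measure (\<lambda>x. (norm (\<omega> n x - Z x))\<^sup>2)"
        using sq_integrable_diff[OF s\<psi> sV] sq_integrable_diff[OF s\<omega> Z] by (auto simp: sq_integrable_def)
      show "AE x in hyp_measure. (norm (\<psi> n x - V x))\<^sup>2 \<le> (norm (\<omega> n x - Z x))\<^sup>2"
        using AE_ball_punctured
      proof eventually_elim
        case (elim x)
        have "\<psi> n x - V x = norm x * (\<omega> n x - Z x)" using elim by (simp add: \<omega>_def V_def right_diff_distrib)
        then have "\<bar>\<psi> n x - V x\<bar> = norm x * \<bar>\<omega> n x - Z x\<bar>" by (simp add: abs_mult)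
        also have "\<dots> \<le> \<bar>\<omega> n x - Z x\<bar>" using elim by (intro mult_left_le_one_le) auto
        finally show ?case by (simp add: abs_le_square_iff)
      qed
    qed
  qed simp
  \<comment> \<open>The test functions converge in L2 both to \<open>v\<close> and to
    \<open>norm x * Z x\<close>, so \<open>Z\<close> is the quotient of \<open>v\<close> by the
    norm.\<close>
  then have vV: "AE x in hyp_measure. v x = V x" by (rule L2_limit_unique[OF s\<psi> sv sV \<psi>v])
  have vm: "v \<in> borel_measurable hyp_measure" using sv by (simp add: sq_integrable_def)
  note P = source_pairing[OF U vm Z vV[unfolded V_def]]
  show "integrable hyp_measure (\<lambda>x. a x * f (U (norm x)) * v x)" by (rule P(1))
  have "(\<lambda>n. \<integral>x. fgrad (euclidean_grad (\<psi> n)) x \<bullet> Y x \<partial>hyp_measure) \<longlonglongrightarrow> (\<integral>x. frame (H12_grad v) x \<bullet> Y x \<partial>hyp_measure)"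
    by (rule tendsto_integral_inner[OF sg sG Y \<psi>G])
  then have 1: "(\<lambda>n. l * (\<integral>x. a x * f (U (norm x)) * \<psi> n x \<partial>hyp_measure)) \<longlonglongrightarrow> (\<integral>x. Y x \<bullet> frame (H12_grad v) x \<partial>hyp_measure)"
    using test[OF t] by (simp add: inner_commute)
  have "(\<lambda>n. \<integral>x. \<omega> n x \<bullet> (a x * f (U (norm x)) * norm x) \<partial>hyp_measure) \<longlonglongrightarrow> (\<integral>x. Z x \<bullet> (a x * f (U (norm x)) * norm x) \<partial>hyp_measure)"
    by (rule tendsto_integral_inner[OF s\<omega> Z source_sq_integrable[OF U] \<omega>Z])
  then have "(\<lambda>n. \<integral>x. a x * f (U (norm x)) * \<psi> n x \<partial>hyp_measure) \<longlonglongrightarrow> (\<integral>x. a x * f (U (norm x)) * v x \<partial>hyp_measure)"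
    unfolding P(2) source_pairing_C1(2)[OF U C] \<omega>_def inner_commute[of "Z _"] inner_commute[of "_ / norm _"] .
  then have "(\<lambda>n. l * (\<integral>x. a x * f (U (norm x)) * \<psi> n x \<partial>hyp_measure)) \<longlonglongrightarrow> l * (\<integral>x. a x * f (U (norm x)) * v x \<partial>hyp_measure)"
    by (rule tendsto_mult_left)
  with 1 show "(\<integral>x. Y x \<bullet> frame (H12_grad v) x \<partial>hyp_measure) = l * (\<integral>x. a x * f (U (norm x)) * v x \<partial>hyp_measure)"
    by (rule LIMSEQ_unique)
qed

lemma weak_solution_exists:
  assumes l: "l > 0" and small: "l * (4 * (C0 + 1)) \<le> 1"
    and neg: "radial_C1 \<zeta>0 \<zeta>0'" "Dir \<zeta>0' \<le> 1" "J l \<zeta>0 \<zeta>0' < 0"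
  obtains u where "weak_solution l a f u" "SO_invariant u" "\<not> (AE x in hyp_measure. u x = 0)" "H12_norm u \<le> sqrt (2 * l * C0)"
proof -
  obtain \<eta> \<eta>' U Y m where \<eta>: "\<And>n. radial_C1 (\<eta> n) (\<eta>' n)" and D: "\<And>n. Dir (\<eta>' n) \<le> 1"
    and U: "adm K0 U" and lim: "\<And>r. 0 < r \<Longrightarrow> r < 1 \<Longrightarrow> (\<lambda>n. \<eta> n r) \<longlonglongrightarrow> U r"
    and Y: "sq_integrable hyp_measure Y" and EY: "(\<lambda>n. \<integral>x. (norm (E (\<eta>' n) x - Y x))\<^sup>2 \<partial>hyp_measure) \<longlonglongrightarrow> 0"
    and eq: "(\<integral>x. (norm (Y x))\<^sup>2 \<partial>hyp_measure) / 2 - l * Psi U = m" and m: "m < 0"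
    and Y_le: "(\<integral>x. (norm (Y x))\<^sup>2 \<partial>hyp_measure) \<le> 2 * l * C0"
    and m_le: "\<And>\<zeta> \<zeta>'. radial_C1 \<zeta> \<zeta>' \<Longrightarrow> Dir \<zeta>' \<le> 1 \<Longrightarrow> m \<le> J l \<zeta> \<zeta>'"
    by (rule minimizer[OF l neg]) blast
  have EL: "(\<integral>x. Y x \<bullet> E \<zeta>' x \<partial>hyp_measure) = l * (\<integral>x. a x * f (U (norm x)) * \<zeta> (norm x) \<partial>hyp_measure)"
    if "radial_C1 \<zeta> \<zeta>'" for \<zeta> \<zeta>'
    by (rule Euler_Lagrange[OF l small \<eta> D U lim Y EY eq Y_le m_le that])
  have test: "(\<integral>x. Y x \<bullet> fgrad (euclidean_grad \<phi>) x \<partial>hyp_measure) = l * (\<integral>x. a x * f (U (norm x)) * \<phi> x \<partial>hyp_measure)"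
    if "test_function \<phi>" for \<phi>
    by (rule weak_form_test_function[OF l U \<eta> Y EY EL that])
  have weak: "integrable hyp_measure (\<lambda>x. a x * f (U (norm x)) * v x)"
    "(\<integral>x. Y x \<bullet> frame (H12_grad v) x \<partial>hyp_measure) = l * (\<integral>x. a x * f (U (norm x)) * v x \<partial>hyp_measure)"
    if "v \<in> H12" for v
    by (rule weak_form_H12[OF U Y test that]; assumption)+
  define u where "u x = U (norm x)" for x :: "real^'n"
  have C: "C1_ball (\<lambda>x::real^'n. \<eta> n (norm x)) (rgrad (\<eta>' n))" for n by (rule radial_C1_grad[OF \<eta>])
  have Um[measurable]: "U \<in> borel_measurable borel" using U by (simp add: adm_def)
  have "L2_Cauchy hyp_measure (\<lambda>n. E (\<eta>' n))" by (rule L2_Cauchy_of_limit[OF sq_E[OF \<eta>] Y EY])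
  then have Cau: "L2_Cauchy hyp_measure (\<lambda>n (x::real^'n). \<eta> n (norm x))"
    unfolding E_def by (rule L2_Cauchy_Hardy(1)[OF N C])
  have um: "u \<in> borel_measurable hyp_measure" unfolding u_def[abs_def]
    by (intro borel_measurable_hyp_measure) measurable
  \<comment> \<open>The whole sequence converges pointwise, so the subsequence demanded by the limit
    lemma is the identity.\<close>
  have "AE x::real^'n in hyp_measure. (\<lambda>n. \<eta> (id n) (norm x)) \<longlonglongrightarrow> u x"
    using AE_ball_punctured by eventually_elim (simp add: u_def lim)
  note L = L2_Cauchy_AE_limit[OF C1_ball_sq_integrable(1)[OF C] Cau strict_mono_id um this]
  have uH: "u \<in> H12" and uY: "AE x in hyp_measure. frame (H12_grad u) x = Y x"
    using H12_limit[OF N C Y L(1) EY[unfolded E_def] L(2)] by auto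
  have "weak_solution l a f u"
    unfolding weak_solution_def
  proof (intro conjI ballI uH)
    fix v :: "real^'n \<Rightarrow> real" assume v: "v \<in> H12"
    show "integrable hyp_measure (\<lambda>x. a x * f (u x) * v x)" using weak(1)[OF v] by (simp add: u_def)
    have fm: "frame (H12_grad w) \<in> borel_measurable hyp_measure" if w: "w \<in> H12" for w :: "real^'n \<Rightarrow> real"
      by (rule is_H12_gradD[OF H12_approximation[OF w]]) (simp add: sq_integrable_def)
    have Ym: "Y \<in> borel_measurable hyp_measure" using Y by (simp add: sq_integrable_def)
    have "(\<integral>x. hyp_inner x (H12_grad u x) (H12_grad v x) \<partial>hyp_measure) = (\<integral>x. frame (H12_grad u) x \<bullet> frame (H12_grad v) x \<partial>hyp_measure)"
      by (simp add: hyp_inner_frame)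
    also have "\<dots> = (\<integral>x. Y x \<bullet> frame (H12_grad v) x \<partial>hyp_measure)"
      using uY by (intro integral_cong_AE borel_measurable_inner fm uH v Ym) auto
    also have "\<dots> = l * (\<integral>x. a x * f (u x) * v x \<partial>hyp_measure)" using weak(2)[OF v] by (simp add: u_def)
    finally show "(\<integral>x. hyp_inner x (H12_grad u x) (H12_grad v x) \<partial>hyp_measure) = l * (\<integral>x. a x * f (u x) * v x \<partial>hyp_measure)" .
  qed
  moreover have "SO_invariant u" unfolding u_def[abs_def] by (rule SO_invariant_radial)
  moreover have "\<not> (AE x in hyp_measure. u x = 0)"
  proof
    assume "AE x in hyp_measure. u x = 0"
    \<comment> \<open>As \<open>F 0 = 0\<close>, a trivial \<open>u\<close> would have
      \<open>Psi U = 0\<close>, and the squared norm of \<open>Y\<close> would be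
      \<open>2 * m\<close>, a negative number.\<close>
    then have "AE x in hyp_measure. a x * F (U (norm x)) = 0" by eventually_elim (simp add: u_def F_0)
    then have "Psi U = 0" unfolding Psi_def by (rule integral_eq_zero_AE)
    then have "(\<integral>x. (norm (Y x))\<^sup>2 \<partial>hyp_measure) < 0" using eq m by simp
    moreover have "(\<integral>x. (norm (Y x))\<^sup>2 \<partial>hyp_measure) \<ge> 0" by simp
    ultimately show False by linarith
  qed
  moreover have "H12_norm u \<le> sqrt (2 * l * C0)"
  proof -
    have "(\<integral>x. (norm (frame (H12_grad u) x))\<^sup>2 \<partial>hyp_measure) = (\<integral>x. (norm (Y x))\<^sup>2 \<partial>hyp_measure)"
    proof (rule integral_cong_AE)
      have "sq_integrable hyp_measure (frame (H12_grad u))"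
        by (rule is_H12_gradD[OF H12_approximation[OF uH]])
      then show "(\<lambda>x. (norm (frame (H12_grad u) x))\<^sup>2) \<in> borel_measurable hyp_measure" by (auto simp: sq_integrable_def)
      show "(\<lambda>x. (norm (Y x))\<^sup>2) \<in> borel_measurable hyp_measure" using Y by (auto simp: sq_integrable_def)
    qed (use uY in auto)
    then show ?thesis using Y_le by (simp add: H12_norm_def field_norm_frame)
  qed
  ultimately show thesis by (rule that)
qed

section \<open>A competitor of negative energy\<close>

text \<open>Scaling a bump by \<open>t\<close> scales its energy by the square of \<open>t\<close>,
  whereas near 0 the primitive \<open>F\<close> exceeds any multiple of the square. So the nonlinear
  term wins for every \<open>l > 0\<close> once \<open>t\<close> is small.\<close>

lemma negative_energy:
  assumes F0: "filterlim (\<lambda>t. integral {0..t} f / t\<^sup>2) at_top (at_right 0)" and a: "\<not> (AE x in hyp_measure. a x = 0)" and l: "l > 0"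
  obtains \<eta> \<eta>' where "radial_C1 \<eta> \<eta>'" "Dir \<eta>' \<le> 1" "J l \<eta> \<eta>' < 0"
proof -
  define \<beta> where "\<beta> R r = (max 0 (R\<^sup>2 - r\<^sup>2))\<^sup>2" for R r :: real
  \<comment> \<open>The bumps exhaust the ball, so one of them meets the set where \<open>a\<close>
    is nonzero; \<open>k + 2\<close> makes \<open>R 0\<close> positive.\<close>
  define R where "R k = 1 - 1 / real (k + 2)" for k
  have R: "0 < R k" "R k < 1" for k by (auto simp: R_def)
  have \<beta>: "radial_C1 (\<beta> (R k)) (\<lambda>r. - 4 * r * max 0 ((R k)\<^sup>2 - r\<^sup>2))" for k
    unfolding \<beta>_def[abs_def] by (rule radial_C1_bump[OF R])
  have \<beta>0: "0 \<le> \<beta> (R k) r" and \<beta>1: "\<beta> (R k) r \<le> 1" for k r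
  proof -
    show "0 \<le> \<beta> (R k) r" by (simp add: \<beta>_def)
    have "(R k)\<^sup>2 \<le> 1" using R[of k] by (intro power_le_one) auto
    moreover have "0 \<le> r\<^sup>2" by simp
    ultimately have "max 0 ((R k)\<^sup>2 - r\<^sup>2) \<le> 1" by linarith
    then show "\<beta> (R k) r \<le> 1" unfolding \<beta>_def by (intro power_le_one) auto
  qed
  have i: "integrable hyp_measure (\<lambda>x. a x * (\<beta> (R k) (norm x))\<^sup>2)" for k
  proof (rule Bochner_Integration.integrable_bound[OF a_int])
    note [measurable] = radial_C1_measurable[OF \<beta>]
    show "(\<lambda>x. a x * (\<beta> (R k) (norm x))\<^sup>2) \<in> borel_measurable hyp_measure"
      by (intro borel_measurable_hyp_measure) measurable
    show "AE x in hyp_measure. norm (a x * (\<beta> (R k) (norm x))\<^sup>2) \<le> norm (a x)"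
    proof (intro AE_I2)
      fix x :: "real^'n"
      have "(\<beta> (R k) (norm x))\<^sup>2 \<le> 1" using \<beta>0 \<beta>1 by (intro power_le_one)
      then show "norm (a x * (\<beta> (R k) (norm x))\<^sup>2) \<le> norm (a x)"
        using a_nonneg[of x] by (simp add: mult_left_le)
    qed
  qed
  have "\<exists>k. (\<integral>x. a x * (\<beta> (R k) (norm x))\<^sup>2 \<partial>hyp_measure) \<noteq> 0"
  proof (rule ccontr)
    assume "\<not> ?thesis"
    then have "(\<integral>x. a x * (\<beta> (R k) (norm x))\<^sup>2 \<partial>hyp_measure) = 0" for k by simp
    then have "AE x in hyp_measure. a x * (\<beta> (R k) (norm x))\<^sup>2 = 0" for k
      using integral_nonneg_eq_0_iff_AE[OF i[of k]] a_nonneg by simp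
    then have "AE x in hyp_measure. \<forall>k. a x * (\<beta> (R k) (norm x))\<^sup>2 = 0" unfolding AE_all_countable by (rule allI)
    then have "AE x in hyp_measure. a x = 0"
      using AE_ball_punctured
    proof eventually_elim
      case (elim x)
      obtain k where k: "1 / real (Suc k) < 1 - norm x" using elim(2) reals_Archimedean[of "1 - norm x"] unfolding inverse_eq_divide by auto
      have "1 / real (k + 2) \<le> 1 / real (Suc k)" by (intro divide_left_mono) auto
      then have "norm x < R k" using k by (simp add: R_def)
      then have "(norm x)\<^sup>2 < (R k)\<^sup>2" by (intro power_strict_mono) auto
      then have "\<beta> (R k) (norm x) \<noteq> 0" by (simp add: \<beta>_def)
      then show ?case using elim(1) by (metis mult_eq_0_iff power_not_zero)
    qed
    then show False using a by simp
  qed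
  then obtain k where Ik: "(\<integral>x. a x * (\<beta> (R k) (norm x))\<^sup>2 \<partial>hyp_measure) \<noteq> 0" by blast
  define \<eta> \<eta>' where "\<eta> = \<beta> (R k)" and "\<eta>' r = - 4 * r * max 0 ((R k)\<^sup>2 - r\<^sup>2)" for r
  define I where "I = (\<integral>x. a x * (\<eta> (norm x))\<^sup>2 \<partial>hyp_measure)"
  have "I \<ge> 0" unfolding I_def using a_nonneg by (intro Bochner_Integration.integral_nonneg) auto
  then have I: "I > 0" using Ik by (simp add: I_def \<eta>_def)
  have \<eta>: "radial_C1 \<eta> \<eta>'" unfolding \<eta>_def \<eta>'_def[abs_def] by (rule \<beta>)
  have \<eta>0: "0 \<le> \<eta> r" and \<eta>1: "\<eta> r \<le> 1" for r using \<beta>0 \<beta>1 by (auto simp: \<eta>_def)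
  have iI: "integrable hyp_measure (\<lambda>x. a x * (\<eta> (norm x))\<^sup>2)" unfolding \<eta>_def by (rule i)
  define d0 where "d0 = Dir \<eta>'"
  have d0: "d0 \<ge> 0" unfolding d0_def by (rule Dir_nonneg)
  \<comment> \<open>Makes the nonlinear term at least \<open>t\<^sup>2 * (d0 + 1)\<close>, against
    the energy contribution \<open>t\<^sup>2 * d0 / 2\<close>.\<close>
  define M where "M = (d0 + 1) / (l * I)"
  have "\<forall>\<^sub>F t in at_right 0. M \<le> integral {0..t} f / t\<^sup>2" using F0 by (simp add: filterlim_at_top)
  then obtain b where b: "b > 0" "\<And>t. 0 < t \<Longrightarrow> t < b \<Longrightarrow> M \<le> integral {0..t} f / t\<^sup>2"
    unfolding eventually_at_right_field by blast
  \<comment> \<open>Since \<open>\<eta>\<close> is at most 1, \<open>t < b\<close> keeps the values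
    in the range of the lower bound for \<open>F\<close>; the second entry gives
    \<open>t \<le> 1\<close> and \<open>t * d0 \<le> 1\<close>, hence energy at most 1.\<close>
  define t where "t = min (b / 2) (1 / (1 + d0))"
  have t: "0 < t" "t < b" "t \<le> 1 / (1 + d0)" using b d0 by (auto simp: t_def)
  have F: "M * s\<^sup>2 \<le> F s" if s: "0 \<le> s" "s < b" for s
  proof (cases "s = 0")
    case False
    then have "M * s\<^sup>2 \<le> integral {0..s} f" using b(2)[of s] s by (simp add: pos_le_divide_eq)
    then show ?thesis using s by (simp add: F_def)
  qed (simp add: F_0)
  \<comment> \<open>The zero summand fits the scaling into the lemmas on linear combinations of two
    profiles.\<close>
  define \<mu> \<mu>' where "\<mu> r = t * \<eta> r + 0 * \<eta> r" and "\<mu>' r = t * \<eta>' r + 0 * \<eta>' r" for r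
  have \<mu>: "radial_C1 \<mu> \<mu>'" unfolding \<mu>_def[abs_def] \<mu>'_def[abs_def] by (rule radial_C1_linear[OF \<eta> \<eta>])
  have D: "Dir \<mu>' = t\<^sup>2 * d0"
    unfolding Dir_def d0_def \<mu>'_def[abs_def] E_linear by (simp add: power_mult_distrib)
  have "t\<^sup>2 * d0 \<le> 1"
  proof -
    have t1: "t * (1 + d0) \<le> 1" using t d0 by (simp add: pos_le_divide_eq)
    have "t \<le> 1" using t(3) d0 by (smt (verit) divide_le_eq_1_pos)
    then have "t * (t * d0) \<le> t * d0" using t d0 by (intro mult_left_le_one_le) auto
    also have "\<dots> \<le> 1" using t1 t by (simp add: distrib_left)
    finally show ?thesis by (simp add: power2_eq_square)
  qed
  then have D1: "Dir \<mu>' \<le> 1" by (simp add: D)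
  have "(\<integral>x. M * t\<^sup>2 * (a x * (\<eta> (norm x))\<^sup>2) \<partial>hyp_measure) \<le> Psi \<mu>"
    unfolding Psi_def
  proof (rule integral_mono)
    show "integrable hyp_measure (\<lambda>x. M * t\<^sup>2 * (a x * (\<eta> (norm x))\<^sup>2))" by (intro integrable_mult_right iI)
    show "integrable hyp_measure (\<lambda>x. a x * F (\<mu> (norm x)))" by (rule Psi_integrable[OF adm_radial[OF \<mu> D1] K0_ge_1])
    fix x :: "real^'n"
    have "t * \<eta> (norm x) \<le> t * 1" using t \<eta>1 by (intro mult_left_mono) auto
    then have "t * \<eta> (norm x) < b" using t by linarith
    then have "M * (t * \<eta> (norm x))\<^sup>2 \<le> F (\<mu> (norm x))"
      using F[of "t * \<eta> (norm x)"] t \<eta>0[of "norm x"] by (simp add: \<mu>_def)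
    then have "a x * (M * (t * \<eta> (norm x))\<^sup>2) \<le> a x * F (\<mu> (norm x))" by (intro mult_left_mono a_nonneg)
    then show "M * t\<^sup>2 * (a x * (\<eta> (norm x))\<^sup>2) \<le> a x * F (\<mu> (norm x))" by (simp add: power_mult_distrib mult_ac)
  qed
  then have "M * t\<^sup>2 * I \<le> Psi \<mu>" by (simp add: I_def)
  then have "l * (M * t\<^sup>2 * I) \<le> l * Psi \<mu>" using l by (intro mult_left_mono) auto
  moreover have "l * (M * t\<^sup>2 * I) = t\<^sup>2 * (d0 + 1)" using l I by (simp add: M_def)
  ultimately have "J l \<mu> \<mu>' \<le> t\<^sup>2 * d0 / 2 - t\<^sup>2 * (d0 + 1)" by (simp add: J_def D)
  also have "\<dots> = - (t\<^sup>2 * (d0 / 2 + 1))" by (simp add: field_simps)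
  also have "\<dots> < 0" using t d0 by (simp add: mult_pos_pos)
  finally show thesis using that[OF \<mu> D1] by simp
qed

end

section \<open>Return to the given coefficient\<close>

lemma weak_solution_cong:
  fixes a \<alpha> :: "real ^ 'n \<Rightarrow> real"
  assumes eq: "AE x in hyp_measure. \<alpha> x = a x" and \<alpha>: "\<alpha> \<in> borel_measurable hyp_measure" and a: "a \<in> borel_measurable hyp_measure"
    and f: "f \<in> borel_measurable borel" and w: "weak_solution l a f u"
  shows "weak_solution l \<alpha> f u"
proof -
  have L2: "v \<in> borel_measurable hyp_measure" if "v \<in> H12" for v :: "real^'n \<Rightarrow> real"
    using that by (auto simp: H12_def L2_tendsto_def in_L2_def)
  have u: "u \<in> borel_measurable hyp_measure" using w by (simp add: weak_solution_def L2)
  have fu: "(\<lambda>x. f (u x)) \<in> borel_measurable hyp_measure" by (rule measurable_compose[OF u f])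
  show ?thesis unfolding weak_solution_def
  proof (intro conjI ballI)
    show "u \<in> H12" using w by (simp add: weak_solution_def)
    fix v :: "real^'n \<Rightarrow> real" assume v: "v \<in> H12"
    have e: "AE x in hyp_measure. \<alpha> x * f (u x) * v x = a x * f (u x) * v x" using eq by eventually_elim simp
    have m1: "(\<lambda>x. \<alpha> x * f (u x) * v x) \<in> borel_measurable hyp_measure" and m2: "(\<lambda>x. a x * f (u x) * v x) \<in> borel_measurable hyp_measure"
      using \<alpha> a fu L2[OF v] by (auto intro!: borel_measurable_times)
    show "integrable hyp_measure (\<lambda>x. \<alpha> x * f (u x) * v x)"
      using integrable_cong_AE[OF m1 m2 e] w v by (simp add: weak_solution_def)
    show "(\<integral>x. hyp_inner x (H12_grad u x) (H12_grad v x) \<partial>hyp_measure) = l * (\<integral>x. \<alpha> x * f (u x) * v x \<partial>hyp_measure)"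
      using integral_cong_AE[OF m1 m2 e] w v by (simp add: weak_solution_def)
  qed
qed

theorem theorem1p1:
  fixes f :: "real \<Rightarrow> real" and \<alpha> :: "real ^ 'n \<Rightarrow> real" and q :: real
  assumes N_ge_3: "CARD('n) \<ge> 3"
    and f_cont: "continuous_on UNIV f"
    and q_bounds: "2 < q" "q < 2 * real CARD('n) / (real CARD('n) - 2)"
    and f_growth: "bdd_above (range (\<lambda>t. \<bar>f t\<bar> / (1 + \<bar>t\<bar> powr (q - 1))))"
    and f_zero: "filterlim (\<lambda>t. integral {0..t} f / t\<^sup>2) at_top (at_right 0)"
    and \<alpha>_L1: "integrable hyp_measure \<alpha>"
    and \<alpha>_Linf: "in_Linf \<alpha>"
    and \<alpha>_nonzero: "\<not> (AE x in hyp_measure. \<alpha> x = 0)"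
    and \<alpha>_nonneg: "AE x in hyp_measure. \<alpha> x \<ge> 0"
    and \<alpha>_radial: "radially_symmetric \<alpha>"
  shows "\<exists>L>0. \<exists>u :: real \<Rightarrow> real ^ 'n \<Rightarrow> real.
           (\<forall>l. 0 < l \<and> l < L \<longrightarrow>
              weak_solution l \<alpha> f (u l) \<and> SO_invariant (u l) \<and>
              \<not> (AE x in hyp_measure. u l x = 0)) \<and>
           ((\<lambda>l. H12_norm (u l)) \<longlongrightarrow> 0) (at_right 0)"
proof -
  obtain Cf where Cf: "\<And>t. \<bar>f t\<bar> / (1 + \<bar>t\<bar> powr (q - 1)) \<le> Cf"
    using f_growth unfolding bdd_above_def by auto
  have f_bound: "\<bar>f t\<bar> \<le> Cf * (1 + \<bar>t\<bar> powr (q - 1))" for t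
  proof -
    have "0 < 1 + \<bar>t\<bar> powr (q - 1)" by (intro add_pos_nonneg) auto
    then show ?thesis using Cf[of t] by (simp add: pos_divide_le_eq)
  qed
  have \<alpha>m: "\<alpha> \<in> borel_measurable hyp_measure" using \<alpha>_L1 by (rule borel_measurable_integrable)
  obtain C where C: "AE x in hyp_measure. \<bar>\<alpha> x\<bar> \<le> C" using \<alpha>_Linf unfolding in_Linf_def by blast
  obtain h where h: "AE x in hyp_measure. \<alpha> x = h (norm x)" using \<alpha>_radial unfolding radially_symmetric_def by blast
  \<comment> \<open>The maximum with 0 supplies the nonnegative bound that the Borel representative
    requires.\<close>
  have b: "AE x in hyp_measure. 0 \<le> \<alpha> x \<and> \<alpha> x \<le> max 0 C" using C \<alpha>_nonneg by eventually_elim auto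
  obtain H where H: "H \<in> borel_measurable borel" "\<And>r. 0 \<le> H r" "\<And>r. H r \<le> max 0 C"
    and \<alpha>H: "AE x in hyp_measure. \<alpha> x = H (norm x)"
    using radial_borel_representative[OF \<alpha>m h b] by auto
  define a where "a x = H (norm x)" for x :: "real^'n"
  note [measurable] = H(1)
  have am: "a \<in> borel_measurable hyp_measure"
    unfolding a_def[abs_def] by (intro borel_measurable_hyp_measure) measurable
  have eq: "AE x in hyp_measure. \<alpha> x = a x" using \<alpha>H by (simp add: a_def)
  have a_int: "integrable hyp_measure a" using integrable_cong_AE[OF \<alpha>m am eq] \<alpha>_L1 by simp
  have a_nz: "\<not> (AE x in hyp_measure. a x = 0)"
  proof
    assume "AE x in hyp_measure. a x = 0"
    with eq have "AE x in hyp_measure. \<alpha> x = 0" by eventually_elim simp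
    then show False using \<alpha>_nonzero by simp
  qed
  interpret radial_problem f H q Cf "max 0 C" a
    by unfold_locales (use N_ge_3 f_cont q_bounds f_bound H a_int in \<open>auto simp: a_def[abs_def]\<close>)
  \<comment> \<open>For \<open>l < L\<close> the minimizer stays in the interior of the unit ball;
    the added 1 covers \<open>C0 = 0\<close>.\<close>
  define L where "L = 1 / (4 * (C0 + 1))"
  have L: "L > 0" using C0_nonneg by (simp add: L_def)
  have "\<exists>u. weak_solution l \<alpha> f u \<and> SO_invariant u \<and> \<not> (AE x in hyp_measure. u x = 0) \<and> H12_norm u \<le> sqrt (2 * l * C0)"
    if l: "0 < l" "l < L" for l
  proof -
    have small: "l * (4 * (C0 + 1)) \<le> 1" using l C0_nonneg by (simp add: L_def pos_less_divide_eq)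
    obtain \<eta> \<eta>' where \<eta>: "radial_C1 \<eta> \<eta>'" "Dir \<eta>' \<le> 1" "J l \<eta> \<eta>' < 0"
      by (rule negative_energy[OF f_zero a_nz l(1)])
    obtain u where "weak_solution l a f u" "SO_invariant u" "\<not> (AE x in hyp_measure. u x = 0)" "H12_norm u \<le> sqrt (2 * l * C0)"
      by (rule weak_solution_exists[OF l(1) small \<eta>])
    then show ?thesis using weak_solution_cong[OF eq \<alpha>m am f_borel] by blast
  qed
  \<comment> \<open>One solution is chosen for each \<open>l\<close> in the interval; its values
    elsewhere are arbitrary and do not affect the limit at 0 from the right.\<close>
  then obtain u where u: "\<And>l. 0 < l \<Longrightarrow> l < L \<Longrightarrow> weak_solution l \<alpha> f (u l) \<and> SO_invariant (u l) \<and>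
      \<not> (AE x in hyp_measure. u l x = 0) \<and> H12_norm (u l) \<le> sqrt (2 * l * C0)"
    by metis
  have ev: "\<forall>\<^sub>F l in at_right 0. 0 < l \<and> l < L"
    using L by (auto simp: eventually_at_right_field intro!: exI[of _ L])
  have "((\<lambda>l. H12_norm (u l)) \<longlongrightarrow> 0) (at_right 0)"
  proof (rule tendsto_sandwich[OF _ _ tendsto_const])
    show "\<forall>\<^sub>F l in at_right 0. 0 \<le> H12_norm (u l)"
      by (intro always_eventually allI) (simp add: H12_norm_def field_norm_def)
    show "\<forall>\<^sub>F l in at_right 0. H12_norm (u l) \<le> sqrt (2 * l * C0)"
      using ev by eventually_elim (use u in blast)
    have "((\<lambda>l. sqrt (2 * l * C0)) \<longlongrightarrow> sqrt (2 * 0 * C0)) (at_right 0)" by (intro tendsto_intros)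
    then show "((\<lambda>l. sqrt (2 * l * C0)) \<longlongrightarrow> 0) (at_right 0)" by simp
  qed
  then show ?thesis using L u by blast
qed

end
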